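(* Let $\mathcal{Q}=\mathcal{Q}_3$ or $\mathcal{Q}=\mathcal{Q}_4$. The monoidal closed structure given by $-\mathbin{\hat\otimes}-$ and $\mathrm{Hom}$ on $\mathrm{Ind}\text{-}(\mathrm{Vect}^{\mathrm{op}})$ induces a monoidal closed structure on the reflective full subcategory of $\mathcal{Q}$-free objects, with tensor product $\mathcal{R}^\infty_{\mathcal{Q}}(-\mathbin{\hat\otimes}-)$ and internal hom $\mathrm{Hom}$.
   Context: Fix a field $\mathbf{k}$ and a (non-trivial) Grothendieck universe; sets in it are small. $\mathrm{Vect}$ is the category of small $\mathbf{k}$-vector spaces, $[\mathrm{Vect},\mathrm{Vect}]$ the category of $\mathbf{k}$-additive functors (acting $\mathbf{k}$-linearly on hom-spaces) and natural transformations, $\mathbb{Y}V:=\mathrm{Vect}(V,-)$. $\mathrm{Ind}\text{-}(\mathrm{Vect}^{\mathrm{op}})$ is the full subcategory of $[\mathrm{Vect},\mathrm{Vect}]$ on the small functors, i.e. those isomorphic to a colimit, over a small directed poset, of representables. $\mathcal{Q}_3$ is the class of cokernels of the canonical inclusions $(\mathbb{Y}\mathbf{k})^{\oplus\kappa}\to(\mathbb{Y}\mathbf{k})^\kappa$, $\kappa$ a small cardinal. $\mathcal{Q}_4$ is the class of all quotients $\mathbb{Y}V/\bigcup_{H\in\mathcal{F}}\mathbb{Y}(V/H)$ with $V\in\mathrm{Vect}$ and $\mathcal{F}$ a filter of linear subspaces of $V$ (nonempty, closed under finite intersections and larger subspaces) with $\bigcap\mathcal{F}=0$, where $\mathbb{Y}(V/H)\subseteq\mathbb{Y}V$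 consists of the linear maps vanishing on $H$. An object $X$ is $\mathcal{Q}$-free if there is no nonzero natural transformation $Q\to X$ with $Q\in\mathcal{Q}$. The full subcategory of $\mathcal{Q}$-free objects of $\mathrm{Ind}\text{-}(\mathrm{Vect}^{\mathrm{op}})$ is (epi-)reflective; $\mathcal{R}^\infty_{\mathcal{Q}}$ denotes the reflection, regarded as an endofunctor of $\mathrm{Ind}\text{-}(\mathrm{Vect}^{\mathrm{op}})$. The tensor product on $\mathrm{Ind}\text{-}(\mathrm{Vect}^{\mathrm{op}})$ is $(X\hat\otimes Y)(V)\cong\int^{H_0}\int^{H_1}X(H_0)\otimes Y(H_1)\otimes\mathrm{Vect}(H_0\otimes H_1,V)$ (induced by $\otimes_{\mathbf{k}}$ on $\mathrm{Vect}^{\mathrm{op}}$, so $\mathbb{Y}V\hat\otimes\mathbb{Y}W\cong\mathbb{Y}(V\otimes W)$ and $\hat\otimes$ preserves small colimits in each variable), with unit $\mathbb{Y}\mathbf{k}$; $\mathrm{Hom}(X,-)$ is the right adjoint of $X\hat\otimes-$, concretely $\mathrm{Hom}(X,Y)(V)$ is the space of natural transformations from $X$ to $Y(-\otimes V)$. *)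

theory Defs
  imports "HOL-Algebra.Module" "HOL-Library.FuncSet"
begin

section \<open>Categories, functors, reflections\<close>

text \<open>Arrows do not carry their domain and codomain: \<open>Comp C A g f\<close> is the composite
  \<open>g \<circ> f\<close> of \<open>f : A \<rightarrow> B\<close> and \<open>g : B \<rightarrow> D\<close>, and \<open>Idn C A\<close> is the identity of \<open>A\<close>.\<close>

record ('o, 'm) cat =
  Obj :: "'o set"
  Hom :: "'o \<Rightarrow> 'o \<Rightarrow> 'm set"
  Comp :: "'o \<Rightarrow> 'm \<Rightarrow> 'm \<Rightarrow> 'm"
  Idn :: "'o \<Rightarrow> 'm"

locale category =
  fixes C :: "('o, 'm) cat"
  assumes Idn_in_Hom: "A \<in> Obj C \<Longrightarrow> Idn C A \<in> Hom C A A"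
    and Comp_in_Hom: "\<lbrakk>A \<in> Obj C; B \<in> Obj C; D \<in> Obj C; f \<in> Hom C A B; g \<in> Hom C B D\<rbrakk>
      \<Longrightarrow> Comp C A g f \<in> Hom C A D"
    and Comp_Idn: "\<lbrakk>A \<in> Obj C; B \<in> Obj C; f \<in> Hom C A B\<rbrakk> \<Longrightarrow> Comp C A f (Idn C A) = f"
    and Idn_Comp: "\<lbrakk>A \<in> Obj C; B \<in> Obj C; f \<in> Hom C A B\<rbrakk> \<Longrightarrow> Comp C A (Idn C B) f = f"
    and Comp_assoc: "\<lbrakk>A \<in> Obj C; B \<in> Obj C; D \<in> Obj C; E \<in> Obj C;
        f \<in> Hom C A B; g \<in> Hom C B D; h \<in> Hom C D E\<rbrakk>
      \<Longrightarrow> Comp C A h (Comp C A g f) = Comp C A (Comp C B h g) f"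

definition is_isomorphism :: "('o, 'm) cat \<Rightarrow> 'o \<Rightarrow> 'o \<Rightarrow> 'm \<Rightarrow> bool" where
  "is_isomorphism C A B f \<longleftrightarrow> f \<in> Hom C A B \<and>
     (\<exists>g \<in> Hom C B A. Comp C A g f = Idn C A \<and> Comp C B f g = Idn C B)"

definition full_subcat :: "('o, 'm) cat \<Rightarrow> 'o set \<Rightarrow> ('o, 'm) cat" where
  "full_subcat C S = C\<lparr>Obj := Obj C \<inter> S\<rparr>"

record ('o, 'm, 'p, 'n) fctr =
  on_ob :: "'o \<Rightarrow> 'p"
  on_mor :: "'o \<Rightarrow> 'o \<Rightarrow> 'm \<Rightarrow> 'n"

definition is_functor :: "('o, 'm) cat \<Rightarrow> ('p, 'n) cat \<Rightarrow> ('o, 'm, 'p, 'n) fctr \<Rightarrow> bool" where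
  "is_functor C D F \<longleftrightarrow>
     (\<forall>A \<in> Obj C. on_ob F A \<in> Obj D) \<and>
     (\<forall>A \<in> Obj C. \<forall>B \<in> Obj C. \<forall>f \<in> Hom C A B.
        on_mor F A B f \<in> Hom D (on_ob F A) (on_ob F B)) \<and>
     (\<forall>A \<in> Obj C. on_mor F A A (Idn C A) = Idn D (on_ob F A)) \<and>
     (\<forall>A \<in> Obj C. \<forall>B \<in> Obj C. \<forall>E \<in> Obj C. \<forall>f \<in> Hom C A B. \<forall>g \<in> Hom C B E.
        on_mor F A E (Comp C A g f) = Comp D (on_ob F A) (on_mor F B E g) (on_mor F A B f))"

definition nat_transf ::
  "('o, 'm) cat \<Rightarrow> ('p, 'n) cat \<Rightarrow> ('o, 'm, 'p, 'n) fctr \<Rightarrow> ('o, 'm, 'p, 'n) fctr \<Rightarrow> ('o \<Rightarrow> 'n) set"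
  where
  "nat_transf C D F G =
     {\<tau> \<in> (\<Pi>\<^sub>E A \<in> Obj C. Hom D (on_ob F A) (on_ob G A)).
        \<forall>A \<in> Obj C. \<forall>B \<in> Obj C. \<forall>f \<in> Hom C A B.
          Comp D (on_ob F A) (on_mor G A B f) (\<tau> A) = Comp D (on_ob F A) (\<tau> B) (on_mor F A B f)}"

definition functor_cat ::
  "('o, 'm) cat \<Rightarrow> ('p, 'n) cat \<Rightarrow> (('o, 'm, 'p, 'n) fctr, 'o \<Rightarrow> 'n) cat" where
  "functor_cat C D = \<lparr>
     Obj = {F. is_functor C D F},
     Hom = nat_transf C D,
     Comp = (\<lambda>F \<tau> \<sigma>. \<lambda>A \<in> Obj C. Comp D (on_ob F A) (\<tau> A) (\<sigma> A)),
     Idn = (\<lambda>F. \<lambda>A \<in> Obj C. Idn D (on_ob F A))\<rparr>"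

definition is_product ::
  "('o, 'm) cat \<Rightarrow> 'i set \<Rightarrow> ('i \<Rightarrow> 'o) \<Rightarrow> 'o \<Rightarrow> ('i \<Rightarrow> 'm) \<Rightarrow> bool" where
  "is_product C I A P p \<longleftrightarrow> P \<in> Obj C \<and> (\<forall>i \<in> I. p i \<in> Hom C P (A i)) \<and>
     (\<forall>Z \<in> Obj C. \<forall>f. (\<forall>i \<in> I. f i \<in> Hom C Z (A i)) \<longrightarrow>
        (\<exists>!h. h \<in> Hom C Z P \<and> (\<forall>i \<in> I. Comp C Z (p i) h = f i)))"

definition is_coproduct ::
  "('o, 'm) cat \<Rightarrow> 'i set \<Rightarrow> ('i \<Rightarrow> 'o) \<Rightarrow> 'o \<Rightarrow> ('i \<Rightarrow> 'm) \<Rightarrow> bool" where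
  "is_coproduct C I A S s \<longleftrightarrow> S \<in> Obj C \<and> (\<forall>i \<in> I. s i \<in> Hom C (A i) S) \<and>
     (\<forall>Z \<in> Obj C. \<forall>f. (\<forall>i \<in> I. f i \<in> Hom C (A i) Z) \<longrightarrow>
        (\<exists>!h. h \<in> Hom C S Z \<and> (\<forall>i \<in> I. Comp C (A i) h (s i) = f i)))"

text \<open>The last clauses say that \<open>\<iota>\<close> is a colimiting cocone for the diagram
  \<open>t i j : A i \<rightarrow> A j\<close>, \<open>i \<le> j\<close>, over the directed poset \<open>(I, r)\<close>.\<close>

definition is_directed_colimit ::
  "('o, 'm) cat \<Rightarrow> 'i set \<Rightarrow> 'i rel \<Rightarrow> ('i \<Rightarrow> 'o) \<Rightarrow> ('i \<Rightarrow> 'i \<Rightarrow> 'm) \<Rightarrow> 'o \<Rightarrow> ('i \<Rightarrow> 'm) \<Rightarrow> bool"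
  where
  "is_directed_colimit C I r A t X \<iota> \<longleftrightarrow>
     partial_order_on I r \<and> I \<noteq> {} \<and> (\<forall>i \<in> I. \<forall>j \<in> I. \<exists>k \<in> I. (i, k) \<in> r \<and> (j, k) \<in> r) \<and>
     (\<forall>i \<in> I. A i \<in> Obj C) \<and>
     (\<forall>(i, j) \<in> r. t i j \<in> Hom C (A i) (A j)) \<and>
     (\<forall>i \<in> I. t i i = Idn C (A i)) \<and>
     (\<forall>i j k. (i, j) \<in> r \<longrightarrow> (j, k) \<in> r \<longrightarrow> Comp C (A i) (t j k) (t i j) = t i k) \<and>
     X \<in> Obj C \<and> (\<forall>i \<in> I. \<iota> i \<in> Hom C (A i) X) \<and>
     (\<forall>(i, j) \<in> r. Comp C (A i) (\<iota> j) (t i j) = \<iota> i) \<and>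
     (\<forall>Z \<in> Obj C. \<forall>f. (\<forall>i \<in> I. f i \<in> Hom C (A i) Z) \<longrightarrow>
        (\<forall>(i, j) \<in> r. Comp C (A i) (f j) (t i j) = f i) \<longrightarrow>
        (\<exists>!h. h \<in> Hom C X Z \<and> (\<forall>i \<in> I. Comp C (A i) h (\<iota> i) = f i)))"

text \<open>\<open>R\<close> and \<open>\<eta>\<close> are the object part and the unit of a left adjoint to the inclusion of the full
  subcategory on \<open>S\<close>; the value of this left adjoint on arrows is then \<open>refl_mor\<close>.\<close>

definition is_reflection ::
  "('o, 'm) cat \<Rightarrow> 'o set \<Rightarrow> ('o \<Rightarrow> 'o) \<Rightarrow> ('o \<Rightarrow> 'm) \<Rightarrow> bool" where
  "is_reflection C S R \<eta> \<longleftrightarrow> (\<forall>X \<in> Obj C.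
     R X \<in> Obj C \<inter> S \<and> \<eta> X \<in> Hom C X (R X) \<and>
     (\<forall>Z \<in> Obj C \<inter> S. \<forall>f \<in> Hom C X Z. \<exists>!g. g \<in> Hom C (R X) Z \<and> Comp C X g (\<eta> X) = f))"

definition refl_mor ::
  "('o, 'm) cat \<Rightarrow> ('o \<Rightarrow> 'o) \<Rightarrow> ('o \<Rightarrow> 'm) \<Rightarrow> 'o \<Rightarrow> 'o \<Rightarrow> 'm \<Rightarrow> 'm" where
  "refl_mor C R \<eta> X Y f =
     (THE g. g \<in> Hom C (R X) (R Y) \<and> Comp C X g (\<eta> X) = Comp C X (\<eta> Y) f)"


section \<open>Monoidal closed categories\<close>

text \<open>\<open>tmor M A A' B B' f g\<close> is the tensor product of \<open>f : A \<rightarrow> A'\<close> and \<open>g : B \<rightarrow> B'\<close>;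
  \<open>asc M X Y Z : (X \<otimes> Y) \<otimes> Z \<rightarrow> X \<otimes> (Y \<otimes> Z)\<close>;
  \<open>evl M X Z : X \<otimes> [X, Z] \<rightarrow> Z\<close> is the counit of the adjunction between \<open>X \<otimes> -\<close>
  and \<open>[X, -]\<close>.\<close>

record ('o, 'm) clmon =
  tob :: "'o \<Rightarrow> 'o \<Rightarrow> 'o"
  tmor :: "'o \<Rightarrow> 'o \<Rightarrow> 'o \<Rightarrow> 'o \<Rightarrow> 'm \<Rightarrow> 'm \<Rightarrow> 'm"
  unt :: "'o"
  asc :: "'o \<Rightarrow> 'o \<Rightarrow> 'o \<Rightarrow> 'm"
  lun :: "'o \<Rightarrow> 'm"
  run :: "'o \<Rightarrow> 'm"
  ihom :: "'o \<Rightarrow> 'o \<Rightarrow> 'o"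
  evl :: "'o \<Rightarrow> 'o \<Rightarrow> 'm"

locale monoidal_category = category C for C :: "('o, 'm) cat" +
  fixes M :: "('o, 'm) clmon"
  assumes tob_Obj: "\<lbrakk>A \<in> Obj C; B \<in> Obj C\<rbrakk> \<Longrightarrow> tob M A B \<in> Obj C"
    and tmor_Hom: "\<lbrakk>A \<in> Obj C; A' \<in> Obj C; B \<in> Obj C; B' \<in> Obj C; f \<in> Hom C A A'; g \<in> Hom C B B'\<rbrakk>
      \<Longrightarrow> tmor M A A' B B' f g \<in> Hom C (tob M A B) (tob M A' B')"
    and tmor_Idn: "\<lbrakk>A \<in> Obj C; B \<in> Obj C\<rbrakk>
      \<Longrightarrow> tmor M A A B B (Idn C A) (Idn C B) = Idn C (tob M A B)"
    and tmor_Comp: "\<lbrakk>A \<in> Obj C; A' \<in> Obj C; A'' \<in> Obj C; B \<in> Obj C; B' \<in> Obj C; B'' \<in> Obj C;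
        f \<in> Hom C A A'; f' \<in> Hom C A' A''; g \<in> Hom C B B'; g' \<in> Hom C B' B''\<rbrakk>
      \<Longrightarrow> tmor M A A'' B B'' (Comp C A f' f) (Comp C B g' g) =
          Comp C (tob M A B) (tmor M A' A'' B' B'' f' g') (tmor M A A' B B' f g)"
    and unt_Obj: "unt M \<in> Obj C"
    and asc_iso: "\<lbrakk>X \<in> Obj C; Y \<in> Obj C; Z \<in> Obj C\<rbrakk>
      \<Longrightarrow> is_isomorphism C (tob M (tob M X Y) Z) (tob M X (tob M Y Z)) (asc M X Y Z)"
    and asc_natural: "\<lbrakk>X \<in> Obj C; X' \<in> Obj C; Y \<in> Obj C; Y' \<in> Obj C; Z \<in> Obj C; Z' \<in> Obj C;
        f \<in> Hom C X X'; g \<in> Hom C Y Y'; h \<in> Hom C Z Z'\<rbrakk>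
      \<Longrightarrow> Comp C (tob M (tob M X Y) Z) (asc M X' Y' Z')
            (tmor M (tob M X Y) (tob M X' Y') Z Z' (tmor M X X' Y Y' f g) h) =
          Comp C (tob M (tob M X Y) Z)
            (tmor M X X' (tob M Y Z) (tob M Y' Z') f (tmor M Y Y' Z Z' g h)) (asc M X Y Z)"
    and lun_iso: "X \<in> Obj C \<Longrightarrow> is_isomorphism C (tob M (unt M) X) X (lun M X)"
    and lun_natural: "\<lbrakk>X \<in> Obj C; X' \<in> Obj C; f \<in> Hom C X X'\<rbrakk>
      \<Longrightarrow> Comp C (tob M (unt M) X) (lun M X')
            (tmor M (unt M) (unt M) X X' (Idn C (unt M)) f) =
          Comp C (tob M (unt M) X) f (lun M X)"
    and run_iso: "X \<in> Obj C \<Longrightarrow> is_isomorphism C (tob M X (unt M)) X (run M X)"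
    and run_natural: "\<lbrakk>X \<in> Obj C; X' \<in> Obj C; f \<in> Hom C X X'\<rbrakk>
      \<Longrightarrow> Comp C (tob M X (unt M)) (run M X')
            (tmor M X X' (unt M) (unt M) f (Idn C (unt M))) =
          Comp C (tob M X (unt M)) f (run M X)"
    and pentagon: "\<lbrakk>W \<in> Obj C; X \<in> Obj C; Y \<in> Obj C; Z \<in> Obj C\<rbrakk>
      \<Longrightarrow> Comp C (tob M (tob M (tob M W X) Y) Z) (asc M W X (tob M Y Z)) (asc M (tob M W X) Y Z) =
          Comp C (tob M (tob M (tob M W X) Y) Z)
            (tmor M W W (tob M (tob M X Y) Z) (tob M X (tob M Y Z)) (Idn C W) (asc M X Y Z))
            (Comp C (tob M (tob M (tob M W X) Y) Z)
              (asc M W (tob M X Y) Z)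
              (tmor M (tob M (tob M W X) Y) (tob M W (tob M X Y)) Z Z (asc M W X Y) (Idn C Z)))"
    and triangle: "\<lbrakk>X \<in> Obj C; Y \<in> Obj C\<rbrakk>
      \<Longrightarrow> Comp C (tob M (tob M X (unt M)) Y)
            (tmor M X X (tob M (unt M) Y) Y (Idn C X) (lun M Y)) (asc M X (unt M) Y) =
          tmor M (tob M X (unt M)) X Y Y (run M X) (Idn C Y)"

locale closed_monoidal_category = monoidal_category C M
  for C :: "('o, 'm) cat" and M :: "('o, 'm) clmon" +
  assumes ihom_Obj: "\<lbrakk>X \<in> Obj C; Z \<in> Obj C\<rbrakk> \<Longrightarrow> ihom M X Z \<in> Obj C"
    and evl_Hom: "\<lbrakk>X \<in> Obj C; Z \<in> Obj C\<rbrakk> \<Longrightarrow> evl M X Z \<in> Hom C (tob M X (ihom M X Z)) Z"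
    and evl_universal: "\<lbrakk>X \<in> Obj C; Y \<in> Obj C; Z \<in> Obj C; g \<in> Hom C (tob M X Y) Z\<rbrakk>
      \<Longrightarrow> \<exists>!h. h \<in> Hom C Y (ihom M X Z) \<and>
            Comp C (tob M X Y) (evl M X Z)
              (tmor M X X Y (ihom M X Z) (Idn C X) h) = g"

text \<open>\<open>N\<close> is the structure induced by \<open>M\<close> on the reflective full subcategory on \<open>S\<close>: tensor product
  and unit are the reflections of the ambient ones, the internal hom is the ambient one, and the
  structure maps are the unique ones compatible with the ambient ones along the reflection unit
  (equivalently, \<open>\<eta>\<close> makes the inclusion a lax monoidal functor, and the evaluation of \<open>N\<close>
  extends that of \<open>M\<close>).\<close>

definition induced_structure ::
  "('o, 'm) cat \<Rightarrow> ('o, 'm) clmon \<Rightarrow> 'o set \<Rightarrow> ('o \<Rightarrow> 'o) \<Rightarrow> ('o \<Rightarrow> 'm) \<Rightarrow> ('o, 'm) clmon \<Rightarrow> bool"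
  where
  "induced_structure C M S R \<eta> N \<longleftrightarrow>
     unt N = R (unt M) \<and>
     (\<forall>X \<in> Obj C \<inter> S. \<forall>Y \<in> Obj C \<inter> S.
        tob N X Y = R (tob M X Y) \<and> ihom N X Y = ihom M X Y) \<and>
     (\<forall>X \<in> Obj C \<inter> S. \<forall>X' \<in> Obj C \<inter> S. \<forall>Y \<in> Obj C \<inter> S. \<forall>Y' \<in> Obj C \<inter> S.
        \<forall>f \<in> Hom C X X'. \<forall>g \<in> Hom C Y Y'.
          tmor N X X' Y Y' f g =
            refl_mor C R \<eta> (tob M X Y) (tob M X' Y') (tmor M X X' Y Y' f g)) \<and>
     (\<forall>X \<in> Obj C \<inter> S. \<forall>Y \<in> Obj C \<inter> S. \<forall>Z \<in> Obj C \<inter> S.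
        Comp C (tob M (tob M X Y) Z) (asc N X Y Z)
          (Comp C (tob M (tob M X Y) Z)
            (\<eta> (tob M (R (tob M X Y)) Z))
            (tmor M (tob M X Y) (R (tob M X Y)) Z Z (\<eta> (tob M X Y)) (Idn C Z))) =
        Comp C (tob M (tob M X Y) Z)
          (\<eta> (tob M X (R (tob M Y Z))))
          (Comp C (tob M (tob M X Y) Z)
            (tmor M X X (tob M Y Z) (R (tob M Y Z)) (Idn C X) (\<eta> (tob M Y Z)))
            (asc M X Y Z))) \<and>
     (\<forall>X \<in> Obj C \<inter> S.
        Comp C (tob M (unt M) X) (lun N X)
          (Comp C (tob M (unt M) X)
            (\<eta> (tob M (R (unt M)) X))
            (tmor M (unt M) (R (unt M)) X X (\<eta> (unt M)) (Idn C X))) = lun M X) \<and>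
     (\<forall>X \<in> Obj C \<inter> S.
        Comp C (tob M X (unt M)) (run N X)
          (Comp C (tob M X (unt M))
            (\<eta> (tob M X (R (unt M))))
            (tmor M X X (unt M) (R (unt M)) (Idn C X) (\<eta> (unt M)))) = run M X) \<and>
     (\<forall>X \<in> Obj C \<inter> S. \<forall>Z \<in> Obj C \<inter> S.
        Comp C (tob M X (ihom M X Z)) (evl N X Z) (\<eta> (tob M X (ihom M X Z))) = evl M X Z)"


section \<open>Small vector spaces\<close>

text \<open>The type \<open>'u\<close> is the universe itself and \<open>elts x\<close> the set of elements of \<open>x\<close>. By Mostowski
  collapse the models are exactly the Grothendieck universes with an infinite element. Since
  the family \<open>f\<close> in \<open>union\<close> is an arbitrary function, all subsets of \<open>elts x\<close> and all images of
  \<open>elts x\<close> in \<open>'u\<close> are again of the form \<open>elts z\<close>.\<close>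

locale grothendieck_universe =
  fixes elts :: "'u \<Rightarrow> 'u set"
  assumes extensionality: "elts x = elts y \<Longrightarrow> x = y"
    and foundation: "wf {(x, y). x \<in> elts y}"
    and pairing: "\<exists>z. elts z = {x, y}"
    and powerset: "\<exists>z. elts z = {y. elts y \<subseteq> elts x}"
    and union: "\<exists>z. elts z = (\<Union>i \<in> elts x. elts (f i))"
    and non_trivial: "\<exists>x. infinite (elts x)"

definition code :: "('u \<Rightarrow> 'u set) \<Rightarrow> 'u set \<Rightarrow> 'u" where
  "code elts A = (THE z. elts z = A)"

definition kpair :: "('u \<Rightarrow> 'u set) \<Rightarrow> 'u \<Rightarrow> 'u \<Rightarrow> 'u" where
  "kpair elts x y = code elts {code elts {x}, code elts {x, y}}"

text \<open>A map between small sets is, through its graph, an element of the universe.\<close>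

definition graph :: "('u \<Rightarrow> 'u set) \<Rightarrow> 'u set \<Rightarrow> ('u \<Rightarrow> 'u) \<Rightarrow> 'u" where
  "graph elts A f = code elts ((\<lambda>x. kpair elts x (f x)) ` A)"

definition of_graph :: "('u \<Rightarrow> 'u set) \<Rightarrow> 'u set \<Rightarrow> 'u \<Rightarrow> ('u \<Rightarrow> 'u)" where
  "of_graph elts A g = (\<lambda>x \<in> A. THE y. kpair elts x y \<in> elts g)"

type_synonym 'u vec = "('u, 'u) module"
type_synonym 'u vmap = "'u \<Rightarrow> 'u"
type_synonym 'u vfun = "('u vec, 'u vmap, 'u vec, 'u vmap) fctr"
type_synonym 'u vnat = "'u vec \<Rightarrow> 'u vmap"

text \<open>The data fixed throughout: universe, ground field, and a choice of tensor products
  \<open>vtens V W\<close> of vector spaces with bilinear maps \<open>vbil V W : V \<times> W \<rightarrow> V \<otimes> W\<close>.\<close>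

record 'u vdata =
  elts :: "'u \<Rightarrow> 'u set"
  fld :: "'u ring"
  vtens :: "'u vec \<Rightarrow> 'u vec \<Rightarrow> 'u vec"
  vbil :: "'u vec \<Rightarrow> 'u vec \<Rightarrow> 'u \<Rightarrow> 'u \<Rightarrow> 'u"

definition small :: "'u vdata \<Rightarrow> 'u set \<Rightarrow> bool" where
  "small B A \<longleftrightarrow> A \<in> range (elts B)"

definition linmaps :: "'u vdata \<Rightarrow> 'u vec \<Rightarrow> 'u vec \<Rightarrow> 'u vmap set" where
  "linmaps B V W = {f \<in> carrier V \<rightarrow>\<^sub>E carrier W.
     (\<forall>x \<in> carrier V. \<forall>y \<in> carrier V. f (x \<oplus>\<^bsub>V\<^esub> y) = f x \<oplus>\<^bsub>W\<^esub> f y) \<and>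
     (\<forall>c \<in> carrier (fld B). \<forall>x \<in> carrier V. f (c \<odot>\<^bsub>V\<^esub> x) = c \<odot>\<^bsub>W\<^esub> f x)}"

definition Vect :: "'u vdata \<Rightarrow> ('u vec, 'u vmap) cat" where
  "Vect B = \<lparr>
     Obj = {V. module (fld B) V \<and> small B (carrier V)},
     Hom = linmaps B,
     Comp = (\<lambda>V g f. compose (carrier V) g f),
     Idn = (\<lambda>V. \<lambda>x \<in> carrier V. x)\<rparr>"

definition map_add :: "'u vec \<Rightarrow> 'u vec \<Rightarrow> 'u vmap \<Rightarrow> 'u vmap \<Rightarrow> 'u vmap" where
  "map_add V W f g = (\<lambda>x \<in> carrier V. f x \<oplus>\<^bsub>W\<^esub> g x)"

definition map_smult :: "'u vec \<Rightarrow> 'u vec \<Rightarrow> 'u \<Rightarrow> 'u vmap \<Rightarrow> 'u vmap" where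
  "map_smult V W c f = (\<lambda>x \<in> carrier V. c \<odot>\<^bsub>W\<^esub> f x)"

definition bilinear_on ::
  "'u vdata \<Rightarrow> 'u vec \<Rightarrow> 'u vec \<Rightarrow> 'u vec \<Rightarrow> ('u \<Rightarrow> 'u \<Rightarrow> 'u) \<Rightarrow> bool" where
  "bilinear_on B V W Z b \<longleftrightarrow>
     (\<forall>x \<in> carrier V. (\<lambda>y \<in> carrier W. b x y) \<in> linmaps B W Z) \<and>
     (\<forall>y \<in> carrier W. (\<lambda>x \<in> carrier V. b x y) \<in> linmaps B V Z)"

definition is_tensor :: "'u vdata \<Rightarrow> 'u vec \<Rightarrow> 'u vec \<Rightarrow> 'u vec \<Rightarrow> ('u \<Rightarrow> 'u \<Rightarrow> 'u) \<Rightarrow> bool" where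
  "is_tensor B V W T t \<longleftrightarrow> T \<in> Obj (Vect B) \<and> bilinear_on B V W T t \<and>
     (\<forall>Z \<in> Obj (Vect B). \<forall>b. bilinear_on B V W Z b \<longrightarrow>
        (\<exists>!h. h \<in> linmaps B T Z \<and> (\<forall>x \<in> carrier V. \<forall>y \<in> carrier W. h (t x y) = b x y)))"

locale vect_setting =
  fixes B :: "'u vdata"
  assumes universe: "grothendieck_universe (elts B)"
    and ground_field: "field (fld B)"
    and ground_field_small: "small B (carrier (fld B))"
    and tensors: "\<lbrakk>V \<in> Obj (Vect B); W \<in> Obj (Vect B)\<rbrakk>
      \<Longrightarrow> is_tensor B V W (vtens B V W) (vbil B V W)"

definition vtens_map ::
  "'u vdata \<Rightarrow> 'u vec \<Rightarrow> 'u vec \<Rightarrow> 'u vec \<Rightarrow> 'u vec \<Rightarrow> 'u vmap \<Rightarrow> 'u vmap \<Rightarrow> 'u vmap" where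
  "vtens_map B V V' W W' f g = (THE h. h \<in> linmaps B (vtens B V W) (vtens B V' W') \<and>
     (\<forall>x \<in> carrier V. \<forall>y \<in> carrier W. h (vbil B V W x y) = vbil B V' W' (f x) (g y)))"

definition vassoc_inv :: "'u vdata \<Rightarrow> 'u vec \<Rightarrow> 'u vec \<Rightarrow> 'u vec \<Rightarrow> 'u vmap" where
  "vassoc_inv B U V W =
     (THE h. h \<in> linmaps B (vtens B U (vtens B V W)) (vtens B (vtens B U V) W) \<and>
       (\<forall>x \<in> carrier U. \<forall>y \<in> carrier V. \<forall>z \<in> carrier W.
          h (vbil B U (vtens B V W) x (vbil B V W y z)) =
          vbil B (vtens B U V) W (vbil B U V x y) z))"

definition ground :: "'u vdata \<Rightarrow> 'u vec" where
  "ground B = \<lparr>carrier = carrier (fld B), mult = mult (fld B), one = one (fld B),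
     zero = zero (fld B), add = add (fld B), smult = mult (fld B)\<rparr>"


section \<open>The categories [Vect, Vect] and Ind-(Vect\<open>\<^sup>o\<^sup>p\<close>)\<close>

definition LinFun :: "'u vdata \<Rightarrow> ('u vfun, 'u vnat) cat" where
  "LinFun B = full_subcat (functor_cat (Vect B) (Vect B))
     {X. \<forall>V \<in> Obj (Vect B). \<forall>W \<in> Obj (Vect B).
        (\<forall>f \<in> linmaps B V W. \<forall>g \<in> linmaps B V W.
           on_mor X V W (map_add V W f g) =
           map_add (on_ob X V) (on_ob X W) (on_mor X V W f) (on_mor X V W g)) \<and>
        (\<forall>c \<in> carrier (fld B). \<forall>f \<in> linmaps B V W.
           on_mor X V W (map_smult V W c f) =
           map_smult (on_ob X V) (on_ob X W) c (on_mor X V W f))}"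

definition zero_nat :: "'u vdata \<Rightarrow> 'u vfun \<Rightarrow> 'u vfun \<Rightarrow> 'u vnat" where
  "zero_nat B X Y = (\<lambda>V \<in> Obj (Vect B). \<lambda>x \<in> carrier (on_ob X V). \<zero>\<^bsub>on_ob Y V\<^esub>)"

text \<open>The space of linear maps \<open>V \<rightarrow> W\<close>, coded by graphs; the ring multiplication slots of
  a module record play no role.\<close>

definition hom_space :: "'u vdata \<Rightarrow> 'u vec \<Rightarrow> 'u vec \<Rightarrow> 'u vec" where
  "hom_space B V W =
     (let c = graph (elts B) (carrier V); d = of_graph (elts B) (carrier V) in
      \<lparr>carrier = c ` linmaps B V W,
       mult = undefined, one = undefined,
       zero = c (\<lambda>x \<in> carrier V. \<zero>\<^bsub>W\<^esub>),
       add = (\<lambda>f g. c (map_add V W (d f) (d g))),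
       smult = (\<lambda>a f. c (map_smult V W a (d f)))\<rparr>)"

definition Yo :: "'u vdata \<Rightarrow> 'u vec \<Rightarrow> 'u vfun" where
  "Yo B V = \<lparr>
     on_ob = hom_space B V,
     on_mor = (\<lambda>W W' f. \<lambda>g \<in> carrier (hom_space B V W).
       graph (elts B) (carrier V) (compose (carrier V) f (of_graph (elts B) (carrier V) g)))\<rparr>"

definition Ind :: "'u vdata \<Rightarrow> ('u vfun, 'u vnat) cat" where
  "Ind B = full_subcat (LinFun B)
     {X. \<exists>I r V t \<iota>. small B I \<and> (\<forall>i \<in> I. V i \<in> Obj (Vect B)) \<and>
        is_directed_colimit (LinFun B) I r (\<lambda>i. Yo B (V i)) t X \<iota>}"


section \<open>The classes Q3 and Q4 and Q-free objects\<close>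

definition is_cokernel ::
  "'u vdata \<Rightarrow> 'u vfun \<Rightarrow> 'u vfun \<Rightarrow> 'u vnat \<Rightarrow> 'u vfun \<Rightarrow> 'u vnat \<Rightarrow> bool" where
  "is_cokernel B S P c Q q \<longleftrightarrow> Q \<in> Obj (LinFun B) \<and> q \<in> Hom (LinFun B) P Q \<and>
     Comp (LinFun B) S q c = zero_nat B S Q \<and>
     (\<forall>Z \<in> Obj (LinFun B). \<forall>f \<in> Hom (LinFun B) P Z.
        Comp (LinFun B) S f c = zero_nat B S Z \<longrightarrow>
        (\<exists>!h. h \<in> Hom (LinFun B) Q Z \<and> Comp (LinFun B) P h q = f))"

text \<open>\<open>c\<close> is the canonical map from the coproduct to the product of copies of the unit.\<close>

definition Q3 :: "'u vdata \<Rightarrow> 'u vfun set" where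
  "Q3 B = {Q. \<exists>I S s P p c q. small B I \<and>
     is_coproduct (LinFun B) I (\<lambda>i. Yo B (ground B)) S s \<and>
     is_product (LinFun B) I (\<lambda>i. Yo B (ground B)) P p \<and>
     c \<in> Hom (LinFun B) S P \<and>
     (\<forall>i \<in> I. \<forall>j \<in> I.
        Comp (LinFun B) (Yo B (ground B)) (p j) (Comp (LinFun B) (Yo B (ground B)) c (s i)) =
        (if i = j then Idn (LinFun B) (Yo B (ground B))
         else zero_nat B (Yo B (ground B)) (Yo B (ground B)))) \<and>
     is_cokernel B S P c Q q}"

definition subspace_filter :: "'u vdata \<Rightarrow> 'u vec \<Rightarrow> 'u set set \<Rightarrow> bool" where
  "subspace_filter B V F \<longleftrightarrow> F \<noteq> {} \<and> (\<forall>H \<in> F. submodule H (fld B) V) \<and>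
     (\<forall>H \<in> F. \<forall>H' \<in> F. H \<inter> H' \<in> F) \<and>
     (\<forall>H \<in> F. \<forall>H'. submodule H' (fld B) V \<longrightarrow> H \<subseteq> H' \<longrightarrow> H' \<in> F)"

text \<open>\<open>q\<close> exhibits \<open>Q\<close> as the (pointwise) quotient of \<open>Yo B V\<close> by the subfunctor of all maps
  vanishing on some member of \<open>F\<close>.\<close>

definition Q4 :: "'u vdata \<Rightarrow> 'u vfun set" where
  "Q4 B = {Q \<in> Obj (LinFun B). \<exists>V F q. V \<in> Obj (Vect B) \<and>
     subspace_filter B V F \<and> \<Inter>F = {\<zero>\<^bsub>V\<^esub>} \<and> q \<in> Hom (LinFun B) (Yo B V) Q \<and>
     (\<forall>W \<in> Obj (Vect B).
        q W ` carrier (on_ob (Yo B V) W) = carrier (on_ob Q W) \<and>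
        {g \<in> carrier (on_ob (Yo B V) W). q W g = \<zero>\<^bsub>on_ob Q W\<^esub>} =
        graph (elts B) (carrier V) ` {f \<in> linmaps B V W. \<exists>H \<in> F. \<forall>x \<in> H. f x = \<zero>\<^bsub>W\<^esub>})}"

definition Qfree :: "'u vdata \<Rightarrow> 'u vfun set \<Rightarrow> 'u vfun set" where
  "Qfree B \<Q> = {X. \<forall>Q \<in> \<Q>. \<forall>\<tau> \<in> Hom (LinFun B) Q X. \<tau> = zero_nat B Q X}"


section \<open>Tensor product and internal hom of Ind-objects\<close>

text \<open>\<open>\<psi>\<close> is a cowedge under the functor
  \<open>(H0, H1) \<mapsto> X(H0) \<otimes> Y(H1) \<otimes> Vect(H0 \<otimes> H1, V)\<close> with vertex \<open>Z\<close>, its components being written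
  as trilinear maps.\<close>

definition is_cowedge ::
  "'u vdata \<Rightarrow> 'u vfun \<Rightarrow> 'u vfun \<Rightarrow> 'u vec \<Rightarrow> 'u vec \<Rightarrow>
    ('u vec \<Rightarrow> 'u vec \<Rightarrow> 'u \<Rightarrow> 'u \<Rightarrow> 'u vmap \<Rightarrow> 'u) \<Rightarrow> bool" where
  "is_cowedge B X Y V Z \<psi> \<longleftrightarrow>
     (\<forall>H0 \<in> Obj (Vect B). \<forall>H1 \<in> Obj (Vect B).
       (\<forall>f \<in> linmaps B (vtens B H0 H1) V.
          bilinear_on B (on_ob X H0) (on_ob Y H1) Z (\<lambda>x y. \<psi> H0 H1 x y f)) \<and>
       (\<forall>x \<in> carrier (on_ob X H0). \<forall>y \<in> carrier (on_ob Y H1).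
          (\<forall>f \<in> linmaps B (vtens B H0 H1) V. \<forall>g \<in> linmaps B (vtens B H0 H1) V.
             \<psi> H0 H1 x y (map_add (vtens B H0 H1) V f g) = \<psi> H0 H1 x y f \<oplus>\<^bsub>Z\<^esub> \<psi> H0 H1 x y g) \<and>
          (\<forall>c \<in> carrier (fld B). \<forall>f \<in> linmaps B (vtens B H0 H1) V.
             \<psi> H0 H1 x y (map_smult (vtens B H0 H1) V c f) = c \<odot>\<^bsub>Z\<^esub> \<psi> H0 H1 x y f))) \<and>
     (\<forall>H0 \<in> Obj (Vect B). \<forall>H0' \<in> Obj (Vect B). \<forall>H1 \<in> Obj (Vect B). \<forall>H1' \<in> Obj (Vect B).
       \<forall>a \<in> linmaps B H0 H0'. \<forall>b \<in> linmaps B H1 H1'.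
       \<forall>x \<in> carrier (on_ob X H0). \<forall>y \<in> carrier (on_ob Y H1).
       \<forall>f \<in> linmaps B (vtens B H0' H1') V.
         \<psi> H0' H1' (on_mor X H0 H0' a x) (on_mor Y H1 H1' b y) f =
         \<psi> H0 H1 x y (compose (carrier (vtens B H0 H1)) f (vtens_map B H0 H0' H1 H1' a b)))"

text \<open>\<open>dob D X Y\<close> is the tensor product of \<open>X\<close> and \<open>Y\<close>, and \<open>dcw D X Y V\<close> the universal cowedge
  with vertex its value at \<open>V\<close>.\<close>

record 'u ddata =
  dob :: "'u vfun \<Rightarrow> 'u vfun \<Rightarrow> 'u vfun"
  dcw :: "'u vfun \<Rightarrow> 'u vfun \<Rightarrow> 'u vec \<Rightarrow> 'u vec \<Rightarrow> 'u vec \<Rightarrow> 'u \<Rightarrow> 'u \<Rightarrow> 'u vmap \<Rightarrow> 'u"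

definition is_ind_tensor :: "'u vdata \<Rightarrow> 'u ddata \<Rightarrow> bool" where
  "is_ind_tensor B D \<longleftrightarrow> (\<forall>X \<in> Obj (Ind B). \<forall>Y \<in> Obj (Ind B).
     dob D X Y \<in> Obj (Ind B) \<and>
     (\<forall>V \<in> Obj (Vect B).
        is_cowedge B X Y V (on_ob (dob D X Y) V) (dcw D X Y V) \<and>
        (\<forall>Z \<in> Obj (Vect B). \<forall>\<psi>. is_cowedge B X Y V Z \<psi> \<longrightarrow>
          (\<exists>!h. h \<in> linmaps B (on_ob (dob D X Y) V) Z \<and>
             (\<forall>H0 \<in> Obj (Vect B). \<forall>H1 \<in> Obj (Vect B).
              \<forall>x \<in> carrier (on_ob X H0). \<forall>y \<in> carrier (on_ob Y H1).
              \<forall>f \<in> linmaps B (vtens B H0 H1) V.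
                h (dcw D X Y V H0 H1 x y f) = \<psi> H0 H1 x y f)))) \<and>
     (\<forall>V \<in> Obj (Vect B). \<forall>V' \<in> Obj (Vect B). \<forall>g \<in> linmaps B V V'.
        \<forall>H0 \<in> Obj (Vect B). \<forall>H1 \<in> Obj (Vect B).
        \<forall>x \<in> carrier (on_ob X H0). \<forall>y \<in> carrier (on_ob Y H1).
        \<forall>f \<in> linmaps B (vtens B H0 H1) V.
          on_mor (dob D X Y) V V' g (dcw D X Y V H0 H1 x y f) =
          dcw D X Y V' H0 H1 x y (compose (carrier (vtens B H0 H1)) g f)))"

text \<open>The functor \<open>Y(- \<otimes> V)\<close>.\<close>

definition shift :: "'u vdata \<Rightarrow> 'u vfun \<Rightarrow> 'u vec \<Rightarrow> 'u vfun" where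
  "shift B Y V = \<lparr>
     on_ob = (\<lambda>H. on_ob Y (vtens B H V)),
     on_mor = (\<lambda>H H' a. on_mor Y (vtens B H V) (vtens B H' V)
       (vtens_map B H H' V V a (\<lambda>v \<in> carrier V. v)))\<rparr>"

text \<open>Natural transformations between functors on \<open>Vect\<close> are not elements of the universe, so the
  internal hom comes with linear bijections \<open>hnt N X Y V\<close> from its value at \<open>V\<close>
  onto the space of natural transformations \<open>X \<rightarrow> Y(- \<otimes> V)\<close>, natural in \<open>V\<close>.\<close>

record 'u hdata =
  hob :: "'u vfun \<Rightarrow> 'u vfun \<Rightarrow> 'u vfun"
  hnt :: "'u vfun \<Rightarrow> 'u vfun \<Rightarrow> 'u vec \<Rightarrow> 'u \<Rightarrow> 'u vnat"

definition is_ind_hom :: "'u vdata \<Rightarrow> 'u hdata \<Rightarrow> bool" where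
  "is_ind_hom B N \<longleftrightarrow> (\<forall>X \<in> Obj (Ind B). \<forall>Y \<in> Obj (Ind B).
     hob N X Y \<in> Obj (Ind B) \<and>
     (\<forall>V \<in> Obj (Vect B).
        bij_betw (hnt N X Y V) (carrier (on_ob (hob N X Y) V))
          (Hom (LinFun B) X (shift B Y V)) \<and>
        (\<forall>H \<in> Obj (Vect B). \<forall>x \<in> carrier (on_ob X H).
          (\<forall>s \<in> carrier (on_ob (hob N X Y) V). \<forall>t \<in> carrier (on_ob (hob N X Y) V).
            hnt N X Y V (s \<oplus>\<^bsub>on_ob (hob N X Y) V\<^esub> t) H x =
            hnt N X Y V s H x \<oplus>\<^bsub>on_ob (shift B Y V) H\<^esub> hnt N X Y V t H x) \<and>
          (\<forall>c \<in> carrier (fld B). \<forall>s \<in> carrier (on_ob (hob N X Y) V).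
            hnt N X Y V (c \<odot>\<^bsub>on_ob (hob N X Y) V\<^esub> s) H x =
            c \<odot>\<^bsub>on_ob (shift B Y V) H\<^esub> hnt N X Y V s H x))) \<and>
     (\<forall>V \<in> Obj (Vect B). \<forall>V' \<in> Obj (Vect B). \<forall>g \<in> linmaps B V V'.
        \<forall>s \<in> carrier (on_ob (hob N X Y) V). \<forall>H \<in> Obj (Vect B). \<forall>x \<in> carrier (on_ob X H).
          hnt N X Y V' (on_mor (hob N X Y) V V' g s) H x =
          on_mor Y (vtens B H V) (vtens B H V')
            (vtens_map B H H V V' (\<lambda>h \<in> carrier H. h) g) (hnt N X Y V s H x)))"

text \<open>Arrows out of a tensor product are determined by their values on the elements
  \<open>dcw D X Y V H0 H1 x y f\<close>; the structure maps induced by those of \<open>\<otimes>\<close> on \<open>Vect\<close> are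
  given by these values.\<close>

definition ind_tmor ::
  "'u vdata \<Rightarrow> 'u ddata \<Rightarrow> 'u vfun \<Rightarrow> 'u vfun \<Rightarrow> 'u vfun \<Rightarrow> 'u vfun \<Rightarrow> 'u vnat \<Rightarrow> 'u vnat \<Rightarrow> 'u vnat"
  where
  "ind_tmor B D X X' Y Y' \<sigma> \<tau> = (THE \<theta>. \<theta> \<in> Hom (Ind B) (dob D X Y) (dob D X' Y') \<and>
     (\<forall>V \<in> Obj (Vect B). \<forall>H0 \<in> Obj (Vect B). \<forall>H1 \<in> Obj (Vect B).
      \<forall>x \<in> carrier (on_ob X H0). \<forall>y \<in> carrier (on_ob Y H1).
      \<forall>f \<in> linmaps B (vtens B H0 H1) V.
        \<theta> V (dcw D X Y V H0 H1 x y f) = dcw D X' Y' V H0 H1 (\<sigma> H0 x) (\<tau> H1 y) f))"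

text \<open>With \<open>f : H0 \<otimes> H1 \<rightarrow> H\<close> and \<open>g : H \<otimes> L \<rightarrow> V\<close>, the linear map on the right is
  \<open>H0 \<otimes> (H1 \<otimes> L) \<cong> (H0 \<otimes> H1) \<otimes> L \<rightarrow> H \<otimes> L \<rightarrow> V\<close>.\<close>

definition ind_asc :: "'u vdata \<Rightarrow> 'u ddata \<Rightarrow> 'u vfun \<Rightarrow> 'u vfun \<Rightarrow> 'u vfun \<Rightarrow> 'u vnat" where
  "ind_asc B D X Y Z =
     (THE \<theta>. \<theta> \<in> Hom (Ind B) (dob D (dob D X Y) Z) (dob D X (dob D Y Z)) \<and>
     (\<forall>V \<in> Obj (Vect B). \<forall>H \<in> Obj (Vect B). \<forall>L \<in> Obj (Vect B).
      \<forall>H0 \<in> Obj (Vect B). \<forall>H1 \<in> Obj (Vect B).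
      \<forall>x \<in> carrier (on_ob X H0). \<forall>y \<in> carrier (on_ob Y H1). \<forall>z \<in> carrier (on_ob Z L).
      \<forall>f \<in> linmaps B (vtens B H0 H1) H. \<forall>g \<in> linmaps B (vtens B H L) V.
        \<theta> V (dcw D (dob D X Y) Z V H L (dcw D X Y H H0 H1 x y f) z g) =
        dcw D X (dob D Y Z) V H0 (vtens B H1 L) x
          (dcw D Y Z (vtens B H1 L) H1 L y z (\<lambda>w \<in> carrier (vtens B H1 L). w))
          (compose (carrier (vtens B H0 (vtens B H1 L))) g
            (compose (carrier (vtens B H0 (vtens B H1 L)))
              (vtens_map B (vtens B H0 H1) H L L f (\<lambda>l \<in> carrier L. l))
              (vassoc_inv B H0 H1 L)))))"

definition ind_lun :: "'u vdata \<Rightarrow> 'u ddata \<Rightarrow> 'u vfun \<Rightarrow> 'u vnat" where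
  "ind_lun B D X = (THE \<theta>. \<theta> \<in> Hom (Ind B) (dob D (Yo B (ground B)) X) X \<and>
     (\<forall>V \<in> Obj (Vect B). \<forall>H0 \<in> Obj (Vect B). \<forall>H1 \<in> Obj (Vect B).
      \<forall>u \<in> linmaps B (ground B) H0. \<forall>x \<in> carrier (on_ob X H1).
      \<forall>f \<in> linmaps B (vtens B H0 H1) V.
        \<theta> V (dcw D (Yo B (ground B)) X V H0 H1 (graph (elts B) (carrier (ground B)) u) x f) =
        on_mor X H1 V (\<lambda>h \<in> carrier H1. f (vbil B H0 H1 (u \<one>\<^bsub>fld B\<^esub>) h)) x))"

definition ind_run :: "'u vdata \<Rightarrow> 'u ddata \<Rightarrow> 'u vfun \<Rightarrow> 'u vnat" where
  "ind_run B D X = (THE \<theta>. \<theta> \<in> Hom (Ind B) (dob D X (Yo B (ground B))) X \<and>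
     (\<forall>V \<in> Obj (Vect B). \<forall>H0 \<in> Obj (Vect B). \<forall>H1 \<in> Obj (Vect B).
      \<forall>x \<in> carrier (on_ob X H0). \<forall>u \<in> linmaps B (ground B) H1.
      \<forall>f \<in> linmaps B (vtens B H0 H1) V.
        \<theta> V (dcw D X (Yo B (ground B)) V H0 H1 x (graph (elts B) (carrier (ground B)) u) f) =
        on_mor X H0 V (\<lambda>h \<in> carrier H0. f (vbil B H0 H1 h (u \<one>\<^bsub>fld B\<^esub>))) x))"

definition ind_evl :: "'u vdata \<Rightarrow> 'u ddata \<Rightarrow> 'u hdata \<Rightarrow> 'u vfun \<Rightarrow> 'u vfun \<Rightarrow> 'u vnat" where
  "ind_evl B D N X Z = (THE \<theta>. \<theta> \<in> Hom (Ind B) (dob D X (hob N X Z)) Z \<and>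
     (\<forall>V \<in> Obj (Vect B). \<forall>H0 \<in> Obj (Vect B). \<forall>H1 \<in> Obj (Vect B).
      \<forall>x \<in> carrier (on_ob X H0). \<forall>s \<in> carrier (on_ob (hob N X Z) H1).
      \<forall>f \<in> linmaps B (vtens B H0 H1) V.
        \<theta> V (dcw D X (hob N X Z) V H0 H1 x s f) =
        on_mor Z (vtens B H0 H1) V f (hnt N X Z H1 s H0 x)))"

definition ind_clmon :: "'u vdata \<Rightarrow> 'u ddata \<Rightarrow> 'u hdata \<Rightarrow> ('u vfun, 'u vnat) clmon" where
  "ind_clmon B D N = \<lparr>
     tob = dob D, tmor = ind_tmor B D, unt = Yo B (ground B),
     asc = ind_asc B D, lun = ind_lun B D, run = ind_run B D,
     ihom = hob N, evl = ind_evl B D N\<rparr>"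

end

theory Submission
  imports Defs
begin

text \<open>
  Call a family \<open>\<beta>(x, y) \<in> Z(H \<otimes> L)\<close>, bilinear in \<open>x \<in> X(H)\<close> and \<open>y \<in> Y(L)\<close> and natural in
  \<open>H\<close> and \<open>L\<close>, a bifamily from \<open>X, Y\<close> to \<open>Z\<close>.  The tensor product of Ind-objects carries a universal
  bifamily \<open>u\<close>, and its reflection carries \<open>\<eta> \<circ> u\<close>, which is universal among the bifamilies with
  \<open>\<Q>\<close>-free target.  Structure maps are then determined by their values on the iterated generators
  \<open>u(u(x, y), z)\<close>, where the coherence laws become those of the tensor product of vector spaces.  To
  construct and compare such maps one fixes one variable at a time, for which the admissible targets
  have to be closed under \<open>Z \<mapsto> Z(- \<otimes> V)\<close> and \<open>Z \<mapsto> Z(V \<otimes> -)\<close>.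

  For \<open>\<Q>\<close>-free targets this closure, and the fact that \<open>Hom(X, Z)\<close> is \<open>\<Q>\<close>-free whenever \<open>Z\<close> is, amount
  to the following: if \<open>Z\<close> is \<open>\<Q>\<close>-free, then every map \<open>Q \<rightarrow> Z(V \<otimes> -)\<close> with \<open>Q \<in> \<Q>\<close> is zero.  If \<open>Q\<close> is a
  quotient of \<open>\<Y>V'\<close>, such a map is an element of \<open>Z(V \<otimes> V')\<close>, that is a map \<open>\<Y>(V \<otimes> V') \<rightarrow> Z\<close>, and this
  map factors through another member of \<open>\<Q>\<close>: for \<open>Q3\<close> the one with index set a basis of
  \<open>V \<otimes> V'\<close>, and for \<open>Q4\<close> the one given by the filter generated by the subspaces \<open>V \<otimes> H\<close>.
\<close>

text \<open>The power \<open>(Yo B kk)^I\<close> is itself representable: a linear map out of a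
  space T with basis I is the family of its values on I, so the power is \<open>Yo B T\<close>, and
  the copower consists of the maps with finitely many nonzero basis values. Hence members of
  \<open>Q3\<close>, like those of \<open>Q4\<close>, are quotients of a representable, and both
  cases reduce to an element y of Z(V \<otimes> V'). For \<open>Q3\<close> the basis of V \<otimes>
  V' consists of tensors b \<otimes> d, because the projection onto such a line factors through id
  \<otimes> (projection onto d), which kills y.

  The monoidal laws are proved once, in a locale with two classes of functors, and instantiated
  twice. For Ind-objects every linear functor may be a target, since the coend is universal at each
  V separately. The reflection is universal only for Q-free Ind-objects, while Z(V \<otimes> -) as a
  concrete functor is merely isomorphic to the Ind-object Hom(\<Y>V, Z); so its targets are the
  functors isomorphic to a Q-free Ind-object. Both structures being given on generators,
  compatibility with the reflection unit is again a comparison of values.\<close>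

context grothendieck_universe
begin

section \<open>Small sets, pairs and graphs in the universe\<close>

lemma elts_code: "A \<in> range elts \<Longrightarrow> elts (code elts A) = A"
  unfolding code_def by (rule theI2[of _ "the_inv elts A"])
    (auto simp: the_inv_f_f injI extensionality intro: extensionality)

text \<open>A set that is minimal for membership has no elements, and foundation supplies
  one.\<close>

lemma small_empty: "{} \<in> range elts"
proof -
  obtain z where "\<And>y. (y, z) \<in> {(x, y). x \<in> elts y} \<Longrightarrow> y \<notin> UNIV"
    using wfE_min[OF foundation UNIV_I] by metis
  then have "elts z = {}" by auto
  then show ?thesis by (metis rangeI)
qed

lemma small_insert2: "{x, y} \<in> range elts"
  by (metis pairing rangeI)

lemma small_singleton: "{x} \<in> range elts"
  using small_insert2[of x x] by simp

lemma small_UN: "A \<in> range elts \<Longrightarrow> (\<And>x. x \<in> A \<Longrightarrow> f x \<in> range elts) \<Longrightarrow> (\<Union>x\<in>A. f x) \<in> range elts"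
proof -
  assume "A \<in> range elts" and f: "\<And>x. x \<in> A \<Longrightarrow> f x \<in> range elts"
  then obtain a where a: "A = elts a" by auto
  \<comment> \<open>The axiom \<open>union\<close> takes a family of elements of the universe, so
    each small set enters through its code.\<close>
  obtain z where "elts z = (\<Union>i \<in> elts a. elts (code elts (f i)))" using union by metis
  moreover have "\<And>i. i \<in> elts a \<Longrightarrow> elts (code elts (f i)) = f i"
    using f a by (simp add: elts_code)
  ultimately have "elts z = (\<Union>i\<in>A. f i)" using a by simp
  then show ?thesis by (metis rangeI)
qed

text \<open>Separation is obtained from unions: points of A outside S contribute the empty set
  instead of a singleton.\<close>

lemma small_subset: "A \<in> range elts \<Longrightarrow> S \<subseteq> A \<Longrightarrow> S \<in> range elts"
proof -
  assume "A \<in> range elts" "S \<subseteq> A"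
  then have "(\<Union>x\<in>A. if x \<in> S then {x} else {}) \<in> range elts"
    by (intro small_UN) (auto simp: small_empty small_singleton)
  moreover have "(\<Union>x\<in>A. if x \<in> S then {x} else {}) = S" using \<open>S \<subseteq> A\<close> by auto
  ultimately show ?thesis by simp
qed

lemma small_image: "A \<in> range elts \<Longrightarrow> f ` A \<in> range elts"
  using small_UN[of A "\<lambda>x. {f x}"] by (simp add: small_singleton UNION_singleton_eq_range)

lemma code_inject:
  "A \<in> range elts \<Longrightarrow> A' \<in> range elts \<Longrightarrow> code elts A = code elts A' \<longleftrightarrow> A = A'"
  by (metis elts_code)

lemma kpair_inject: "kpair elts x y = kpair elts x' y' \<longleftrightarrow> x = x' \<and> y = y'"
  unfolding kpair_def
  by (simp add: code_inject small_insert2 small_singleton) (auto simp: doubleton_eq_iff code_inject small_insert2 small_singleton)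

lemma small_pairs:
  assumes "A \<in> range elts" "A' \<in> range elts"
  shows "(\<lambda>(x, y). kpair elts x y) ` (A \<times> A') \<in> range elts"
proof -
  have "(\<lambda>(x, y). kpair elts x y) ` (A \<times> A') = (\<Union>x\<in>A. kpair elts x ` A')" by auto
  then show ?thesis using assms by (simp add: small_UN small_image)
qed

lemma elts_graph: "A \<in> range elts \<Longrightarrow> elts (graph elts A f) = (\<lambda>x. kpair elts x (f x)) ` A"
  unfolding graph_def by (simp add: elts_code small_image)

text \<open>Extensionality is what makes the code faithful: the graph says nothing about points
  outside A, and there \<open>of_graph\<close> returns \<open>undefined\<close>.\<close>

lemma of_graph_graph:
  assumes "A \<in> range elts" "f \<in> extensional A"
  shows "of_graph elts A (graph elts A f) = f"
proof
  fix x show "of_graph elts A (graph elts A f) x = f x"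
    using assms by (cases "x \<in> A") (auto simp: of_graph_def elts_graph kpair_inject image_iff extensional_def intro!: the_equality)
qed

text \<open>A graph is a subset of the set of all pairs, hence an element of its powerset.\<close>

lemma small_graphs:
  assumes "A \<in> range elts" "A' \<in> range elts"
  shows "graph elts A ` (A \<rightarrow>\<^sub>E A') \<in> range elts"
proof -
  obtain p where p: "elts p = (\<lambda>(x, y). kpair elts x y) ` (A \<times> A')"
    using small_pairs[OF assms] by (metis imageE)
  obtain z where z: "elts z = {y. elts y \<subseteq> elts p}" using powerset by blast
  have "graph elts A f \<in> elts z" if "f \<in> A \<rightarrow>\<^sub>E A'" for f
    using that assms(1) by (fastforce simp: z p elts_graph)
  then have "graph elts A ` (A \<rightarrow>\<^sub>E A') \<subseteq> elts z"
    by blast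
  then show ?thesis using small_subset by (metis rangeI)
qed

end

section \<open>Small vector spaces and linear maps\<close>

context vect_setting
begin

sublocale U: grothendieck_universe "elts B"
  by (rule universe)

sublocale K: field "fld B"
  by (rule ground_field)

abbreviation Vob where "Vob \<equiv> Obj (Vect B)"
abbreviation lin where "lin \<equiv> linmaps B"
abbreviation vtensor (infixr \<open>\<star>\<close> 75) where "V \<star> W \<equiv> vtens B V W"
abbreviation idm where "idm V \<equiv> (\<lambda>x \<in> carrier V. x)"
abbreviation cmp where "cmp V g f \<equiv> compose (carrier V) g f"

lemma small_eq: "small B A \<longleftrightarrow> A \<in> range (elts B)"
  by (simp add: small_def)

lemma Vob_iff: "V \<in> Vob \<longleftrightarrow> module (fld B) V \<and> small B (carrier V)"
  by (simp add: Vect_def)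

lemma Vob_module: "V \<in> Vob \<Longrightarrow> module (fld B) V"
  by (simp add: Vob_iff)

lemma Vob_small: "V \<in> Vob \<Longrightarrow> carrier V \<in> range (elts B)"
  by (simp add: Vob_iff small_eq)

lemma Vob_group: "V \<in> Vob \<Longrightarrow> abelian_group V"
  using Vob_module module.axioms(2) by blast

lemma Vob_monoid: "V \<in> Vob \<Longrightarrow> abelian_monoid V"
  using Vob_group abelian_group.axioms(1) by blast

lemma Vect_simps [simp]: "Hom (Vect B) = lin" "Comp (Vect B) V g f = cmp V g f"
  "Idn (Vect B) V = idm V"
  by (simp_all add: Vect_def)

lemma vadd_closed [simp]: "V \<in> Vob \<Longrightarrow> x \<in> carrier V \<Longrightarrow> y \<in> carrier V \<Longrightarrow> x \<oplus>\<^bsub>V\<^esub> y \<in> carrier V"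
  by (simp add: Vob_monoid abelian_monoid.a_closed)

lemma vzero_closed [simp]: "V \<in> Vob \<Longrightarrow> \<zero>\<^bsub>V\<^esub> \<in> carrier V"
  by (simp add: Vob_monoid abelian_monoid.zero_closed)

lemma vneg_closed [simp]: "V \<in> Vob \<Longrightarrow> x \<in> carrier V \<Longrightarrow> \<ominus>\<^bsub>V\<^esub> x \<in> carrier V"
  by (simp add: Vob_group abelian_group.a_inv_closed)

lemma vsmult_closed [simp]:
  "V \<in> Vob \<Longrightarrow> c \<in> carrier (fld B) \<Longrightarrow> x \<in> carrier V \<Longrightarrow> c \<odot>\<^bsub>V\<^esub> x \<in> carrier V"
  by (rule module.smult_closed[OF Vob_module])

lemma vzero_left [simp]: "V \<in> Vob \<Longrightarrow> x \<in> carrier V \<Longrightarrow> \<zero>\<^bsub>V\<^esub> \<oplus>\<^bsub>V\<^esub> x = x"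
  by (simp add: Vob_monoid abelian_monoid.l_zero)

lemma vzero_right [simp]: "V \<in> Vob \<Longrightarrow> x \<in> carrier V \<Longrightarrow> x \<oplus>\<^bsub>V\<^esub> \<zero>\<^bsub>V\<^esub> = x"
  by (simp add: Vob_monoid abelian_monoid.r_zero)

lemma vsmult_zero [simp]: "V \<in> Vob \<Longrightarrow> c \<in> carrier (fld B) \<Longrightarrow> c \<odot>\<^bsub>V\<^esub> \<zero>\<^bsub>V\<^esub> = \<zero>\<^bsub>V\<^esub>"
  by (rule module.smult_r_null[OF Vob_module])

lemma vsmult_zero_left [simp]: "V \<in> Vob \<Longrightarrow> x \<in> carrier V \<Longrightarrow> \<zero>\<^bsub>fld B\<^esub> \<odot>\<^bsub>V\<^esub> x = \<zero>\<^bsub>V\<^esub>"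
  by (simp add: Vob_module module.smult_l_null)

lemma vsmult_one [simp]: "V \<in> Vob \<Longrightarrow> x \<in> carrier V \<Longrightarrow> \<one>\<^bsub>fld B\<^esub> \<odot>\<^bsub>V\<^esub> x = x"
  by (simp add: Vob_module module.smult_one)

lemma vadd4: "V \<in> Vob \<Longrightarrow> a \<in> carrier V \<Longrightarrow> b \<in> carrier V \<Longrightarrow> c \<in> carrier V \<Longrightarrow> d \<in> carrier V \<Longrightarrow>
    (a \<oplus>\<^bsub>V\<^esub> b) \<oplus>\<^bsub>V\<^esub> (c \<oplus>\<^bsub>V\<^esub> d) = (a \<oplus>\<^bsub>V\<^esub> c) \<oplus>\<^bsub>V\<^esub> (b \<oplus>\<^bsub>V\<^esub> d)"
  by (simp add: Vob_monoid abelian_monoid.a_ac abelian_monoid.a_closed)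

lemma vsmult_add:
  "V \<in> Vob \<Longrightarrow> c \<in> carrier (fld B) \<Longrightarrow> x \<in> carrier V \<Longrightarrow> y \<in> carrier V \<Longrightarrow>
    c \<odot>\<^bsub>V\<^esub> (x \<oplus>\<^bsub>V\<^esub> y) = c \<odot>\<^bsub>V\<^esub> x \<oplus>\<^bsub>V\<^esub> c \<odot>\<^bsub>V\<^esub> y"
  by (rule module.smult_r_distr[OF Vob_module])

lemma vadd_smult:
  "V \<in> Vob \<Longrightarrow> c \<in> carrier (fld B) \<Longrightarrow> d \<in> carrier (fld B) \<Longrightarrow> x \<in> carrier V \<Longrightarrow>
    (c \<oplus>\<^bsub>fld B\<^esub> d) \<odot>\<^bsub>V\<^esub> x = c \<odot>\<^bsub>V\<^esub> x \<oplus>\<^bsub>V\<^esub> d \<odot>\<^bsub>V\<^esub> x"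
  by (simp add: Vob_module module.smult_l_distr)

lemma vsmult_smult:
  "V \<in> Vob \<Longrightarrow> c \<in> carrier (fld B) \<Longrightarrow> d \<in> carrier (fld B) \<Longrightarrow> x \<in> carrier V \<Longrightarrow>
    c \<odot>\<^bsub>V\<^esub> (d \<odot>\<^bsub>V\<^esub> x) = (c \<otimes>\<^bsub>fld B\<^esub> d) \<odot>\<^bsub>V\<^esub> x"
  by (simp add: Vob_module module.smult_assoc1)

lemma vsmult_comm:
  "V \<in> Vob \<Longrightarrow> c \<in> carrier (fld B) \<Longrightarrow> d \<in> carrier (fld B) \<Longrightarrow> x \<in> carrier V \<Longrightarrow>
    c \<odot>\<^bsub>V\<^esub> (d \<odot>\<^bsub>V\<^esub> x) = d \<odot>\<^bsub>V\<^esub> (c \<odot>\<^bsub>V\<^esub> x)"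
  by (simp add: vsmult_smult K.m_comm)

text \<open>Written as scaling by -1, negation is respected by linear maps and subspaces without any
  separate argument.\<close>

lemma vneg_eq_smult: "V \<in> Vob \<Longrightarrow> x \<in> carrier V \<Longrightarrow> \<ominus>\<^bsub>V\<^esub> x = (\<ominus>\<^bsub>fld B\<^esub> \<one>\<^bsub>fld B\<^esub>) \<odot>\<^bsub>V\<^esub> x"
  by (simp add: Vob_module module.smult_l_minus module.smult_one)

lemma vminus_eq_zero:
  assumes "V \<in> Vob" "x \<in> carrier V" "y \<in> carrier V" shows "x \<ominus>\<^bsub>V\<^esub> y = \<zero>\<^bsub>V\<^esub> \<longleftrightarrow> x = y"
proof -
  interpret abelian_group V using assms(1) by (rule Vob_group)
  show ?thesis using assms
    by (metis a_minus_def a_inv_closed minus_equality minus_minus r_neg)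
qed

lemma vminus_self [simp]: "V \<in> Vob \<Longrightarrow> x \<in> carrier V \<Longrightarrow> x \<ominus>\<^bsub>V\<^esub> x = \<zero>\<^bsub>V\<^esub>"
  by (simp add: vminus_eq_zero)

lemma vminus_zero [simp]: "V \<in> Vob \<Longrightarrow> x \<in> carrier V \<Longrightarrow> x \<ominus>\<^bsub>V\<^esub> \<zero>\<^bsub>V\<^esub> = x"
  by (simp add: a_minus_def vneg_eq_smult)

lemma linI:
  assumes "f \<in> extensional (carrier V)" "\<And>x. x \<in> carrier V \<Longrightarrow> f x \<in> carrier W"
    and "\<And>x y. x \<in> carrier V \<Longrightarrow> y \<in> carrier V \<Longrightarrow> f (x \<oplus>\<^bsub>V\<^esub> y) = f x \<oplus>\<^bsub>W\<^esub> f y"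
    and "\<And>c x. c \<in> carrier (fld B) \<Longrightarrow> x \<in> carrier V \<Longrightarrow> f (c \<odot>\<^bsub>V\<^esub> x) = c \<odot>\<^bsub>W\<^esub> f x"
  shows "f \<in> lin V W"
  using assms by (simp add: linmaps_def PiE_iff)

lemma lin_restrictI:
  assumes "V \<in> Vob" "\<And>x. x \<in> carrier V \<Longrightarrow> f x \<in> carrier W"
    and "\<And>x y. x \<in> carrier V \<Longrightarrow> y \<in> carrier V \<Longrightarrow> f (x \<oplus>\<^bsub>V\<^esub> y) = f x \<oplus>\<^bsub>W\<^esub> f y"
    and "\<And>c x. c \<in> carrier (fld B) \<Longrightarrow> x \<in> carrier V \<Longrightarrow> f (c \<odot>\<^bsub>V\<^esub> x) = c \<odot>\<^bsub>W\<^esub> f x"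
  shows "restrict f (carrier V) \<in> lin V W"
  using assms by (intro linI) simp_all

lemma lin_closed: "f \<in> lin V W \<Longrightarrow> x \<in> carrier V \<Longrightarrow> f x \<in> carrier W"
  by (auto simp: linmaps_def)

lemma lin_extensional: "f \<in> lin V W \<Longrightarrow> f \<in> extensional (carrier V)"
  by (simp add: linmaps_def PiE_iff)

lemma lin_add: "f \<in> lin V W \<Longrightarrow> x \<in> carrier V \<Longrightarrow> y \<in> carrier V \<Longrightarrow> f (x \<oplus>\<^bsub>V\<^esub> y) = f x \<oplus>\<^bsub>W\<^esub> f y"
  by (simp add: linmaps_def)

lemma lin_smult:
  "f \<in> lin V W \<Longrightarrow> c \<in> carrier (fld B) \<Longrightarrow> x \<in> carrier V \<Longrightarrow> f (c \<odot>\<^bsub>V\<^esub> x) = c \<odot>\<^bsub>W\<^esub> f x"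
  by (simp add: linmaps_def)

lemma lin_eqI: "f \<in> lin V W \<Longrightarrow> g \<in> lin V W \<Longrightarrow> (\<And>x. x \<in> carrier V \<Longrightarrow> f x = g x) \<Longrightarrow> f = g"
  using lin_extensional extensionalityI by metis

lemma lin_zero: "f \<in> lin V W \<Longrightarrow> V \<in> Vob \<Longrightarrow> W \<in> Vob \<Longrightarrow> f \<zero>\<^bsub>V\<^esub> = \<zero>\<^bsub>W\<^esub>"
  using lin_smult[of f V W "\<zero>\<^bsub>fld B\<^esub>" "\<zero>\<^bsub>V\<^esub>"] lin_closed[of f V W "\<zero>\<^bsub>V\<^esub>"] by simp

lemma lin_neg: "f \<in> lin V W \<Longrightarrow> V \<in> Vob \<Longrightarrow> W \<in> Vob \<Longrightarrow> x \<in> carrier V \<Longrightarrow> f (\<ominus>\<^bsub>V\<^esub> x) = \<ominus>\<^bsub>W\<^esub> f x"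
  by (simp add: vneg_eq_smult lin_smult lin_closed)

lemma lin_minus: "f \<in> lin V W \<Longrightarrow> V \<in> Vob \<Longrightarrow> W \<in> Vob \<Longrightarrow> x \<in> carrier V \<Longrightarrow> y \<in> carrier V \<Longrightarrow>
    f (x \<ominus>\<^bsub>V\<^esub> y) = f x \<ominus>\<^bsub>W\<^esub> f y"
  by (simp add: a_minus_def lin_add lin_neg)

lemma lin_finsum:
  assumes f: "f \<in> lin V W" and V: "V \<in> Vob" and W: "W \<in> Vob" and "finite A" "g \<in> A \<rightarrow> carrier V"
  shows "f (finsum V g A) = finsum W (\<lambda>i. f (g i)) A"
proof -
  interpret V: abelian_monoid V using V by (rule Vob_monoid)
  interpret W: abelian_monoid W using W by (rule Vob_monoid)
  show ?thesis using assms(4,5)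
  proof (induction A)
    case empty then show ?case using f V W by (simp add: lin_zero)
  next
    case (insert a A)
    then have "g \<in> A \<rightarrow> carrier V" "g a \<in> carrier V" by auto
    with insert show ?case
      using f by (simp add: V.finsum_insert W.finsum_insert lin_add V.finsum_closed lin_closed[OF f] Pi_iff)
  qed
qed

lemma idm_lin [simp]: "V \<in> Vob \<Longrightarrow> idm V \<in> lin V V"
  by (rule lin_restrictI) simp_all

lemma cmp_lin: "U \<in> Vob \<Longrightarrow> f \<in> lin U V \<Longrightarrow> g \<in> lin V W \<Longrightarrow> cmp U g f \<in> lin U W"
  unfolding compose_def
  by (rule lin_restrictI) (auto simp: lin_add lin_smult lin_closed)

lemma cmp_apply [simp]: "x \<in> carrier U \<Longrightarrow> cmp U g f x = g (f x)"
  by (rule compose_eq)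

lemma zero_lin [simp]: "V \<in> Vob \<Longrightarrow> W \<in> Vob \<Longrightarrow> (\<lambda>x \<in> carrier V. \<zero>\<^bsub>W\<^esub>) \<in> lin V W"
  by (rule lin_restrictI) simp_all

lemma map_add_lin:
  "V \<in> Vob \<Longrightarrow> W \<in> Vob \<Longrightarrow> f \<in> lin V W \<Longrightarrow> g \<in> lin V W \<Longrightarrow> map_add V W f g \<in> lin V W"
  unfolding map_add_def
  by (rule lin_restrictI) (auto simp: lin_add lin_smult lin_closed vadd4 vsmult_add)

lemma map_smult_lin:
  "V \<in> Vob \<Longrightarrow> W \<in> Vob \<Longrightarrow> c \<in> carrier (fld B) \<Longrightarrow> f \<in> lin V W \<Longrightarrow> map_smult V W c f \<in> lin V W"
  unfolding map_smult_def
  by (rule lin_restrictI) (auto simp: lin_add lin_smult lin_closed vsmult_add vsmult_comm[of W c])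

lemma map_add_apply: "x \<in> carrier V \<Longrightarrow> map_add V W f g x = f x \<oplus>\<^bsub>W\<^esub> g x"
  by (simp add: map_add_def)

lemma map_smult_apply: "x \<in> carrier V \<Longrightarrow> map_smult V W c f x = c \<odot>\<^bsub>W\<^esub> f x"
  by (simp add: map_smult_def)

text \<open>Existence of additive inverses is not among the assumptions: scaling by -1 provides
  them.\<close>

lemma moduleI':
  assumes cl: "\<And>x y. x \<in> carrier V \<Longrightarrow> y \<in> carrier V \<Longrightarrow> x \<oplus>\<^bsub>V\<^esub> y \<in> carrier V"
    and z: "\<zero>\<^bsub>V\<^esub> \<in> carrier V"
    and sm: "\<And>c x. c \<in> carrier (fld B) \<Longrightarrow> x \<in> carrier V \<Longrightarrow> c \<odot>\<^bsub>V\<^esub> x \<in> carrier V"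
    and assoc: "\<And>x y z. x \<in> carrier V \<Longrightarrow> y \<in> carrier V \<Longrightarrow> z \<in> carrier V \<Longrightarrow>
      (x \<oplus>\<^bsub>V\<^esub> y) \<oplus>\<^bsub>V\<^esub> z = x \<oplus>\<^bsub>V\<^esub> (y \<oplus>\<^bsub>V\<^esub> z)"
    and comm: "\<And>x y. x \<in> carrier V \<Longrightarrow> y \<in> carrier V \<Longrightarrow> x \<oplus>\<^bsub>V\<^esub> y = y \<oplus>\<^bsub>V\<^esub> x"
    and lz: "\<And>x. x \<in> carrier V \<Longrightarrow> \<zero>\<^bsub>V\<^esub> \<oplus>\<^bsub>V\<^esub> x = x"
    and s0: "\<And>x. x \<in> carrier V \<Longrightarrow> \<zero>\<^bsub>fld B\<^esub> \<odot>\<^bsub>V\<^esub> x = \<zero>\<^bsub>V\<^esub>"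
    and s1: "\<And>x. x \<in> carrier V \<Longrightarrow> \<one>\<^bsub>fld B\<^esub> \<odot>\<^bsub>V\<^esub> x = x"
    and ld: "\<And>c d x. c \<in> carrier (fld B) \<Longrightarrow> d \<in> carrier (fld B) \<Longrightarrow> x \<in> carrier V \<Longrightarrow>
      (c \<oplus>\<^bsub>fld B\<^esub> d) \<odot>\<^bsub>V\<^esub> x = c \<odot>\<^bsub>V\<^esub> x \<oplus>\<^bsub>V\<^esub> d \<odot>\<^bsub>V\<^esub> x"
    and rd: "\<And>c x y. c \<in> carrier (fld B) \<Longrightarrow> x \<in> carrier V \<Longrightarrow> y \<in> carrier V \<Longrightarrow>
      c \<odot>\<^bsub>V\<^esub> (x \<oplus>\<^bsub>V\<^esub> y) = c \<odot>\<^bsub>V\<^esub> x \<oplus>\<^bsub>V\<^esub> c \<odot>\<^bsub>V\<^esub> y"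
    and as: "\<And>c d x. c \<in> carrier (fld B) \<Longrightarrow> d \<in> carrier (fld B) \<Longrightarrow> x \<in> carrier V \<Longrightarrow>
      (c \<otimes>\<^bsub>fld B\<^esub> d) \<odot>\<^bsub>V\<^esub> x = c \<odot>\<^bsub>V\<^esub> (d \<odot>\<^bsub>V\<^esub> x)"
  shows "module (fld B) V"
proof (rule moduleI)
  show "cring (fld B)" by (rule K.is_cring)
  show "abelian_group V"
  proof (rule abelian_groupI)
    fix x assume x: "x \<in> carrier V"
    have "(\<ominus>\<^bsub>fld B\<^esub> \<one>\<^bsub>fld B\<^esub>) \<odot>\<^bsub>V\<^esub> x \<oplus>\<^bsub>V\<^esub> \<one>\<^bsub>fld B\<^esub> \<odot>\<^bsub>V\<^esub> x = \<zero>\<^bsub>V\<^esub>"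
      using x by (simp flip: ld add: K.l_neg s0)
    then show "\<exists>y\<in>carrier V. y \<oplus>\<^bsub>V\<^esub> x = \<zero>\<^bsub>V\<^esub>"
      using x s1 sm by auto
  qed (use assms in auto)
qed (use assms in auto)

lemma submodule_iff:
  assumes V: "V \<in> Vob"
  shows "submodule H (fld B) V \<longleftrightarrow> H \<subseteq> carrier V \<and> \<zero>\<^bsub>V\<^esub> \<in> H \<and>
     (\<forall>x\<in>H. \<forall>y\<in>H. x \<oplus>\<^bsub>V\<^esub> y \<in> H) \<and> (\<forall>c\<in>carrier (fld B). \<forall>x\<in>H. c \<odot>\<^bsub>V\<^esub> x \<in> H)" (is "_ \<longleftrightarrow> ?R")
proof
  interpret module "fld B" V using V by (rule Vob_module)
  show "submodule H (fld B) V \<Longrightarrow> ?R"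
    using submoduleE subgroup.one_closed[OF submodule.axioms(1)] by (metis monoid.select_convs(2))
  show "?R \<Longrightarrow> submodule H (fld B) V"
    using V by (intro submoduleI) (auto simp: vneg_eq_smult subset_iff)
qed

lemma submoduleD:
  assumes "submodule H (fld B) V" "V \<in> Vob"
  shows "x \<in> H \<Longrightarrow> x \<in> carrier V" "\<zero>\<^bsub>V\<^esub> \<in> H" "x \<in> H \<Longrightarrow> y \<in> H \<Longrightarrow> x \<oplus>\<^bsub>V\<^esub> y \<in> H"
    "c \<in> carrier (fld B) \<Longrightarrow> x \<in> H \<Longrightarrow> c \<odot>\<^bsub>V\<^esub> x \<in> H"
  using assms by (auto simp: submodule_iff)

lemma subspace_Vob:
  assumes V: "V \<in> Vob" and H: "submodule H (fld B) V"
  shows "V\<lparr>carrier := H\<rparr> \<in> Vob"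
  using submodule.submodule_is_module[OF H Vob_module[OF V]] U.small_subset[OF Vob_small[OF V]] H
  by (auto simp: Vob_iff small_eq submodule_iff[OF V])

lemma submodule_minus: "V \<in> Vob \<Longrightarrow> submodule H (fld B) V \<Longrightarrow> x \<in> H \<Longrightarrow> y \<in> H \<Longrightarrow> x \<ominus>\<^bsub>V\<^esub> y \<in> H"
  by (auto simp: a_minus_def submodule_iff vneg_eq_smult subset_iff)

text \<open>This equalizer serves to spread an equality of linear maps from a spanning set to the
  whole space.\<close>

lemma kernel_submodule: "V \<in> Vob \<Longrightarrow> W \<in> Vob \<Longrightarrow> f \<in> lin V W \<Longrightarrow> g \<in> lin V W \<Longrightarrow>
    submodule {x \<in> carrier V. f x = g x} (fld B) V"
  by (auto simp: submodule_iff lin_zero lin_add lin_smult)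

section \<open>Quotient spaces\<close>

definition quot_rep :: "'u vec \<Rightarrow> 'u set \<Rightarrow> 'u \<Rightarrow> 'u" where
  "quot_rep V H x = (SOME y. y \<in> carrier V \<and> x \<ominus>\<^bsub>V\<^esub> y \<in> H)"

text \<open>The quotient lives on a set of representatives: a set of cosets is not a subset of the type of
  the universe.\<close>

definition quot :: "'u vec \<Rightarrow> 'u set \<Rightarrow> 'u vec" where
  "quot V H = V\<lparr>carrier := quot_rep V H ` carrier V, zero := quot_rep V H \<zero>\<^bsub>V\<^esub>,
     add := (\<lambda>x y. quot_rep V H (x \<oplus>\<^bsub>V\<^esub> y)), smult := (\<lambda>c x. quot_rep V H (c \<odot>\<^bsub>V\<^esub> x))\<rparr>"

text \<open>The module laws are equations, so they pass along a surjection that respects the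
  operations. M may have another element type, which is how laws are brought from spaces of
  functions to spaces of codes.\<close>

lemma module_image:
  assumes M: "module (fld B) M"
    and surj: "p ` carrier M = carrier V"
    and add: "\<And>x y. x \<in> carrier M \<Longrightarrow> y \<in> carrier M \<Longrightarrow> p (x \<oplus>\<^bsub>M\<^esub> y) = p x \<oplus>\<^bsub>V\<^esub> p y"
    and zero: "p \<zero>\<^bsub>M\<^esub> = \<zero>\<^bsub>V\<^esub>"
    and smult: "\<And>c x. c \<in> carrier (fld B) \<Longrightarrow> x \<in> carrier M \<Longrightarrow> p (c \<odot>\<^bsub>M\<^esub> x) = c \<odot>\<^bsub>V\<^esub> p x"
  shows "module (fld B) V"
proof -
  interpret M: module "fld B" M by (rule M)
  note [simp] = add[symmetric] smult[symmetric] zero[symmetric]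
  show ?thesis
    by (rule moduleI', unfold surj[symmetric])
      (auto simp: M.M.a_ac M.smult_l_distr M.smult_r_distr M.smult_assoc1)
qed

context
  fixes V H assumes V: "V \<in> Vob" and H: "submodule H (fld B) V"
begin

text \<open>Transitivity of congruence modulo H, in the form that rewrites the predicate inside
  \<open>quot_rep\<close>.\<close>

lemma minus_mem_trans:
  assumes "x \<in> carrier V" "y \<in> carrier V" "z \<in> carrier V" "x \<ominus>\<^bsub>V\<^esub> y \<in> H"
  shows "x \<ominus>\<^bsub>V\<^esub> z \<in> H \<longleftrightarrow> y \<ominus>\<^bsub>V\<^esub> z \<in> H"
proof -
  interpret abelian_group V using V by (rule Vob_group)
  have e1: "x \<ominus>\<^bsub>V\<^esub> z = (x \<ominus>\<^bsub>V\<^esub> y) \<oplus>\<^bsub>V\<^esub> (y \<ominus>\<^bsub>V\<^esub> z)"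
    using assms by (simp add: a_minus_def a_assoc r_neg1)
  have e2: "y \<ominus>\<^bsub>V\<^esub> z = (x \<ominus>\<^bsub>V\<^esub> z) \<ominus>\<^bsub>V\<^esub> (x \<ominus>\<^bsub>V\<^esub> y)"
    unfolding e1 using assms by (simp add: a_minus_def[of _ _ "x \<ominus>\<^bsub>V\<^esub> y"] a_comm[of _ "\<ominus>\<^bsub>V\<^esub> (x \<ominus>\<^bsub>V\<^esub> y)"] r_neg1 r_neg2)
  show ?thesis
  proof
    assume "x \<ominus>\<^bsub>V\<^esub> z \<in> H"
    then show "y \<ominus>\<^bsub>V\<^esub> z \<in> H" unfolding e2 using assms(4) by (rule submodule_minus[OF V H])
  next
    assume "y \<ominus>\<^bsub>V\<^esub> z \<in> H"
    then show "x \<ominus>\<^bsub>V\<^esub> z \<in> H" unfolding e1 using assms(4) by (simp add: submoduleD[OF H V])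
  qed
qed

lemma quot_rep: assumes "x \<in> carrier V" shows "quot_rep V H x \<in> carrier V" "x \<ominus>\<^bsub>V\<^esub> quot_rep V H x \<in> H"
proof -
  have "x \<in> carrier V \<and> x \<ominus>\<^bsub>V\<^esub> x \<in> H"
    using assms H V by (simp add: submodule_iff)
  then have "quot_rep V H x \<in> carrier V \<and> x \<ominus>\<^bsub>V\<^esub> quot_rep V H x \<in> H"
    unfolding quot_rep_def by (rule someI)
  then show "quot_rep V H x \<in> carrier V" "x \<ominus>\<^bsub>V\<^esub> quot_rep V H x \<in> H" by auto
qed

text \<open>Congruent vectors give the same predicate under \<open>SOME\<close>, so the chosen
  representative depends on the coset only.\<close>

lemma quot_rep_eq_iff:
  assumes "x \<in> carrier V" "y \<in> carrier V"
  shows "quot_rep V H x = quot_rep V H y \<longleftrightarrow> x \<ominus>\<^bsub>V\<^esub> y \<in> H"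
proof
  assume "x \<ominus>\<^bsub>V\<^esub> y \<in> H"
  then have "(\<lambda>z. z \<in> carrier V \<and> x \<ominus>\<^bsub>V\<^esub> z \<in> H) = (\<lambda>z. z \<in> carrier V \<and> y \<ominus>\<^bsub>V\<^esub> z \<in> H)"
    using minus_mem_trans assms by blast
  then show "quot_rep V H x = quot_rep V H y" unfolding quot_rep_def by simp
next
  assume "quot_rep V H x = quot_rep V H y"
  moreover have "y \<ominus>\<^bsub>V\<^esub> y \<in> H" using assms H V by (simp add: submodule_iff)
  ultimately show "x \<ominus>\<^bsub>V\<^esub> y \<in> H"
    using minus_mem_trans[OF assms(1) quot_rep(1)[OF assms(1)] assms(2) quot_rep(2)[OF assms(1)]]
      minus_mem_trans[OF assms(2) quot_rep(1)[OF assms(2)] assms(2) quot_rep(2)[OF assms(2)]] by simp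
qed

lemma quot_rep_add:
  assumes "x \<in> carrier V" "y \<in> carrier V"
  shows "quot_rep V H (quot_rep V H x \<oplus>\<^bsub>V\<^esub> quot_rep V H y) = quot_rep V H (x \<oplus>\<^bsub>V\<^esub> y)"
proof -
  interpret abelian_group V using V by (rule Vob_group)
  let ?x = "quot_rep V H x" and ?y = "quot_rep V H y"
  have "(x \<oplus>\<^bsub>V\<^esub> y) \<ominus>\<^bsub>V\<^esub> (?x \<oplus>\<^bsub>V\<^esub> ?y) = (x \<ominus>\<^bsub>V\<^esub> ?x) \<oplus>\<^bsub>V\<^esub> (y \<ominus>\<^bsub>V\<^esub> ?y)"
    using assms quot_rep by (simp add: a_minus_def minus_add a_ac)
  also have "\<dots> \<in> H" using quot_rep assms H by (simp add: submodule_iff[OF V])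
  finally show ?thesis using assms V quot_rep by (simp add: quot_rep_eq_iff[symmetric])
qed

lemma quot_rep_smult:
  assumes "c \<in> carrier (fld B)" "x \<in> carrier V"
  shows "quot_rep V H (c \<odot>\<^bsub>V\<^esub> quot_rep V H x) = quot_rep V H (c \<odot>\<^bsub>V\<^esub> x)"
proof -
  interpret module "fld B" V using V by (rule Vob_module)
  have "c \<odot>\<^bsub>V\<^esub> x \<ominus>\<^bsub>V\<^esub> c \<odot>\<^bsub>V\<^esub> quot_rep V H x = c \<odot>\<^bsub>V\<^esub> (x \<ominus>\<^bsub>V\<^esub> quot_rep V H x)"
    using assms quot_rep by (simp add: a_minus_def smult_r_distr smult_r_minus)
  also have "\<dots> \<in> H" using quot_rep assms H by (simp add: submodule_iff[OF V])
  finally show ?thesis using assms V quot_rep by (simp add: quot_rep_eq_iff[symmetric])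
qed

lemma quot_Vob: "quot V H \<in> Vob"
proof -
  have "module (fld B) (quot V H)"
    by (rule module_image[OF Vob_module[OF V], of "quot_rep V H"])
      (simp_all add: quot_def quot_rep_add quot_rep_smult)
  moreover have "carrier (quot V H) \<in> range (elts B)"
    by (simp add: quot_def U.small_image Vob_small V)
  ultimately show ?thesis by (simp add: Vob_iff small_eq)
qed

lemma quot_map_lin: "restrict (quot_rep V H) (carrier V) \<in> lin V (quot V H)"
  by (rule lin_restrictI[OF V]) (simp_all add: quot_def quot_rep_add quot_rep_smult)

lemma quot_map_surj: "quot_rep V H ` carrier V = carrier (quot V H)"
  by (simp add: quot_def)

lemma quot_map_zero: "x \<in> carrier V \<Longrightarrow> quot_rep V H x = \<zero>\<^bsub>quot V H\<^esub> \<longleftrightarrow> x \<in> H"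
  using V by (simp add: quot_def quot_rep_eq_iff)

lemma quot_carrier: "z \<in> carrier (quot V H) \<Longrightarrow> z \<in> carrier V \<and> quot_rep V H z = z"
proof -
  assume "z \<in> carrier (quot V H)"
  then obtain x where x: "x \<in> carrier V" "z = quot_rep V H x" by (auto simp: quot_def)
  then show ?thesis using quot_rep[OF x(1)] quot_rep_eq_iff[of x z] by simp
qed

text \<open>As the quotient lives on representatives, the induced map is f itself restricted to
  them; f is constant on cosets because it kills H.\<close>

lemma quot_lift:
  assumes W: "W \<in> Vob" and f: "f \<in> lin V W" and f0: "\<And>x. x \<in> H \<Longrightarrow> f x = \<zero>\<^bsub>W\<^esub>"
  shows "restrict f (carrier (quot V H)) \<in> lin (quot V H) W"
    and "x \<in> carrier V \<Longrightarrow> f (quot_rep V H x) = f x"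
proof -
  have *: "f (quot_rep V H x) = f x" if "x \<in> carrier V" for x
  proof -
    have "f x \<ominus>\<^bsub>W\<^esub> f (quot_rep V H x) = \<zero>\<^bsub>W\<^esub>"
      using f0[OF quot_rep(2)[OF that]] that V W f quot_rep(1) by (simp add: lin_minus)
    then show ?thesis using W lin_closed[OF f] quot_rep(1) that by (simp add: vminus_eq_zero)
  qed
  then show "x \<in> carrier V \<Longrightarrow> f (quot_rep V H x) = f x" .
  show "restrict f (carrier (quot V H)) \<in> lin (quot V H) W"
  proof (rule lin_restrictI[OF quot_Vob])
    fix x y assume "x \<in> carrier (quot V H)" "y \<in> carrier (quot V H)"
    then show "f (x \<oplus>\<^bsub>quot V H\<^esub> y) = f x \<oplus>\<^bsub>W\<^esub> f y"
      using quot_carrier[of x] quot_carrier[of y] V f by (simp add: quot_def * lin_add)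
  next
    fix c x assume "c \<in> carrier (fld B)" "x \<in> carrier (quot V H)"
    then show "f (c \<odot>\<^bsub>quot V H\<^esub> x) = c \<odot>\<^bsub>W\<^esub> f x"
      using quot_carrier[of x] V f by (simp add: quot_def * lin_smult)
  qed (use quot_carrier lin_closed[OF f] in blast)
qed

end

lemma bilinear_onI:
  assumes "V \<in> Vob" "W \<in> Vob"
    and "\<And>x y. x \<in> carrier V \<Longrightarrow> y \<in> carrier W \<Longrightarrow> b x y \<in> carrier Z"
    and "\<And>x x' y. x \<in> carrier V \<Longrightarrow> x' \<in> carrier V \<Longrightarrow> y \<in> carrier W \<Longrightarrow> b (x \<oplus>\<^bsub>V\<^esub> x') y = b x y \<oplus>\<^bsub>Z\<^esub> b x' y"
    and "\<And>x y y'. x \<in> carrier V \<Longrightarrow> y \<in> carrier W \<Longrightarrow> y' \<in> carrier W \<Longrightarrow> b x (y \<oplus>\<^bsub>W\<^esub> y') = b x y \<oplus>\<^bsub>Z\<^esub> b x y'"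
    and "\<And>c x y. c \<in> carrier (fld B) \<Longrightarrow> x \<in> carrier V \<Longrightarrow> y \<in> carrier W \<Longrightarrow> b (c \<odot>\<^bsub>V\<^esub> x) y = c \<odot>\<^bsub>Z\<^esub> b x y"
    and "\<And>c x y. c \<in> carrier (fld B) \<Longrightarrow> x \<in> carrier V \<Longrightarrow> y \<in> carrier W \<Longrightarrow> b x (c \<odot>\<^bsub>W\<^esub> y) = c \<odot>\<^bsub>Z\<^esub> b x y"
  shows "bilinear_on B V W Z b"
  using assms by (auto simp: bilinear_on_def intro!: lin_restrictI)

lemma bilinear_onD:
  assumes b: "bilinear_on B V W Z b" and V: "V \<in> Vob" and W: "W \<in> Vob"
  shows "x \<in> carrier V \<Longrightarrow> y \<in> carrier W \<Longrightarrow> b x y \<in> carrier Z"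
    and "x \<in> carrier V \<Longrightarrow> x' \<in> carrier V \<Longrightarrow> y \<in> carrier W \<Longrightarrow> b (x \<oplus>\<^bsub>V\<^esub> x') y = b x y \<oplus>\<^bsub>Z\<^esub> b x' y"
    and "x \<in> carrier V \<Longrightarrow> y \<in> carrier W \<Longrightarrow> y' \<in> carrier W \<Longrightarrow> b x (y \<oplus>\<^bsub>W\<^esub> y') = b x y \<oplus>\<^bsub>Z\<^esub> b x y'"
    and "c \<in> carrier (fld B) \<Longrightarrow> x \<in> carrier V \<Longrightarrow> y \<in> carrier W \<Longrightarrow> b (c \<odot>\<^bsub>V\<^esub> x) y = c \<odot>\<^bsub>Z\<^esub> b x y"
    and "c \<in> carrier (fld B) \<Longrightarrow> x \<in> carrier V \<Longrightarrow> y \<in> carrier W \<Longrightarrow> b x (c \<odot>\<^bsub>W\<^esub> y) = c \<odot>\<^bsub>Z\<^esub> b x y"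
proof -
  have l: "(\<lambda>y\<in>carrier W. b x y) \<in> lin W Z" if "x \<in> carrier V" for x using b that by (simp add: bilinear_on_def)
  have r: "(\<lambda>x\<in>carrier V. b x y) \<in> lin V Z" if "y \<in> carrier W" for y using b that by (simp add: bilinear_on_def)
  show "x \<in> carrier V \<Longrightarrow> y \<in> carrier W \<Longrightarrow> b x y \<in> carrier Z"
    using lin_closed[OF l] by auto
  show "x \<in> carrier V \<Longrightarrow> x' \<in> carrier V \<Longrightarrow> y \<in> carrier W \<Longrightarrow> b (x \<oplus>\<^bsub>V\<^esub> x') y = b x y \<oplus>\<^bsub>Z\<^esub> b x' y"
    using lin_add[OF r, of y x x'] V by simp
  show "x \<in> carrier V \<Longrightarrow> y \<in> carrier W \<Longrightarrow> y' \<in> carrier W \<Longrightarrow> b x (y \<oplus>\<^bsub>W\<^esub> y') = b x y \<oplus>\<^bsub>Z\<^esub> b x y'"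
    using lin_add[OF l, of x y y'] W by simp
  show "c \<in> carrier (fld B) \<Longrightarrow> x \<in> carrier V \<Longrightarrow> y \<in> carrier W \<Longrightarrow> b (c \<odot>\<^bsub>V\<^esub> x) y = c \<odot>\<^bsub>Z\<^esub> b x y"
    using lin_smult[OF r, of y c x] V by simp
  show "c \<in> carrier (fld B) \<Longrightarrow> x \<in> carrier V \<Longrightarrow> y \<in> carrier W \<Longrightarrow> b x (c \<odot>\<^bsub>W\<^esub> y) = c \<odot>\<^bsub>Z\<^esub> b x y"
    using lin_smult[OF l, of x c y] W by simp
qed

subsection \<open>Tensor products of vector spaces\<close>

abbreviation vb where "vb \<equiv> vbil B"
abbreviation tm where "tm \<equiv> vtens_map B"

lemma vt_Vob [simp]: "V \<in> Vob \<Longrightarrow> W \<in> Vob \<Longrightarrow> V \<star> W \<in> Vob"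
  using tensors by (simp add: is_tensor_def)

lemma vt_bilinear: "V \<in> Vob \<Longrightarrow> W \<in> Vob \<Longrightarrow> bilinear_on B V W (V \<star> W) (vb V W)"
  using tensors by (simp add: is_tensor_def)

lemmas vb_closed [simp] = bilinear_onD(1)[OF vt_bilinear]
  and vb_add_left = bilinear_onD(2)[OF vt_bilinear]
  and vb_add_right = bilinear_onD(3)[OF vt_bilinear]
  and vb_smult_left = bilinear_onD(4)[OF vt_bilinear]
  and vb_smult_right = bilinear_onD(5)[OF vt_bilinear]

lemma vt_lift:
  assumes "V \<in> Vob" "W \<in> Vob" "Z \<in> Vob" "bilinear_on B V W Z b"
  shows "\<exists>h. h \<in> lin (V \<star> W) Z \<and> (\<forall>x\<in>carrier V. \<forall>y\<in>carrier W. h (vb V W x y) = b x y)"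
  using tensors[OF assms(1,2)] assms(3,4) unfolding is_tensor_def by blast

lemma bilinear_on_lin:
  assumes V: "V \<in> Vob" and W: "W \<in> Vob" and h: "h \<in> lin (V \<star> W) Z"
  shows "bilinear_on B V W Z (\<lambda>x y. h (vb V W x y))"
  using V W by (intro bilinear_onI)
    (auto simp: lin_closed[OF h] lin_add[OF h] lin_smult[OF h]
      vb_add_left vb_add_right vb_smult_left vb_smult_right)

text \<open>The uniqueness half of the universal property, applied to the bilinear map (x, y)
  \<mapsto> f(x \<otimes> y).\<close>

lemma vt_ext:
  assumes V: "V \<in> Vob" and W: "W \<in> Vob" and Z: "Z \<in> Vob" and f: "f \<in> lin (V \<star> W) Z" and g: "g \<in> lin (V \<star> W) Z"
    and eq: "\<And>x y. x \<in> carrier V \<Longrightarrow> y \<in> carrier W \<Longrightarrow> f (vb V W x y) = g (vb V W x y)"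
  shows "f = g"
proof -
  have "\<exists>!h. h \<in> lin (V \<star> W) Z \<and> (\<forall>x\<in>carrier V. \<forall>y\<in>carrier W. h (vb V W x y) = f (vb V W x y))"
    using tensors[OF V W] Z bilinear_on_lin[OF V W f] unfolding is_tensor_def by blast
  then show ?thesis using f g eq by metis
qed

text \<open>\<open>vtens_map\<close> is a definite description; existence comes from the universal
  property and uniqueness from \<open>vt_ext\<close>, and together they release its defining
  properties.\<close>

lemma tm_props:
  assumes V: "V \<in> Vob" "V' \<in> Vob" and W: "W \<in> Vob" "W' \<in> Vob" and f: "f \<in> lin V V'" and g: "g \<in> lin W W'"
  shows tm_lin: "tm V V' W W' f g \<in> lin (V \<star> W) (V' \<star> W')" (is ?A)
    and tm_vb: "x \<in> carrier V \<Longrightarrow> y \<in> carrier W \<Longrightarrow>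
      tm V V' W W' f g (vb V W x y) = vb V' W' (f x) (g y)" (is "PROP ?B")
proof -
  let ?P = "\<lambda>h. h \<in> lin (V \<star> W) (V' \<star> W') \<and> (\<forall>x\<in>carrier V. \<forall>y\<in>carrier W. h (vb V W x y) = vb V' W' (f x) (g y))"
  have "bilinear_on B V W (V' \<star> W') (\<lambda>x y. vb V' W' (f x) (g y))"
    using V W by (intro bilinear_onI)
      (auto simp: lin_closed[OF f] lin_closed[OF g] lin_add[OF f] lin_smult[OF f] lin_add[OF g] lin_smult[OF g]
      vb_add_left vb_add_right vb_smult_left vb_smult_right)
  then have "\<exists>h. ?P h"
    using vt_lift[OF V(1) W(1) vt_Vob[OF V(2) W(2)]] by fast
  moreover have "h' = h''" if "?P h'" "?P h''" for h' h''
  proof (rule vt_ext[OF V(1) W(1) vt_Vob[OF V(2) W(2)]])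
    show "h' \<in> lin (V \<star> W) (V' \<star> W')" "h'' \<in> lin (V \<star> W) (V' \<star> W')" using that by blast+
    show "\<And>x y. x \<in> carrier V \<Longrightarrow> y \<in> carrier W \<Longrightarrow> h' (vb V W x y) = h'' (vb V W x y)" using that by simp
  qed
  ultimately have "\<exists>!h. ?P h" by blast
  from theI'[OF this] show ?A "PROP ?B" unfolding vtens_map_def by auto
qed

lemma tm_eqI:
  assumes "V \<in> Vob" "V' \<in> Vob" "W \<in> Vob" "W' \<in> Vob" "f \<in> lin V V'" "g \<in> lin W W'"
    and "h \<in> lin (V \<star> W) (V' \<star> W')"
    and "\<And>x y. x \<in> carrier V \<Longrightarrow> y \<in> carrier W \<Longrightarrow> h (vb V W x y) = vb V' W' (f x) (g y)"
  shows "tm V V' W W' f g = h"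
  by (rule vt_ext[of V W "V' \<star> W'"]) (simp_all add: assms tm_lin tm_vb)

lemma tm_idm [simp]: "V \<in> Vob \<Longrightarrow> W \<in> Vob \<Longrightarrow> tm V V W W (idm V) (idm W) = idm (V \<star> W)"
  by (rule tm_eqI) simp_all

lemma tm_cmp:
  assumes "V \<in> Vob" "V' \<in> Vob" "V'' \<in> Vob" "W \<in> Vob" "W' \<in> Vob" "W'' \<in> Vob"
    "f \<in> lin V V'" "g \<in> lin W W'" "f' \<in> lin V' V''" "g' \<in> lin W' W''"
  shows "tm V V'' W W'' (cmp V f' f) (cmp W g' g) = cmp (V \<star> W) (tm V' V'' W' W'' f' g') (tm V V' W W' f g)"
proof (rule tm_eqI)
  show "cmp V f' f \<in> lin V V''" "cmp W g' g \<in> lin W W''"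
    using assms cmp_lin by blast+
  show "cmp (V \<star> W) (tm V' V'' W' W'' f' g') (tm V V' W W' f g) \<in> lin (V \<star> W) (V'' \<star> W'')"
    using assms by (intro cmp_lin[of _ _ "V' \<star> W'"] tm_lin) simp_all
qed (use assms in \<open>simp_all add: tm_lin tm_vb lin_closed[of f V V'] lin_closed[of g W W']\<close>)

lemma ground_Vob [simp]: "ground B \<in> Vob"
proof -
  have "module (fld B) (ground B)"
    by (rule moduleI') (simp_all add: ground_def K.a_ac K.l_distr K.r_distr K.m_assoc)
  then show ?thesis using ground_field_small by (simp add: Vob_iff ground_def)
qed

lemma carrier_ground: "carrier (ground B) = carrier (fld B)"
  by (simp add: ground_def)

lemma ground_simps [simp]: "c \<in> carrier (ground B) \<longleftrightarrow> c \<in> carrier (fld B)" "\<zero>\<^bsub>ground B\<^esub> = \<zero>\<^bsub>fld B\<^esub>"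
  "x \<oplus>\<^bsub>ground B\<^esub> y = x \<oplus>\<^bsub>fld B\<^esub> y" "c \<odot>\<^bsub>ground B\<^esub> x = c \<otimes>\<^bsub>fld B\<^esub> x"
  by (simp_all add: ground_def)

subsection \<open>Coherence of the tensor product of vector spaces\<close>

context
  fixes V V' W W' assumes V: "V \<in> Vob" "V' \<in> Vob" and W: "W \<in> Vob" "W' \<in> Vob"
begin

lemma tm_add_left: "f \<in> lin V V' \<Longrightarrow> f' \<in> lin V V' \<Longrightarrow> g \<in> lin W W' \<Longrightarrow>
    tm V V' W W' (map_add V V' f f') g = map_add (V \<star> W) (V' \<star> W') (tm V V' W W' f g) (tm V V' W W' f' g)"
  using V W by (intro tm_eqI map_add_lin tm_lin)
    (auto simp: map_add_apply tm_vb vb_add_left lin_closed)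

lemma tm_smult_left: "c \<in> carrier (fld B) \<Longrightarrow> f \<in> lin V V' \<Longrightarrow> g \<in> lin W W' \<Longrightarrow>
    tm V V' W W' (map_smult V V' c f) g = map_smult (V \<star> W) (V' \<star> W') c (tm V V' W W' f g)"
  using V W by (intro tm_eqI map_smult_lin tm_lin)
    (auto simp: map_smult_apply tm_vb vb_smult_left lin_closed)

lemma tm_add_right: "f \<in> lin V V' \<Longrightarrow> g \<in> lin W W' \<Longrightarrow> g' \<in> lin W W' \<Longrightarrow>
    tm V V' W W' f (map_add W W' g g') = map_add (V \<star> W) (V' \<star> W') (tm V V' W W' f g) (tm V V' W W' f g')"
  using V W by (intro tm_eqI map_add_lin tm_lin)
    (auto simp: map_add_apply tm_vb vb_add_right lin_closed)

lemma tm_smult_right: "c \<in> carrier (fld B) \<Longrightarrow> f \<in> lin V V' \<Longrightarrow> g \<in> lin W W' \<Longrightarrow>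
    tm V V' W W' f (map_smult W W' c g) = map_smult (V \<star> W) (V' \<star> W') c (tm V V' W W' f g)"
  using V W by (intro tm_eqI map_smult_lin tm_lin)
    (auto simp: map_smult_apply tm_vb vb_smult_right lin_closed)

end

lemma vb_left_lin: "V \<in> Vob \<Longrightarrow> W \<in> Vob \<Longrightarrow> x \<in> carrier V \<Longrightarrow> restrict (vb V W x) (carrier W) \<in> lin W (V \<star> W)"
  by (rule lin_restrictI) (simp_all add: vb_add_right vb_smult_right)

lemma vb_right_lin:
  "V \<in> Vob \<Longrightarrow> W \<in> Vob \<Longrightarrow> y \<in> carrier W \<Longrightarrow> (\<lambda>x \<in> carrier V. vb V W x y) \<in> lin V (V \<star> W)"
  by (rule lin_restrictI) (simp_all add: vb_add_left vb_smult_left)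

text \<open>The inverse of \<open>vassoc_inv\<close>, needed to invert the associator of
  functors.\<close>

definition va where
  "va U V W = (SOME h. h \<in> lin ((U \<star> V) \<star> W) (U \<star> (V \<star> W)) \<and>
     (\<forall>x \<in> carrier U. \<forall>y \<in> carrier V. \<forall>z \<in> carrier W.
        h (vb (U \<star> V) W (vb U V x y) z) = vb U (V \<star> W) x (vb V W y z)))"

abbreviation vai where "vai \<equiv> vassoc_inv B"

context
  fixes U V W assumes [simp]: "U \<in> Vob" "V \<in> Vob" "W \<in> Vob"
begin

text \<open>With z fixed, f and g composed with - \<otimes> z are maps on U \<otimes> V and can be
  compared by \<open>vt_ext\<close>; this yields equality on all t \<otimes> z.\<close>

lemma vt_ext3l:
  assumes Z: "Z \<in> Vob" and f: "f \<in> lin ((U \<star> V) \<star> W) Z" and g: "g \<in> lin ((U \<star> V) \<star> W) Z"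
    and eq: "\<And>x y z. x \<in> carrier U \<Longrightarrow> y \<in> carrier V \<Longrightarrow> z \<in> carrier W \<Longrightarrow>
      f (vb (U \<star> V) W (vb U V x y) z) = g (vb (U \<star> V) W (vb U V x y) z)"
  shows "f = g"
proof (rule vt_ext[OF _ _ Z f g])
  fix t z assume t: "t \<in> carrier (U \<star> V)" and z: "z \<in> carrier W"
  let ?r = "\<lambda>t\<in>carrier (U \<star> V). vb (U \<star> V) W t z"
  have r: "?r \<in> lin (U \<star> V) ((U \<star> V) \<star> W)" using z by (intro vb_right_lin) simp_all
  have "cmp (U \<star> V) f ?r = cmp (U \<star> V) g ?r"
    by (rule vt_ext[OF _ _ Z cmp_lin[OF _ r f] cmp_lin[OF _ r g]]) (simp_all add: eq z)
  from fun_cong[OF this, of t] show "f (vb (U \<star> V) W t z) = g (vb (U \<star> V) W t z)" using t by simp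
qed simp_all

lemma vt_ext3r:
  assumes Z: "Z \<in> Vob" and f: "f \<in> lin (U \<star> (V \<star> W)) Z" and g: "g \<in> lin (U \<star> (V \<star> W)) Z"
    and eq: "\<And>x y z. x \<in> carrier U \<Longrightarrow> y \<in> carrier V \<Longrightarrow> z \<in> carrier W \<Longrightarrow>
      f (vb U (V \<star> W) x (vb V W y z)) = g (vb U (V \<star> W) x (vb V W y z))"
  shows "f = g"
proof (rule vt_ext[OF _ _ Z f g])
  fix t x assume t: "t \<in> carrier (V \<star> W)" and x: "x \<in> carrier U"
  let ?r = "restrict (vb U (V \<star> W) x) (carrier (V \<star> W))"
  have r: "?r \<in> lin (V \<star> W) (U \<star> (V \<star> W))" using x by (intro vb_left_lin) simp_all
  have "cmp (V \<star> W) f ?r = cmp (V \<star> W) g ?r"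
    by (rule vt_ext[OF _ _ Z cmp_lin[OF _ r f] cmp_lin[OF _ r g]]) (simp_all add: eq x)
  from fun_cong[OF this, of t] show "f (vb U (V \<star> W) x t) = g (vb U (V \<star> W) x t)" using t by simp
qed simp_all

text \<open>For fixed z the map id \<otimes> (- \<otimes> z) is linear on U \<otimes> V, and it
  depends linearly on z because tensoring of maps is linear in each argument. So it amounts to a
  bilinear map on U \<otimes> V and W, which is lifted.\<close>

lemma va_props:
  shows va_lin: "va U V W \<in> lin ((U \<star> V) \<star> W) (U \<star> (V \<star> W))"
    and va_vb: "x \<in> carrier U \<Longrightarrow> y \<in> carrier V \<Longrightarrow> z \<in> carrier W \<Longrightarrow>
      va U V W (vb (U \<star> V) W (vb U V x y) z) = vb U (V \<star> W) x (vb V W y z)"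
proof -
  let ?P = "\<lambda>h. h \<in> lin ((U \<star> V) \<star> W) (U \<star> (V \<star> W)) \<and>
     (\<forall>x \<in> carrier U. \<forall>y \<in> carrier V. \<forall>z \<in> carrier W.
        h (vb (U \<star> V) W (vb U V x y) z) = vb U (V \<star> W) x (vb V W y z))"
  let ?r = "\<lambda>z. \<lambda>y \<in> carrier V. vb V W y z"
  let ?b = "\<lambda>t z. tm U U V (V \<star> W) (idm U) (?r z) t"
  have r: "?r z \<in> lin V (V \<star> W)" if "z \<in> carrier W" for z using that by (intro vb_right_lin) simp_all
  have tl: "tm U U V (V \<star> W) (idm U) (?r z) \<in> lin (U \<star> V) (U \<star> V \<star> W)" if "z \<in> carrier W" for z
    using that r by (intro tm_lin) simp_all
  have r_add: "?r (z \<oplus>\<^bsub>W\<^esub> z') = map_add V (V \<star> W) (?r z) (?r z')" if "z \<in> carrier W" "z' \<in> carrier W" for z z'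
    using that by (auto simp: map_add_def vb_add_right fun_eq_iff)
  have r_smult: "?r (c \<odot>\<^bsub>W\<^esub> z) = map_smult V (V \<star> W) c (?r z)" if "z \<in> carrier W" "c \<in> carrier (fld B)" for z c
    using that by (auto simp: map_smult_def vb_smult_right fun_eq_iff)
  have "bilinear_on B (U \<star> V) W (U \<star> V \<star> W) ?b"
  proof (rule bilinear_onI)
    fix t z z' assume "t \<in> carrier (U \<star> V)" "z \<in> carrier W" "z' \<in> carrier W"
    then show "?b t (z \<oplus>\<^bsub>W\<^esub> z') = ?b t z \<oplus>\<^bsub>U \<star> V \<star> W\<^esub> ?b t z'"
      using tm_add_right[of U U V "V \<star> W" "idm U" "?r z" "?r z'"] r by (simp add: r_add map_add_apply)
  next
    fix t z c assume "c \<in> carrier (fld B)" "t \<in> carrier (U \<star> V)" "z \<in> carrier W"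
    then show "?b t (c \<odot>\<^bsub>W\<^esub> z) = c \<odot>\<^bsub>U \<star> V \<star> W\<^esub> ?b t z"
      using tm_smult_right[of U U V "V \<star> W" c "idm U" "?r z"] r by (simp add: r_smult map_smult_apply)
  qed (simp_all add: lin_closed[OF tl] lin_add[OF tl] lin_smult[OF tl])
  then obtain h where h: "h \<in> lin ((U \<star> V) \<star> W) (U \<star> V \<star> W)"
    "\<forall>t\<in>carrier (U \<star> V). \<forall>z\<in>carrier W. h (vb (U \<star> V) W t z) = ?b t z"
    using vt_lift[of "U \<star> V" W "U \<star> V \<star> W" ?b] by auto
  have "?P h" using h r by (auto simp: tm_vb)
  then have "?P (va U V W)" unfolding va_def by (rule someI[of ?P])
  then show "va U V W \<in> lin ((U \<star> V) \<star> W) (U \<star> (V \<star> W))"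
    "x \<in> carrier U \<Longrightarrow> y \<in> carrier V \<Longrightarrow> z \<in> carrier W \<Longrightarrow>
      va U V W (vb (U \<star> V) W (vb U V x y) z) = vb U (V \<star> W) x (vb V W y z)" by auto
qed

text \<open>Here x is held fixed and (x \<otimes> -) \<otimes> id is used. Since
  \<open>vassoc_inv\<close> is a definite description, uniqueness has to be shown as well.\<close>

lemma vai_props:
  shows vai_lin: "vai U V W \<in> lin (U \<star> (V \<star> W)) ((U \<star> V) \<star> W)"
    and vai_vb: "x \<in> carrier U \<Longrightarrow> y \<in> carrier V \<Longrightarrow> z \<in> carrier W \<Longrightarrow>
      vai U V W (vb U (V \<star> W) x (vb V W y z)) = vb (U \<star> V) W (vb U V x y) z"
proof -
  let ?P = "\<lambda>h. h \<in> lin (U \<star> (V \<star> W)) ((U \<star> V) \<star> W) \<and>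
     (\<forall>x \<in> carrier U. \<forall>y \<in> carrier V. \<forall>z \<in> carrier W.
        h (vb U (V \<star> W) x (vb V W y z)) = vb (U \<star> V) W (vb U V x y) z)"
  let ?r = "\<lambda>x. \<lambda>y \<in> carrier V. vb U V x y"
  let ?b = "\<lambda>x t. tm V (U \<star> V) W W (?r x) (idm W) t"
  have r: "?r x \<in> lin V (U \<star> V)" if "x \<in> carrier U" for x using that vb_left_lin[of U V x] by simp
  have tl: "tm V (U \<star> V) W W (?r x) (idm W) \<in> lin (V \<star> W) ((U \<star> V) \<star> W)" if "x \<in> carrier U" for x
    using that r by (intro tm_lin) simp_all
  have r_add: "?r (x \<oplus>\<^bsub>U\<^esub> x') = map_add V (U \<star> V) (?r x) (?r x')" if "x \<in> carrier U" "x' \<in> carrier U" for x x'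
    using that by (auto simp: map_add_def vb_add_left fun_eq_iff)
  have r_smult: "?r (c \<odot>\<^bsub>U\<^esub> x) = map_smult V (U \<star> V) c (?r x)" if "x \<in> carrier U" "c \<in> carrier (fld B)" for x c
    using that by (auto simp: map_smult_def vb_smult_left fun_eq_iff)
  have "bilinear_on B U (V \<star> W) ((U \<star> V) \<star> W) ?b"
  proof (rule bilinear_onI)
    fix t x x' assume "t \<in> carrier (V \<star> W)" "x \<in> carrier U" "x' \<in> carrier U"
    then show "?b (x \<oplus>\<^bsub>U\<^esub> x') t = ?b x t \<oplus>\<^bsub>(U \<star> V) \<star> W\<^esub> ?b x' t"
      using tm_add_left[of V "U \<star> V" W W "?r x" "?r x'" "idm W"] r by (simp add: r_add map_add_apply)
  next
    fix t x c assume "c \<in> carrier (fld B)" "t \<in> carrier (V \<star> W)" "x \<in> carrier U"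
    then show "?b (c \<odot>\<^bsub>U\<^esub> x) t = c \<odot>\<^bsub>(U \<star> V) \<star> W\<^esub> ?b x t"
      using tm_smult_left[of V "U \<star> V" W W c "?r x" "idm W"] r by (simp add: r_smult map_smult_apply)
  qed (simp_all add: lin_closed[OF tl] lin_add[OF tl] lin_smult[OF tl])
  then obtain h where h: "h \<in> lin (U \<star> V \<star> W) ((U \<star> V) \<star> W)"
    "\<forall>x\<in>carrier U. \<forall>t\<in>carrier (V \<star> W). h (vb U (V \<star> W) x t) = ?b x t"
    using vt_lift[of U "V \<star> W" "(U \<star> V) \<star> W" ?b] by auto
  have "?P h" using h r by (auto simp: tm_vb)
  moreover have "h' = h''" if "?P h'" "?P h''" for h' h''
  proof (rule vt_ext3r)
    show "h' \<in> lin (U \<star> (V \<star> W)) ((U \<star> V) \<star> W)" "h'' \<in> lin (U \<star> (V \<star> W)) ((U \<star> V) \<star> W)"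
      using that by blast+
  qed (use that in simp_all)
  ultimately have "\<exists>!h. ?P h" by blast
  from theI'[OF this] have "?P (vai U V W)" unfolding vassoc_inv_def .
  then show "vai U V W \<in> lin (U \<star> (V \<star> W)) ((U \<star> V) \<star> W)"
    "x \<in> carrier U \<Longrightarrow> y \<in> carrier V \<Longrightarrow> z \<in> carrier W \<Longrightarrow>
      vai U V W (vb U (V \<star> W) x (vb V W y z)) = vb (U \<star> V) W (vb U V x y) z" by auto
qed

lemma va_vai: "cmp (U \<star> V \<star> W) (va U V W) (vai U V W) = idm (U \<star> V \<star> W)"
  by (rule vt_ext3r[OF _ cmp_lin[OF _ vai_lin va_lin]]) (simp_all add: va_vb vai_vb)

lemma vai_va: "cmp ((U \<star> V) \<star> W) (vai U V W) (va U V W) = idm ((U \<star> V) \<star> W)"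
  by (rule vt_ext3l[OF _ cmp_lin[OF _ va_lin vai_lin]]) (simp_all add: va_vb vai_vb)

end

lemma vai_natural:
  assumes [simp]: "U \<in> Vob" "V \<in> Vob" "W \<in> Vob" "U' \<in> Vob" "V' \<in> Vob" "W' \<in> Vob"
    and f: "f \<in> lin U U'" and g: "g \<in> lin V V'" and h: "h \<in> lin W W'"
  shows "cmp (U \<star> V \<star> W) (tm (U \<star> V) (U' \<star> V') W W' (tm U U' V V' f g) h) (vai U V W) =
    cmp (U \<star> V \<star> W) (vai U' V' W') (tm U U' (V \<star> W) (V' \<star> W') f (tm V V' W W' g h))"
proof (rule vt_ext3r)
  have t1: "tm (U \<star> V) (U' \<star> V') W W' (tm U U' V V' f g) h \<in> lin ((U \<star> V) \<star> W) ((U' \<star> V') \<star> W')"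
    using f g h by (intro tm_lin) simp_all
  have t2: "tm U U' (V \<star> W) (V' \<star> W') f (tm V V' W W' g h) \<in> lin (U \<star> (V \<star> W)) (U' \<star> (V' \<star> W'))"
    using f g h by (intro tm_lin) simp_all
  show "cmp (U \<star> V \<star> W) (tm (U \<star> V) (U' \<star> V') W W' (tm U U' V V' f g) h) (vai U V W) \<in> lin (U \<star> V \<star> W) ((U' \<star> V') \<star> W')"
    by (rule cmp_lin[OF _ vai_lin t1]) simp_all
  show "cmp (U \<star> V \<star> W) (vai U' V' W') (tm U U' (V \<star> W) (V' \<star> W') f (tm V V' W W' g h)) \<in> lin (U \<star> V \<star> W) ((U' \<star> V') \<star> W')"
    by (rule cmp_lin[OF _ t2 vai_lin]) simp_all
qed (simp_all add: vai_vb tm_vb tm_lin f g h lin_closed[OF f] lin_closed[OF g] lin_closed[OF h])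

lemma va_natural:
  assumes [simp]: "U \<in> Vob" "V \<in> Vob" "W \<in> Vob" "U' \<in> Vob" "V' \<in> Vob" "W' \<in> Vob"
    and f: "f \<in> lin U U'" and g: "g \<in> lin V V'" and h: "h \<in> lin W W'"
  shows "cmp ((U \<star> V) \<star> W) (tm U U' (V \<star> W) (V' \<star> W') f (tm V V' W W' g h)) (va U V W) =
    cmp ((U \<star> V) \<star> W) (va U' V' W') (tm (U \<star> V) (U' \<star> V') W W' (tm U U' V V' f g) h)"
proof (rule vt_ext3l)
  have t1: "tm (U \<star> V) (U' \<star> V') W W' (tm U U' V V' f g) h \<in> lin ((U \<star> V) \<star> W) ((U' \<star> V') \<star> W')"
    using f g h by (intro tm_lin) simp_all
  have t2: "tm U U' (V \<star> W) (V' \<star> W') f (tm V V' W W' g h) \<in> lin (U \<star> (V \<star> W)) (U' \<star> (V' \<star> W'))"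
    using f g h by (intro tm_lin) simp_all
  show "cmp ((U \<star> V) \<star> W) (tm U U' (V \<star> W) (V' \<star> W') f (tm V V' W W' g h)) (va U V W) \<in> lin ((U \<star> V) \<star> W) (U' \<star> (V' \<star> W'))"
    by (rule cmp_lin[OF _ va_lin t2]) simp_all
  show "cmp ((U \<star> V) \<star> W) (va U' V' W') (tm (U \<star> V) (U' \<star> V') W W' (tm U U' V V' f g) h) \<in> lin ((U \<star> V) \<star> W) (U' \<star> (V' \<star> W'))"
    by (rule cmp_lin[OF _ t1 va_lin]) simp_all
qed (simp_all add: va_vb tm_vb tm_lin f g h lin_closed[OF f] lin_closed[OF g] lin_closed[OF h])

abbreviation kk where "kk \<equiv> ground B"

text \<open>These maps point into the tensor product because the unitors of functors, taken at e
  \<otimes> x with x in X(L), have to land in X(k \<otimes> L) or X(L \<otimes> k).\<close>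

definition vlu where "vlu V = (\<lambda>v \<in> carrier V. vb kk V \<one>\<^bsub>fld B\<^esub> v)"
definition vru where "vru V = (\<lambda>v \<in> carrier V. vb V kk v \<one>\<^bsub>fld B\<^esub>)"

lemma vlu_lin: "V \<in> Vob \<Longrightarrow> vlu V \<in> lin V (kk \<star> V)"
  unfolding vlu_def using vb_left_lin[of kk V "\<one>\<^bsub>fld B\<^esub>"] by simp

lemma vru_lin: "V \<in> Vob \<Longrightarrow> vru V \<in> lin V (V \<star> kk)"
  unfolding vru_def by (rule vb_right_lin) simp_all

lemma ex_vlui:
  assumes [simp]: "V \<in> Vob"
  shows "\<exists>h. h \<in> lin (kk \<star> V) V \<and> (\<forall>c\<in>carrier (fld B). \<forall>v\<in>carrier V. h (vb kk V c v) = c \<odot>\<^bsub>V\<^esub> v)"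
proof -
  have "bilinear_on B kk V V (\<lambda>c v. c \<odot>\<^bsub>V\<^esub> v)"
    by (rule bilinear_onI) (simp_all add: vadd_smult vsmult_add vsmult_smult K.m_comm)
  from vt_lift[OF _ _ _ this] show ?thesis by (simp add: carrier_ground)
qed

lemma ex_vrui:
  assumes [simp]: "V \<in> Vob"
  shows "\<exists>h. h \<in> lin (V \<star> kk) V \<and> (\<forall>c\<in>carrier (fld B). \<forall>v\<in>carrier V. h (vb V kk v c) = c \<odot>\<^bsub>V\<^esub> v)"
proof -
  have "bilinear_on B V kk V (\<lambda>v c. c \<odot>\<^bsub>V\<^esub> v)"
    by (rule bilinear_onI) (simp_all add: vadd_smult vsmult_add vsmult_smult K.m_comm)
  from vt_lift[OF _ _ _ this] show ?thesis by (auto simp: carrier_ground)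
qed

definition vlui where
  "vlui V = (SOME h. h \<in> lin (kk \<star> V) V \<and> (\<forall>c\<in>carrier (fld B). \<forall>v\<in>carrier V. h (vb kk V c v) = c \<odot>\<^bsub>V\<^esub> v))"
definition vrui where
  "vrui V = (SOME h. h \<in> lin (V \<star> kk) V \<and> (\<forall>c\<in>carrier (fld B). \<forall>v\<in>carrier V. h (vb V kk v c) = c \<odot>\<^bsub>V\<^esub> v))"

lemma vlui_lin: "V \<in> Vob \<Longrightarrow> vlui V \<in> lin (kk \<star> V) V"
  and vlui_vb: "V \<in> Vob \<Longrightarrow> c \<in> carrier (fld B) \<Longrightarrow> v \<in> carrier V \<Longrightarrow> vlui V (vb kk V c v) = c \<odot>\<^bsub>V\<^esub> v"
  using someI_ex[OF ex_vlui, of V] unfolding vlui_def by auto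

lemma vrui_lin: "V \<in> Vob \<Longrightarrow> vrui V \<in> lin (V \<star> kk) V"
  and vrui_vb: "V \<in> Vob \<Longrightarrow> c \<in> carrier (fld B) \<Longrightarrow> v \<in> carrier V \<Longrightarrow> vrui V (vb V kk v c) = c \<odot>\<^bsub>V\<^esub> v"
  using someI_ex[OF ex_vrui, of V] unfolding vrui_def by auto

subsection \<open>Linear functors and natural transformations\<close>

abbreviation LF where "LF \<equiv> Obj (LinFun B)"
abbreviation nt where "nt \<equiv> Hom (LinFun B)"
abbreviation el where "el X V \<equiv> carrier (on_ob X V)"

lemma LF_I:
  assumes "\<And>V. V \<in> Vob \<Longrightarrow> on_ob X V \<in> Vob"
    and mor: "\<And>V W f. V \<in> Vob \<Longrightarrow> W \<in> Vob \<Longrightarrow> f \<in> lin V W \<Longrightarrow> on_mor X V W f \<in> lin (on_ob X V) (on_ob X W)"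
    and "\<And>V x. V \<in> Vob \<Longrightarrow> x \<in> el X V \<Longrightarrow> on_mor X V V (idm V) x = x"
    and "\<And>U V W f g x. U \<in> Vob \<Longrightarrow> V \<in> Vob \<Longrightarrow> W \<in> Vob \<Longrightarrow> f \<in> lin U V \<Longrightarrow> g \<in> lin V W \<Longrightarrow> x \<in> el X U \<Longrightarrow>
      on_mor X U W (cmp U g f) x = on_mor X V W g (on_mor X U V f x)"
    and "\<And>V W f g x. V \<in> Vob \<Longrightarrow> W \<in> Vob \<Longrightarrow> f \<in> lin V W \<Longrightarrow> g \<in> lin V W \<Longrightarrow> x \<in> el X V \<Longrightarrow>
      on_mor X V W (map_add V W f g) x = on_mor X V W f x \<oplus>\<^bsub>on_ob X W\<^esub> on_mor X V W g x"
    and "\<And>V W c f x. V \<in> Vob \<Longrightarrow> W \<in> Vob \<Longrightarrow> c \<in> carrier (fld B) \<Longrightarrow> f \<in> lin V W \<Longrightarrow> x \<in> el X V \<Longrightarrow>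
      on_mor X V W (map_smult V W c f) x = c \<odot>\<^bsub>on_ob X W\<^esub> on_mor X V W f x"
  shows "X \<in> LF"
  unfolding LinFun_def full_subcat_def functor_cat_def is_functor_def
  using assms
  by (auto intro!: lin_eqI[OF mor idm_lin] lin_eqI[OF mor cmp_lin] lin_eqI[OF mor map_add_lin]
      lin_eqI[OF mor map_smult_lin] mor cmp_lin map_add_lin map_smult_lin simp: map_add_apply map_smult_apply)

lemma LF_ob [simp]: "X \<in> LF \<Longrightarrow> V \<in> Vob \<Longrightarrow> on_ob X V \<in> Vob"
  unfolding LinFun_def full_subcat_def functor_cat_def is_functor_def by simp

lemma LF_mor: "X \<in> LF \<Longrightarrow> V \<in> Vob \<Longrightarrow> W \<in> Vob \<Longrightarrow> f \<in> lin V W \<Longrightarrow> on_mor X V W f \<in> lin (on_ob X V) (on_ob X W)"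
  unfolding LinFun_def full_subcat_def functor_cat_def is_functor_def by simp

lemma LF_mor_closed [simp]: "X \<in> LF \<Longrightarrow> V \<in> Vob \<Longrightarrow> W \<in> Vob \<Longrightarrow> f \<in> lin V W \<Longrightarrow> x \<in> el X V \<Longrightarrow> on_mor X V W f x \<in> el X W"
  by (rule lin_closed[OF LF_mor])

lemma LF_id [simp]: "X \<in> LF \<Longrightarrow> V \<in> Vob \<Longrightarrow> x \<in> el X V \<Longrightarrow> on_mor X V V (idm V) x = x"
  unfolding LinFun_def full_subcat_def functor_cat_def is_functor_def by simp

lemma LF_cmp: "X \<in> LF \<Longrightarrow> U \<in> Vob \<Longrightarrow> V \<in> Vob \<Longrightarrow> W \<in> Vob \<Longrightarrow> f \<in> lin U V \<Longrightarrow> g \<in> lin V W \<Longrightarrow> x \<in> el X U \<Longrightarrow>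
    on_mor X V W g (on_mor X U V f x) = on_mor X U W (cmp U g f) x"
  unfolding LinFun_def full_subcat_def functor_cat_def is_functor_def by simp

lemma LF_map_add: "X \<in> LF \<Longrightarrow> V \<in> Vob \<Longrightarrow> W \<in> Vob \<Longrightarrow> f \<in> lin V W \<Longrightarrow> g \<in> lin V W \<Longrightarrow> x \<in> el X V \<Longrightarrow>
    on_mor X V W (map_add V W f g) x = on_mor X V W f x \<oplus>\<^bsub>on_ob X W\<^esub> on_mor X V W g x"
  unfolding LinFun_def full_subcat_def by (simp add: map_add_apply)

lemma LF_map_smult: "X \<in> LF \<Longrightarrow> V \<in> Vob \<Longrightarrow> W \<in> Vob \<Longrightarrow> c \<in> carrier (fld B) \<Longrightarrow> f \<in> lin V W \<Longrightarrow> x \<in> el X V \<Longrightarrow>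
    on_mor X V W (map_smult V W c f) x = c \<odot>\<^bsub>on_ob X W\<^esub> on_mor X V W f x"
  unfolding LinFun_def full_subcat_def by (simp add: map_smult_apply)

lemma LF_zero_map: 
  assumes "X \<in> LF" "V \<in> Vob" "W \<in> Vob" "x \<in> el X V"
  shows "on_mor X V W (\<lambda>v \<in> carrier V. \<zero>\<^bsub>W\<^esub>) x = \<zero>\<^bsub>on_ob X W\<^esub>"
proof -
  let ?z = "\<lambda>v \<in> carrier V. \<zero>\<^bsub>W\<^esub>"
  have "?z = map_smult V W \<zero>\<^bsub>fld B\<^esub> ?z" using assms by (auto simp: map_smult_def)
  then show ?thesis using LF_map_smult[of X V W "\<zero>\<^bsub>fld B\<^esub>" ?z x] assms by simp
qed

lemma nt_iff: "\<sigma> \<in> nt X Y \<longleftrightarrow> \<sigma> \<in> (\<Pi>\<^sub>E V\<in>Vob. lin (on_ob X V) (on_ob Y V)) \<and>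
   (\<forall>V\<in>Vob. \<forall>W\<in>Vob. \<forall>f\<in>lin V W. cmp (on_ob X V) (on_mor Y V W f) (\<sigma> V) = cmp (on_ob X V) (\<sigma> W) (on_mor X V W f))"
  unfolding LinFun_def full_subcat_def functor_cat_def nat_transf_def by simp

lemma nt_lin: "\<sigma> \<in> nt X Y \<Longrightarrow> V \<in> Vob \<Longrightarrow> \<sigma> V \<in> lin (on_ob X V) (on_ob Y V)"
  by (auto simp: nt_iff)

lemma nt_closed [simp]: "\<sigma> \<in> nt X Y \<Longrightarrow> V \<in> Vob \<Longrightarrow> x \<in> el X V \<Longrightarrow> \<sigma> V x \<in> el Y V"
  by (rule lin_closed[OF nt_lin])

lemma nt_natural: "\<sigma> \<in> nt X Y \<Longrightarrow> V \<in> Vob \<Longrightarrow> W \<in> Vob \<Longrightarrow> f \<in> lin V W \<Longrightarrow> x \<in> el X V \<Longrightarrow>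
    \<sigma> W (on_mor X V W f x) = on_mor Y V W f (\<sigma> V x)"
proof -
  assume *: "\<sigma> \<in> nt X Y" "V \<in> Vob" "W \<in> Vob" "f \<in> lin V W" "x \<in> el X V"
  then have "cmp (on_ob X V) (on_mor Y V W f) (\<sigma> V) = cmp (on_ob X V) (\<sigma> W) (on_mor X V W f)"
    unfolding nt_iff by blast
  from fun_cong[OF this, of x] show ?thesis using * by simp
qed

lemma nt_extensional: "\<sigma> \<in> nt X Y \<Longrightarrow> \<sigma> \<in> extensional Vob"
  by (simp add: nt_iff PiE_iff)

lemma nt_eqI:
  assumes "\<sigma> \<in> nt X Y" "\<tau> \<in> nt X Y" "\<And>V x. V \<in> Vob \<Longrightarrow> x \<in> el X V \<Longrightarrow> \<sigma> V x = \<tau> V x"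
  shows "\<sigma> = \<tau>"
  by (rule extensionalityI[OF nt_extensional[OF assms(1)] nt_extensional[OF assms(2)]])
    (rule lin_eqI[OF nt_lin[OF assms(1)] nt_lin[OF assms(2)]], simp_all add: assms(3))

text \<open>Both restrictions are needed: arrows of the functor category are extensional in the
  object, and their components are extensional in the element.\<close>

definition mknt :: "'u vfun \<Rightarrow> ('u vec \<Rightarrow> 'u \<Rightarrow> 'u) \<Rightarrow> 'u vnat" where
  "mknt X t = (\<lambda>V\<in>Vob. \<lambda>x\<in>el X V. t V x)"

lemma mknt_apply [simp]: "V \<in> Vob \<Longrightarrow> x \<in> el X V \<Longrightarrow> mknt X t V x = t V x"
  by (simp add: mknt_def)

lemma mknt_nt:
  assumes X: "X \<in> LF"
    and "\<And>V x. V \<in> Vob \<Longrightarrow> x \<in> el X V \<Longrightarrow> t V x \<in> el Y V"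
    and "\<And>V x y. V \<in> Vob \<Longrightarrow> x \<in> el X V \<Longrightarrow> y \<in> el X V \<Longrightarrow> t V (x \<oplus>\<^bsub>on_ob X V\<^esub> y) = t V x \<oplus>\<^bsub>on_ob Y V\<^esub> t V y"
    and "\<And>V c x. V \<in> Vob \<Longrightarrow> c \<in> carrier (fld B) \<Longrightarrow> x \<in> el X V \<Longrightarrow> t V (c \<odot>\<^bsub>on_ob X V\<^esub> x) = c \<odot>\<^bsub>on_ob Y V\<^esub> t V x"
    and nat: "\<And>V W f x. V \<in> Vob \<Longrightarrow> W \<in> Vob \<Longrightarrow> f \<in> lin V W \<Longrightarrow> x \<in> el X V \<Longrightarrow>
      t W (on_mor X V W f x) = on_mor Y V W f (t V x)"
  shows "mknt X t \<in> nt X Y"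
proof -
  have "(\<lambda>x\<in>el X V. t V x) \<in> lin (on_ob X V) (on_ob Y V)" if "V \<in> Vob" for V
    using assms that by (intro lin_restrictI) simp_all
  then show ?thesis using X nat
    by (auto simp: nt_iff mknt_def compose_def fun_eq_iff)
qed

lemma LF_Comp_apply [simp]: "V \<in> Vob \<Longrightarrow> x \<in> el X V \<Longrightarrow> Comp (LinFun B) X \<tau> \<sigma> V x = \<tau> V (\<sigma> V x)"
  by (simp add: LinFun_def full_subcat_def functor_cat_def)

lemma LF_Idn_apply [simp]: "V \<in> Vob \<Longrightarrow> x \<in> el X V \<Longrightarrow> Idn (LinFun B) X V x = x"
  by (simp add: LinFun_def full_subcat_def functor_cat_def)

lemma LF_Comp_eq: "Comp (LinFun B) X \<tau> \<sigma> = mknt X (\<lambda>V x. \<tau> V (\<sigma> V x))"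
  by (simp add: LinFun_def full_subcat_def functor_cat_def mknt_def compose_def)

lemma LF_Idn_eq: "Idn (LinFun B) X = mknt X (\<lambda>V x. x)"
  by (simp add: LinFun_def full_subcat_def functor_cat_def mknt_def)

lemma nt_add: "\<sigma> \<in> nt X Y \<Longrightarrow> V \<in> Vob \<Longrightarrow> x \<in> el X V \<Longrightarrow> y \<in> el X V \<Longrightarrow>
    \<sigma> V (x \<oplus>\<^bsub>on_ob X V\<^esub> y) = \<sigma> V x \<oplus>\<^bsub>on_ob Y V\<^esub> \<sigma> V y"
  by (rule lin_add[OF nt_lin])

lemma nt_smult: "\<sigma> \<in> nt X Y \<Longrightarrow> V \<in> Vob \<Longrightarrow> c \<in> carrier (fld B) \<Longrightarrow> x \<in> el X V \<Longrightarrow>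
    \<sigma> V (c \<odot>\<^bsub>on_ob X V\<^esub> x) = c \<odot>\<^bsub>on_ob Y V\<^esub> \<sigma> V x"
  by (rule lin_smult[OF nt_lin])

lemma Comp_nt: "X \<in> LF \<Longrightarrow> \<sigma> \<in> nt X Y \<Longrightarrow> \<tau> \<in> nt Y Z \<Longrightarrow> Comp (LinFun B) X \<tau> \<sigma> \<in> nt X Z"
  unfolding LF_Comp_eq by (rule mknt_nt) (simp_all add: nt_add[of _ X Y] nt_add[of _ Y Z] nt_smult[of _ X Y] nt_smult[of _ Y Z] nt_natural)

lemma Idn_nt [simp]: "X \<in> LF \<Longrightarrow> Idn (LinFun B) X \<in> nt X X"
  unfolding LF_Idn_eq by (rule mknt_nt) simp_all

lemma zero_nat_apply [simp]: "V \<in> Vob \<Longrightarrow> x \<in> el X V \<Longrightarrow> zero_nat B X Y V x = \<zero>\<^bsub>on_ob Y V\<^esub>"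
  by (simp add: zero_nat_def)

lemma zero_nat_eq: "zero_nat B X Y = mknt X (\<lambda>V x. \<zero>\<^bsub>on_ob Y V\<^esub>)"
  by (simp add: zero_nat_def mknt_def)

lemma zero_nat_nt [simp]: "X \<in> LF \<Longrightarrow> Y \<in> LF \<Longrightarrow> zero_nat B X Y \<in> nt X Y"
  unfolding zero_nat_eq by (rule mknt_nt) (simp_all add: lin_zero[OF LF_mor])

text \<open>Pointwise sums and multiples of transformations make it possible to test linearity in a
  parameter on generators of the source.\<close>

definition nt_sum where "nt_sum X Y \<sigma> \<tau> = mknt X (\<lambda>V x. \<sigma> V x \<oplus>\<^bsub>on_ob Y V\<^esub> \<tau> V x)"
definition nt_scale where "nt_scale X Y c \<sigma> = mknt X (\<lambda>V x. c \<odot>\<^bsub>on_ob Y V\<^esub> \<sigma> V x)"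

lemma nt_sum_apply [simp]: "V \<in> Vob \<Longrightarrow> x \<in> el X V \<Longrightarrow> nt_sum X Y \<sigma> \<tau> V x = \<sigma> V x \<oplus>\<^bsub>on_ob Y V\<^esub> \<tau> V x"
  by (simp add: nt_sum_def)

lemma nt_scale_apply [simp]: "V \<in> Vob \<Longrightarrow> x \<in> el X V \<Longrightarrow> nt_scale X Y c \<sigma> V x = c \<odot>\<^bsub>on_ob Y V\<^esub> \<sigma> V x"
  by (simp add: nt_scale_def)

lemma nt_sum_nt: "X \<in> LF \<Longrightarrow> Y \<in> LF \<Longrightarrow> \<sigma> \<in> nt X Y \<Longrightarrow> \<tau> \<in> nt X Y \<Longrightarrow> nt_sum X Y \<sigma> \<tau> \<in> nt X Y"
  unfolding nt_sum_def
  by (rule mknt_nt) (simp_all add: nt_add nt_smult vadd4 vsmult_add nt_natural lin_add[OF LF_mor])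

lemma nt_scale_nt: "X \<in> LF \<Longrightarrow> Y \<in> LF \<Longrightarrow> c \<in> carrier (fld B) \<Longrightarrow> \<sigma> \<in> nt X Y \<Longrightarrow> nt_scale X Y c \<sigma> \<in> nt X Y"
  unfolding nt_scale_def
  by (rule mknt_nt) (simp_all add: nt_add nt_smult vsmult_add vsmult_comm[of _ c] nt_natural lin_smult[OF LF_mor])

subsection \<open>Shifted functors\<close>

abbreviation shr where "shr \<equiv> shift B"

text \<open>The mirror image of \<open>shift\<close>: holding the left variable of a bifamily fixed
  leads to values in Y(V \<otimes> -).\<close>

definition shl :: "'u vfun \<Rightarrow> 'u vec \<Rightarrow> 'u vfun" where
  "shl Y V = \<lparr> on_ob = (\<lambda>H. on_ob Y (V \<star> H)),
     on_mor = (\<lambda>H H' a. on_mor Y (V \<star> H) (V \<star> H') (tm V V H H' (idm V) a))\<rparr>"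

lemma shr_simps [simp]: "on_ob (shr Y V) H = on_ob Y (H \<star> V)"
  "on_mor (shr Y V) H H' a = on_mor Y (H \<star> V) (H' \<star> V) (tm H H' V V a (idm V))"
  by (simp_all add: shift_def)

lemma shl_simps [simp]: "on_ob (shl Y V) H = on_ob Y (V \<star> H)"
  "on_mor (shl Y V) H H' a = on_mor Y (V \<star> H) (V \<star> H') (tm V V H H' (idm V) a)"
  by (simp_all add: shl_def)

lemma cmp_idm [simp]: "V \<in> Vob \<Longrightarrow> cmp V (idm V) (idm V) = idm V"
  by (auto simp: compose_def)

lemma shr_LF:
  assumes [simp]: "Y \<in> LF" "V \<in> Vob" shows "shr Y V \<in> LF"
proof (rule LF_I)
  fix U' V' W' f g x assume [simp]: "U' \<in> Vob" "V' \<in> Vob" "W' \<in> Vob" "f \<in> lin U' V'" "g \<in> lin V' W'" "x \<in> el (shr Y V) U'"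
  show "on_mor (shr Y V) U' W' (cmp U' g f) x = on_mor (shr Y V) V' W' g (on_mor (shr Y V) U' V' f x)"
    using tm_cmp[of U' V' W' V V V f "idm V" g "idm V"] \<open>x \<in> _\<close> by (simp add: LF_cmp tm_lin)
qed (simp_all add: LF_mor tm_lin tm_add_left tm_smult_left LF_map_add LF_map_smult)

lemma shl_LF:
  assumes [simp]: "Y \<in> LF" "V \<in> Vob" shows "shl Y V \<in> LF"
proof (rule LF_I)
  fix U' V' W' f g x assume [simp]: "U' \<in> Vob" "V' \<in> Vob" "W' \<in> Vob" "f \<in> lin U' V'" "g \<in> lin V' W'" "x \<in> el (shl Y V) U'"
  show "on_mor (shl Y V) U' W' (cmp U' g f) x = on_mor (shl Y V) V' W' g (on_mor (shl Y V) U' V' f x)"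
    using tm_cmp[of V V V U' V' W' "idm V" f "idm V" g] \<open>x \<in> _\<close> by (simp add: LF_cmp tm_lin)
qed (simp_all add: LF_mor tm_lin tm_add_right tm_smult_right LF_map_add LF_map_smult)

declare tm_lin [simp] vai_lin [simp] va_lin [simp] vlu_lin [simp] vru_lin [simp] vlui_lin [simp] vrui_lin [simp]

lemma vlu_apply: "v \<in> carrier V \<Longrightarrow> vlu V v = vb kk V \<one>\<^bsub>fld B\<^esub> v"
  by (simp add: vlu_def)

lemma vru_apply: "v \<in> carrier V \<Longrightarrow> vru V v = vb V kk v \<one>\<^bsub>fld B\<^esub>"
  by (simp add: vru_def)

lemma vlu_natural: "V \<in> Vob \<Longrightarrow> W \<in> Vob \<Longrightarrow> f \<in> lin V W \<Longrightarrow>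
    cmp V (vlu W) f = cmp V (tm kk kk V W (idm kk) f) (vlu V)"
  by (rule lin_eqI[OF cmp_lin[of V f W "vlu W" "kk \<star> W"] cmp_lin[of V "vlu V" "kk \<star> V" _ "kk \<star> W"]])
    (simp_all add: vlu_apply lin_closed[of f V W] tm_vb)

lemma vru_natural: "V \<in> Vob \<Longrightarrow> W \<in> Vob \<Longrightarrow> f \<in> lin V W \<Longrightarrow>
    cmp V (vru W) f = cmp V (tm V W kk kk f (idm kk)) (vru V)"
  by (rule lin_eqI[OF cmp_lin[of V f W "vru W" "W \<star> kk"] cmp_lin[of V "vru V" "V \<star> kk" _ "W \<star> kk"]])
    (simp_all add: vru_apply lin_closed[of f V W] tm_vb)

lemma vlui_vlu: "V \<in> Vob \<Longrightarrow> cmp V (vlui V) (vlu V) = idm V"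
  by (rule lin_eqI[OF cmp_lin[of V _ "kk \<star> V" _ V]]) (simp_all add: vlu_apply vlui_vb)

lemma vrui_vru: "V \<in> Vob \<Longrightarrow> cmp V (vrui V) (vru V) = idm V"
  by (rule lin_eqI[OF cmp_lin[of V _ "V \<star> kk" _ V]]) (simp_all add: vru_apply vrui_vb)

text \<open>\<open>vlui\<close> removes the outer copy of k, whereas \<open>vlu\<close> inserted the
  inner one: c \<otimes> v goes to c \<otimes> (1 \<otimes> v) and then to c(1 \<otimes> v), which
  equals c \<otimes> v.\<close>

lemma vlui_tm_vlu:
  assumes [simp]: "V \<in> Vob"
  shows "cmp (kk \<star> V) (vlui (kk \<star> V)) (tm kk kk V (kk \<star> V) (idm kk) (vlu V)) = idm (kk \<star> V)"
  by (rule vt_ext[OF _ _ _ cmp_lin[of _ _ "kk \<star> kk \<star> V"] idm_lin])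
    (simp_all add: tm_vb vlu_apply vlui_vb vb_smult_left[symmetric])

lemma vrui_tm_vru:
  assumes [simp]: "V \<in> Vob"
  shows "cmp (V \<star> kk) (vrui (V \<star> kk)) (tm V (V \<star> kk) kk kk (vru V) (idm kk)) = idm (V \<star> kk)"
  by (rule vt_ext[OF _ _ _ cmp_lin[of _ _ "(V \<star> kk) \<star> kk"] idm_lin])
    (simp_all add: tm_vb vru_apply vrui_vb vb_smult_right[symmetric])

lemma vassoc_triangle:
  assumes [simp]: "V \<in> Vob" "W \<in> Vob"
  shows "cmp (V \<star> W) (vai V kk W) (tm V V W (kk \<star> W) (idm V) (vlu W)) = tm V (V \<star> kk) W W (vru V) (idm W)"
  by (rule vt_ext[OF _ _ _ cmp_lin[of _ _ "V \<star> kk \<star> W" _ "(V \<star> kk) \<star> W"]])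
    (simp_all add: tm_vb vlu_apply vru_apply vai_vb)

text \<open>Both sides are linear in t. Fixing the first factor leaves a threefold product, where
  \<open>vt_ext3r\<close> reduces the claim to pure tensors.\<close>

lemma vassoc_pentagon:
  assumes [simp]: "T \<in> Vob" "U \<in> Vob" "V \<in> Vob" "W \<in> Vob" and t: "t \<in> carrier (T \<star> U \<star> V \<star> W)"
  shows "vai (T \<star> U) V W (vai T U (V \<star> W) t) =
    tm ((T \<star> U \<star> V)) ((T \<star> U) \<star> V) W W (vai T U V) (idm W)
      (vai T (U \<star> V) W (tm T T (U \<star> V \<star> W) ((U \<star> V) \<star> W) (idm T) (vai U V W) t))"
proof -
  let ?D = "T \<star> U \<star> V \<star> W" and ?C = "((T \<star> U) \<star> V) \<star> W"
  let ?f = "cmp ?D (vai (T \<star> U) V W) (vai T U (V \<star> W))"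
  let ?g = "cmp ?D (tm ((T \<star> U \<star> V)) ((T \<star> U) \<star> V) W W (vai T U V) (idm W))
      (cmp ?D (vai T (U \<star> V) W) (tm T T (U \<star> V \<star> W) ((U \<star> V) \<star> W) (idm T) (vai U V W)))"
  have f: "?f \<in> lin ?D ?C" by (rule cmp_lin[of _ _ "(T \<star> U) \<star> V \<star> W"]) simp_all
  have g: "?g \<in> lin ?D ?C"
    by (rule cmp_lin[of _ _ "(T \<star> U \<star> V) \<star> W", OF _ cmp_lin[of _ _ "T \<star> (U \<star> V) \<star> W"]]) simp_all
  have "?f = ?g"
  proof (rule vt_ext[OF _ _ _ f g])
    fix x r assume x: "x \<in> carrier T" and r: "r \<in> carrier (U \<star> V \<star> W)"
    let ?r = "restrict (vb T (U \<star> V \<star> W) x) (carrier (U \<star> V \<star> W))"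
    have l: "?r \<in> lin (U \<star> V \<star> W) ?D" using x by (intro vb_left_lin) simp_all
    have "cmp (U \<star> V \<star> W) ?f ?r = cmp (U \<star> V \<star> W) ?g ?r"
      by (rule vt_ext3r[OF _ _ _ _ cmp_lin[OF _ l f] cmp_lin[OF _ l g]])
        (simp_all add: x vai_vb[of "T \<star> U" V W] vai_vb[of T U "V \<star> W"] vai_vb[of T "U \<star> V" W] tm_vb vai_vb[of U V W] vai_vb[of T U V])
    from fun_cong[OF this, of r] show "?f (vb T (U \<star> V \<star> W) x r) = ?g (vb T (U \<star> V \<star> W) x r)" using r by simp
  qed simp_all
  from fun_cong[OF this, of t] show ?thesis using t by simp
qed

text \<open>By Yoneda, a cowedge on X(H) \<otimes> Y(L) \<otimes> Vect(H \<otimes> L, V) that is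
  natural in V is determined by its values at the identity of H \<otimes> L. Recording only these
  removes the third variable; the component at f is recovered by applying Z(f).\<close>

definition bifam :: "'u vfun \<Rightarrow> 'u vfun \<Rightarrow> 'u vfun \<Rightarrow> ('u vec \<Rightarrow> 'u vec \<Rightarrow> 'u \<Rightarrow> 'u \<Rightarrow> 'u) \<Rightarrow> bool" where
  "bifam X Y Z \<beta> \<longleftrightarrow>
    (\<forall>H\<in>Vob. \<forall>L\<in>Vob. bilinear_on B (on_ob X H) (on_ob Y L) (on_ob Z (H \<star> L)) (\<beta> H L)) \<and>
    (\<forall>H\<in>Vob. \<forall>H'\<in>Vob. \<forall>L\<in>Vob. \<forall>L'\<in>Vob. \<forall>a\<in>lin H H'. \<forall>b\<in>lin L L'. \<forall>x\<in>el X H. \<forall>y\<in>el Y L.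
       \<beta> H' L' (on_mor X H H' a x) (on_mor Y L L' b y) =
       on_mor Z (H \<star> L) (H' \<star> L') (tm H H' L L' a b) (\<beta> H L x y))"

lemma bifamI:
  assumes "X \<in> LF" "Y \<in> LF"
    and "\<And>H L x y. H \<in> Vob \<Longrightarrow> L \<in> Vob \<Longrightarrow> x \<in> el X H \<Longrightarrow> y \<in> el Y L \<Longrightarrow> \<beta> H L x y \<in> el Z (H \<star> L)"
    and "\<And>H L x x' y. H \<in> Vob \<Longrightarrow> L \<in> Vob \<Longrightarrow> x \<in> el X H \<Longrightarrow> x' \<in> el X H \<Longrightarrow> y \<in> el Y L \<Longrightarrow>
      \<beta> H L (x \<oplus>\<^bsub>on_ob X H\<^esub> x') y = \<beta> H L x y \<oplus>\<^bsub>on_ob Z (H \<star> L)\<^esub> \<beta> H L x' y"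
    and "\<And>H L x y y'. H \<in> Vob \<Longrightarrow> L \<in> Vob \<Longrightarrow> x \<in> el X H \<Longrightarrow> y \<in> el Y L \<Longrightarrow> y' \<in> el Y L \<Longrightarrow>
      \<beta> H L x (y \<oplus>\<^bsub>on_ob Y L\<^esub> y') = \<beta> H L x y \<oplus>\<^bsub>on_ob Z (H \<star> L)\<^esub> \<beta> H L x y'"
    and "\<And>H L c x y. H \<in> Vob \<Longrightarrow> L \<in> Vob \<Longrightarrow> c \<in> carrier (fld B) \<Longrightarrow> x \<in> el X H \<Longrightarrow> y \<in> el Y L \<Longrightarrow>
      \<beta> H L (c \<odot>\<^bsub>on_ob X H\<^esub> x) y = c \<odot>\<^bsub>on_ob Z (H \<star> L)\<^esub> \<beta> H L x y"
    and "\<And>H L c x y. H \<in> Vob \<Longrightarrow> L \<in> Vob \<Longrightarrow> c \<in> carrier (fld B) \<Longrightarrow> x \<in> el X H \<Longrightarrow> y \<in> el Y L \<Longrightarrow>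
      \<beta> H L x (c \<odot>\<^bsub>on_ob Y L\<^esub> y) = c \<odot>\<^bsub>on_ob Z (H \<star> L)\<^esub> \<beta> H L x y"
    and "\<And>H H' L L' a b x y. H \<in> Vob \<Longrightarrow> H' \<in> Vob \<Longrightarrow> L \<in> Vob \<Longrightarrow> L' \<in> Vob \<Longrightarrow> a \<in> lin H H' \<Longrightarrow> b \<in> lin L L' \<Longrightarrow>
      x \<in> el X H \<Longrightarrow> y \<in> el Y L \<Longrightarrow> \<beta> H' L' (on_mor X H H' a x) (on_mor Y L L' b y) =
       on_mor Z (H \<star> L) (H' \<star> L') (tm H H' L L' a b) (\<beta> H L x y)"
  shows "bifam X Y Z \<beta>"
  unfolding bifam_def using assms by (auto intro!: bilinear_onI)

context
  fixes X Y Z \<beta> H L assumes \<beta>: "bifam X Y Z \<beta>" and X: "X \<in> LF" and Y: "Y \<in> LF" and H: "H \<in> Vob" and L: "L \<in> Vob"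
begin

lemma bifam_bilinear: "bilinear_on B (on_ob X H) (on_ob Y L) (on_ob Z (H \<star> L)) (\<beta> H L)"
  using \<beta> H L unfolding bifam_def by blast

lemmas bifam_closed = bilinear_onD(1)[OF bifam_bilinear LF_ob[OF X H] LF_ob[OF Y L]]
  and bifam_add_left = bilinear_onD(2)[OF bifam_bilinear LF_ob[OF X H] LF_ob[OF Y L]]
  and bifam_add_right = bilinear_onD(3)[OF bifam_bilinear LF_ob[OF X H] LF_ob[OF Y L]]
  and bifam_smult_left = bilinear_onD(4)[OF bifam_bilinear LF_ob[OF X H] LF_ob[OF Y L]]
  and bifam_smult_right = bilinear_onD(5)[OF bifam_bilinear LF_ob[OF X H] LF_ob[OF Y L]]

lemma bifam_natural: "H' \<in> Vob \<Longrightarrow> L' \<in> Vob \<Longrightarrow> a \<in> lin H H' \<Longrightarrow> b \<in> lin L L' \<Longrightarrow> x \<in> el X H \<Longrightarrow> y \<in> el Y L \<Longrightarrow>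
    \<beta> H' L' (on_mor X H H' a x) (on_mor Y L L' b y) =
       on_mor Z (H \<star> L) (H' \<star> L') (tm H H' L L' a b) (\<beta> H L x y)"
  using \<beta> H L unfolding bifam_def by blast

lemma bifam_natural_left: "H' \<in> Vob \<Longrightarrow> a \<in> lin H H' \<Longrightarrow> x \<in> el X H \<Longrightarrow> y \<in> el Y L \<Longrightarrow>
    \<beta> H' L (on_mor X H H' a x) y = on_mor Z (H \<star> L) (H' \<star> L) (tm H H' L L a (idm L)) (\<beta> H L x y)"
  using bifam_natural[of H' L a "idm L" x y] Y L by simp

lemma bifam_natural_right: "L' \<in> Vob \<Longrightarrow> b \<in> lin L L' \<Longrightarrow> x \<in> el X H \<Longrightarrow> y \<in> el Y L \<Longrightarrow>
    \<beta> H L' x (on_mor Y L L' b y) = on_mor Z (H \<star> L) (H \<star> L') (tm H H L L' (idm H) b) (\<beta> H L x y)"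
  using bifam_natural[of H L' "idm H" b x y] X H by simp

end

abbreviation subLF :: "'u vfun set \<Rightarrow> ('u vfun, 'u vnat) cat" where
  "subLF S \<equiv> (LinFun B)\<lparr>Obj := S\<rparr>"

lemma category_subLF:
  assumes "S \<subseteq> LF" shows "category (subLF S)"
proof
  fix A D f assume *: "A \<in> Obj (subLF S)" "D \<in> Obj (subLF S)" "f \<in> Hom (subLF S) A D"
  with assms show "Comp (subLF S) A f (Idn (subLF S) A) = f" "Comp (subLF S) A (Idn (subLF S) D) f = f"
    by (auto intro!: nt_eqI[of _ A D] Comp_nt)
next
  fix A D E F f g h assume *: "A \<in> Obj (subLF S)" "D \<in> Obj (subLF S)" "E \<in> Obj (subLF S)" "F \<in> Obj (subLF S)"
    "f \<in> Hom (subLF S) A D" "g \<in> Hom (subLF S) D E" "h \<in> Hom (subLF S) E F"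
  with assms have [simp]: "A \<in> LF" "D \<in> LF" "E \<in> LF" "f \<in> nt A D" "g \<in> nt D E" "h \<in> nt E F" by auto
  have "Comp (LinFun B) A h (Comp (LinFun B) A g f) = Comp (LinFun B) A (Comp (LinFun B) D h g) f"
    by (rule nt_eqI[OF Comp_nt[of A _ E _ F] Comp_nt[of A _ D _ F]])
      (auto intro: Comp_nt[of A f D g E] Comp_nt[of D g E h F] simp: nt_closed[of f A D])
  then show "Comp (subLF S) A h (Comp (subLF S) A g f) = Comp (subLF S) A (Comp (subLF S) D h g) f"
    by simp
qed (use assms in \<open>auto intro!: Comp_nt\<close>)

end

subsection \<open>Monoidal closed structures from universal bifamilies\<close>

text \<open>\<open>\<O>\<close> is the class of objects that is to carry the monoidal structure, and \<open>\<T>\<close> the class of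
  targets for which \<open>u\<close> is universal; the shifts of an object of \<open>\<O>\<close> are only required to be in \<open>\<T>\<close>.\<close>

locale day = vect_setting B for B :: "'u vdata" +
  fixes \<O> \<T> :: "'u vfun set" and dob :: "'u vfun \<Rightarrow> 'u vfun \<Rightarrow> 'u vfun"
    and u :: "'u vfun \<Rightarrow> 'u vfun \<Rightarrow> 'u vec \<Rightarrow> 'u vec \<Rightarrow> 'u \<Rightarrow> 'u \<Rightarrow> 'u"
    and J :: "'u vfun" and e :: 'u
    and hob :: "'u vfun \<Rightarrow> 'u vfun \<Rightarrow> 'u vfun"
    and hnt :: "'u vfun \<Rightarrow> 'u vfun \<Rightarrow> 'u vec \<Rightarrow> 'u \<Rightarrow> 'u vnat"
  assumes \<O>_\<T>: "\<O> \<subseteq> \<T>" and \<T>_sub: "\<T> \<subseteq> LF"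
    and shr_\<T> [simp]: "\<lbrakk>Z \<in> \<T>; V \<in> Vob\<rbrakk> \<Longrightarrow> shr Z V \<in> \<T>"
    and shl_\<T> [simp]: "\<lbrakk>Z \<in> \<T>; V \<in> Vob\<rbrakk> \<Longrightarrow> shl Z V \<in> \<T>"
    and dob_\<O> [simp]: "\<lbrakk>X \<in> \<O>; Y \<in> \<O>\<rbrakk> \<Longrightarrow> dob X Y \<in> \<O>"
    and u_bifam: "\<lbrakk>X \<in> \<O>; Y \<in> \<O>\<rbrakk> \<Longrightarrow> bifam X Y (dob X Y) (u X Y)"
    and u_lift: "\<lbrakk>X \<in> \<O>; Y \<in> \<O>; Z \<in> \<T>; bifam X Y Z \<beta>\<rbrakk> \<Longrightarrow>
      \<exists>\<theta>\<in>nt (dob X Y) Z. \<forall>H\<in>Vob. \<forall>L\<in>Vob. \<forall>x\<in>el X H. \<forall>y\<in>el Y L. \<theta> (H \<star> L) (u X Y H L x y) = \<beta> H L x y"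
    and u_ext: "\<lbrakk>X \<in> \<O>; Y \<in> \<O>; Z \<in> \<T>; \<theta> \<in> nt (dob X Y) Z; \<theta>' \<in> nt (dob X Y) Z;
      \<And>H L x y. \<lbrakk>H \<in> Vob; L \<in> Vob; x \<in> el X H; y \<in> el Y L\<rbrakk> \<Longrightarrow>
        \<theta> (H \<star> L) (u X Y H L x y) = \<theta>' (H \<star> L) (u X Y H L x y)\<rbrakk> \<Longrightarrow> \<theta> = \<theta>'"
    and J_\<O> [simp]: "J \<in> \<O>" and e_J [simp]: "e \<in> el J kk"
    and J_lift: "\<lbrakk>Z \<in> \<T>; z \<in> el Z kk\<rbrakk> \<Longrightarrow> \<exists>\<theta>\<in>nt J Z. \<theta> kk e = z"
    and J_ext: "\<lbrakk>Z \<in> \<T>; \<theta> \<in> nt J Z; \<theta>' \<in> nt J Z; \<theta> kk e = \<theta>' kk e\<rbrakk> \<Longrightarrow> \<theta> = \<theta>'"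
    and hob_\<O> [simp]: "\<lbrakk>X \<in> \<O>; Z \<in> \<O>\<rbrakk> \<Longrightarrow> hob X Z \<in> \<O>"
    and hnt_bij: "\<lbrakk>X \<in> \<O>; Z \<in> \<O>; V \<in> Vob\<rbrakk> \<Longrightarrow> bij_betw (hnt X Z V) (el (hob X Z) V) (nt X (shr Z V))"
    and hnt_add: "\<lbrakk>X \<in> \<O>; Z \<in> \<O>; V \<in> Vob; H \<in> Vob; x \<in> el X H; s \<in> el (hob X Z) V; t \<in> el (hob X Z) V\<rbrakk> \<Longrightarrow>
      hnt X Z V (s \<oplus>\<^bsub>on_ob (hob X Z) V\<^esub> t) H x = hnt X Z V s H x \<oplus>\<^bsub>on_ob Z (H \<star> V)\<^esub> hnt X Z V t H x"
    and hnt_smult: "\<lbrakk>X \<in> \<O>; Z \<in> \<O>; V \<in> Vob; H \<in> Vob; x \<in> el X H; s \<in> el (hob X Z) V; c \<in> carrier (fld B)\<rbrakk> \<Longrightarrow>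
      hnt X Z V (c \<odot>\<^bsub>on_ob (hob X Z) V\<^esub> s) H x = c \<odot>\<^bsub>on_ob Z (H \<star> V)\<^esub> hnt X Z V s H x"
    and hnt_natural: "\<lbrakk>X \<in> \<O>; Z \<in> \<O>; V \<in> Vob; V' \<in> Vob; g \<in> lin V V'; H \<in> Vob; x \<in> el X H; s \<in> el (hob X Z) V\<rbrakk> \<Longrightarrow>
      hnt X Z V' (on_mor (hob X Z) V V' g s) H x =
      on_mor Z (H \<star> V) (H \<star> V') (tm H H V V' (idm H) g) (hnt X Z V s H x)"
begin

lemma \<T>_LF [simp]: "X \<in> \<T> \<Longrightarrow> X \<in> LF"
  using \<T>_sub by blast

lemma \<O>_in_\<T> [simp]: "X \<in> \<O> \<Longrightarrow> X \<in> \<T>"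
  using \<O>_\<T> by blast

lemma \<O>_LF [simp]: "X \<in> \<O> \<Longrightarrow> X \<in> LF"
  by simp

lemmas u_closed [simp] = bifam_closed[OF u_bifam \<O>_LF \<O>_LF]
  and u_add_left = bifam_add_left[OF u_bifam \<O>_LF \<O>_LF]
  and u_add_right = bifam_add_right[OF u_bifam \<O>_LF \<O>_LF]
  and u_smult_left = bifam_smult_left[OF u_bifam \<O>_LF \<O>_LF]
  and u_smult_right = bifam_smult_right[OF u_bifam \<O>_LF \<O>_LF]
  and u_natural = bifam_natural[OF u_bifam \<O>_LF \<O>_LF]
  and u_natural_left = bifam_natural_left[OF u_bifam \<O>_LF \<O>_LF]
  and u_natural_right = bifam_natural_right[OF u_bifam \<O>_LF \<O>_LF]

text \<open>Generation is tested against targets in \<open>\<T>\<close> only, since the universal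
  property of u speaks of no others. In contrast to \<open>u_ext\<close> the notion can be iterated:
  generators of A yield generators of A \<otimes> Y.\<close>

definition gen :: "'u vfun \<Rightarrow> ('u vec \<times> 'u) set \<Rightarrow> bool" where
  "gen A G \<longleftrightarrow> G \<subseteq> Sigma Vob (el A) \<and> (\<forall>Z\<in>\<T>. \<forall>\<theta>\<in>nt A Z. \<forall>\<theta>'\<in>nt A Z.
     (\<forall>(H, t)\<in>G. \<theta> H t = \<theta>' H t) \<longrightarrow> \<theta> = \<theta>')"

lemma genD: "gen A G \<Longrightarrow> Z \<in> \<T> \<Longrightarrow> \<theta> \<in> nt A Z \<Longrightarrow> \<theta>' \<in> nt A Z \<Longrightarrow>
    (\<And>H t. (H, t) \<in> G \<Longrightarrow> \<theta> H t = \<theta>' H t) \<Longrightarrow> \<theta> = \<theta>'"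
  unfolding gen_def by blast

lemma gen_mem: "gen A G \<Longrightarrow> (H, t) \<in> G \<Longrightarrow> H \<in> Vob \<and> t \<in> el A H"
  unfolding gen_def by blast

definition gdob where "gdob X Y = {(H \<star> L, u X Y H L x y) | H L x y. H \<in> Vob \<and> L \<in> Vob \<and> x \<in> el X H \<and> y \<in> el Y L}"
definition gleft where "gleft A G Y = {(H \<star> L, u A Y H L t y) | H L t y. (H, t) \<in> G \<and> L \<in> Vob \<and> y \<in> el Y L}"
definition gright where "gright X A G = {(H \<star> L, u X A H L x t) | H L x t. (L, t) \<in> G \<and> H \<in> Vob \<and> x \<in> el X H}"

lemma gdobI: "H \<in> Vob \<Longrightarrow> L \<in> Vob \<Longrightarrow> x \<in> el X H \<Longrightarrow> y \<in> el Y L \<Longrightarrow> (H \<star> L, u X Y H L x y) \<in> gdob X Y"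
  unfolding gdob_def by blast

lemma gleftI: "(H, t) \<in> G \<Longrightarrow> L \<in> Vob \<Longrightarrow> y \<in> el Y L \<Longrightarrow> (H \<star> L, u A Y H L t y) \<in> gleft A G Y"
  unfolding gleft_def by blast

lemma grightI: "(L, t) \<in> G \<Longrightarrow> H \<in> Vob \<Longrightarrow> x \<in> el X H \<Longrightarrow> (H \<star> L, u X A H L x t) \<in> gright X A G"
  unfolding gright_def by blast

lemma gen_dob: "X \<in> \<O> \<Longrightarrow> Y \<in> \<O> \<Longrightarrow> gen (dob X Y) (gdob X Y)"
  unfolding gen_def
proof (intro conjI ballI impI)
  assume "X \<in> \<O>" "Y \<in> \<O>"
  then show "gdob X Y \<subseteq> Sigma Vob (el (dob X Y))" by (auto simp: gdob_def)
next
  fix Z \<theta> \<theta>' assume XY: "X \<in> \<O>" "Y \<in> \<O>" "Z \<in> \<T>" "\<theta> \<in> nt (dob X Y) Z" "\<theta>' \<in> nt (dob X Y) Z"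
    and *: "\<forall>(H, t)\<in>gdob X Y. \<theta> H t = \<theta>' H t"
  show "\<theta> = \<theta>'"
  proof (rule u_ext[OF XY])
    fix H L x y assume "H \<in> Vob" "L \<in> Vob" "x \<in> el X H" "y \<in> el Y L"
    then have "(H \<star> L, u X Y H L x y) \<in> gdob X Y" by (rule gdobI)
    then show "\<theta> (H \<star> L) (u X Y H L x y) = \<theta>' (H \<star> L) (u X Y H L x y)" using * by auto
  qed
qed

lemma gen_J: "gen J {(kk, e)}"
  unfolding gen_def using J_ext by auto

definition nt_left where "nt_left A Y \<theta> L y = mknt A (\<lambda>H t. \<theta> (H \<star> L) (u A Y H L t y))"
definition nt_right where "nt_right X A \<theta> H x = mknt A (\<lambda>L t. \<theta> (H \<star> L) (u X A H L x t))"

lemma nt_left_nt: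
  assumes [simp]: "A \<in> \<O>" "Y \<in> \<O>" "Z \<in> LF" "L \<in> Vob" "y \<in> el Y L" and \<theta>: "\<theta> \<in> nt (dob A Y) Z"
  shows "nt_left A Y \<theta> L y \<in> nt A (shr Z L)"
  unfolding nt_left_def
  by (rule mknt_nt) (simp_all add: u_add_left u_smult_left u_natural_left
      nt_closed[OF \<theta>] nt_add[OF \<theta>] nt_smult[OF \<theta>] nt_natural[OF \<theta>])

lemma nt_right_nt:
  assumes [simp]: "A \<in> \<O>" "X \<in> \<O>" "Z \<in> LF" "H \<in> Vob" "x \<in> el X H" and \<theta>: "\<theta> \<in> nt (dob X A) Z"
  shows "nt_right X A \<theta> H x \<in> nt A (shl Z H)"
  unfolding nt_right_def
  by (rule mknt_nt) (simp_all add: u_add_right u_smult_right u_natural_right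
      nt_closed[OF \<theta>] nt_add[OF \<theta>] nt_smult[OF \<theta>] nt_natural[OF \<theta>])

text \<open>For fixed y the slice t \<mapsto> \<theta>(t \<otimes> y) is a map from A to Z(-
  \<otimes> L). This target lies in \<open>\<T>\<close>, so agreement on G spreads to all of A, and
  then \<open>u_ext\<close> applies.\<close>

lemma gen_left:
  assumes A [simp]: "A \<in> \<O>" and Y [simp]: "Y \<in> \<O>" and G: "gen A G"
  shows "gen (dob A Y) (gleft A G Y)"
  unfolding gen_def
proof (intro conjI ballI impI)
  show "gleft A G Y \<subseteq> Sigma Vob (el (dob A Y))" using gen_mem[OF G] by (auto simp: gleft_def)
next
  fix Z \<theta> \<theta>' assume Z [simp]: "Z \<in> \<T>" and \<theta>: "\<theta> \<in> nt (dob A Y) Z" and \<theta>': "\<theta>' \<in> nt (dob A Y) Z"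
    and *: "\<forall>(H, t)\<in>gleft A G Y. \<theta> H t = \<theta>' H t"
  show "\<theta> = \<theta>'"
  proof (rule u_ext[OF A Y Z \<theta> \<theta>'])
    fix H L x y assume [simp]: "H \<in> Vob" "L \<in> Vob" "x \<in> el A H" "y \<in> el Y L"
    have "nt_left A Y \<theta> L y = nt_left A Y \<theta>' L y"
    proof (rule genD[OF G, of "shr Z L"])
      fix H t assume Ht: "(H, t) \<in> G"
      then have "(H \<star> L, u A Y H L t y) \<in> gleft A G Y" by (rule gleftI) simp_all
      then show "nt_left A Y \<theta> L y H t = nt_left A Y \<theta>' L y H t"
        using * gen_mem[OF G Ht] by (auto simp: nt_left_def)
    qed (simp_all add: nt_left_nt \<theta> \<theta>')
    from fun_cong[OF fun_cong[OF this, of H], of x] show "\<theta> (H \<star> L) (u A Y H L x y) = \<theta>' (H \<star> L) (u A Y H L x y)"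
      by (simp add: nt_left_def)
  qed
qed

lemma gen_right:
  assumes A [simp]: "A \<in> \<O>" and X [simp]: "X \<in> \<O>" and G: "gen A G"
  shows "gen (dob X A) (gright X A G)"
  unfolding gen_def
proof (intro conjI ballI impI)
  show "gright X A G \<subseteq> Sigma Vob (el (dob X A))" using gen_mem[OF G] by (auto simp: gright_def)
next
  fix Z \<theta> \<theta>' assume Z [simp]: "Z \<in> \<T>" and \<theta>: "\<theta> \<in> nt (dob X A) Z" and \<theta>': "\<theta>' \<in> nt (dob X A) Z"
    and *: "\<forall>(H, t)\<in>gright X A G. \<theta> H t = \<theta>' H t"
  show "\<theta> = \<theta>'"
  proof (rule u_ext[OF X A Z \<theta> \<theta>'])
    fix H L x y assume [simp]: "H \<in> Vob" "L \<in> Vob" "x \<in> el X H" "y \<in> el A L"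
    have "nt_right X A \<theta> H x = nt_right X A \<theta>' H x"
    proof (rule genD[OF G, of "shl Z H"])
      fix L t assume Lt: "(L, t) \<in> G"
      then have "(H \<star> L, u X A H L x t) \<in> gright X A G" by (rule grightI) simp_all
      then show "nt_right X A \<theta> H x L t = nt_right X A \<theta>' H x L t"
        using * gen_mem[OF G Lt] by (auto simp: nt_right_def)
    qed (simp_all add: nt_right_nt \<theta> \<theta>')
    from fun_cong[OF fun_cong[OF this, of L], of y] show "\<theta> (H \<star> L) (u X A H L x y) = \<theta>' (H \<star> L) (u X A H L x y)"
      by (simp add: nt_right_def)
  qed
qed

text \<open>Each side of an additivity, homogeneity or naturality law in y is itself a natural
  transformation out of A, so these laws need checking only on G. This is what allows
  \<open>\<phi>\<close> to be put together from arbitrary choices.\<close>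

lemma bifam_param_left:
  assumes [simp]: "A \<in> \<O>" "Y \<in> \<O>" "Z \<in> \<T>" and G: "gen A G"
    and \<phi>: "\<And>L y. L \<in> Vob \<Longrightarrow> y \<in> el Y L \<Longrightarrow> \<phi> L y \<in> nt A (shr Z L)"
    and add: "\<And>H t L y y'. (H, t) \<in> G \<Longrightarrow> L \<in> Vob \<Longrightarrow> y \<in> el Y L \<Longrightarrow> y' \<in> el Y L \<Longrightarrow>
      \<phi> L (y \<oplus>\<^bsub>on_ob Y L\<^esub> y') H t = \<phi> L y H t \<oplus>\<^bsub>on_ob Z (H \<star> L)\<^esub> \<phi> L y' H t"
    and smult: "\<And>H t L c y. (H, t) \<in> G \<Longrightarrow> L \<in> Vob \<Longrightarrow> c \<in> carrier (fld B) \<Longrightarrow> y \<in> el Y L \<Longrightarrow>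
      \<phi> L (c \<odot>\<^bsub>on_ob Y L\<^esub> y) H t = c \<odot>\<^bsub>on_ob Z (H \<star> L)\<^esub> \<phi> L y H t"
    and nat: "\<And>H t L L' b y. (H, t) \<in> G \<Longrightarrow> L \<in> Vob \<Longrightarrow> L' \<in> Vob \<Longrightarrow> b \<in> lin L L' \<Longrightarrow> y \<in> el Y L \<Longrightarrow>
      \<phi> L' (on_mor Y L L' b y) H t = on_mor Z (H \<star> L) (H \<star> L') (tm H H L L' (idm H) b) (\<phi> L y H t)"
  shows "bifam A Y Z (\<lambda>H L t y. \<phi> L y H t)"
proof (rule bifamI)
  fix H L x y y' assume *: "H \<in> Vob" "L \<in> Vob" "x \<in> el A H" "y \<in> el Y L" "y' \<in> el Y L"
  have "\<phi> L (y \<oplus>\<^bsub>on_ob Y L\<^esub> y') = nt_sum A (shr Z L) (\<phi> L y) (\<phi> L y')"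
    by (rule genD[OF G, of "shr Z L"]) (use * gen_mem[OF G] in \<open>simp_all add: add \<phi> nt_sum_nt shr_LF\<close>)
  then show "\<phi> L (y \<oplus>\<^bsub>on_ob Y L\<^esub> y') H x = \<phi> L y H x \<oplus>\<^bsub>on_ob Z (H \<star> L)\<^esub> \<phi> L y' H x"
    using * by simp
next
  fix H L c x y assume *: "H \<in> Vob" "L \<in> Vob" "c \<in> carrier (fld B)" "x \<in> el A H" "y \<in> el Y L"
  have "\<phi> L (c \<odot>\<^bsub>on_ob Y L\<^esub> y) = nt_scale A (shr Z L) c (\<phi> L y)"
    by (rule genD[OF G, of "shr Z L"]) (use * gen_mem[OF G] in \<open>simp_all add: smult \<phi> nt_scale_nt shr_LF\<close>)
  then show "\<phi> L (c \<odot>\<^bsub>on_ob Y L\<^esub> y) H x = c \<odot>\<^bsub>on_ob Z (H \<star> L)\<^esub> \<phi> L y H x"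
    using * by simp
next
  fix H H' L L' a b x y assume [simp]: "H \<in> Vob" "H' \<in> Vob" "L \<in> Vob" "L' \<in> Vob" "a \<in> lin H H'" "b \<in> lin L L'" "x \<in> el A H" "y \<in> el Y L"
  \<comment> \<open>The expected value of \<open>\<phi>\<close> at the transported y, namely the
    values of \<open>\<phi> L y\<close> transported along b. Once it is known to be natural in A,
    agreement on G identifies the two.\<close>
  let ?p = "mknt A (\<lambda>H t. on_mor Z (H \<star> L) (H \<star> L') (tm H H L L' (idm H) b) (\<phi> L y H t))"
  have \<phi>c [simp]: "\<phi> L y V t \<in> el Z (V \<star> L)" if "V \<in> Vob" "t \<in> el A V" for V t
    using nt_closed[OF \<phi>[of L y], of V t] that by simp
  have p: "?p \<in> nt A (shr Z L')"
  proof (rule mknt_nt)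
    fix V W f t assume [simp]: "V \<in> Vob" "W \<in> Vob" "f \<in> lin V W" "t \<in> el A V"
    have "cmp (V \<star> L) (tm W W L L' (idm W) b) (tm V W L L f (idm L)) = cmp (V \<star> L) (tm V W L' L' f (idm L')) (tm V V L L' (idm V) b)"
      by (rule vt_ext[OF _ _ _ cmp_lin[of _ _ "W \<star> L" _ "W \<star> L'"] cmp_lin[of _ _ "V \<star> L'"]]) (simp_all add: tm_vb lin_closed[of f V W] lin_closed[of b L L'])
    then show "on_mor Z (W \<star> L) (W \<star> L') (tm W W L L' (idm W) b) (\<phi> L y W (on_mor A V W f t)) =
      on_mor (shr Z L') V W f (on_mor Z (V \<star> L) (V \<star> L') (tm V V L L' (idm V) b) (\<phi> L y V t))"
      by (simp add: nt_natural[OF \<phi>] LF_cmp)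
  qed (simp_all add: nt_add[OF \<phi>] nt_smult[OF \<phi>] lin_add[OF LF_mor] lin_smult[OF LF_mor])
  have "\<phi> L' (on_mor Y L L' b y) = ?p"
    by (rule genD[OF G _ _ p]) (use gen_mem[OF G] in \<open>simp_all add: \<phi> nat\<close>)
  \<comment> \<open>a \<otimes> b is a \<otimes> id followed by id \<otimes> b, so joint naturality
    follows from naturality in each variable.\<close>
  moreover have "cmp (H \<star> L) (tm H' H' L L' (idm H') b) (tm H H' L L a (idm L)) = tm H H' L L' a b"
    by (rule sym, rule tm_eqI[OF _ _ _ _ _ _ cmp_lin[of _ _ "H' \<star> L"]]) (simp_all add: tm_vb lin_closed[of a H H'])
  ultimately show "\<phi> L' (on_mor Y L L' b y) H' (on_mor A H H' a x) = on_mor Z (H \<star> L) (H' \<star> L') (tm H H' L L' a b) (\<phi> L y H x)"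
    by (simp add: nt_natural[OF \<phi>] LF_cmp)
next
  fix H L x y assume "H \<in> Vob" "L \<in> Vob" "x \<in> el A H" "y \<in> el Y L"
  then show "\<phi> L y H x \<in> el Z (H \<star> L)" using nt_closed[OF \<phi>[of L y], of H x] by simp
qed (simp_all add: nt_add[OF \<phi>] nt_smult[OF \<phi>])

lemma bifam_param_right:
  assumes [simp]: "A \<in> \<O>" "X \<in> \<O>" "Z \<in> \<T>" and G: "gen A G"
    and \<phi>: "\<And>H x. H \<in> Vob \<Longrightarrow> x \<in> el X H \<Longrightarrow> \<phi> H x \<in> nt A (shl Z H)"
    and add: "\<And>L t H x x'. (L, t) \<in> G \<Longrightarrow> H \<in> Vob \<Longrightarrow> x \<in> el X H \<Longrightarrow> x' \<in> el X H \<Longrightarrow>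
      \<phi> H (x \<oplus>\<^bsub>on_ob X H\<^esub> x') L t = \<phi> H x L t \<oplus>\<^bsub>on_ob Z (H \<star> L)\<^esub> \<phi> H x' L t"
    and smult: "\<And>L t H c x. (L, t) \<in> G \<Longrightarrow> H \<in> Vob \<Longrightarrow> c \<in> carrier (fld B) \<Longrightarrow> x \<in> el X H \<Longrightarrow>
      \<phi> H (c \<odot>\<^bsub>on_ob X H\<^esub> x) L t = c \<odot>\<^bsub>on_ob Z (H \<star> L)\<^esub> \<phi> H x L t"
    and nat: "\<And>L t H H' a x. (L, t) \<in> G \<Longrightarrow> H \<in> Vob \<Longrightarrow> H' \<in> Vob \<Longrightarrow> a \<in> lin H H' \<Longrightarrow> x \<in> el X H \<Longrightarrow>
      \<phi> H' (on_mor X H H' a x) L t = on_mor Z (H \<star> L) (H' \<star> L) (tm H H' L L a (idm L)) (\<phi> H x L t)"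
  shows "bifam X A Z (\<lambda>H L x t. \<phi> H x L t)"
proof (rule bifamI)
  fix H L x x' y assume *: "H \<in> Vob" "L \<in> Vob" "x \<in> el X H" "x' \<in> el X H" "y \<in> el A L"
  have "\<phi> H (x \<oplus>\<^bsub>on_ob X H\<^esub> x') = nt_sum A (shl Z H) (\<phi> H x) (\<phi> H x')"
    by (rule genD[OF G, of "shl Z H"]) (use * gen_mem[OF G] in \<open>simp_all add: add \<phi> nt_sum_nt shl_LF\<close>)
  then show "\<phi> H (x \<oplus>\<^bsub>on_ob X H\<^esub> x') L y = \<phi> H x L y \<oplus>\<^bsub>on_ob Z (H \<star> L)\<^esub> \<phi> H x' L y"
    using * by simp
next
  fix H L c x y assume *: "H \<in> Vob" "L \<in> Vob" "c \<in> carrier (fld B)" "x \<in> el X H" "y \<in> el A L"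
  have "\<phi> H (c \<odot>\<^bsub>on_ob X H\<^esub> x) = nt_scale A (shl Z H) c (\<phi> H x)"
    by (rule genD[OF G, of "shl Z H"]) (use * gen_mem[OF G] in \<open>simp_all add: smult \<phi> nt_scale_nt shl_LF\<close>)
  then show "\<phi> H (c \<odot>\<^bsub>on_ob X H\<^esub> x) L y = c \<odot>\<^bsub>on_ob Z (H \<star> L)\<^esub> \<phi> H x L y"
    using * by simp
next
  fix H H' L L' a b x y assume [simp]: "H \<in> Vob" "H' \<in> Vob" "L \<in> Vob" "L' \<in> Vob" "a \<in> lin H H'" "b \<in> lin L L'" "x \<in> el X H" "y \<in> el A L"
  let ?p = "mknt A (\<lambda>L t. on_mor Z (H \<star> L) (H' \<star> L) (tm H H' L L a (idm L)) (\<phi> H x L t))"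
  have \<phi>c [simp]: "\<phi> H x V t \<in> el Z (H \<star> V)" if "V \<in> Vob" "t \<in> el A V" for V t
    using nt_closed[OF \<phi>[of H x], of V t] that by simp
  have p: "?p \<in> nt A (shl Z H')"
  proof (rule mknt_nt)
    fix V W f t assume [simp]: "V \<in> Vob" "W \<in> Vob" "f \<in> lin V W" "t \<in> el A V"
    have "cmp (H \<star> V) (tm H H' W W a (idm W)) (tm H H V W (idm H) f) = cmp (H \<star> V) (tm H' H' V W (idm H') f) (tm H H' V V a (idm V))"
      by (rule vt_ext[OF _ _ _ cmp_lin[of _ _ "H \<star> W" _ "H' \<star> W"] cmp_lin[of _ _ "H' \<star> V"]]) (simp_all add: tm_vb lin_closed[of f V W] lin_closed[of a H H'])
    then show "on_mor Z (H \<star> W) (H' \<star> W) (tm H H' W W a (idm W)) (\<phi> H x W (on_mor A V W f t)) =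
      on_mor (shl Z H') V W f (on_mor Z (H \<star> V) (H' \<star> V) (tm H H' V V a (idm V)) (\<phi> H x V t))"
      by (simp add: nt_natural[OF \<phi>] LF_cmp)
  qed (simp_all add: nt_add[OF \<phi>] nt_smult[OF \<phi>] lin_add[OF LF_mor] lin_smult[OF LF_mor])
  have "\<phi> H' (on_mor X H H' a x) = ?p"
    by (rule genD[OF G _ _ p]) (use gen_mem[OF G] in \<open>simp_all add: \<phi> nat\<close>)
  moreover have "cmp (H \<star> L) (tm H H' L' L' a (idm L')) (tm H H L L' (idm H) b) = tm H H' L L' a b"
    by (rule sym, rule tm_eqI[OF _ _ _ _ _ _ cmp_lin[of _ _ "H \<star> L'"]]) (simp_all add: tm_vb lin_closed[of b L L'])
  ultimately show "\<phi> H' (on_mor X H H' a x) L' (on_mor A L L' b y) = on_mor Z (H \<star> L) (H' \<star> L') (tm H H' L L' a b) (\<phi> H x L y)"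
    by (simp add: nt_natural[OF \<phi>] LF_cmp)
next
  fix H L x y assume "H \<in> Vob" "L \<in> Vob" "x \<in> el X H" "y \<in> el A L"
  then show "\<phi> H x L y \<in> el Z (H \<star> L)" using nt_closed[OF \<phi>[of H x], of L y] by simp
qed (simp_all add: nt_add[OF \<phi>] nt_smult[OF \<phi>])

section \<open>Existence of the structure maps and extensionality on iterated generators\<close>

lemma bifamI_tmor:
  assumes [simp]: "X \<in> \<O>" "Y \<in> \<O>" "X' \<in> \<O>" "Y' \<in> \<O>" and s: "\<sigma> \<in> nt X X'" and t: "\<tau> \<in> nt Y Y'"
  shows "bifam X Y (dob X' Y') (\<lambda>H L x y. u X' Y' H L (\<sigma> H x) (\<tau> L y))"
  by (rule bifamI) (simp_all add: nt_add[OF s] nt_smult[OF s] nt_add[OF t] nt_smult[OF t]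
      u_add_left u_add_right u_smult_left u_smult_right nt_natural[OF s] nt_natural[OF t] u_natural
      nt_closed[OF s] nt_closed[OF t])

lemma ex_tmor:
  assumes "X \<in> \<O>" "Y \<in> \<O>" "X' \<in> \<O>" "Y' \<in> \<O>" "\<sigma> \<in> nt X X'" "\<tau> \<in> nt Y Y'"
  shows "\<exists>\<theta>\<in>nt (dob X Y) (dob X' Y'). \<forall>H\<in>Vob. \<forall>L\<in>Vob. \<forall>x\<in>el X H. \<forall>y\<in>el Y L.
    \<theta> (H \<star> L) (u X Y H L x y) = u X' Y' H L (\<sigma> H x) (\<tau> L y)"
  by (rule u_lift[OF _ _ _ bifamI_tmor]) (use assms in simp_all)

text \<open>\<open>gen_left\<close>, applied to the generators of X \<otimes> Y, shows that the
  tensors (x \<otimes> y) \<otimes> z suffice. The next lemmas treat the other bracketings and the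
  cases involving the unit in the same way.\<close>

lemma ext_ll:
  assumes [simp]: "X \<in> \<O>" "Y \<in> \<O>" "Z \<in> \<O>" and T: "T \<in> \<T>"
    and "\<theta> \<in> nt (dob (dob X Y) Z) T" "\<theta>' \<in> nt (dob (dob X Y) Z) T"
    and eq: "\<And>H0 H1 L x y z. H0 \<in> Vob \<Longrightarrow> H1 \<in> Vob \<Longrightarrow> L \<in> Vob \<Longrightarrow> x \<in> el X H0 \<Longrightarrow> y \<in> el Y H1 \<Longrightarrow> z \<in> el Z L \<Longrightarrow>
      \<theta> ((H0 \<star> H1) \<star> L) (u (dob X Y) Z (H0 \<star> H1) L (u X Y H0 H1 x y) z) =
      \<theta>' ((H0 \<star> H1) \<star> L) (u (dob X Y) Z (H0 \<star> H1) L (u X Y H0 H1 x y) z)"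
  shows "\<theta> = \<theta>'"
  by (rule genD[OF gen_left[OF _ _ gen_dob] T assms(5,6)]) (use eq in \<open>auto simp: gleft_def gdob_def\<close>)

lemma ext_rr:
  assumes [simp]: "X \<in> \<O>" "Y \<in> \<O>" "Z \<in> \<O>" and T: "T \<in> \<T>"
    and "\<theta> \<in> nt (dob X (dob Y Z)) T" "\<theta>' \<in> nt (dob X (dob Y Z)) T"
    and eq: "\<And>H0 H1 L x y z. H0 \<in> Vob \<Longrightarrow> H1 \<in> Vob \<Longrightarrow> L \<in> Vob \<Longrightarrow> x \<in> el X H0 \<Longrightarrow> y \<in> el Y H1 \<Longrightarrow> z \<in> el Z L \<Longrightarrow>
      \<theta> (H0 \<star> H1 \<star> L) (u X (dob Y Z) H0 (H1 \<star> L) x (u Y Z H1 L y z)) =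
      \<theta>' (H0 \<star> H1 \<star> L) (u X (dob Y Z) H0 (H1 \<star> L) x (u Y Z H1 L y z))"
  shows "\<theta> = \<theta>'"
  by (rule genD[OF gen_right[OF _ _ gen_dob] T assms(5,6)]) (use eq in \<open>auto simp: gright_def gdob_def\<close>)

lemma ext_lll:
  assumes [simp]: "W \<in> \<O>" "X \<in> \<O>" "Y \<in> \<O>" "Z \<in> \<O>" and T: "T \<in> \<T>"
    and "\<theta> \<in> nt (dob (dob (dob W X) Y) Z) T" "\<theta>' \<in> nt (dob (dob (dob W X) Y) Z) T"
    and eq: "\<And>H0 H1 H2 L w x y z. H0 \<in> Vob \<Longrightarrow> H1 \<in> Vob \<Longrightarrow> H2 \<in> Vob \<Longrightarrow> L \<in> Vob \<Longrightarrow>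
      w \<in> el W H0 \<Longrightarrow> x \<in> el X H1 \<Longrightarrow> y \<in> el Y H2 \<Longrightarrow> z \<in> el Z L \<Longrightarrow>
      \<theta> (((H0 \<star> H1) \<star> H2) \<star> L) (u (dob (dob W X) Y) Z ((H0 \<star> H1) \<star> H2) L (u (dob W X) Y (H0 \<star> H1) H2 (u W X H0 H1 w x) y) z) =
      \<theta>' (((H0 \<star> H1) \<star> H2) \<star> L) (u (dob (dob W X) Y) Z ((H0 \<star> H1) \<star> H2) L (u (dob W X) Y (H0 \<star> H1) H2 (u W X H0 H1 w x) y) z)"
  shows "\<theta> = \<theta>'"
  by (rule genD[OF gen_left[OF _ _ gen_left[OF _ _ gen_dob]] T assms(6,7)]) (use eq in \<open>auto simp: gleft_def gdob_def\<close>)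

lemma ext_J_left:
  assumes "X \<in> \<O>" "T \<in> \<T>" "\<theta> \<in> nt (dob J X) T" "\<theta>' \<in> nt (dob J X) T"
    and "\<And>L x. L \<in> Vob \<Longrightarrow> x \<in> el X L \<Longrightarrow> \<theta> (kk \<star> L) (u J X kk L e x) = \<theta>' (kk \<star> L) (u J X kk L e x)"
  shows "\<theta> = \<theta>'"
  by (rule genD[OF gen_left[OF _ _ gen_J] assms(2-4)]) (use assms in \<open>auto simp: gleft_def\<close>)

lemma ext_J_right:
  assumes "X \<in> \<O>" "T \<in> \<T>" "\<theta> \<in> nt (dob X J) T" "\<theta>' \<in> nt (dob X J) T"
    and "\<And>L x. L \<in> Vob \<Longrightarrow> x \<in> el X L \<Longrightarrow> \<theta> (L \<star> kk) (u X J L kk x e) = \<theta>' (L \<star> kk) (u X J L kk x e)"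
  shows "\<theta> = \<theta>'"
  by (rule genD[OF gen_right[OF _ _ gen_J] assms(2-4)]) (use assms in \<open>auto simp: gright_def\<close>)

lemma ext_J_mid:
  assumes "X \<in> \<O>" "Y \<in> \<O>" "T \<in> \<T>" "\<theta> \<in> nt (dob (dob X J) Y) T" "\<theta>' \<in> nt (dob (dob X J) Y) T"
    and "\<And>H L x y. H \<in> Vob \<Longrightarrow> L \<in> Vob \<Longrightarrow> x \<in> el X H \<Longrightarrow> y \<in> el Y L \<Longrightarrow>
      \<theta> ((H \<star> kk) \<star> L) (u (dob X J) Y (H \<star> kk) L (u X J H kk x e) y) =
      \<theta>' ((H \<star> kk) \<star> L) (u (dob X J) Y (H \<star> kk) L (u X J H kk x e) y)"
  shows "\<theta> = \<theta>'"
  by (rule genD[OF gen_left[OF _ _ gen_right[OF _ _ gen_J]] assms(3-5)]) (use assms in \<open>auto simp: gleft_def gright_def\<close>)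

text \<open>For each z the bifamily \<gamma>(-, -, z) lifts to a map from X \<otimes> Y to W(-
  \<otimes> L). These lifts form a bifamily in (t, z), which is lifted once more.\<close>

lemma ex_tri_left:
  assumes [simp]: "X \<in> \<O>" "Y \<in> \<O>" "Z \<in> \<O>" and W [simp]: "W \<in> \<T>"
    and b: "\<And>L z. L \<in> Vob \<Longrightarrow> z \<in> el Z L \<Longrightarrow> bifam X Y (shr W L) (\<lambda>H0 H1 x y. \<gamma> H0 H1 L x y z)"
    and add: "\<And>H0 H1 L x y z z'. H0 \<in> Vob \<Longrightarrow> H1 \<in> Vob \<Longrightarrow> L \<in> Vob \<Longrightarrow> x \<in> el X H0 \<Longrightarrow> y \<in> el Y H1 \<Longrightarrow> z \<in> el Z L \<Longrightarrow> z' \<in> el Z L \<Longrightarrow>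
      \<gamma> H0 H1 L x y (z \<oplus>\<^bsub>on_ob Z L\<^esub> z') = \<gamma> H0 H1 L x y z \<oplus>\<^bsub>on_ob W ((H0 \<star> H1) \<star> L)\<^esub> \<gamma> H0 H1 L x y z'"
    and smult: "\<And>H0 H1 L x y z c. H0 \<in> Vob \<Longrightarrow> H1 \<in> Vob \<Longrightarrow> L \<in> Vob \<Longrightarrow> x \<in> el X H0 \<Longrightarrow> y \<in> el Y H1 \<Longrightarrow> z \<in> el Z L \<Longrightarrow> c \<in> carrier (fld B) \<Longrightarrow>
      \<gamma> H0 H1 L x y (c \<odot>\<^bsub>on_ob Z L\<^esub> z) = c \<odot>\<^bsub>on_ob W ((H0 \<star> H1) \<star> L)\<^esub> \<gamma> H0 H1 L x y z"
    and nat: "\<And>H0 H1 L L' f x y z. H0 \<in> Vob \<Longrightarrow> H1 \<in> Vob \<Longrightarrow> L \<in> Vob \<Longrightarrow> L' \<in> Vob \<Longrightarrow> f \<in> lin L L' \<Longrightarrow> x \<in> el X H0 \<Longrightarrow> y \<in> el Y H1 \<Longrightarrow> z \<in> el Z L \<Longrightarrow>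
      \<gamma> H0 H1 L' x y (on_mor Z L L' f z) = on_mor W ((H0 \<star> H1) \<star> L) ((H0 \<star> H1) \<star> L') (tm (H0 \<star> H1) (H0 \<star> H1) L L' (idm (H0 \<star> H1)) f) (\<gamma> H0 H1 L x y z)"
  shows "\<exists>\<theta>\<in>nt (dob (dob X Y) Z) W. \<forall>H0\<in>Vob. \<forall>H1\<in>Vob. \<forall>L\<in>Vob. \<forall>x\<in>el X H0. \<forall>y\<in>el Y H1. \<forall>z\<in>el Z L.
    \<theta> ((H0 \<star> H1) \<star> L) (u (dob X Y) Z (H0 \<star> H1) L (u X Y H0 H1 x y) z) = \<gamma> H0 H1 L x y z"
proof -
  define P where "P L z \<theta> \<longleftrightarrow> \<theta> \<in> nt (dob X Y) (shr W L) \<and> (\<forall>H0\<in>Vob. \<forall>H1\<in>Vob. \<forall>x\<in>el X H0. \<forall>y\<in>el Y H1.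
    \<theta> (H0 \<star> H1) (u X Y H0 H1 x y) = \<gamma> H0 H1 L x y z)" for L z \<theta>
  \<comment> \<open>The lifts are chosen independently for different z; that they depend linearly
    and naturally on z is forced by their values on generators.\<close>
  define \<phi> where "\<phi> L z = (SOME \<theta>. P L z \<theta>)" for L z
  have P: "P L z (\<phi> L z)" if "L \<in> Vob" "z \<in> el Z L" for L z
  proof -
    have "\<exists>\<theta>. P L z \<theta>" unfolding P_def using u_lift[OF _ _ _ b[OF that]] that by auto
    then show ?thesis unfolding \<phi>_def by (rule someI_ex)
  qed
  then have nt\<phi>: "\<phi> L z \<in> nt (dob X Y) (shr W L)" if "L \<in> Vob" "z \<in> el Z L" for L z
    using that unfolding P_def by blast
  have u\<phi> [simp]: "\<phi> L z (H0 \<star> H1) (u X Y H0 H1 x y) = \<gamma> H0 H1 L x y z"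
    if "L \<in> Vob" "z \<in> el Z L" "H0 \<in> Vob" "H1 \<in> Vob" "x \<in> el X H0" "y \<in> el Y H1" for L z H0 H1 x y
    using P that unfolding P_def by blast
  have "bifam (dob X Y) Z W (\<lambda>H L t z. \<phi> L z H t)"
    by (rule bifam_param_left[OF _ _ _ gen_dob[of X Y] nt\<phi>]) (auto simp: gdob_def add smult nat)
  from u_lift[OF _ _ _ this] obtain \<theta> where \<theta>: "\<theta> \<in> nt (dob (dob X Y) Z) W" and
    *: "\<forall>H\<in>Vob. \<forall>L\<in>Vob. \<forall>x\<in>el (dob X Y) H. \<forall>y\<in>el Z L. \<theta> (H \<star> L) (u (dob X Y) Z H L x y) = \<phi> L y H x"
    by auto
  show ?thesis by (rule bexI[OF _ \<theta>]) (simp add: *)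
qed

lemma ex_tri_right:
  assumes [simp]: "X \<in> \<O>" "Y \<in> \<O>" "Z \<in> \<O>" and W [simp]: "W \<in> \<T>"
    and b: "\<And>H0 x. H0 \<in> Vob \<Longrightarrow> x \<in> el X H0 \<Longrightarrow> bifam Y Z (shl W H0) (\<lambda>H1 L y z. \<gamma> H0 H1 L x y z)"
    and add: "\<And>H0 H1 L x x' y z. H0 \<in> Vob \<Longrightarrow> H1 \<in> Vob \<Longrightarrow> L \<in> Vob \<Longrightarrow> x \<in> el X H0 \<Longrightarrow> x' \<in> el X H0 \<Longrightarrow> y \<in> el Y H1 \<Longrightarrow> z \<in> el Z L \<Longrightarrow>
      \<gamma> H0 H1 L (x \<oplus>\<^bsub>on_ob X H0\<^esub> x') y z = \<gamma> H0 H1 L x y z \<oplus>\<^bsub>on_ob W (H0 \<star> H1 \<star> L)\<^esub> \<gamma> H0 H1 L x' y z"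
    and smult: "\<And>H0 H1 L x y z c. H0 \<in> Vob \<Longrightarrow> H1 \<in> Vob \<Longrightarrow> L \<in> Vob \<Longrightarrow> x \<in> el X H0 \<Longrightarrow> y \<in> el Y H1 \<Longrightarrow> z \<in> el Z L \<Longrightarrow> c \<in> carrier (fld B) \<Longrightarrow>
      \<gamma> H0 H1 L (c \<odot>\<^bsub>on_ob X H0\<^esub> x) y z = c \<odot>\<^bsub>on_ob W (H0 \<star> H1 \<star> L)\<^esub> \<gamma> H0 H1 L x y z"
    and nat: "\<And>H0 H0' H1 L f x y z. H0 \<in> Vob \<Longrightarrow> H0' \<in> Vob \<Longrightarrow> H1 \<in> Vob \<Longrightarrow> L \<in> Vob \<Longrightarrow> f \<in> lin H0 H0' \<Longrightarrow> x \<in> el X H0 \<Longrightarrow> y \<in> el Y H1 \<Longrightarrow> z \<in> el Z L \<Longrightarrow>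
      \<gamma> H0' H1 L (on_mor X H0 H0' f x) y z = on_mor W (H0 \<star> H1 \<star> L) (H0' \<star> H1 \<star> L) (tm H0 H0' (H1 \<star> L) (H1 \<star> L) f (idm (H1 \<star> L))) (\<gamma> H0 H1 L x y z)"
  shows "\<exists>\<theta>\<in>nt (dob X (dob Y Z)) W. \<forall>H0\<in>Vob. \<forall>H1\<in>Vob. \<forall>L\<in>Vob. \<forall>x\<in>el X H0. \<forall>y\<in>el Y H1. \<forall>z\<in>el Z L.
    \<theta> (H0 \<star> H1 \<star> L) (u X (dob Y Z) H0 (H1 \<star> L) x (u Y Z H1 L y z)) = \<gamma> H0 H1 L x y z"
proof -
  define P where "P H0 x \<theta> \<longleftrightarrow> \<theta> \<in> nt (dob Y Z) (shl W H0) \<and> (\<forall>H1\<in>Vob. \<forall>L\<in>Vob. \<forall>y\<in>el Y H1. \<forall>z\<in>el Z L.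
    \<theta> (H1 \<star> L) (u Y Z H1 L y z) = \<gamma> H0 H1 L x y z)" for H0 x \<theta>
  define \<phi> where "\<phi> H0 x = (SOME \<theta>. P H0 x \<theta>)" for H0 x
  have P: "P H0 x (\<phi> H0 x)" if "H0 \<in> Vob" "x \<in> el X H0" for H0 x
  proof -
    have "\<exists>\<theta>. P H0 x \<theta>" unfolding P_def using u_lift[OF _ _ _ b[OF that]] that by auto
    then show ?thesis unfolding \<phi>_def by (rule someI_ex)
  qed
  then have nt\<phi>: "\<phi> H0 x \<in> nt (dob Y Z) (shl W H0)" if "H0 \<in> Vob" "x \<in> el X H0" for H0 x
    using that unfolding P_def by blast
  have u\<phi> [simp]: "\<phi> H0 x (H1 \<star> L) (u Y Z H1 L y z) = \<gamma> H0 H1 L x y z"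
    if "H0 \<in> Vob" "x \<in> el X H0" "H1 \<in> Vob" "L \<in> Vob" "y \<in> el Y H1" "z \<in> el Z L" for L z H0 H1 x y
    using P that unfolding P_def by blast
  have "bifam X (dob Y Z) W (\<lambda>H L x t. \<phi> H x L t)"
    by (rule bifam_param_right[OF _ _ _ gen_dob[of Y Z] nt\<phi>]) (auto simp: gdob_def add smult nat)
  from u_lift[OF _ _ _ this] obtain \<theta> where \<theta>: "\<theta> \<in> nt (dob X (dob Y Z)) W" and
    *: "\<forall>H\<in>Vob. \<forall>L\<in>Vob. \<forall>x\<in>el X H. \<forall>y\<in>el (dob Y Z) L. \<theta> (H \<star> L) (u X (dob Y Z) H L x y) = \<phi> H x L y"
    by auto
  show ?thesis by (rule bexI[OF _ \<theta>]) (simp add: *)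
qed

text \<open>Naturality of \<open>vai\<close> in the shape in which it occurs below, after a functor
  F has been applied.\<close>

lemma vai_apply_natural:
  assumes "U \<in> Vob" "V \<in> Vob" "W \<in> Vob" "U' \<in> Vob" "V' \<in> Vob" "W' \<in> Vob"
    "f \<in> lin U U'" "g \<in> lin V V'" "h \<in> lin W W'" "F \<in> LF" "t \<in> el F (U \<star> V \<star> W)"
  shows "on_mor F (U' \<star> V' \<star> W') ((U' \<star> V') \<star> W') (vai U' V' W')
      (on_mor F (U \<star> V \<star> W) (U' \<star> V' \<star> W') (tm U U' (V \<star> W) (V' \<star> W') f (tm V V' W W' g h)) t) =
    on_mor F ((U \<star> V) \<star> W) ((U' \<star> V') \<star> W') (tm (U \<star> V) (U' \<star> V') W W' (tm U U' V V' f g) h)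
      (on_mor F (U \<star> V \<star> W) ((U \<star> V) \<star> W) (vai U V W) t)"
  using assms by (simp add: LF_cmp vai_natural)

lemma va_apply_natural:
  assumes "U \<in> Vob" "V \<in> Vob" "W \<in> Vob" "U' \<in> Vob" "V' \<in> Vob" "W' \<in> Vob"
    "f \<in> lin U U'" "g \<in> lin V V'" "h \<in> lin W W'" "F \<in> LF" "t \<in> el F ((U \<star> V) \<star> W)"
  shows "on_mor F ((U' \<star> V') \<star> W') (U' \<star> V' \<star> W') (va U' V' W')
      (on_mor F ((U \<star> V) \<star> W) ((U' \<star> V') \<star> W') (tm (U \<star> V) (U' \<star> V') W W' (tm U U' V V' f g) h) t) =
    on_mor F (U \<star> V \<star> W) (U' \<star> V' \<star> W') (tm U U' (V \<star> W) (V' \<star> W') f (tm V V' W W' g h))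
      (on_mor F ((U \<star> V) \<star> W) (U \<star> V \<star> W) (va U V W) t)"
  using assms by (simp add: LF_cmp va_natural)

text \<open>x \<otimes> (y \<otimes> z) lives over H0 \<otimes> (H1 \<otimes> L), but a value over
  (H0 \<otimes> H1) \<otimes> L is wanted, so it is transported along \<open>vai\<close>. Naturality
  of \<open>vai\<close> makes the assignment a legitimate input for
  \<open>ex_tri_left\<close>.\<close>

lemma ex_asc:
  assumes [simp]: "X \<in> \<O>" "Y \<in> \<O>" "Z \<in> \<O>"
  shows "\<exists>\<theta>\<in>nt (dob (dob X Y) Z) (dob X (dob Y Z)).
    \<forall>H0\<in>Vob. \<forall>H1\<in>Vob. \<forall>L\<in>Vob. \<forall>x\<in>el X H0. \<forall>y\<in>el Y H1. \<forall>z\<in>el Z L.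
    \<theta> ((H0 \<star> H1) \<star> L) (u (dob X Y) Z (H0 \<star> H1) L (u X Y H0 H1 x y) z) =
    on_mor (dob X (dob Y Z)) (H0 \<star> H1 \<star> L) ((H0 \<star> H1) \<star> L) (vai H0 H1 L) (u X (dob Y Z) H0 (H1 \<star> L) x (u Y Z H1 L y z))"
proof (rule ex_tri_left)
  let ?T = "dob X (dob Y Z)"
  let ?g = "\<lambda>H0 H1 L x y z. on_mor ?T (H0 \<star> H1 \<star> L) ((H0 \<star> H1) \<star> L) (vai H0 H1 L) (u X (dob Y Z) H0 (H1 \<star> L) x (u Y Z H1 L y z))"
  show "bifam X Y (shr ?T L) (\<lambda>H0 H1 x y. ?g H0 H1 L x y z)" if [simp]: "L \<in> Vob" "z \<in> el Z L" for L z
  proof (rule bifamI)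
    fix H H' La L' a b x y assume [simp]: "H \<in> Vob" "H' \<in> Vob" "La \<in> Vob" "L' \<in> Vob" "a \<in> lin H H'" "b \<in> lin La L'" "x \<in> el X H" "y \<in> el Y La"
    show "?g H' L' L (on_mor X H H' a x) (on_mor Y La L' b y) z = on_mor (shr ?T L) (H \<star> La) (H' \<star> L') (tm H H' La L' a b) (?g H La L x y z)"
      by (simp add: u_natural_left[of Y Z] u_natural[of X "dob Y Z"] vai_apply_natural)
  qed (simp_all add: u_add_left u_add_right u_smult_left u_smult_right lin_add[OF LF_mor] lin_smult[OF LF_mor])
  fix H0 H1 L L' f x y z assume [simp]: "H0 \<in> Vob" "H1 \<in> Vob" "L \<in> Vob" "L' \<in> Vob" "f \<in> lin L L'" "x \<in> el X H0" "y \<in> el Y H1" "z \<in> el Z L"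
  show "?g H0 H1 L' x y (on_mor Z L L' f z) = on_mor ?T ((H0 \<star> H1) \<star> L) ((H0 \<star> H1) \<star> L') (tm (H0 \<star> H1) (H0 \<star> H1) L L' (idm (H0 \<star> H1)) f) (?g H0 H1 L x y z)"
    using vai_apply_natural[of H0 H1 L H0 H1 L' "idm H0" "idm H1" f ?T]
    by (simp add: u_natural_right[of Y Z] u_natural_right[of X "dob Y Z"])
qed (simp_all add: u_add_left u_add_right u_smult_left u_smult_right lin_add[OF LF_mor] lin_smult[OF LF_mor])

lemma ex_asc_inv:
  assumes [simp]: "X \<in> \<O>" "Y \<in> \<O>" "Z \<in> \<O>"
  shows "\<exists>\<theta>\<in>nt (dob X (dob Y Z)) (dob (dob X Y) Z).
    \<forall>H0\<in>Vob. \<forall>H1\<in>Vob. \<forall>L\<in>Vob. \<forall>x\<in>el X H0. \<forall>y\<in>el Y H1. \<forall>z\<in>el Z L.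
    \<theta> (H0 \<star> H1 \<star> L) (u X (dob Y Z) H0 (H1 \<star> L) x (u Y Z H1 L y z)) =
    on_mor (dob (dob X Y) Z) ((H0 \<star> H1) \<star> L) (H0 \<star> H1 \<star> L) (va H0 H1 L) (u (dob X Y) Z (H0 \<star> H1) L (u X Y H0 H1 x y) z)"
proof (rule ex_tri_right)
  let ?T = "dob (dob X Y) Z"
  let ?g = "\<lambda>H0 H1 L x y z. on_mor ?T ((H0 \<star> H1) \<star> L) (H0 \<star> H1 \<star> L) (va H0 H1 L) (u (dob X Y) Z (H0 \<star> H1) L (u X Y H0 H1 x y) z)"
  show "bifam Y Z (shl ?T H0) (\<lambda>H1 L y z. ?g H0 H1 L x y z)" if [simp]: "H0 \<in> Vob" "x \<in> el X H0" for H0 x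
  proof (rule bifamI)
    fix H H' L L' a b y z assume [simp]: "H \<in> Vob" "H' \<in> Vob" "L \<in> Vob" "L' \<in> Vob" "a \<in> lin H H'" "b \<in> lin L L'" "y \<in> el Y H" "z \<in> el Z L"
    show "?g H0 H' L' x (on_mor Y H H' a y) (on_mor Z L L' b z) = on_mor (shl ?T H0) (H \<star> L) (H' \<star> L') (tm H H' L L' a b) (?g H0 H L x y z)"
      by (simp add: u_natural_right[of X Y] u_natural[of "dob X Y" Z] va_apply_natural)
  qed (simp_all add: u_add_left u_add_right u_smult_left u_smult_right lin_add[OF LF_mor] lin_smult[OF LF_mor])
  fix H0 H0' H1 L f x y z assume [simp]: "H0 \<in> Vob" "H0' \<in> Vob" "H1 \<in> Vob" "L \<in> Vob" "f \<in> lin H0 H0'" "x \<in> el X H0" "y \<in> el Y H1" "z \<in> el Z L"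
  show "?g H0' H1 L (on_mor X H0 H0' f x) y z = on_mor ?T (H0 \<star> H1 \<star> L) (H0' \<star> H1 \<star> L) (tm H0 H0' (H1 \<star> L) (H1 \<star> L) f (idm (H1 \<star> L))) (?g H0 H1 L x y z)"
    using va_apply_natural[of H0 H1 L H0' H1 L f "idm H1" "idm L" ?T]
    by (simp add: u_natural_left[of X Y] u_natural_left[of "dob X Y" Z])
qed (simp_all add: u_add_left u_add_right u_smult_left u_smult_right lin_add[OF LF_mor] lin_smult[OF LF_mor])

text \<open>Maps out of J into targets in \<open>\<T>\<close> correspond to elements over k. So each
  x yields a map from J to X(- \<otimes> L) that sends e to x transported along v \<mapsto> 1
  \<otimes> v, and these maps form a bifamily.\<close>

lemma ex_lun:
  assumes [simp]: "X \<in> \<O>"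
  shows "\<exists>\<theta>\<in>nt (dob J X) X. \<forall>L\<in>Vob. \<forall>x\<in>el X L. \<theta> (kk \<star> L) (u J X kk L e x) = on_mor X L (kk \<star> L) (vlu L) x"
proof -
  define \<phi> where "\<phi> L x = (SOME \<theta>. \<theta> \<in> nt J (shr X L) \<and> \<theta> kk e = on_mor X L (kk \<star> L) (vlu L) x)" for L x
  have \<phi>: "\<phi> L x \<in> nt J (shr X L) \<and> \<phi> L x kk e = on_mor X L (kk \<star> L) (vlu L) x" if "L \<in> Vob" "x \<in> el X L" for L x
  proof -
    have "\<exists>\<theta>. \<theta> \<in> nt J (shr X L) \<and> \<theta> kk e = on_mor X L (kk \<star> L) (vlu L) x"
      using J_lift[of "shr X L" "on_mor X L (kk \<star> L) (vlu L) x"] that by auto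
    then show ?thesis unfolding \<phi>_def by (rule someI_ex)
  qed
  have "bifam J X X (\<lambda>H L t x. \<phi> L x H t)"
  proof (rule bifam_param_left[OF _ _ _ gen_J])
    fix H t L L' b y assume *: "(H, t) \<in> {(kk, e)}" "L \<in> Vob" "L' \<in> Vob" "b \<in> lin L L'" "y \<in> el X L"
    then show "\<phi> L' (on_mor X L L' b y) H t = on_mor X (H \<star> L) (H \<star> L') (tm H H L L' (idm H) b) (\<phi> L y H t)"
      by (simp add: \<phi> LF_cmp vlu_natural)
  qed (use \<phi> in \<open>auto simp: lin_add[OF LF_mor] lin_smult[OF LF_mor]\<close>)
  from u_lift[OF _ _ _ this] obtain \<theta> where \<theta>: "\<theta> \<in> nt (dob J X) X" and
    *: "\<forall>H\<in>Vob. \<forall>L\<in>Vob. \<forall>t\<in>el J H. \<forall>x\<in>el X L. \<theta> (H \<star> L) (u J X H L t x) = \<phi> L x H t" by auto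
  show ?thesis by (rule bexI[OF _ \<theta>]) (simp add: * \<phi>)
qed

lemma ex_run:
  assumes [simp]: "X \<in> \<O>"
  shows "\<exists>\<theta>\<in>nt (dob X J) X. \<forall>L\<in>Vob. \<forall>x\<in>el X L. \<theta> (L \<star> kk) (u X J L kk x e) = on_mor X L (L \<star> kk) (vru L) x"
proof -
  define \<phi> where "\<phi> L x = (SOME \<theta>. \<theta> \<in> nt J (shl X L) \<and> \<theta> kk e = on_mor X L (L \<star> kk) (vru L) x)" for L x
  have \<phi>: "\<phi> L x \<in> nt J (shl X L) \<and> \<phi> L x kk e = on_mor X L (L \<star> kk) (vru L) x" if "L \<in> Vob" "x \<in> el X L" for L x
  proof -
    have "\<exists>\<theta>. \<theta> \<in> nt J (shl X L) \<and> \<theta> kk e = on_mor X L (L \<star> kk) (vru L) x"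
      using J_lift[of "shl X L" "on_mor X L (L \<star> kk) (vru L) x"] that by auto
    then show ?thesis unfolding \<phi>_def by (rule someI_ex)
  qed
  have "bifam X J X (\<lambda>H L x t. \<phi> H x L t)"
  proof (rule bifam_param_right[OF _ _ _ gen_J])
    fix L t H H' a x assume *: "(L, t) \<in> {(kk, e)}" "H \<in> Vob" "H' \<in> Vob" "a \<in> lin H H'" "x \<in> el X H"
    then show "\<phi> H' (on_mor X H H' a x) L t = on_mor X (H \<star> L) (H' \<star> L) (tm H H' L L a (idm L)) (\<phi> H x L t)"
      by (simp add: \<phi> LF_cmp vru_natural)
  qed (use \<phi> in \<open>auto simp: lin_add[OF LF_mor] lin_smult[OF LF_mor]\<close>)
  from u_lift[OF _ _ _ this] obtain \<theta> where \<theta>: "\<theta> \<in> nt (dob X J) X" and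
    *: "\<forall>H\<in>Vob. \<forall>L\<in>Vob. \<forall>x\<in>el X H. \<forall>t\<in>el J L. \<theta> (H \<star> L) (u X J H L x t) = \<phi> H x L t" by auto
  show ?thesis by (rule bexI[OF _ \<theta>]) (simp add: * \<phi>)
qed

lemma hnt_nt: "X \<in> \<O> \<Longrightarrow> Z \<in> \<O> \<Longrightarrow> V \<in> Vob \<Longrightarrow> s \<in> el (hob X Z) V \<Longrightarrow> hnt X Z V s \<in> nt X (shr Z V)"
  using hnt_bij bij_betwE by blast

lemma hnt_closed [simp]: "X \<in> \<O> \<Longrightarrow> Z \<in> \<O> \<Longrightarrow> V \<in> Vob \<Longrightarrow> s \<in> el (hob X Z) V \<Longrightarrow> H \<in> Vob \<Longrightarrow> x \<in> el X H \<Longrightarrow>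
    hnt X Z V s H x \<in> el Z (H \<star> V)"
  using nt_closed[OF hnt_nt] by simp

lemma hnt_eqI:
  assumes "X \<in> \<O>" "Z \<in> \<O>" "V \<in> Vob" "s \<in> el (hob X Z) V" "t \<in> el (hob X Z) V"
    and "\<And>H x. H \<in> Vob \<Longrightarrow> x \<in> el X H \<Longrightarrow> hnt X Z V s H x = hnt X Z V t H x"
  shows "s = t"
proof -
  have "hnt X Z V s = hnt X Z V t"
    by (rule nt_eqI[OF hnt_nt hnt_nt]) (use assms in auto)
  then show ?thesis using hnt_bij[OF assms(1-3)] assms(4,5) by (meson bij_betw_def inj_on_eq_iff)
qed

text \<open>The assignment (x, s) \<mapsto> s(x) is already a bifamily: naturality in x is that of
  the transformation named by s, and naturality in s is part of the description of Hom.\<close>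

lemma ex_evl:
  assumes [simp]: "X \<in> \<O>" "Z \<in> \<O>"
  shows "\<exists>\<theta>\<in>nt (dob X (hob X Z)) Z. \<forall>H\<in>Vob. \<forall>L\<in>Vob. \<forall>x\<in>el X H. \<forall>s\<in>el (hob X Z) L.
    \<theta> (H \<star> L) (u X (hob X Z) H L x s) = hnt X Z L s H x"
proof (rule u_lift)
  show "bifam X (hob X Z) Z (\<lambda>H L x s. hnt X Z L s H x)"
  proof (rule bifamI)
    fix H H' L L' a b x s assume [simp]: "H \<in> Vob" "H' \<in> Vob" "L \<in> Vob" "L' \<in> Vob" "a \<in> lin H H'" "b \<in> lin L L'"
      "x \<in> el X H" "s \<in> el (hob X Z) L"
    have "cmp (H \<star> L) (tm H' H' L L' (idm H') b) (tm H H' L L a (idm L)) = tm H H' L L' a b"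
      by (rule sym, rule tm_eqI[OF _ _ _ _ _ _ cmp_lin[of _ _ "H' \<star> L"]]) (simp_all add: tm_vb lin_closed[of a H H'])
    then show "hnt X Z L' (on_mor (hob X Z) L L' b s) H' (on_mor X H H' a x) =
      on_mor Z (H \<star> L) (H' \<star> L') (tm H H' L L' a b) (hnt X Z L s H x)"
      using nt_natural[OF hnt_nt[of X Z L s], of H H' a x] by (simp add: hnt_natural LF_cmp)
  qed (simp_all add: hnt_add hnt_smult nt_add[OF hnt_nt] nt_smult[OF hnt_nt])
qed simp_all

end

text \<open>The structure enters only through its values on generators. Hence the laws below apply
  equally to the explicitly defined \<open>ind_clmon\<close> and to a structure on the Q-free
  objects that is obtained by choice.\<close>

locale day_mon = day B \<O> \<T> dob u J e hob hnt
  for B :: "'u vdata" and \<O> \<T> dob u J e hob hnt +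
  fixes M :: "('u vfun, 'u vnat) clmon"
  assumes M_simps [simp]: "tob M = dob" "unt M = J" "ihom M = hob"
    and tmor_nt [simp]: "\<lbrakk>X \<in> \<O>; X' \<in> \<O>; Y \<in> \<O>; Y' \<in> \<O>; \<sigma> \<in> nt X X'; \<tau> \<in> nt Y Y'\<rbrakk> \<Longrightarrow>
      tmor M X X' Y Y' \<sigma> \<tau> \<in> nt (dob X Y) (dob X' Y')"
    and tmor_u [simp]: "\<lbrakk>X \<in> \<O>; X' \<in> \<O>; Y \<in> \<O>; Y' \<in> \<O>; \<sigma> \<in> nt X X'; \<tau> \<in> nt Y Y';
        H \<in> Vob; L \<in> Vob; x \<in> el X H; y \<in> el Y L\<rbrakk> \<Longrightarrow>
      tmor M X X' Y Y' \<sigma> \<tau> (H \<star> L) (u X Y H L x y) = u X' Y' H L (\<sigma> H x) (\<tau> L y)"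
    and asc_nt [simp]: "\<lbrakk>X \<in> \<O>; Y \<in> \<O>; Z \<in> \<O>\<rbrakk> \<Longrightarrow> asc M X Y Z \<in> nt (dob (dob X Y) Z) (dob X (dob Y Z))"
    and asc_u [simp]: "\<lbrakk>X \<in> \<O>; Y \<in> \<O>; Z \<in> \<O>; H0 \<in> Vob; H1 \<in> Vob; L \<in> Vob;
        x \<in> el X H0; y \<in> el Y H1; z \<in> el Z L\<rbrakk> \<Longrightarrow>
      asc M X Y Z ((H0 \<star> H1) \<star> L) (u (dob X Y) Z (H0 \<star> H1) L (u X Y H0 H1 x y) z) =
      on_mor (dob X (dob Y Z)) (H0 \<star> H1 \<star> L) ((H0 \<star> H1) \<star> L) (vai H0 H1 L)
        (u X (dob Y Z) H0 (H1 \<star> L) x (u Y Z H1 L y z))"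
    and lun_nt [simp]: "X \<in> \<O> \<Longrightarrow> lun M X \<in> nt (dob J X) X"
    and lun_u [simp]: "\<lbrakk>X \<in> \<O>; L \<in> Vob; x \<in> el X L\<rbrakk> \<Longrightarrow>
      lun M X (kk \<star> L) (u J X kk L e x) = on_mor X L (kk \<star> L) (vlu L) x"
    and run_nt [simp]: "X \<in> \<O> \<Longrightarrow> run M X \<in> nt (dob X J) X"
    and run_u [simp]: "\<lbrakk>X \<in> \<O>; L \<in> Vob; x \<in> el X L\<rbrakk> \<Longrightarrow>
      run M X (L \<star> kk) (u X J L kk x e) = on_mor X L (L \<star> kk) (vru L) x"
    and evl_nt [simp]: "\<lbrakk>X \<in> \<O>; Z \<in> \<O>\<rbrakk> \<Longrightarrow> evl M X Z \<in> nt (dob X (hob X Z)) Z"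
    and evl_u [simp]: "\<lbrakk>X \<in> \<O>; Z \<in> \<O>; H \<in> Vob; L \<in> Vob; x \<in> el X H; s \<in> el (hob X Z) L\<rbrakk> \<Longrightarrow>
      evl M X Z (H \<star> L) (u X (hob X Z) H L x s) = hnt X Z L s H x"
begin

section \<open>Coherence laws and closedness\<close>

abbreviation CC where "CC \<equiv> subLF \<O>"

text \<open>The inverse is the lift from \<open>ex_asc_inv\<close>. On generators the two composites
  become transport along \<open>va\<close> and \<open>vai\<close> composed in either order.\<close>

lemma asc_isomorphism:
  assumes [simp]: "X \<in> \<O>" "Y \<in> \<O>" "Z \<in> \<O>"
  shows "is_isomorphism CC (dob (dob X Y) Z) (dob X (dob Y Z)) (asc M X Y Z)"
proof -
  obtain \<theta> where \<theta>: "\<theta> \<in> nt (dob X (dob Y Z)) (dob (dob X Y) Z)" and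
    \<theta>u: "\<And>H0 H1 L x y z. H0 \<in> Vob \<Longrightarrow> H1 \<in> Vob \<Longrightarrow> L \<in> Vob \<Longrightarrow> x \<in> el X H0 \<Longrightarrow> y \<in> el Y H1 \<Longrightarrow> z \<in> el Z L \<Longrightarrow>
    \<theta> (H0 \<star> H1 \<star> L) (u X (dob Y Z) H0 (H1 \<star> L) x (u Y Z H1 L y z)) =
    on_mor (dob (dob X Y) Z) ((H0 \<star> H1) \<star> L) (H0 \<star> H1 \<star> L) (va H0 H1 L) (u (dob X Y) Z (H0 \<star> H1) L (u X Y H0 H1 x y) z)"
    using ex_asc_inv[of X Y Z] by auto
  have "Comp (LinFun B) (dob (dob X Y) Z) \<theta> (asc M X Y Z) = Idn (LinFun B) (dob (dob X Y) Z)"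
    by (rule ext_ll[of X Y Z, OF _ _ _ _ Comp_nt[OF _ asc_nt \<theta>] Idn_nt])
      (simp_all add: nt_natural[OF \<theta>] \<theta>u LF_cmp vai_va)
  moreover have "Comp (LinFun B) (dob X (dob Y Z)) (asc M X Y Z) \<theta> = Idn (LinFun B) (dob X (dob Y Z))"
    by (rule ext_rr[of X Y Z, OF _ _ _ _ Comp_nt[OF _ \<theta> asc_nt] Idn_nt])
      (simp_all add: nt_natural[OF asc_nt] \<theta>u LF_cmp va_vai)
  ultimately show ?thesis using \<theta> by (auto simp: is_isomorphism_def)
qed

lemma lun_isomorphism:
  assumes [simp]: "X \<in> \<O>"
  shows "is_isomorphism CC (dob J X) X (lun M X)"
proof -
  \<comment> \<open>The inverse sends x to e \<otimes> x, transported back along k \<otimes> V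
    \<cong> V.\<close>
  let ?\<theta> = "mknt X (\<lambda>V x. on_mor (dob J X) (kk \<star> V) V (vlui V) (u J X kk V e x))"
  have \<theta>: "?\<theta> \<in> nt X (dob J X)"
  proof (rule mknt_nt)
    fix V W f x assume [simp]: "V \<in> Vob" "W \<in> Vob" "f \<in> lin V W" "x \<in> el X V"
    have "cmp (kk \<star> V) (vlui W) (tm kk kk V W (idm kk) f) = cmp (kk \<star> V) f (vlui V)"
      by (rule vt_ext[OF _ _ _ cmp_lin[of _ _ "kk \<star> W" _ W] cmp_lin[of _ _ V]])
        (simp_all add: tm_vb vlui_vb lin_closed[of f V W] lin_smult[of f V W])
    then show "on_mor (dob J X) (kk \<star> W) W (vlui W) (u J X kk W e (on_mor X V W f x)) =
        on_mor (dob J X) V W f (on_mor (dob J X) (kk \<star> V) V (vlui V) (u J X kk V e x))"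
      by (simp add: u_natural_right LF_cmp)
  qed (simp_all add: u_add_right u_smult_right lin_add[OF LF_mor] lin_smult[OF LF_mor])
  have "Comp (LinFun B) (dob J X) ?\<theta> (lun M X) = Idn (LinFun B) (dob J X)"
    by (rule ext_J_left[of X, OF _ _ Comp_nt[OF _ lun_nt \<theta>] Idn_nt])
      (simp_all add: u_natural_right LF_cmp vlui_tm_vlu)
  moreover have "Comp (LinFun B) X (lun M X) ?\<theta> = Idn (LinFun B) X"
    by (rule nt_eqI[OF Comp_nt[OF _ \<theta> lun_nt] Idn_nt])
      (simp_all add: nt_natural[OF lun_nt] LF_cmp vlui_vlu)
  ultimately show ?thesis using \<theta> by (auto simp: is_isomorphism_def)
qed

lemma run_isomorphism:
  assumes [simp]: "X \<in> \<O>"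
  shows "is_isomorphism CC (dob X J) X (run M X)"
proof -
  let ?\<theta> = "mknt X (\<lambda>V x. on_mor (dob X J) (V \<star> kk) V (vrui V) (u X J V kk x e))"
  have \<theta>: "?\<theta> \<in> nt X (dob X J)"
  proof (rule mknt_nt)
    fix V W f x assume [simp]: "V \<in> Vob" "W \<in> Vob" "f \<in> lin V W" "x \<in> el X V"
    have "cmp (V \<star> kk) (vrui W) (tm V W kk kk f (idm kk)) = cmp (V \<star> kk) f (vrui V)"
      by (rule vt_ext[OF _ _ _ cmp_lin[of _ _ "W \<star> kk" _ W] cmp_lin[of _ _ V]])
        (simp_all add: tm_vb vrui_vb lin_closed[of f V W] lin_smult[of f V W])
    then show "on_mor (dob X J) (W \<star> kk) W (vrui W) (u X J W kk (on_mor X V W f x) e) =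
        on_mor (dob X J) V W f (on_mor (dob X J) (V \<star> kk) V (vrui V) (u X J V kk x e))"
      by (simp add: u_natural_left LF_cmp)
  qed (simp_all add: u_add_left u_smult_left lin_add[OF LF_mor] lin_smult[OF LF_mor])
  have "Comp (LinFun B) (dob X J) ?\<theta> (run M X) = Idn (LinFun B) (dob X J)"
    by (rule ext_J_right[of X, OF _ _ Comp_nt[OF _ run_nt \<theta>] Idn_nt])
      (simp_all add: u_natural_left LF_cmp vrui_tm_vru)
  moreover have "Comp (LinFun B) X (run M X) ?\<theta> = Idn (LinFun B) X"
    by (rule nt_eqI[OF Comp_nt[OF _ \<theta> run_nt] Idn_nt])
      (simp_all add: nt_natural[OF run_nt] LF_cmp vrui_vru)
  ultimately show ?thesis using \<theta> by (auto simp: is_isomorphism_def)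
qed

lemma asc_naturality:
  assumes [simp]: "X \<in> \<O>" "X' \<in> \<O>" "Y \<in> \<O>" "Y' \<in> \<O>" "Z \<in> \<O>" "Z' \<in> \<O>"
    and f [simp]: "f \<in> nt X X'" and g [simp]: "g \<in> nt Y Y'" and h [simp]: "h \<in> nt Z Z'"
  shows "Comp (LinFun B) (dob (dob X Y) Z) (asc M X' Y' Z')
        (tmor M (dob X Y) (dob X' Y') Z Z' (tmor M X X' Y Y' f g) h) =
      Comp (LinFun B) (dob (dob X Y) Z)
        (tmor M X X' (dob Y Z) (dob Y' Z') f (tmor M Y Y' Z Z' g h)) (asc M X Y Z)" (is "?l = ?r")
proof -
  note [simp] = nt_closed[OF f] nt_closed[OF g] nt_closed[OF h]
  have l: "?l \<in> nt (dob (dob X Y) Z) (dob X' (dob Y' Z'))"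
    by (rule Comp_nt[of _ _ "dob (dob X' Y') Z'"]) simp_all
  have t: "tmor M X X' (dob Y Z) (dob Y' Z') f (tmor M Y Y' Z Z' g h) \<in> nt (dob X (dob Y Z)) (dob X' (dob Y' Z'))"
    by simp
  have r: "?r \<in> nt (dob (dob X Y) Z) (dob X' (dob Y' Z'))"
    by (rule Comp_nt[of _ _ "dob X (dob Y Z)"]) simp_all
  show ?thesis
    by (rule ext_ll[of X Y Z, OF _ _ _ _ l r]) (simp_all add: nt_natural[OF t])
qed

text \<open>On a generator ((w \<otimes> x) \<otimes> y) \<otimes> z both sides are the fully
  right-bracketed tensor, transported along two linear maps that agree by
  \<open>vassoc_pentagon\<close>.\<close>

lemma pentagon_law:
  assumes [simp]: "W \<in> \<O>" "X \<in> \<O>" "Y \<in> \<O>" "Z \<in> \<O>"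
  shows "Comp (LinFun B) (dob (dob (dob W X) Y) Z) (asc M W X (dob Y Z)) (asc M (dob W X) Y Z) =
      Comp (LinFun B) (dob (dob (dob W X) Y) Z)
        (tmor M W W (dob (dob X Y) Z) (dob X (dob Y Z)) (Idn (LinFun B) W) (asc M X Y Z))
        (Comp (LinFun B) (dob (dob (dob W X) Y) Z)
          (asc M W (dob X Y) Z)
          (tmor M (dob (dob W X) Y) (dob W (dob X Y)) Z Z (asc M W X Y) (Idn (LinFun B) Z)))" (is "?l = ?r")
proof -
  let ?A = "dob (dob (dob W X) Y) Z" and ?T = "dob W (dob X (dob Y Z))"
  have l: "?l \<in> nt ?A ?T"
    by (rule Comp_nt[of _ _ "dob (dob W X) (dob Y Z)"]) simp_all
  have t: "tmor M W W (dob (dob X Y) Z) (dob X (dob Y Z)) (Idn (LinFun B) W) (asc M X Y Z) \<in> nt (dob W (dob (dob X Y) Z)) ?T"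
    by simp
  have r: "?r \<in> nt ?A ?T"
    by (rule Comp_nt[of _ _ "dob W (dob (dob X Y) Z)", OF _ Comp_nt[of _ _ "dob (dob W (dob X Y)) Z"]]) simp_all
  show ?thesis
  proof (rule ext_lll[of W X Y Z, OF _ _ _ _ _ l r])
    fix H0 H1 H2 L w x y z
    assume [simp]: "H0 \<in> Vob" "H1 \<in> Vob" "H2 \<in> Vob" "L \<in> Vob" "w \<in> el W H0" "x \<in> el X H1" "y \<in> el Y H2" "z \<in> el Z L"
    let ?g = "u W (dob X (dob Y Z)) H0 (H1 \<star> H2 \<star> L) w (u X (dob Y Z) H1 (H2 \<star> L) x (u Y Z H2 L y z))"
    \<comment> \<open>The identity of linear maps, with composites nested in the way in which
      naturality produces the transports on the right-hand side.\<close>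
    have e: "cmp (H0 \<star> H1 \<star> H2 \<star> L) (vai (H0 \<star> H1) H2 L) (vai H0 H1 (H2 \<star> L)) =
      cmp (H0 \<star> H1 \<star> H2 \<star> L) (tm (H0 \<star> H1 \<star> H2) ((H0 \<star> H1) \<star> H2) L L (vai H0 H1 H2) (idm L))
        (cmp (H0 \<star> H1 \<star> H2 \<star> L) (vai H0 (H1 \<star> H2) L)
          (tm H0 H0 (H1 \<star> H2 \<star> L) ((H1 \<star> H2) \<star> L) (idm H0) (vai H1 H2 L)))"
      by (auto simp: compose_def vassoc_pentagon)
    have c: "cmp (H0 \<star> H1 \<star> H2 \<star> L) (vai H0 (H1 \<star> H2) L) (tm H0 H0 (H1 \<star> H2 \<star> L) ((H1 \<star> H2) \<star> L) (idm H0) (vai H1 H2 L))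
      \<in> lin (H0 \<star> H1 \<star> H2 \<star> L) ((H0 \<star> H1 \<star> H2) \<star> L)"
      by (rule cmp_lin[of _ _ "H0 \<star> (H1 \<star> H2) \<star> L"]) simp_all
    have "?l (((H0 \<star> H1) \<star> H2) \<star> L) (u (dob (dob W X) Y) Z ((H0 \<star> H1) \<star> H2) L (u (dob W X) Y (H0 \<star> H1) H2 (u W X H0 H1 w x) y) z) =
      on_mor ?T (H0 \<star> H1 \<star> H2 \<star> L) (((H0 \<star> H1) \<star> H2) \<star> L) (cmp (H0 \<star> H1 \<star> H2 \<star> L) (vai (H0 \<star> H1) H2 L) (vai H0 H1 (H2 \<star> L))) ?g"
      by (simp add: nt_natural[OF asc_nt] LF_cmp)
    also have "\<dots> = ?r (((H0 \<star> H1) \<star> H2) \<star> L) (u (dob (dob W X) Y) Z ((H0 \<star> H1) \<star> H2) L (u (dob W X) Y (H0 \<star> H1) H2 (u W X H0 H1 w x) y) z)"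
      unfolding e
      by (simp add: u_natural_left[of "dob W (dob X Y)" Z] u_natural_right[of W "dob X (dob Y Z)"]
          nt_natural[OF asc_nt] nt_natural[OF t]) (simp add: LF_cmp c)
    finally show "?l (((H0 \<star> H1) \<star> H2) \<star> L) (u (dob (dob W X) Y) Z ((H0 \<star> H1) \<star> H2) L (u (dob W X) Y (H0 \<star> H1) H2 (u W X H0 H1 w x) y) z) =
       ?r (((H0 \<star> H1) \<star> H2) \<star> L) (u (dob (dob W X) Y) Z ((H0 \<star> H1) \<star> H2) L (u (dob W X) Y (H0 \<star> H1) H2 (u W X H0 H1 w x) y) z)" .
  qed simp_all
qed

text \<open>The generators (x \<otimes> e) \<otimes> y suffice, and on them the law is
  \<open>vassoc_triangle\<close> seen through the functor X \<otimes> Y.\<close>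

lemma triangle_law:
  assumes [simp]: "X \<in> \<O>" "Y \<in> \<O>"
  shows "Comp (LinFun B) (dob (dob X J) Y)
      (tmor M X X (dob J Y) Y (Idn (LinFun B) X) (lun M Y)) (asc M X J Y) =
    tmor M (dob X J) X Y Y (run M X) (Idn (LinFun B) Y)"
proof -
  have t: "tmor M X X (dob J Y) Y (Idn (LinFun B) X) (lun M Y) \<in> nt (dob X (dob J Y)) (dob X Y)"
    by simp
  show ?thesis
    by (rule ext_J_mid[of X Y, OF _ _ _ Comp_nt[OF _ asc_nt t]])
      (simp_all add: nt_natural[OF t] u_natural_right u_natural_left LF_cmp vassoc_triangle)
qed

lemma monoidal_category_CC: "monoidal_category CC M"
proof (intro monoidal_category.intro monoidal_category_axioms.intro)
  show "category CC" by (rule category_subLF) auto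
  fix A A' A'' D D' D'' f f' g g'
  assume "A \<in> Obj CC" "A' \<in> Obj CC" "A'' \<in> Obj CC" "D \<in> Obj CC" "D' \<in> Obj CC" "D'' \<in> Obj CC"
    "f \<in> Hom CC A A'" "f' \<in> Hom CC A' A''" "g \<in> Hom CC D D'" "g' \<in> Hom CC D' D''"
  then have [simp]: "A \<in> \<O>" "A' \<in> \<O>" "A'' \<in> \<O>" "D \<in> \<O>" "D' \<in> \<O>" "D'' \<in> \<O>"
    and f [simp]: "f \<in> nt A A'" and f' [simp]: "f' \<in> nt A' A''" and g [simp]: "g \<in> nt D D'" and g' [simp]: "g' \<in> nt D' D''" by auto
  note [simp] = nt_closed[OF f] nt_closed[OF g] Comp_nt[OF _ f f'] Comp_nt[OF _ g g']
  have "tmor M A A'' D D'' (Comp (LinFun B) A f' f) (Comp (LinFun B) D g' g) =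
    Comp (LinFun B) (dob A D) (tmor M A' A'' D' D'' f' g') (tmor M A A' D D' f g)"
    by (rule u_ext[of A D, OF _ _ _ _ Comp_nt[of _ _ "dob A' D'" _ "dob A'' D''"]]) simp_all
  then show "tmor M A A'' D D'' (Comp CC A f' f) (Comp CC D g' g) =
    Comp CC (tob M A D) (tmor M A' A'' D' D'' f' g') (tmor M A A' D D' f g)" by simp
next
  fix A D assume "A \<in> Obj CC" "D \<in> Obj CC"
  then have [simp]: "A \<in> \<O>" "D \<in> \<O>" by simp_all
  have "tmor M A A D D (Idn (LinFun B) A) (Idn (LinFun B) D) = Idn (LinFun B) (dob A D)"
    by (rule u_ext[of A D "dob A D"]) simp_all
  then show "tmor M A A D D (Idn CC A) (Idn CC D) = Idn CC (tob M A D)" by simp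
next
  fix X X' f assume "X \<in> Obj CC" "X' \<in> Obj CC" "f \<in> Hom CC X X'"
  then have [simp]: "X \<in> \<O>" "X' \<in> \<O>" and f [simp]: "f \<in> nt X X'" by simp_all
  have "Comp (LinFun B) (dob J X) (lun M X') (tmor M J J X X' (Idn (LinFun B) J) f) = Comp (LinFun B) (dob J X) f (lun M X)"
    by (rule ext_J_left[OF _ _ Comp_nt[of _ _ "dob J X'" _ X'] Comp_nt[of _ _ X]]) (simp_all add: nt_natural[OF f] nt_closed[OF f])
  then show "Comp CC (tob M (unt M) X) (lun M X') (tmor M (unt M) (unt M) X X' (Idn CC (unt M)) f) =
    Comp CC (tob M (unt M) X) f (lun M X)" by simp
  have "Comp (LinFun B) (dob X J) (run M X') (tmor M X X' J J f (Idn (LinFun B) J)) = Comp (LinFun B) (dob X J) f (run M X)"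
    by (rule ext_J_right[OF _ _ Comp_nt[of _ _ "dob X' J" _ X'] Comp_nt[of _ _ X]]) (simp_all add: nt_natural[OF f] nt_closed[OF f])
  then show "Comp CC (tob M X (unt M)) (run M X') (tmor M X X' (unt M) (unt M) f (Idn CC (unt M))) =
    Comp CC (tob M X (unt M)) f (run M X)" by simp
qed (simp_all add: asc_isomorphism lun_isomorphism run_isomorphism asc_naturality pentagon_law triangle_law)

definition curry where
  "curry X Y Z g V y = mknt X (\<lambda>H x. g (H \<star> V) (u X Y H V x y))"

lemma curry_nt:
  assumes [simp]: "X \<in> \<O>" "Y \<in> \<O>" "Z \<in> \<O>" and g: "g \<in> nt (dob X Y) Z" and [simp]: "V \<in> Vob" "y \<in> el Y V"
  shows "curry X Y Z g V y \<in> nt X (shr Z V)"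
  unfolding curry_def
  by (rule mknt_nt) (simp_all add: nt_closed[OF g] u_add_left u_smult_left nt_add[OF g] nt_smult[OF g] u_natural_left nt_natural[OF g])

text \<open>\<open>k V y\<close> is the element that \<open>hnt\<close> sends to x \<mapsto> g(x
  \<otimes> y). Injectivity of \<open>hnt\<close> turns linearity and naturality of g into those of
  k.\<close>

lemma evl_universal_law:
  assumes [simp]: "X \<in> \<O>" "Y \<in> \<O>" "Z \<in> \<O>" and g: "g \<in> nt (dob X Y) Z"
  shows "\<exists>!h. h \<in> nt Y (hob X Z) \<and>
    Comp (LinFun B) (dob X Y) (evl M X Z) (tmor M X X Y (hob X Z) (Idn (LinFun B) X) h) = g"
proof -
  define k where "k V y = inv_into (el (hob X Z) V) (hnt X Z V) (curry X Y Z g V y)" for V y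
  have k: "k V y \<in> el (hob X Z) V" "hnt X Z V (k V y) = curry X Y Z g V y" if "V \<in> Vob" "y \<in> el Y V" for V y
  proof -
    have "curry X Y Z g V y \<in> hnt X Z V ` el (hob X Z) V"
      using hnt_bij[of X Z V] curry_nt[OF _ _ _ g] that by (simp add: bij_betw_def)
    then show "k V y \<in> el (hob X Z) V" "hnt X Z V (k V y) = curry X Y Z g V y"
      unfolding k_def by (rule inv_into_into, rule f_inv_into_f)
  qed
  have hk [simp]: "hnt X Z V (k V y) H x = g (H \<star> V) (u X Y H V x y)" if "V \<in> Vob" "y \<in> el Y V" "H \<in> Vob" "x \<in> el X H" for V y H x
    using that by (simp add: k curry_def)
  note [simp] = nt_closed[OF g]
  have h: "mknt Y k \<in> nt Y (hob X Z)"
  proof (rule mknt_nt)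
    fix V y y' assume [simp]: "V \<in> Vob" "y \<in> el Y V" "y' \<in> el Y V"
    show "k V (y \<oplus>\<^bsub>on_ob Y V\<^esub> y') = k V y \<oplus>\<^bsub>on_ob (hob X Z) V\<^esub> k V y'"
      by (rule hnt_eqI[of X Z V]) (simp_all add: k(1) hnt_add u_add_right nt_add[OF g])
  next
    fix V c y assume [simp]: "V \<in> Vob" "y \<in> el Y V" "c \<in> carrier (fld B)"
    show "k V (c \<odot>\<^bsub>on_ob Y V\<^esub> y) = c \<odot>\<^bsub>on_ob (hob X Z) V\<^esub> k V y"
      by (rule hnt_eqI[of X Z V]) (simp_all add: k(1) hnt_smult u_smult_right nt_smult[OF g])
  next
    fix V W f y assume [simp]: "V \<in> Vob" "W \<in> Vob" "f \<in> lin V W" "y \<in> el Y V"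
    show "k W (on_mor Y V W f y) = on_mor (hob X Z) V W f (k V y)"
      by (rule hnt_eqI[of X Z W]) (simp_all add: k(1) hnt_natural u_natural_right nt_natural[OF g])
  qed (simp_all add: k(1))
  \<comment> \<open>On generators, evaluation after id \<otimes> h only sees the transformation
    named by h(y), so injectivity of \<open>hnt\<close> also yields uniqueness of h.\<close>
  have eval: "Comp (LinFun B) (dob X Y) (evl M X Z) (tmor M X X Y (hob X Z) (Idn (LinFun B) X) h) (H \<star> V) (u X Y H V x y) = hnt X Z V (h V y) H x"
    if h: "h \<in> nt Y (hob X Z)" and [simp]: "H \<in> Vob" "V \<in> Vob" "x \<in> el X H" "y \<in> el Y V" for h H V x y
    using h by (simp add: nt_closed[OF h])
  show ?thesis
  proof (rule ex1I[of _ "mknt Y k"], intro conjI)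
    show "Comp (LinFun B) (dob X Y) (evl M X Z) (tmor M X X Y (hob X Z) (Idn (LinFun B) X) (mknt Y k)) = g"
    proof (rule u_ext[of X Y Z, OF _ _ _ _ g])
      show "Comp (LinFun B) (dob X Y) (evl M X Z) (tmor M X X Y (hob X Z) (Idn (LinFun B) X) (mknt Y k)) \<in> nt (dob X Y) Z"
        using h by (intro Comp_nt[of _ _ "dob X (hob X Z)"]) simp_all
    qed (simp_all only: eval[OF h], simp_all)
  next
    fix h' assume h': "h' \<in> nt Y (hob X Z) \<and> Comp (LinFun B) (dob X Y) (evl M X Z) (tmor M X X Y (hob X Z) (Idn (LinFun B) X) h') = g"
    then have hn: "h' \<in> nt Y (hob X Z)" by simp
    show "h' = mknt Y k"
    proof (rule nt_eqI[OF hn h])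
      fix V y assume [simp]: "V \<in> Vob" "y \<in> el Y V"
      show "h' V y = mknt Y k V y"
        by (rule hnt_eqI[of X Z V]) (use eval[OF hn] h' nt_closed[OF hn] in \<open>simp_all add: k(1)\<close>)
    qed
  qed (rule h)
qed

lemma closed_monoidal_category_CC: "closed_monoidal_category CC M"
proof (intro closed_monoidal_category.intro closed_monoidal_category_axioms.intro monoidal_category_CC)
  fix X Y Z g assume "X \<in> Obj CC" "Y \<in> Obj CC" "Z \<in> Obj CC" "g \<in> Hom CC (tob M X Y) Z"
  then show "\<exists>!h. h \<in> Hom CC Y (ihom M X Z) \<and>
      Comp CC (tob M X Y) (evl M X Z) (tmor M X X Y (ihom M X Z) (Idn CC X) h) = g"
    using evl_universal_law[of X Y Z g] by simp
qed simp_all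

end

context day
begin

text \<open>The existence lemmas prescribe each structure map by its values on generators; one map
  is chosen for every choice of objects.\<close>

lemma ex_day_mon: "\<exists>M. day_mon B \<O> \<T> dob u J e hob hnt M"
proof -
  define tm' where "tm' X X' Y Y' \<sigma> \<tau> = (SOME \<theta>. \<theta> \<in> nt (dob X Y) (dob X' Y') \<and> (\<forall>H\<in>Vob. \<forall>L\<in>Vob. \<forall>x\<in>el X H. \<forall>y\<in>el Y L.
    \<theta> (H \<star> L) (u X Y H L x y) = u X' Y' H L (\<sigma> H x) (\<tau> L y)))" for X X' Y Y' \<sigma> \<tau>
  define as where "as X Y Z = (SOME \<theta>. \<theta> \<in> nt (dob (dob X Y) Z) (dob X (dob Y Z)) \<and>
    (\<forall>H0\<in>Vob. \<forall>H1\<in>Vob. \<forall>L\<in>Vob. \<forall>x\<in>el X H0. \<forall>y\<in>el Y H1. \<forall>z\<in>el Z L.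
    \<theta> ((H0 \<star> H1) \<star> L) (u (dob X Y) Z (H0 \<star> H1) L (u X Y H0 H1 x y) z) =
    on_mor (dob X (dob Y Z)) (H0 \<star> H1 \<star> L) ((H0 \<star> H1) \<star> L) (vai H0 H1 L) (u X (dob Y Z) H0 (H1 \<star> L) x (u Y Z H1 L y z))))" for X Y Z
  define lu where "lu X = (SOME \<theta>. \<theta> \<in> nt (dob J X) X \<and> (\<forall>L\<in>Vob. \<forall>x\<in>el X L. \<theta> (kk \<star> L) (u J X kk L e x) = on_mor X L (kk \<star> L) (vlu L) x))" for X
  define ru where "ru X = (SOME \<theta>. \<theta> \<in> nt (dob X J) X \<and> (\<forall>L\<in>Vob. \<forall>x\<in>el X L. \<theta> (L \<star> kk) (u X J L kk x e) = on_mor X L (L \<star> kk) (vru L) x))" for X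
  define ev where "ev X Z = (SOME \<theta>. \<theta> \<in> nt (dob X (hob X Z)) Z \<and> (\<forall>H\<in>Vob. \<forall>L\<in>Vob. \<forall>x\<in>el X H. \<forall>s\<in>el (hob X Z) L.
    \<theta> (H \<star> L) (u X (hob X Z) H L x s) = hnt X Z L s H x))" for X Z
  note tm'_props = someI_ex[OF ex_tmor[unfolded Bex_def], folded tm'_def]
  note as_props = someI_ex[OF ex_asc[unfolded Bex_def], folded as_def]
  note lu_props = someI_ex[OF ex_lun[unfolded Bex_def], folded lu_def]
  note ru_props = someI_ex[OF ex_run[unfolded Bex_def], folded ru_def]
  note ev_props = someI_ex[OF ex_evl[unfolded Bex_def], folded ev_def]
  have "day_mon B \<O> \<T> dob u J e hob hnt \<lparr>tob = dob, tmor = tm', unt = J, asc = as, lun = lu, run = ru, ihom = hob, evl = ev\<rparr>"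
    by unfold_locales (simp_all add: tm'_props as_props lu_props ru_props ev_props)
  then show ?thesis by blast
qed

end

context vect_setting
begin

subsection \<open>Representable functors\<close>

abbreviation gr where "gr V \<equiv> graph (elts B) (carrier V)"
abbreviation ug where "ug V \<equiv> of_graph (elts B) (carrier V)"

lemma ug_gr: "V \<in> Vob \<Longrightarrow> f \<in> lin V W \<Longrightarrow> ug V (gr V f) = f"
  by (rule U.of_graph_graph[OF Vob_small lin_extensional])

lemma cmp_idm_left: "g \<in> lin V W \<Longrightarrow> cmp V (idm W) g = g"
  by (rule Id_compose) (auto simp: lin_extensional lin_closed)

lemma cmp_idm_right: "g \<in> lin V W \<Longrightarrow> cmp V g (idm V) = g"
  by (rule compose_Id) (auto simp: lin_extensional lin_closed)

text \<open>The space of linear maps with functions as elements. Its element type is not that of the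
  universe, so it only serves as the source from which \<open>module_image\<close> carries the laws
  over to \<open>hom_space\<close>.\<close>

definition linmod :: "'u vec \<Rightarrow> 'u vec \<Rightarrow> ('u, 'u vmap) module" where
  "linmod V W = \<lparr>carrier = lin V W, mult = undefined, one = undefined, zero = (\<lambda>x \<in> carrier V. \<zero>\<^bsub>W\<^esub>),
     add = map_add V W, smult = map_smult V W\<rparr>"

lemma module_linmod:
  assumes V [simp]: "V \<in> Vob" and W [simp]: "W \<in> Vob" shows "module (fld B) (linmod V W)"
proof -
  interpret module "fld B" W using W by (rule Vob_module)
  show ?thesis
    by (rule moduleI')
      (auto simp: linmod_def map_add_apply map_smult_apply lin_closed[of _ V W] a_ac
         smult_l_distr smult_r_distr smult_assoc1 intro!: lin_eqI[of _ V W] map_add_lin map_smult_lin)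
qed

lemma carrier_hom_space: "carrier (hom_space B V W) = gr V ` lin V W"
  by (simp add: hom_space_def Let_def)

lemma hom_space_add: "V \<in> Vob \<Longrightarrow> f \<in> lin V W \<Longrightarrow> g \<in> lin V W \<Longrightarrow>
    gr V f \<oplus>\<^bsub>hom_space B V W\<^esub> gr V g = gr V (map_add V W f g)"
  by (simp add: ug_gr[of V _ W] hom_space_def Let_def)

lemma hom_space_smult: "V \<in> Vob \<Longrightarrow> f \<in> lin V W \<Longrightarrow> c \<odot>\<^bsub>hom_space B V W\<^esub> gr V f = gr V (map_smult V W c f)"
  by (simp add: ug_gr[of V _ W] hom_space_def Let_def)

lemma hom_space_zero: "\<zero>\<^bsub>hom_space B V W\<^esub> = gr V (\<lambda>x \<in> carrier V. \<zero>\<^bsub>W\<^esub>)"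
  by (simp add: hom_space_def Let_def)

lemma hom_space_Vob:
  assumes [simp]: "V \<in> Vob" "W \<in> Vob" shows "hom_space B V W \<in> Vob"
proof -
  have "module (fld B) (hom_space B V W)"
    by (rule module_image[OF module_linmod[of V W], of "gr V"])
      (simp_all add: linmod_def carrier_hom_space hom_space_add hom_space_smult hom_space_zero)
  moreover have "gr V ` lin V W \<in> range (elts B)"
    by (rule U.small_subset[OF U.small_graphs[OF Vob_small Vob_small, of V W]]) (auto simp: linmaps_def)
  ultimately show ?thesis by (simp add: Vob_iff small_eq carrier_hom_space)
qed

lemma el_Yo: "el (Yo B V) W = gr V ` lin V W"
  by (simp add: Yo_def carrier_hom_space)

lemma gr_Yo [simp]: "f \<in> lin V W \<Longrightarrow> gr V f \<in> el (Yo B V) W"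
  by (simp add: el_Yo)

lemma Yo_mor [simp]: "V \<in> Vob \<Longrightarrow> g \<in> lin V W \<Longrightarrow> on_mor (Yo B V) W W' f (gr V g) = gr V (cmp V f g)"
  by (simp add: ug_gr[of V _ W] Yo_def carrier_hom_space)

lemma Yo_ob: "on_ob (Yo B V) W = hom_space B V W"
  by (simp add: Yo_def)

lemma Yo_LF [simp]:
  assumes V [simp]: "V \<in> Vob" shows "Yo B V \<in> LF"
proof (rule LF_I)
  fix W W' f assume [simp]: "W \<in> Vob" "W' \<in> Vob" and f: "f \<in> lin W W'"
  note [simp] = cmp_lin[OF V _ f]
  show "on_mor (Yo B V) W W' f \<in> lin (on_ob (Yo B V) W) (on_ob (Yo B V) W')"
  proof (rule linI)
    fix x y assume "x \<in> el (Yo B V) W" "y \<in> el (Yo B V) W"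
    then obtain g h where [simp]: "g \<in> lin V W" "h \<in> lin V W" "x = gr V g" "y = gr V h" by (auto simp: el_Yo)
    have "cmp V f (map_add V W g h) = map_add V W' (cmp V f g) (cmp V f h)"
      by (auto simp: map_add_def compose_def fun_eq_iff lin_add[OF f] lin_closed[of g V W] lin_closed[of h V W])
    then show "on_mor (Yo B V) W W' f (x \<oplus>\<^bsub>on_ob (Yo B V) W\<^esub> y) =
        on_mor (Yo B V) W W' f x \<oplus>\<^bsub>on_ob (Yo B V) W'\<^esub> on_mor (Yo B V) W W' f y"
      by (simp add: Yo_ob hom_space_add map_add_lin)
  next
    fix c x assume c [simp]: "c \<in> carrier (fld B)" and "x \<in> el (Yo B V) W"
    then obtain g where [simp]: "g \<in> lin V W" "x = gr V g" by (auto simp: el_Yo)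
    have "cmp V f (map_smult V W c g) = map_smult V W' c (cmp V f g)"
      by (auto simp: map_smult_def compose_def fun_eq_iff lin_smult[OF f] lin_closed[of g V W])
    then show "on_mor (Yo B V) W W' f (c \<odot>\<^bsub>on_ob (Yo B V) W\<^esub> x) = c \<odot>\<^bsub>on_ob (Yo B V) W'\<^esub> on_mor (Yo B V) W W' f x"
      by (simp add: Yo_ob hom_space_smult map_smult_lin)
  qed (auto simp: Yo_def carrier_hom_space ug_gr[of V _ W])
next
  fix W x assume "W \<in> Vob" "x \<in> el (Yo B V) W"
  then show "on_mor (Yo B V) W W (idm W) x = x"
    by (auto simp: el_Yo cmp_idm_left)
next
  fix U W W' f g x assume "U \<in> Vob" "W \<in> Vob" "W' \<in> Vob" and f: "f \<in> lin U W" and g: "g \<in> lin W W'" and "x \<in> el (Yo B V) U"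
  then obtain h where [simp]: "h \<in> lin V U" "x = gr V h" by (auto simp: el_Yo)
  have "cmp V (cmp U g f) h = cmp V g (cmp V f h)"
    by (auto simp: compose_def fun_eq_iff lin_closed[of h V U])
  then show "on_mor (Yo B V) U W' (cmp U g f) x = on_mor (Yo B V) W W' g (on_mor (Yo B V) U W f x)"
    by (simp add: cmp_lin[OF V _ f])
next
  fix W W' f g x assume [simp]: "W \<in> Vob" "W' \<in> Vob" and f: "f \<in> lin W W'" and g: "g \<in> lin W W'" and "x \<in> el (Yo B V) W"
  then obtain h where [simp]: "h \<in> lin V W" "x = gr V h" by (auto simp: el_Yo)
  have "cmp V (map_add W W' f g) h = map_add V W' (cmp V f h) (cmp V g h)"
    by (auto simp: map_add_def compose_def fun_eq_iff lin_closed[of h V W])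
  then show "on_mor (Yo B V) W W' (map_add W W' f g) x = on_mor (Yo B V) W W' f x \<oplus>\<^bsub>on_ob (Yo B V) W'\<^esub> on_mor (Yo B V) W W' g x"
    by (simp add: Yo_ob hom_space_add cmp_lin[OF V _ f] cmp_lin[OF V _ g])
next
  fix W W' c f x assume [simp]: "W \<in> Vob" "W' \<in> Vob" "c \<in> carrier (fld B)" and f: "f \<in> lin W W'" and "x \<in> el (Yo B V) W"
  then obtain h where [simp]: "h \<in> lin V W" "x = gr V h" by (auto simp: el_Yo)
  have "cmp V (map_smult W W' c f) h = map_smult V W' c (cmp V f h)"
    by (auto simp: map_smult_def compose_def fun_eq_iff lin_closed[of h V W])
  then show "on_mor (Yo B V) W W' (map_smult W W' c f) x = c \<odot>\<^bsub>on_ob (Yo B V) W'\<^esub> on_mor (Yo B V) W W' f x"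
    by (simp add: Yo_ob hom_space_smult cmp_lin[OF V _ f])
qed (simp add: Yo_ob hom_space_Vob)

lemma Yo_element: "V \<in> Vob \<Longrightarrow> g \<in> lin V W \<Longrightarrow> gr V g = on_mor (Yo B V) V W g (gr V (idm V))"
  by (simp add: cmp_idm_right)

text \<open>The transformation that the Yoneda lemma attaches to the element x; arguments are codes
  of linear maps and have to be decoded by \<open>ug\<close>.\<close>

definition yon :: "'u vfun \<Rightarrow> 'u vec \<Rightarrow> 'u \<Rightarrow> 'u vnat" where
  "yon X V x = mknt (Yo B V) (\<lambda>W g. on_mor X V W (ug V g) x)"

lemma yon_apply: "V \<in> Vob \<Longrightarrow> W \<in> Vob \<Longrightarrow> g \<in> lin V W \<Longrightarrow> yon X V x W (gr V g) = on_mor X V W g x"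
  by (simp add: yon_def ug_gr[of V _ W])

lemma yon_nt:
  assumes [simp]: "X \<in> LF" "V \<in> Vob" "x \<in> el X V" shows "yon X V x \<in> nt (Yo B V) X"
  unfolding yon_def
proof (rule mknt_nt)
  fix W g h assume [simp]: "W \<in> Vob" and "g \<in> el (Yo B V) W" "h \<in> el (Yo B V) W"
  then obtain g' h' where [simp]: "g' \<in> lin V W" "g = gr V g'" "h' \<in> lin V W" "h = gr V h'" by (auto simp: el_Yo)
  show "on_mor X V W (ug V (g \<oplus>\<^bsub>on_ob (Yo B V) W\<^esub> h)) x = on_mor X V W (ug V g) x \<oplus>\<^bsub>on_ob X W\<^esub> on_mor X V W (ug V h) x"
    using map_add_lin[of V W g' h'] by (simp add: ug_gr[of V _ W] Yo_ob hom_space_add LF_map_add)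
next
  fix W c g assume [simp]: "W \<in> Vob" "c \<in> carrier (fld B)" and "g \<in> el (Yo B V) W"
  then obtain g' where [simp]: "g' \<in> lin V W" "g = gr V g'" by (auto simp: el_Yo)
  show "on_mor X V W (ug V (c \<odot>\<^bsub>on_ob (Yo B V) W\<^esub> g)) x = c \<odot>\<^bsub>on_ob X W\<^esub> on_mor X V W (ug V g) x"
    using map_smult_lin[of V W c g'] by (simp add: ug_gr[of V _ W] Yo_ob hom_space_smult LF_map_smult)
next
  fix W W' f g assume [simp]: "W \<in> Vob" "W' \<in> Vob" and f: "f \<in> lin W W'" and "g \<in> el (Yo B V) W"
  then obtain g' where [simp]: "g' \<in> lin V W" "g = gr V g'" by (auto simp: el_Yo)
  show "on_mor X V W' (ug V (on_mor (Yo B V) W W' f g)) x = on_mor X W W' f (on_mor X V W (ug V g) x)"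
    using cmp_lin[of V g' W f W'] f by (simp add: ug_gr[of V _ W] ug_gr[of V _ W'] LF_cmp)
qed (auto simp: el_Yo ug_gr)

lemma nt_Yo_apply:
  assumes "\<theta> \<in> nt (Yo B V) X" "V \<in> Vob" "W \<in> Vob" "g \<in> lin V W"
  shows "\<theta> W (gr V g) = on_mor X V W g (\<theta> V (gr V (idm V)))"
  using nt_natural[OF assms(1), of V W g "gr V (idm V)"] assms by (simp add: cmp_idm_right)

lemma nt_Yo_eqI:
  assumes "\<theta> \<in> nt (Yo B V) X" "\<theta>' \<in> nt (Yo B V) X" "V \<in> Vob" "\<theta> V (gr V (idm V)) = \<theta>' V (gr V (idm V))"
  shows "\<theta> = \<theta>'"
proof (rule nt_eqI[OF assms(1,2)])
  fix W x assume W: "W \<in> Vob" and "x \<in> el (Yo B V) W"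
  then obtain g where g: "g \<in> lin V W" "x = gr V g" by (auto simp: el_Yo)
  show "\<theta> W x = \<theta>' W x"
    unfolding g(2) nt_Yo_apply[OF assms(1,3) W g(1)] nt_Yo_apply[OF assms(2,3) W g(1)] assms(4) ..
qed

subsection \<open>Ind-objects\<close>

abbreviation IO where "IO \<equiv> Obj (Ind B)"

lemma IO_LF [simp]: "X \<in> IO \<Longrightarrow> X \<in> LF"
  by (simp add: Ind_def full_subcat_def)

lemma Ind_eq: "Ind B = subLF IO"
  by (simp add: Ind_def full_subcat_def)

lemma Hom_Ind [simp]: "Hom (Ind B) = nt" "Comp (Ind B) = Comp (LinFun B)" "Idn (Ind B) = Idn (LinFun B)"
  by (simp_all add: Ind_def full_subcat_def)

lemma Yo_IO [simp]:
  assumes V: "V \<in> Vob" shows "Yo B V \<in> IO"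
proof -
  let ?Y = "Yo B V" and ?id = "Idn (LinFun B) (Yo B V)"
  have Y [simp]: "?Y \<in> LF" using V by simp
  have l: "Comp (LinFun B) ?Y f ?id = f" if "f \<in> nt ?Y Z" for f Z
    using that by (intro nt_eqI[OF Comp_nt[OF Y Idn_nt[OF Y]]]) auto
  \<comment> \<open>A representable is the colimit of the diagram consisting of itself over the
    one-point poset.\<close>
  have "is_directed_colimit (LinFun B) {undefined} {(undefined, undefined)} (\<lambda>i. ?Y) (\<lambda>_ _. ?id) ?Y (\<lambda>_. ?id)"
    unfolding is_directed_colimit_def
    by (auto simp: partial_order_on_def preorder_on_def refl_on_def trans_def antisym_def l[OF Idn_nt[OF Y]])
      (use l in \<open>auto intro!: ex1I\<close>)
  moreover have "small B {undefined}" by (simp only: small_eq U.small_singleton)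
  ultimately have "\<exists>I r W t \<iota>. small B I \<and> (\<forall>i\<in>I. W i \<in> Vob) \<and> is_directed_colimit (LinFun B) I r (\<lambda>i. Yo B (W i)) t ?Y \<iota>"
    using V by (intro exI[of _ "{undefined}"] exI[of _ "{(undefined, undefined)}"] exI[of _ "\<lambda>_. V"]
        exI[of _ "\<lambda>_ _. ?id"] exI[of _ "\<lambda>_. ?id"]) simp
  then show ?thesis using Y unfolding Ind_def full_subcat_def by auto
qed

text \<open>Links the linear map written out in \<open>ind_lun\<close> to a composite of
  \<open>vlu\<close>, w \<otimes> id and f, to which functoriality applies.\<close>

lemma lun_map_eq:
  assumes [simp]: "H \<in> Vob" "L \<in> Vob" and w: "w \<in> lin kk H" and f: "f \<in> lin (H \<star> L) V"
  shows "cmp L f (cmp L (tm kk H L L w (idm L)) (vlu L)) = (\<lambda>h\<in>carrier L. f (vb H L (w \<one>\<^bsub>fld B\<^esub>) h))"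
  using w by (auto simp: compose_def fun_eq_iff vlu_apply tm_vb)

lemma run_map_eq:
  assumes [simp]: "H \<in> Vob" "L \<in> Vob" and w: "w \<in> lin kk L" and f: "f \<in> lin (H \<star> L) V"
  shows "cmp H f (cmp H (tm H H kk L (idm H) w) (vru H)) = (\<lambda>h\<in>carrier H. f (vb H L h (w \<one>\<^bsub>fld B\<^esub>)))"
  using w by (auto simp: compose_def fun_eq_iff vru_apply tm_vb)

end

subsection \<open>The tensor product of Ind-objects\<close>

locale ind_setting = vect_setting B for B :: "'u vdata" +
  fixes D :: "'u ddata" and N :: "'u hdata"
  assumes ind_tensor: "is_ind_tensor B D" and ind_hom: "is_ind_hom B N"
begin

abbreviation dt where "dt \<equiv> dob D"
abbreviation dc where "dc \<equiv> dcw D"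

lemma dt_IO [simp]: "X \<in> IO \<Longrightarrow> Y \<in> IO \<Longrightarrow> dt X Y \<in> IO"
  using ind_tensor unfolding is_ind_tensor_def by blast

context
  fixes X Y assumes XY [simp]: "X \<in> IO" "Y \<in> IO"
begin

lemmas dt_props = ind_tensor[unfolded is_ind_tensor_def, THEN bspec, OF XY(1), THEN bspec, OF XY(2), THEN conjunct2]

lemma dc_cowedge: "V \<in> Vob \<Longrightarrow> is_cowedge B X Y V (on_ob (dt X Y) V) (dc X Y V)"
  by (rule dt_props[THEN conjunct1, THEN bspec, THEN conjunct1])

lemma dc_universal: "V \<in> Vob \<Longrightarrow> Z \<in> Vob \<Longrightarrow> is_cowedge B X Y V Z \<psi> \<Longrightarrow>
    \<exists>!h. h \<in> lin (on_ob (dt X Y) V) Z \<and> (\<forall>H0\<in>Vob. \<forall>H1\<in>Vob. \<forall>x\<in>el X H0. \<forall>y\<in>el Y H1. \<forall>f\<in>lin (H0 \<star> H1) V.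
      h (dc X Y V H0 H1 x y f) = \<psi> H0 H1 x y f)"
  by (rule dt_props[THEN conjunct1, THEN bspec, THEN conjunct2, THEN bspec, THEN spec, THEN mp])

lemma dc_mor: "V \<in> Vob \<Longrightarrow> V' \<in> Vob \<Longrightarrow> g \<in> lin V V' \<Longrightarrow> H0 \<in> Vob \<Longrightarrow> H1 \<in> Vob \<Longrightarrow> x \<in> el X H0 \<Longrightarrow> y \<in> el Y H1 \<Longrightarrow>
    f \<in> lin (H0 \<star> H1) V \<Longrightarrow> on_mor (dt X Y) V V' g (dc X Y V H0 H1 x y f) = dc X Y V' H0 H1 x y (cmp (H0 \<star> H1) g f)"
  using dt_props[THEN conjunct2, rule_format] by simp

lemma dc_bilinear: "V \<in> Vob \<Longrightarrow> H0 \<in> Vob \<Longrightarrow> H1 \<in> Vob \<Longrightarrow> f \<in> lin (H0 \<star> H1) V \<Longrightarrow>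
    bilinear_on B (on_ob X H0) (on_ob Y H1) (on_ob (dt X Y) V) (\<lambda>x y. dc X Y V H0 H1 x y f)"
  using dc_cowedge unfolding is_cowedge_def by blast

lemma dc_closed: "V \<in> Vob \<Longrightarrow> H0 \<in> Vob \<Longrightarrow> H1 \<in> Vob \<Longrightarrow> f \<in> lin (H0 \<star> H1) V \<Longrightarrow> x \<in> el X H0 \<Longrightarrow> y \<in> el Y H1 \<Longrightarrow>
    dc X Y V H0 H1 x y f \<in> el (dt X Y) V"
  using bilinear_onD(1)[OF dc_bilinear] by simp

text \<open>Supplies the cowedge for which uniqueness in \<open>dc_universal\<close> is invoked when
  two linear maps are compared.\<close>

lemma cowedge_lin:
  assumes V: "V \<in> Vob" and Z: "Z \<in> Vob" and h: "h \<in> lin (on_ob (dt X Y) V) Z"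
  shows "is_cowedge B X Y V Z (\<lambda>H0 H1 x y f. h (dc X Y V H0 H1 x y f))"
proof -
  note cw = dc_cowedge[OF V, unfolded is_cowedge_def]
  show ?thesis
    unfolding is_cowedge_def
  proof (intro conjI ballI)
    fix H0 H1 f assume *: "H0 \<in> Vob" "H1 \<in> Vob" "f \<in> lin (H0 \<star> H1) V"
    note b = bilinear_onD[OF dc_bilinear[OF V *]]
    show "bilinear_on B (on_ob X H0) (on_ob Y H1) Z (\<lambda>x y. h (dc X Y V H0 H1 x y f))"
      using * by (intro bilinear_onI) (simp_all add: b lin_closed[OF h] lin_add[OF h] lin_smult[OF h])
  next
    fix H0 H1 x y f g assume *: "H0 \<in> Vob" "H1 \<in> Vob" "x \<in> el X H0" "y \<in> el Y H1" "f \<in> lin (H0 \<star> H1) V" "g \<in> lin (H0 \<star> H1) V"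
    then have "dc X Y V H0 H1 x y (map_add (H0 \<star> H1) V f g) = dc X Y V H0 H1 x y f \<oplus>\<^bsub>on_ob (dt X Y) V\<^esub> dc X Y V H0 H1 x y g"
      using cw by blast
    then show "h (dc X Y V H0 H1 x y (map_add (H0 \<star> H1) V f g)) = h (dc X Y V H0 H1 x y f) \<oplus>\<^bsub>Z\<^esub> h (dc X Y V H0 H1 x y g)"
      using * V by (simp add: lin_add[OF h] dc_closed)
  next
    fix H0 H1 x y c f assume *: "H0 \<in> Vob" "H1 \<in> Vob" "x \<in> el X H0" "y \<in> el Y H1" "c \<in> carrier (fld B)" "f \<in> lin (H0 \<star> H1) V"
    then have "dc X Y V H0 H1 x y (map_smult (H0 \<star> H1) V c f) = c \<odot>\<^bsub>on_ob (dt X Y) V\<^esub> dc X Y V H0 H1 x y f"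
      using cw by blast
    then show "h (dc X Y V H0 H1 x y (map_smult (H0 \<star> H1) V c f)) = c \<odot>\<^bsub>Z\<^esub> h (dc X Y V H0 H1 x y f)"
      using * V by (simp add: lin_smult[OF h] dc_closed)
  next
    fix H0 H0' H1 H1' a b x y f assume *: "H0 \<in> Vob" "H0' \<in> Vob" "H1 \<in> Vob" "H1' \<in> Vob" "a \<in> lin H0 H0'" "b \<in> lin H1 H1'"
      "x \<in> el X H0" "y \<in> el Y H1" "f \<in> lin (H0' \<star> H1') V"
    show "h (dc X Y V H0' H1' (on_mor X H0 H0' a x) (on_mor Y H1 H1' b y) f) =
       h (dc X Y V H0 H1 x y (cmp (H0 \<star> H1) f (tm H0 H0' H1 H1' a b)))"
      using cw * by (intro arg_cong[of _ _ h]) blast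
  qed
qed

lemma dc_ext:
  assumes V: "V \<in> Vob" and Z: "Z \<in> Vob" and h: "h \<in> lin (on_ob (dt X Y) V) Z" "h' \<in> lin (on_ob (dt X Y) V) Z"
    and eq: "\<And>H0 H1 x y f. H0 \<in> Vob \<Longrightarrow> H1 \<in> Vob \<Longrightarrow> x \<in> el X H0 \<Longrightarrow> y \<in> el Y H1 \<Longrightarrow> f \<in> lin (H0 \<star> H1) V \<Longrightarrow>
      h (dc X Y V H0 H1 x y f) = h' (dc X Y V H0 H1 x y f)"
  shows "h = h'"
proof -
  let ?P = "\<lambda>k. k \<in> lin (on_ob (dt X Y) V) Z \<and> (\<forall>H0\<in>Vob. \<forall>H1\<in>Vob. \<forall>x\<in>el X H0. \<forall>y\<in>el Y H1. \<forall>f\<in>lin (H0 \<star> H1) V.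
      k (dc X Y V H0 H1 x y f) = h (dc X Y V H0 H1 x y f))"
  have "\<exists>!k. ?P k" by (rule dc_universal[OF V Z cowedge_lin[OF V Z h(1)]])
  moreover have "?P h" using h by simp
  moreover have "?P h'" using h eq by simp
  ultimately show ?thesis by blast
qed

end

definition uu where "uu X Y H L x y = dc X Y (H \<star> L) H L x y (idm (H \<star> L))"

text \<open>Functoriality of the coend in V: each of its generators is the transport, along f, of
  one at an identity.\<close>

lemma dc_eq:
  assumes "X \<in> IO" "Y \<in> IO" "V \<in> Vob" "H \<in> Vob" "L \<in> Vob" "x \<in> el X H" "y \<in> el Y L" "f \<in> lin (H \<star> L) V"
  shows "dc X Y V H L x y f = on_mor (dt X Y) (H \<star> L) V f (uu X Y H L x y)"
  using assms by (simp add: uu_def dc_mor cmp_idm_right)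

lemma uu_bifam:
  assumes [simp]: "X \<in> IO" "Y \<in> IO" shows "bifam X Y (dt X Y) (uu X Y)"
  unfolding bifam_def
proof (intro conjI ballI)
  fix H L assume "H \<in> Vob" "L \<in> Vob"
  then show "bilinear_on B (on_ob X H) (on_ob Y L) (on_ob (dt X Y) (H \<star> L)) (uu X Y H L)"
    using dc_bilinear[of X Y "H \<star> L" H L "idm (H \<star> L)"] by (simp add: uu_def[abs_def])
next
  fix H H' L L' a b x y assume *: "H \<in> Vob" "H' \<in> Vob" "L \<in> Vob" "L' \<in> Vob" "a \<in> lin H H'" "b \<in> lin L L'" "x \<in> el X H" "y \<in> el Y L"
  have "dc X Y (H' \<star> L') H' L' (on_mor X H H' a x) (on_mor Y L L' b y) (idm (H' \<star> L')) =
    dc X Y (H' \<star> L') H L x y (cmp (H \<star> L) (idm (H' \<star> L')) (tm H H' L L' a b))"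
    using dc_cowedge[of X Y "H' \<star> L'"] * idm_lin[of "H' \<star> L'"] unfolding is_cowedge_def by simp
  then show "uu X Y H' L' (on_mor X H H' a x) (on_mor Y L L' b y) =
    on_mor (dt X Y) (H \<star> L) (H' \<star> L') (tm H H' L L' a b) (uu X Y H L x y)"
    using * by (simp add: uu_def dc_mor cmp_idm_right[OF tm_lin] cmp_idm_left[OF tm_lin])
qed

text \<open>At each V the assignment f \<mapsto> Z(f)(\<beta>(x, y)) is a cowedge and induces a
  linear map on the coend. The bifamily thus lifts one V at a time.\<close>

lemma uu_lift:
  assumes X [simp]: "X \<in> IO" and Y [simp]: "Y \<in> IO" and Z [simp]: "Z \<in> LF" and \<beta>: "bifam X Y Z \<beta>"
  shows "\<exists>\<theta>\<in>nt (dt X Y) Z. \<forall>H\<in>Vob. \<forall>L\<in>Vob. \<forall>x\<in>el X H. \<forall>y\<in>el Y L. \<theta> (H \<star> L) (uu X Y H L x y) = \<beta> H L x y"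
proof -
  note [simp] = bifam_closed[OF \<beta> IO_LF[OF X] IO_LF[OF Y]]
  define P where "P V h \<longleftrightarrow> h \<in> lin (on_ob (dt X Y) V) (on_ob Z V) \<and>
      (\<forall>H0\<in>Vob. \<forall>H1\<in>Vob. \<forall>x\<in>el X H0. \<forall>y\<in>el Y H1. \<forall>f\<in>lin (H0 \<star> H1) V.
      h (dc X Y V H0 H1 x y f) = on_mor Z (H0 \<star> H1) V f (\<beta> H0 H1 x y))" for V h
  define h where "h V = (SOME h. P V h)" for V
  have h: "P V (h V)" if V [simp]: "V \<in> Vob" for V
  proof -
    have "is_cowedge B X Y V (on_ob Z V) (\<lambda>H0 H1 x y f. on_mor Z (H0 \<star> H1) V f (\<beta> H0 H1 x y))"
      unfolding is_cowedge_def
    proof (intro conjI ballI)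
      fix H0 H1 f assume [simp]: "H0 \<in> Vob" "H1 \<in> Vob" "f \<in> lin (H0 \<star> H1) V"
      show "bilinear_on B (on_ob X H0) (on_ob Y H1) (on_ob Z V) (\<lambda>x y. on_mor Z (H0 \<star> H1) V f (\<beta> H0 H1 x y))"
        by (rule bilinear_onI)
          (simp_all add: bifam_add_left[OF \<beta>] bifam_add_right[OF \<beta>] bifam_smult_left[OF \<beta>] bifam_smult_right[OF \<beta>]
            lin_add[OF LF_mor] lin_smult[OF LF_mor])
    next
      fix H0 H0' H1 H1' a b x y f assume [simp]: "H0 \<in> Vob" "H0' \<in> Vob" "H1 \<in> Vob" "H1' \<in> Vob" "a \<in> lin H0 H0'" "b \<in> lin H1 H1'"
        "x \<in> el X H0" "y \<in> el Y H1" "f \<in> lin (H0' \<star> H1') V"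
      show "on_mor Z (H0' \<star> H1') V f (\<beta> H0' H1' (on_mor X H0 H0' a x) (on_mor Y H1 H1' b y)) =
        on_mor Z (H0 \<star> H1) V (cmp (H0 \<star> H1) f (tm H0 H0' H1 H1' a b)) (\<beta> H0 H1 x y)"
        by (simp add: bifam_natural[OF \<beta>] LF_cmp)
    qed (simp_all add: LF_map_add LF_map_smult)
    from dc_universal[OF X Y V _ this] have "\<exists>h. P V h" unfolding P_def by auto
    then show ?thesis unfolding h_def by (rule someI_ex)
  qed
  then have hl: "h V \<in> lin (on_ob (dt X Y) V) (on_ob Z V)" if "V \<in> Vob" for V
    using that unfolding P_def by blast
  have hd: "h V (dc X Y V H0 H1 x y f) = on_mor Z (H0 \<star> H1) V f (\<beta> H0 H1 x y)"
    if "V \<in> Vob" "H0 \<in> Vob" "H1 \<in> Vob" "x \<in> el X H0" "y \<in> el Y H1" "f \<in> lin (H0 \<star> H1) V" for V H0 H1 x y f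
    using that h[of V] unfolding P_def by blast
  have nt: "mknt (dt X Y) h \<in> nt (dt X Y) Z"
  proof (rule mknt_nt)
    fix V W g t assume [simp]: "V \<in> Vob" "W \<in> Vob" and g [simp]: "g \<in> lin V W" and t: "t \<in> el (dt X Y) V"
    \<comment> \<open>The components were chosen separately for V and W. Naturality is nevertheless
      automatic, because both composites are linear and agree on the generators of the
      coend.\<close>
    have "cmp (on_ob (dt X Y) V) (h W) (on_mor (dt X Y) V W g) = cmp (on_ob (dt X Y) V) (on_mor Z V W g) (h V)"
      by (rule dc_ext[of X Y V, OF _ _ _ _ cmp_lin[OF _ LF_mor hl] cmp_lin[OF _ hl LF_mor]])
        (simp_all add: dc_closed dc_mor hd cmp_lin[of _ _ V _ W] LF_cmp)
    from fun_cong[OF this, of t] show "h W (on_mor (dt X Y) V W g t) = on_mor Z V W g (h V t)" using t by simp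
  qed (simp_all add: lin_closed[OF hl] lin_add[OF hl] lin_smult[OF hl])
  have "mknt (dt X Y) h (H \<star> L) (uu X Y H L x y) = \<beta> H L x y" if "H \<in> Vob" "L \<in> Vob" "x \<in> el X H" "y \<in> el Y L" for H L x y
    using that hd[of "H \<star> L" H L x y "idm (H \<star> L)"] dc_closed[of X Y "H \<star> L" H L "idm (H \<star> L)" x y] by (simp add: uu_def)
  then show ?thesis using nt by blast
qed

lemma uu_ext:
  assumes X [simp]: "X \<in> IO" and Y [simp]: "Y \<in> IO" and Z [simp]: "Z \<in> LF"
    and \<theta>: "\<theta> \<in> nt (dt X Y) Z" and \<theta>': "\<theta>' \<in> nt (dt X Y) Z"
    and eq: "\<And>H L x y. H \<in> Vob \<Longrightarrow> L \<in> Vob \<Longrightarrow> x \<in> el X H \<Longrightarrow> y \<in> el Y L \<Longrightarrow>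
        \<theta> (H \<star> L) (uu X Y H L x y) = \<theta>' (H \<star> L) (uu X Y H L x y)"
  shows "\<theta> = \<theta>'"
proof (rule nt_eqI[OF \<theta> \<theta>'])
  fix V x assume [simp]: "V \<in> Vob"
  note [simp] = bifam_closed[OF uu_bifam IO_LF IO_LF]
  have "\<theta> V = \<theta>' V"
    by (rule dc_ext[OF X Y _ _ nt_lin[OF \<theta>] nt_lin[OF \<theta>']]) (simp_all add: dc_eq nt_natural[OF \<theta>] nt_natural[OF \<theta>'] eq)
  then show "\<theta> V x = \<theta>' V x" by simp
qed

text \<open>All linear functors serve as targets, since the coend at each V is universal for
  arbitrary small vector spaces; closure under shifts is then immediate. The universal element of
  the unit is the code of the identity of k.\<close>

sublocale I: day B IO LF dt uu "Yo B kk" "gr kk (idm kk)" "hob N" "hnt N"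
proof
  show "\<exists>\<theta>\<in>nt (Yo B kk) Z. \<theta> kk (gr kk (idm kk)) = z" if "Z \<in> LF" "z \<in> el Z kk" for Z z
    using that yon_nt[of Z kk z] yon_apply[of kk kk "idm kk" Z z] by (intro bexI[of _ "yon Z kk z"]) simp_all
  fix X Z V assume *: "X \<in> IO" "Z \<in> IO" "V \<in> Vob"
  note nh = ind_hom[unfolded is_ind_hom_def, rule_format]
  show "bij_betw (hnt N X Z V) (el (hob N X Z) V) (nt X (shr Z V))"
    using nh * by blast
  fix H x s assume **: "H \<in> Vob" "x \<in> el X H" "s \<in> el (hob N X Z) V"
  show "hnt N X Z V (s \<oplus>\<^bsub>on_ob (hob N X Z) V\<^esub> t) H x = hnt N X Z V s H x \<oplus>\<^bsub>on_ob Z (H \<star> V)\<^esub> hnt N X Z V t H x"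
    if "t \<in> el (hob N X Z) V" for t
    using nh * ** that by simp
  show "hnt N X Z V (c \<odot>\<^bsub>on_ob (hob N X Z) V\<^esub> s) H x = c \<odot>\<^bsub>on_ob Z (H \<star> V)\<^esub> hnt N X Z V s H x"
    if "c \<in> carrier (fld B)" for c
    using nh * ** that by simp
  show "hnt N X Z V' (on_mor (hob N X Z) V V' g s) H x = on_mor Z (H \<star> V) (H \<star> V') (tm H H V V' (idm H) g) (hnt N X Z V s H x)"
    if "V' \<in> Vob" "g \<in> lin V V'" for V' g
    using nh * ** that by simp
qed (use ind_hom in \<open>auto simp: shr_LF shl_LF uu_bifam uu_lift is_ind_hom_def intro: uu_ext nt_Yo_eqI\<close>)

section \<open>The explicitly defined structure maps on Ind-objects\<close>

abbreviation MI where "MI \<equiv> ind_clmon B D N"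
abbreviation e\<^sub>0 where "e\<^sub>0 \<equiv> gr kk (idm kk)"
abbreviation Y\<^sub>0 where "Y\<^sub>0 \<equiv> Yo B kk"

lemma dc_id: "X \<in> IO \<Longrightarrow> Y \<in> IO \<Longrightarrow> H \<in> Vob \<Longrightarrow> L \<in> Vob \<Longrightarrow> dc X Y (H \<star> L) H L x y (idm (H \<star> L)) = uu X Y H L x y"
  by (simp add: uu_def)

text \<open>\<open>ind_tmor\<close> prescribes values for all f, while the lift is characterised at
  identities. Naturality passes from identities to general f, and a solution of the description is
  recovered from its values at identities. The other structure maps follow the same pattern.\<close>

lemma ind_tmor_props:
  assumes X [simp]: "X \<in> IO" "Y \<in> IO" "X' \<in> IO" "Y' \<in> IO" and \<sigma>: "\<sigma> \<in> nt X X'" and \<tau>: "\<tau> \<in> nt Y Y'"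
  shows "ind_tmor B D X X' Y Y' \<sigma> \<tau> \<in> nt (dt X Y) (dt X' Y')"
    and "\<lbrakk>H \<in> Vob; L \<in> Vob; x \<in> el X H; y \<in> el Y L\<rbrakk> \<Longrightarrow>
      ind_tmor B D X X' Y Y' \<sigma> \<tau> (H \<star> L) (uu X Y H L x y) = uu X' Y' H L (\<sigma> H x) (\<tau> L y)"
proof -
  note [simp] = nt_closed[OF \<sigma>] nt_closed[OF \<tau>]
  obtain \<theta> where \<theta>: "\<theta> \<in> nt (dt X Y) (dt X' Y')" and
    \<theta>u: "\<And>H L x y. H \<in> Vob \<Longrightarrow> L \<in> Vob \<Longrightarrow> x \<in> el X H \<Longrightarrow> y \<in> el Y L \<Longrightarrow>
      \<theta> (H \<star> L) (uu X Y H L x y) = uu X' Y' H L (\<sigma> H x) (\<tau> L y)"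
    using I.ex_tmor[OF X \<sigma> \<tau>] by auto
  have "ind_tmor B D X X' Y Y' \<sigma> \<tau> = \<theta>"
    unfolding ind_tmor_def
  proof (rule the_equality, intro conjI ballI)
    show "\<theta> \<in> Hom (Ind B) (dt X Y) (dt X' Y')" using \<theta> by simp
    fix V H0 H1 x y f assume [simp]: "V \<in> Vob" "H0 \<in> Vob" "H1 \<in> Vob" "x \<in> el X H0" "y \<in> el Y H1" "f \<in> lin (H0 \<star> H1) V"
    show "\<theta> V (dc X Y V H0 H1 x y f) = dc X' Y' V H0 H1 (\<sigma> H0 x) (\<tau> H1 y) f"
      by (simp add: dc_eq nt_natural[OF \<theta>] \<theta>u)
  next
    fix k assume k: "k \<in> Hom (Ind B) (dt X Y) (dt X' Y') \<and>
      (\<forall>V\<in>Vob. \<forall>H0\<in>Vob. \<forall>H1\<in>Vob. \<forall>x\<in>el X H0. \<forall>y\<in>el Y H1. \<forall>f\<in>lin (H0 \<star> H1) V.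
         k V (dc X Y V H0 H1 x y f) = dc X' Y' V H0 H1 (\<sigma> H0 x) (\<tau> H1 y) f)"
    show "k = \<theta>"
    proof (rule uu_ext[of X Y "dt X' Y'"])
      show "k \<in> nt (dt X Y) (dt X' Y')" using k by simp
      fix H L x y assume [simp]: "H \<in> Vob" "L \<in> Vob" "x \<in> el X H" "y \<in> el Y L"
      have "k (H \<star> L) (dc X Y (H \<star> L) H L x y (idm (H \<star> L))) = dc X' Y' (H \<star> L) H L (\<sigma> H x) (\<tau> L y) (idm (H \<star> L))"
        using k by simp
      then show "k (H \<star> L) (uu X Y H L x y) = \<theta> (H \<star> L) (uu X Y H L x y)" by (simp add: dc_id \<theta>u)
    qed (simp_all add: \<theta>)
  qed
  then show "ind_tmor B D X X' Y Y' \<sigma> \<tau> \<in> nt (dt X Y) (dt X' Y')"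
    "\<lbrakk>H \<in> Vob; L \<in> Vob; x \<in> el X H; y \<in> el Y L\<rbrakk> \<Longrightarrow>
      ind_tmor B D X X' Y Y' \<sigma> \<tau> (H \<star> L) (uu X Y H L x y) = uu X' Y' H L (\<sigma> H x) (\<tau> L y)"
    using \<theta> \<theta>u by simp_all
qed

lemma ind_asc_props:
  assumes [simp]: "X \<in> IO" "Y \<in> IO" "Z \<in> IO"
  shows "ind_asc B D X Y Z \<in> nt (dt (dt X Y) Z) (dt X (dt Y Z))"
    and "\<lbrakk>H0 \<in> Vob; H1 \<in> Vob; L \<in> Vob; x \<in> el X H0; y \<in> el Y H1; z \<in> el Z L\<rbrakk> \<Longrightarrow>
      ind_asc B D X Y Z ((H0 \<star> H1) \<star> L) (uu (dt X Y) Z (H0 \<star> H1) L (uu X Y H0 H1 x y) z) =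
      on_mor (dt X (dt Y Z)) (H0 \<star> H1 \<star> L) ((H0 \<star> H1) \<star> L) (vai H0 H1 L) (uu X (dt Y Z) H0 (H1 \<star> L) x (uu Y Z H1 L y z))"
proof -
  obtain \<theta> where \<theta>: "\<theta> \<in> nt (dt (dt X Y) Z) (dt X (dt Y Z))" and
    \<theta>u: "\<And>H0 H1 L x y z. H0 \<in> Vob \<Longrightarrow> H1 \<in> Vob \<Longrightarrow> L \<in> Vob \<Longrightarrow> x \<in> el X H0 \<Longrightarrow> y \<in> el Y H1 \<Longrightarrow> z \<in> el Z L \<Longrightarrow>
      \<theta> ((H0 \<star> H1) \<star> L) (uu (dt X Y) Z (H0 \<star> H1) L (uu X Y H0 H1 x y) z) =
      on_mor (dt X (dt Y Z)) (H0 \<star> H1 \<star> L) ((H0 \<star> H1) \<star> L) (vai H0 H1 L) (uu X (dt Y Z) H0 (H1 \<star> L) x (uu Y Z H1 L y z))"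
    using I.ex_asc[of X Y Z] by auto
  have "ind_asc B D X Y Z = \<theta>"
    unfolding ind_asc_def
  proof (rule the_equality, intro conjI ballI)
    show "\<theta> \<in> Hom (Ind B) (dt (dt X Y) Z) (dt X (dt Y Z))" using \<theta> by simp
    fix V H L H0 H1 x y z f g assume [simp]: "V \<in> Vob" "H \<in> Vob" "L \<in> Vob" "H0 \<in> Vob" "H1 \<in> Vob" "x \<in> el X H0" "y \<in> el Y H1" "z \<in> el Z L"
      and f [simp]: "f \<in> lin (H0 \<star> H1) H" and g [simp]: "g \<in> lin (H \<star> L) V"
    have c [simp]: "cmp (H0 \<star> H1 \<star> L) (tm (H0 \<star> H1) H L L f (idm L)) (vai H0 H1 L) \<in> lin (H0 \<star> H1 \<star> L) (H \<star> L)"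
      by (rule cmp_lin[of _ _ "(H0 \<star> H1) \<star> L"]) simp_all
    have c' [simp]: "cmp (H0 \<star> H1 \<star> L) g (cmp (H0 \<star> H1 \<star> L) (tm (H0 \<star> H1) H L L f (idm L)) (vai H0 H1 L)) \<in> lin (H0 \<star> H1 \<star> L) V"
      by (rule cmp_lin[OF _ c g]) simp
    show "\<theta> V (dc (dt X Y) Z V H L (dc X Y H H0 H1 x y f) z g) =
      dc X (dt Y Z) V H0 (H1 \<star> L) x (dc Y Z (H1 \<star> L) H1 L y z (idm (H1 \<star> L)))
        (cmp (H0 \<star> H1 \<star> L) g (cmp (H0 \<star> H1 \<star> L) (tm (H0 \<star> H1) H L L f (idm L)) (vai H0 H1 L)))"
      by (simp add: dc_id dc_eq I.u_natural_left nt_natural[OF \<theta>] \<theta>u) (simp add: LF_cmp)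
  next
    fix k assume k: "k \<in> Hom (Ind B) (dt (dt X Y) Z) (dt X (dt Y Z)) \<and>
     (\<forall>V\<in>Vob. \<forall>H\<in>Vob. \<forall>L\<in>Vob. \<forall>H0\<in>Vob. \<forall>H1\<in>Vob. \<forall>x\<in>el X H0. \<forall>y\<in>el Y H1. \<forall>z\<in>el Z L.
      \<forall>f\<in>lin (H0 \<star> H1) H. \<forall>g\<in>lin (H \<star> L) V.
        k V (dc (dt X Y) Z V H L (dc X Y H H0 H1 x y f) z g) =
        dc X (dt Y Z) V H0 (H1 \<star> L) x (dc Y Z (H1 \<star> L) H1 L y z (idm (H1 \<star> L)))
          (cmp (H0 \<star> H1 \<star> L) g (cmp (H0 \<star> H1 \<star> L) (tm (H0 \<star> H1) H L L f (idm L)) (vai H0 H1 L))))"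
    show "k = \<theta>"
    proof (rule I.ext_ll[of X Y Z "dt X (dt Y Z)"])
      show "k \<in> nt (dt (dt X Y) Z) (dt X (dt Y Z))" using k by simp
      fix H0 H1 L x y z assume [simp]: "H0 \<in> Vob" "H1 \<in> Vob" "L \<in> Vob" "x \<in> el X H0" "y \<in> el Y H1" "z \<in> el Z L"
      \<comment> \<open>The description is specialised to H = H0 \<otimes> H1 with identities for f
        and g, which leaves exactly the generators.\<close>
      have "k ((H0 \<star> H1) \<star> L) (dc (dt X Y) Z ((H0 \<star> H1) \<star> L) (H0 \<star> H1) L (dc X Y (H0 \<star> H1) H0 H1 x y (idm (H0 \<star> H1))) z (idm ((H0 \<star> H1) \<star> L))) =
        dc X (dt Y Z) ((H0 \<star> H1) \<star> L) H0 (H1 \<star> L) x (dc Y Z (H1 \<star> L) H1 L y z (idm (H1 \<star> L)))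
          (cmp (H0 \<star> H1 \<star> L) (idm ((H0 \<star> H1) \<star> L)) (cmp (H0 \<star> H1 \<star> L) (tm (H0 \<star> H1) (H0 \<star> H1) L L (idm (H0 \<star> H1)) (idm L)) (vai H0 H1 L)))"
        using k by simp
      then show "k ((H0 \<star> H1) \<star> L) (uu (dt X Y) Z (H0 \<star> H1) L (uu X Y H0 H1 x y) z) =
        \<theta> ((H0 \<star> H1) \<star> L) (uu (dt X Y) Z (H0 \<star> H1) L (uu X Y H0 H1 x y) z)"
        by (simp add: dc_id \<theta>u cmp_idm_left[OF vai_lin] dc_eq)
    qed (simp_all add: \<theta>)
  qed
  then show "ind_asc B D X Y Z \<in> nt (dt (dt X Y) Z) (dt X (dt Y Z))"
    "\<lbrakk>H0 \<in> Vob; H1 \<in> Vob; L \<in> Vob; x \<in> el X H0; y \<in> el Y H1; z \<in> el Z L\<rbrakk> \<Longrightarrow>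
      ind_asc B D X Y Z ((H0 \<star> H1) \<star> L) (uu (dt X Y) Z (H0 \<star> H1) L (uu X Y H0 H1 x y) z) =
      on_mor (dt X (dt Y Z)) (H0 \<star> H1 \<star> L) ((H0 \<star> H1) \<star> L) (vai H0 H1 L) (uu X (dt Y Z) H0 (H1 \<star> L) x (uu Y Z H1 L y z))"
    using \<theta> \<theta>u by simp_all
qed

lemma ind_lun_props:
  assumes [simp]: "X \<in> IO"
  shows "ind_lun B D X \<in> nt (dt Y\<^sub>0 X) X"
    and "\<lbrakk>L \<in> Vob; x \<in> el X L\<rbrakk> \<Longrightarrow> ind_lun B D X (kk \<star> L) (uu Y\<^sub>0 X kk L e\<^sub>0 x) = on_mor X L (kk \<star> L) (vlu L) x"
proof -
  obtain \<theta> where \<theta>: "\<theta> \<in> nt (dt Y\<^sub>0 X) X" and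
    \<theta>u: "\<And>L x. L \<in> Vob \<Longrightarrow> x \<in> el X L \<Longrightarrow> \<theta> (kk \<star> L) (uu Y\<^sub>0 X kk L e\<^sub>0 x) = on_mor X L (kk \<star> L) (vlu L) x"
    using I.ex_lun[of X] by auto
  have "ind_lun B D X = \<theta>"
    unfolding ind_lun_def
  proof (rule the_equality, intro conjI ballI)
    show "\<theta> \<in> Hom (Ind B) (dt Y\<^sub>0 X) X" using \<theta> by simp
    fix V H0 H1 w x f assume [simp]: "V \<in> Vob" "H0 \<in> Vob" "H1 \<in> Vob" and w [simp]: "w \<in> lin kk H0" and x [simp]: "x \<in> el X H1"
      and f [simp]: "f \<in> lin (H0 \<star> H1) V"
    have c [simp]: "cmp H1 (tm kk H0 H1 H1 w (idm H1)) (vlu H1) \<in> lin H1 (H0 \<star> H1)"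
      by (rule cmp_lin[of _ _ "kk \<star> H1"]) simp_all
    \<comment> \<open>Every element of the unit is the transport of \<open>e\<^sub>0\<close> along a
      linear map w, so naturality in the left variable reduces the value at w to the one at
      \<open>e\<^sub>0\<close>.\<close>
    have "\<theta> V (dc Y\<^sub>0 X V H0 H1 (gr kk w) x f) = on_mor X (H0 \<star> H1) V f (on_mor X (kk \<star> H1) (H0 \<star> H1) (tm kk H0 H1 H1 w (idm H1)) (on_mor X H1 (kk \<star> H1) (vlu H1) x))"
      unfolding Yo_element[OF ground_Vob w] by (simp add: dc_eq I.u_natural_left nt_natural[OF \<theta>] \<theta>u del: Yo_mor)
    also have "\<dots> = on_mor X H1 V (\<lambda>h\<in>carrier H1. f (vb H0 H1 (w \<one>\<^bsub>fld B\<^esub>) h)) x"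
      unfolding lun_map_eq[OF \<open>H0 \<in> Vob\<close> \<open>H1 \<in> Vob\<close> w f, symmetric] by (simp add: LF_cmp)
    finally show "\<theta> V (dc Y\<^sub>0 X V H0 H1 (gr kk w) x f) = on_mor X H1 V (\<lambda>h\<in>carrier H1. f (vb H0 H1 (w \<one>\<^bsub>fld B\<^esub>) h)) x" .
  next
    fix k assume k: "k \<in> Hom (Ind B) (dt Y\<^sub>0 X) X \<and>
     (\<forall>V\<in>Vob. \<forall>H0\<in>Vob. \<forall>H1\<in>Vob. \<forall>w\<in>lin kk H0. \<forall>x\<in>el X H1. \<forall>f\<in>lin (H0 \<star> H1) V.
        k V (dc Y\<^sub>0 X V H0 H1 (gr kk w) x f) = on_mor X H1 V (\<lambda>h\<in>carrier H1. f (vb H0 H1 (w \<one>\<^bsub>fld B\<^esub>) h)) x)"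
    show "k = \<theta>"
    proof (rule I.ext_J_left[of X X])
      show "k \<in> nt (dt Y\<^sub>0 X) X" using k by simp
      fix L x assume [simp]: "L \<in> Vob" "x \<in> el X L"
      have "(\<lambda>h\<in>carrier L. (idm (kk \<star> L)) (vb kk L ((idm kk) \<one>\<^bsub>fld B\<^esub>) h)) = vlu L"
        by (auto simp: vlu_def)
      moreover have "k (kk \<star> L) (dc Y\<^sub>0 X (kk \<star> L) kk L e\<^sub>0 x (idm (kk \<star> L))) = on_mor X L (kk \<star> L) (\<lambda>h\<in>carrier L. (idm (kk \<star> L)) (vb kk L ((idm kk) \<one>\<^bsub>fld B\<^esub>) h)) x"
        by (rule k[THEN conjunct2, rule_format]) simp_all
      ultimately have "k (kk \<star> L) (dc Y\<^sub>0 X (kk \<star> L) kk L e\<^sub>0 x (idm (kk \<star> L))) = on_mor X L (kk \<star> L) (vlu L) x" by simp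
      then show "k (kk \<star> L) (uu Y\<^sub>0 X kk L e\<^sub>0 x) = \<theta> (kk \<star> L) (uu Y\<^sub>0 X kk L e\<^sub>0 x)"
        by (simp add: dc_id \<theta>u)
    qed (simp_all add: \<theta>)
  qed
  then show "ind_lun B D X \<in> nt (dt Y\<^sub>0 X) X"
    "\<lbrakk>L \<in> Vob; x \<in> el X L\<rbrakk> \<Longrightarrow> ind_lun B D X (kk \<star> L) (uu Y\<^sub>0 X kk L e\<^sub>0 x) = on_mor X L (kk \<star> L) (vlu L) x"
    using \<theta> \<theta>u by simp_all
qed

lemma ind_run_props:
  assumes [simp]: "X \<in> IO"
  shows "ind_run B D X \<in> nt (dt X Y\<^sub>0) X"
    and "\<lbrakk>L \<in> Vob; x \<in> el X L\<rbrakk> \<Longrightarrow> ind_run B D X (L \<star> kk) (uu X Y\<^sub>0 L kk x e\<^sub>0) = on_mor X L (L \<star> kk) (vru L) x"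
proof -
  obtain \<theta> where \<theta>: "\<theta> \<in> nt (dt X Y\<^sub>0) X" and
    \<theta>u: "\<And>L x. L \<in> Vob \<Longrightarrow> x \<in> el X L \<Longrightarrow> \<theta> (L \<star> kk) (uu X Y\<^sub>0 L kk x e\<^sub>0) = on_mor X L (L \<star> kk) (vru L) x"
    using I.ex_run[of X] by auto
  have "ind_run B D X = \<theta>"
    unfolding ind_run_def
  proof (rule the_equality, intro conjI ballI)
    show "\<theta> \<in> Hom (Ind B) (dt X Y\<^sub>0) X" using \<theta> by simp
    fix V H0 H1 x w f assume [simp]: "V \<in> Vob" "H0 \<in> Vob" "H1 \<in> Vob" and x [simp]: "x \<in> el X H0" and w [simp]: "w \<in> lin kk H1"
      and f [simp]: "f \<in> lin (H0 \<star> H1) V"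
    have c [simp]: "cmp H0 (tm H0 H0 kk H1 (idm H0) w) (vru H0) \<in> lin H0 (H0 \<star> H1)"
      by (rule cmp_lin[of _ _ "H0 \<star> kk"]) simp_all
    have "\<theta> V (dc X Y\<^sub>0 V H0 H1 x (gr kk w) f) = on_mor X (H0 \<star> H1) V f (on_mor X (H0 \<star> kk) (H0 \<star> H1) (tm H0 H0 kk H1 (idm H0) w) (on_mor X H0 (H0 \<star> kk) (vru H0) x))"
      unfolding Yo_element[OF ground_Vob w] by (simp add: dc_eq I.u_natural_right nt_natural[OF \<theta>] \<theta>u del: Yo_mor)
    also have "\<dots> = on_mor X H0 V (\<lambda>h\<in>carrier H0. f (vb H0 H1 h (w \<one>\<^bsub>fld B\<^esub>))) x"
      unfolding run_map_eq[OF \<open>H0 \<in> Vob\<close> \<open>H1 \<in> Vob\<close> w f, symmetric] by (simp add: LF_cmp)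
    finally show "\<theta> V (dc X Y\<^sub>0 V H0 H1 x (gr kk w) f) = on_mor X H0 V (\<lambda>h\<in>carrier H0. f (vb H0 H1 h (w \<one>\<^bsub>fld B\<^esub>))) x" .
  next
    fix k assume k: "k \<in> Hom (Ind B) (dt X Y\<^sub>0) X \<and>
     (\<forall>V\<in>Vob. \<forall>H0\<in>Vob. \<forall>H1\<in>Vob. \<forall>x\<in>el X H0. \<forall>w\<in>lin kk H1. \<forall>f\<in>lin (H0 \<star> H1) V.
        k V (dc X Y\<^sub>0 V H0 H1 x (gr kk w) f) = on_mor X H0 V (\<lambda>h\<in>carrier H0. f (vb H0 H1 h (w \<one>\<^bsub>fld B\<^esub>))) x)"
    show "k = \<theta>"
    proof (rule I.ext_J_right[of X X])
      show "k \<in> nt (dt X Y\<^sub>0) X" using k by simp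
      fix L x assume [simp]: "L \<in> Vob" "x \<in> el X L"
      have "(\<lambda>h\<in>carrier L. (idm (L \<star> kk)) (vb L kk h ((idm kk) \<one>\<^bsub>fld B\<^esub>))) = vru L"
        by (auto simp: vru_def)
      moreover have "k (L \<star> kk) (dc X Y\<^sub>0 (L \<star> kk) L kk x e\<^sub>0 (idm (L \<star> kk))) = on_mor X L (L \<star> kk) (\<lambda>h\<in>carrier L. (idm (L \<star> kk)) (vb L kk h ((idm kk) \<one>\<^bsub>fld B\<^esub>))) x"
        by (rule k[THEN conjunct2, rule_format]) simp_all
      ultimately have "k (L \<star> kk) (dc X Y\<^sub>0 (L \<star> kk) L kk x e\<^sub>0 (idm (L \<star> kk))) = on_mor X L (L \<star> kk) (vru L) x" by simp
      then show "k (L \<star> kk) (uu X Y\<^sub>0 L kk x e\<^sub>0) = \<theta> (L \<star> kk) (uu X Y\<^sub>0 L kk x e\<^sub>0)"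
        by (simp add: dc_id \<theta>u)
    qed (simp_all add: \<theta>)
  qed
  then show "ind_run B D X \<in> nt (dt X Y\<^sub>0) X"
    "\<lbrakk>L \<in> Vob; x \<in> el X L\<rbrakk> \<Longrightarrow> ind_run B D X (L \<star> kk) (uu X Y\<^sub>0 L kk x e\<^sub>0) = on_mor X L (L \<star> kk) (vru L) x"
    using \<theta> \<theta>u by simp_all
qed

lemma ind_evl_props:
  assumes [simp]: "X \<in> IO" "Z \<in> IO"
  shows "ind_evl B D N X Z \<in> nt (dt X (hob N X Z)) Z"
    and "\<lbrakk>H \<in> Vob; L \<in> Vob; x \<in> el X H; s \<in> el (hob N X Z) L\<rbrakk> \<Longrightarrow>
      ind_evl B D N X Z (H \<star> L) (uu X (hob N X Z) H L x s) = hnt N X Z L s H x"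
proof -
  obtain \<theta> where \<theta>: "\<theta> \<in> nt (dt X (hob N X Z)) Z" and
    \<theta>u: "\<And>H L x s. H \<in> Vob \<Longrightarrow> L \<in> Vob \<Longrightarrow> x \<in> el X H \<Longrightarrow> s \<in> el (hob N X Z) L \<Longrightarrow>
      \<theta> (H \<star> L) (uu X (hob N X Z) H L x s) = hnt N X Z L s H x"
    using I.ex_evl[of X Z] by auto
  have "ind_evl B D N X Z = \<theta>"
    unfolding ind_evl_def
  proof (rule the_equality, intro conjI ballI)
    show "\<theta> \<in> Hom (Ind B) (dt X (hob N X Z)) Z" using \<theta> by simp
    fix V H0 H1 x s f assume [simp]: "V \<in> Vob" "H0 \<in> Vob" "H1 \<in> Vob" "x \<in> el X H0" "s \<in> el (hob N X Z) H1" "f \<in> lin (H0 \<star> H1) V"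
    show "\<theta> V (dc X (hob N X Z) V H0 H1 x s f) = on_mor Z (H0 \<star> H1) V f (hnt N X Z H1 s H0 x)"
      by (simp add: dc_eq nt_natural[OF \<theta>] \<theta>u)
  next
    fix k assume k: "k \<in> Hom (Ind B) (dt X (hob N X Z)) Z \<and>
      (\<forall>V\<in>Vob. \<forall>H0\<in>Vob. \<forall>H1\<in>Vob. \<forall>x\<in>el X H0. \<forall>s\<in>el (hob N X Z) H1. \<forall>f\<in>lin (H0 \<star> H1) V.
         k V (dc X (hob N X Z) V H0 H1 x s f) = on_mor Z (H0 \<star> H1) V f (hnt N X Z H1 s H0 x))"
    show "k = \<theta>"
    proof (rule uu_ext[of X "hob N X Z" Z])
      show "k \<in> nt (dt X (hob N X Z)) Z" using k by simp
      fix H L x s assume [simp]: "H \<in> Vob" "L \<in> Vob" "x \<in> el X H" "s \<in> el (hob N X Z) L"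
      have "k (H \<star> L) (dc X (hob N X Z) (H \<star> L) H L x s (idm (H \<star> L))) = on_mor Z (H \<star> L) (H \<star> L) (idm (H \<star> L)) (hnt N X Z L s H x)"
        using k by simp
      then show "k (H \<star> L) (uu X (hob N X Z) H L x s) = \<theta> (H \<star> L) (uu X (hob N X Z) H L x s)" by (simp add: dc_id \<theta>u)
    qed (simp_all add: \<theta>)
  qed
  then show "ind_evl B D N X Z \<in> nt (dt X (hob N X Z)) Z"
    "\<lbrakk>H \<in> Vob; L \<in> Vob; x \<in> el X H; s \<in> el (hob N X Z) L\<rbrakk> \<Longrightarrow>
      ind_evl B D N X Z (H \<star> L) (uu X (hob N X Z) H L x s) = hnt N X Z L s H x"
    using \<theta> \<theta>u by simp_all
qed

sublocale I: day_mon B IO LF dt uu Y\<^sub>0 e\<^sub>0 "hob N" "hnt N" MI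
  by unfold_locales
    (simp_all add: ind_clmon_def ind_tmor_props ind_asc_props ind_lun_props ind_run_props ind_evl_props)

lemma closed_monoidal_Ind: "closed_monoidal_category (Ind B) MI"
  using I.closed_monoidal_category_CC unfolding Ind_eq[symmetric] .

end

context vect_setting
begin

subsection \<open>Bases\<close>

text \<open>Defined from above as an intersection, so that no linear combinations have to be
  handled.\<close>

definition span :: "'u vec \<Rightarrow> 'u set \<Rightarrow> 'u set" where
  "span V A = \<Inter>{H. submodule H (fld B) V \<and> A \<subseteq> H}"

lemma carrier_submodule: "V \<in> Vob \<Longrightarrow> submodule (carrier V) (fld B) V"
  by (simp add: submodule_iff)

lemma span_submodule:
  assumes V: "V \<in> Vob" and A: "A \<subseteq> carrier V" shows "submodule (span V A) (fld B) V"
  unfolding submodule_iff[OF V]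
proof (intro conjI ballI)
  show "span V A \<subseteq> carrier V"
    unfolding span_def by (rule Inter_lower) (simp add: carrier_submodule V A)
qed (auto simp: span_def submoduleD[OF _ V])

lemma span_superset: "A \<subseteq> span V A"
  by (auto simp: span_def)

lemma span_minimal: "submodule H (fld B) V \<Longrightarrow> A \<subseteq> H \<Longrightarrow> span V A \<subseteq> H"
  by (auto simp: span_def)

lemma span_mono: "A \<subseteq> A' \<Longrightarrow> span V A \<subseteq> span V A'"
  by (auto simp: span_def)

lemma span_carrier: "V \<in> Vob \<Longrightarrow> A \<subseteq> carrier V \<Longrightarrow> x \<in> span V A \<Longrightarrow> x \<in> carrier V"
  using submoduleD(1)[OF span_submodule] .

text \<open>This and the next two identities control the coefficient c in x - c v under addition,
  scaling and comparison. They serve both \<open>span_insert\<close> and the coordinates of a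
  basis.\<close>

lemma vminus_smult_add:
  assumes "V \<in> Vob" "x \<in> carrier V" "y \<in> carrier V" "v \<in> carrier V" "c \<in> carrier (fld B)" "d \<in> carrier (fld B)"
  shows "(x \<oplus>\<^bsub>V\<^esub> y) \<ominus>\<^bsub>V\<^esub> (c \<oplus>\<^bsub>fld B\<^esub> d) \<odot>\<^bsub>V\<^esub> v = (x \<ominus>\<^bsub>V\<^esub> c \<odot>\<^bsub>V\<^esub> v) \<oplus>\<^bsub>V\<^esub> (y \<ominus>\<^bsub>V\<^esub> d \<odot>\<^bsub>V\<^esub> v)"
proof -
  interpret module "fld B" V using assms(1) by (rule Vob_module)
  show ?thesis using assms by (simp add: a_minus_def smult_l_distr M.minus_add M.a_ac)
qed

lemma vminus_smult_smult:
  assumes "V \<in> Vob" "x \<in> carrier V" "v \<in> carrier V" "c \<in> carrier (fld B)" "d \<in> carrier (fld B)"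
  shows "d \<odot>\<^bsub>V\<^esub> x \<ominus>\<^bsub>V\<^esub> (d \<otimes>\<^bsub>fld B\<^esub> c) \<odot>\<^bsub>V\<^esub> v = d \<odot>\<^bsub>V\<^esub> (x \<ominus>\<^bsub>V\<^esub> c \<odot>\<^bsub>V\<^esub> v)"
proof -
  interpret module "fld B" V using assms(1) by (rule Vob_module)
  show ?thesis using assms by (simp add: a_minus_def smult_r_distr smult_assoc1 smult_r_minus)
qed

lemma vminus_smult_diff:
  assumes "V \<in> Vob" "x \<in> carrier V" "v \<in> carrier V" "c \<in> carrier (fld B)" "d \<in> carrier (fld B)"
  shows "(d \<ominus>\<^bsub>fld B\<^esub> c) \<odot>\<^bsub>V\<^esub> v = (x \<ominus>\<^bsub>V\<^esub> c \<odot>\<^bsub>V\<^esub> v) \<ominus>\<^bsub>V\<^esub> (x \<ominus>\<^bsub>V\<^esub> d \<odot>\<^bsub>V\<^esub> v)"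
proof -
  interpret module "fld B" V using assms(1) by (rule Vob_module)
  have "(x \<ominus>\<^bsub>V\<^esub> c \<odot>\<^bsub>V\<^esub> v) \<ominus>\<^bsub>V\<^esub> (x \<ominus>\<^bsub>V\<^esub> d \<odot>\<^bsub>V\<^esub> v) =
    (x \<oplus>\<^bsub>V\<^esub> \<ominus>\<^bsub>V\<^esub> x) \<oplus>\<^bsub>V\<^esub> (d \<odot>\<^bsub>V\<^esub> v \<oplus>\<^bsub>V\<^esub> \<ominus>\<^bsub>V\<^esub> (c \<odot>\<^bsub>V\<^esub> v))"
    using assms by (simp only: a_minus_def M.minus_add M.minus_minus M.a_ac vneg_closed vadd_closed vsmult_closed)
  also have "\<dots> = (d \<ominus>\<^bsub>fld B\<^esub> c) \<odot>\<^bsub>V\<^esub> v"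
    using assms by (simp add: M.r_neg a_minus_def smult_l_distr smult_l_minus)
  finally show ?thesis ..
qed

text \<open>The vectors x for which such a c exists form a subspace that contains v and A.\<close>

lemma span_insert:
  assumes V: "V \<in> Vob" and A: "A \<subseteq> carrier V" and v: "v \<in> carrier V" and x: "x \<in> span V (insert v A)"
  obtains c where "c \<in> carrier (fld B)" "x \<ominus>\<^bsub>V\<^esub> c \<odot>\<^bsub>V\<^esub> v \<in> span V A"
proof -
  note S = span_submodule[OF V A]
  let ?H = "{x \<in> carrier V. \<exists>c\<in>carrier (fld B). x \<ominus>\<^bsub>V\<^esub> c \<odot>\<^bsub>V\<^esub> v \<in> span V A}"
  have HI: "x \<in> ?H" if "x \<in> carrier V" "c \<in> carrier (fld B)" "x \<ominus>\<^bsub>V\<^esub> c \<odot>\<^bsub>V\<^esub> v \<in> span V A" for x c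
    using that by blast
  have "submodule ?H (fld B) V"
    unfolding submodule_iff[OF V]
  proof (intro conjI ballI)
    have "\<zero>\<^bsub>V\<^esub> \<ominus>\<^bsub>V\<^esub> \<zero>\<^bsub>fld B\<^esub> \<odot>\<^bsub>V\<^esub> v \<in> span V A" using V v submoduleD(2)[OF S V] by simp
    then show "\<zero>\<^bsub>V\<^esub> \<in> ?H" using V by (intro HI[OF _ K.zero_closed]) simp_all
  next
    fix x y assume "x \<in> ?H" "y \<in> ?H"
    then obtain c d where *: "x \<in> carrier V" "y \<in> carrier V" "c \<in> carrier (fld B)" "d \<in> carrier (fld B)"
      "x \<ominus>\<^bsub>V\<^esub> c \<odot>\<^bsub>V\<^esub> v \<in> span V A" "y \<ominus>\<^bsub>V\<^esub> d \<odot>\<^bsub>V\<^esub> v \<in> span V A" by blast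
    then have "(x \<oplus>\<^bsub>V\<^esub> y) \<ominus>\<^bsub>V\<^esub> (c \<oplus>\<^bsub>fld B\<^esub> d) \<odot>\<^bsub>V\<^esub> v \<in> span V A"
      using V v submoduleD(3)[OF S V] by (simp add: vminus_smult_add)
    then show "x \<oplus>\<^bsub>V\<^esub> y \<in> ?H" using * V by (intro HI[of _ "c \<oplus>\<^bsub>fld B\<^esub> d"]) simp_all
  next
    fix d x assume d: "d \<in> carrier (fld B)" and "x \<in> ?H"
    then obtain c where *: "x \<in> carrier V" "c \<in> carrier (fld B)" "x \<ominus>\<^bsub>V\<^esub> c \<odot>\<^bsub>V\<^esub> v \<in> span V A" by blast
    then have "d \<odot>\<^bsub>V\<^esub> x \<ominus>\<^bsub>V\<^esub> (d \<otimes>\<^bsub>fld B\<^esub> c) \<odot>\<^bsub>V\<^esub> v \<in> span V A"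
      using V v d submoduleD(4)[OF S V] by (simp add: vminus_smult_smult)
    then show "d \<odot>\<^bsub>V\<^esub> x \<in> ?H" using * V d by (intro HI[of _ "d \<otimes>\<^bsub>fld B\<^esub> c"]) simp_all
  qed auto
  moreover have "insert v A \<subseteq> ?H"
  proof
    fix a assume "a \<in> insert v A"
    then consider "a = v" | "a \<in> A" by blast
    then show "a \<in> ?H"
    proof cases
      case 1
      then have "a \<ominus>\<^bsub>V\<^esub> \<one>\<^bsub>fld B\<^esub> \<odot>\<^bsub>V\<^esub> v \<in> span V A" using V v submoduleD(2)[OF S V] by simp
      then show ?thesis using 1 v by (intro HI[OF _ K.one_closed]) simp_all
    next
      case 2
      then have "a \<ominus>\<^bsub>V\<^esub> \<zero>\<^bsub>fld B\<^esub> \<odot>\<^bsub>V\<^esub> v \<in> span V A" using V v A span_superset[of A V] by (simp add: subset_iff)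
      then show ?thesis using 2 A by (intro HI[OF _ K.zero_closed]) auto
    qed
  qed
  ultimately have "x \<in> ?H" using subsetD[OF span_minimal x] by blast
  then show thesis using that by blast
qed

definition indep :: "'u vec \<Rightarrow> 'u set \<Rightarrow> bool" where
  "indep V A \<longleftrightarrow> A \<subseteq> carrier V \<and> (\<forall>a\<in>A. a \<notin> span V (A - {a}))"

text \<open>For C in the chain the spans of C - {a} are nested, so their union is a subspace. A
  dependence in the union of the chain therefore already occurs in one member.\<close>

lemma indep_chain:
  assumes V: "V \<in> Vob" and ne: "\<C> \<noteq> {}" and ch: "subset.chain {A. indep V A} \<C>"
  shows "indep V (\<Union>\<C>)"
proof -
  have ind: "indep V C" if "C \<in> \<C>" for C using ch that by (auto simp: subset_chain_def)
  have lin: "C \<subseteq> C' \<or> C' \<subseteq> C" if "C \<in> \<C>" "C' \<in> \<C>" for C C' using ch that by (auto simp: subset_chain_def)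
  have sub: "\<Union>\<C> \<subseteq> carrier V" using ind unfolding indep_def by blast
  have "a \<notin> span V (\<Union>\<C> - {a})" if a: "a \<in> \<Union>\<C>" for a
  proof
    assume as: "a \<in> span V (\<Union>\<C> - {a})"
    obtain C0 where C0: "C0 \<in> \<C>" "a \<in> C0" using a by blast
    \<comment> \<open>Only members containing a are considered, since only they exclude a dependence
      of a; all other members lie inside \<open>C0\<close>.\<close>
    let ?D = "{C \<in> \<C>. a \<in> C}"
    let ?K = "\<Union>C\<in>?D. span V (C - {a})"
    have S: "submodule (span V (C - {a})) (fld B) V" if "C \<in> ?D" for C
      using ind[of C] that V by (intro span_submodule) (auto simp: indep_def)
    have KS: "submodule ?K (fld B) V"
      unfolding submodule_iff[OF V]
    proof (intro conjI ballI)
      show "?K \<subseteq> carrier V" using submoduleD(1)[OF S V] by blast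
      show "\<zero>\<^bsub>V\<^esub> \<in> ?K" using submoduleD(2)[OF S V] C0 by blast
    next
      fix x y assume "x \<in> ?K" "y \<in> ?K"
      then obtain C C' where C: "C \<in> ?D" "C' \<in> ?D" "x \<in> span V (C - {a})" "y \<in> span V (C' - {a})" by blast
      show "x \<oplus>\<^bsub>V\<^esub> y \<in> ?K"
      proof (cases "C \<subseteq> C'")
        case True
        then have "x \<in> span V (C' - {a})" using C span_mono[of "C - {a}" "C' - {a}" V] by blast
        then have "x \<oplus>\<^bsub>V\<^esub> y \<in> span V (C' - {a})" using C submoduleD(3)[OF S V] by blast
        then show ?thesis using C by blast
      next
        case False
        then have "C' \<subseteq> C" using lin C by blast
        then have "y \<in> span V (C - {a})" using C span_mono[of "C' - {a}" "C - {a}" V] by blast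
        then have "x \<oplus>\<^bsub>V\<^esub> y \<in> span V (C - {a})" using C submoduleD(3)[OF S V] by blast
        then show ?thesis using C by blast
      qed
    next
      fix c x assume c: "c \<in> carrier (fld B)" and "x \<in> ?K"
      then obtain C where C: "C \<in> ?D" "x \<in> span V (C - {a})" by blast
      then have "c \<odot>\<^bsub>V\<^esub> x \<in> span V (C - {a})" using c submoduleD(4)[OF S V] by blast
      then show "c \<odot>\<^bsub>V\<^esub> x \<in> ?K" using C by blast
    qed
    have KE: "\<Union>\<C> - {a} \<subseteq> ?K"
    proof
      fix x assume "x \<in> \<Union>\<C> - {a}"
      then obtain C where C: "C \<in> \<C>" "x \<in> C" "x \<noteq> a" by blast
      obtain C' where C': "C' \<in> ?D" "x \<in> C'"
        using lin[OF C(1) C0(1)] C C0 by blast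
      then have "x \<in> span V (C' - {a})" using C span_superset[of "C' - {a}" V] by blast
      then show "x \<in> ?K" using C' by blast
    qed
    obtain C where "C \<in> ?D" "a \<in> span V (C - {a})"
      using subsetD[OF span_minimal[OF KS KE] as] by blast
    then show False using ind[of C] by (simp add: indep_def)
  qed
  then show ?thesis using sub by (simp add: indep_def)
qed

text \<open>A vector v outside the span of a maximal independent set could be added to it: a
  dependence in the enlarged set either has a nonzero coefficient at v, which puts v into the span,
  or is a dependence in the old set.\<close>

lemma ex_maximal_indep:
  assumes V: "V \<in> Vob"
  obtains E where "indep V E" "span V E = carrier V"
proof -
  have "\<exists>E\<in>{A. indep V A}. \<forall>A\<in>{A. indep V A}. E \<subseteq> A \<longrightarrow> A = E"
  proof (rule subset_Zorn_nonempty)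
    have "indep V {}" by (simp add: indep_def)
    then show "{A. indep V A} \<noteq> {}" by blast
  qed (use indep_chain[OF V] in blast)
  then obtain E where E: "indep V E" and mx: "\<And>A. indep V A \<Longrightarrow> E \<subseteq> A \<Longrightarrow> A = E" by blast
  then have Ec: "E \<subseteq> carrier V" by (simp add: indep_def)
  note S = span_submodule[OF V Ec]
  have "v \<in> span V E" if v: "v \<in> carrier V" for v
  proof (rule ccontr)
    assume nv: "v \<notin> span V E"
    then have vE: "v \<notin> E" using span_superset[of E V] by blast
    have "indep V (insert v E)"
      unfolding indep_def
    proof (intro conjI ballI notI)
      show "insert v E \<subseteq> carrier V" using v Ec by blast
      fix a assume a: "a \<in> insert v E" and as: "a \<in> span V (insert v E - {a})"
      show False
      proof (cases "a = v")
        case True then show False using as nv vE by simp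
      next
        case False
        then have aE: "a \<in> E" and ac: "a \<in> carrier V" using a Ec by auto
        have "a \<in> span V (insert v (E - {a}))" using as False by (simp add: insert_Diff_if)
        then obtain c where c: "c \<in> carrier (fld B)" "a \<ominus>\<^bsub>V\<^esub> c \<odot>\<^bsub>V\<^esub> v \<in> span V (E - {a})"
          using span_insert[OF V _ v, of "E - {a}" a] Ec by blast
        have "c \<noteq> \<zero>\<^bsub>fld B\<^esub>"
        proof
          assume "c = \<zero>\<^bsub>fld B\<^esub>"
          then show False using c(2) E aE ac v V unfolding indep_def by simp
        qed
        then have u: "c \<in> Units (fld B)" using c(1) by (simp add: K.field_Units)
        then have ci: "inv\<^bsub>fld B\<^esub> c \<in> carrier (fld B)" "inv\<^bsub>fld B\<^esub> c \<otimes>\<^bsub>fld B\<^esub> c = \<one>\<^bsub>fld B\<^esub>"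
          by (simp_all add: K.Units_l_inv)
        interpret module "fld B" V using V by (rule Vob_module)
        \<comment> \<open>c v is the difference of a - 0 v and a - c v, both of which lie in the
          span of E; dividing by c contradicts the choice of v.\<close>
        have "c \<odot>\<^bsub>V\<^esub> v = (c \<ominus>\<^bsub>fld B\<^esub> \<zero>\<^bsub>fld B\<^esub>) \<odot>\<^bsub>V\<^esub> v" using c by (simp add: a_minus_def)
        also have "\<dots> = (a \<ominus>\<^bsub>V\<^esub> \<zero>\<^bsub>fld B\<^esub> \<odot>\<^bsub>V\<^esub> v) \<ominus>\<^bsub>V\<^esub> (a \<ominus>\<^bsub>V\<^esub> c \<odot>\<^bsub>V\<^esub> v)"
          using c by (intro vminus_smult_diff[OF V ac v]) simp_all
        also have "\<dots> \<in> span V E"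
        proof (rule submodule_minus[OF V S])
          show "a \<ominus>\<^bsub>V\<^esub> \<zero>\<^bsub>fld B\<^esub> \<odot>\<^bsub>V\<^esub> v \<in> span V E" using V v ac aE span_superset[of E V] by (simp add: subset_iff)
          show "a \<ominus>\<^bsub>V\<^esub> c \<odot>\<^bsub>V\<^esub> v \<in> span V E" using c(2) span_mono[of "E - {a}" E V] by blast
        qed
        finally have "inv\<^bsub>fld B\<^esub> c \<odot>\<^bsub>V\<^esub> (c \<odot>\<^bsub>V\<^esub> v) \<in> span V E" using ci submoduleD(4)[OF S V] by blast
        then show False using nv V v ci c by (simp add: vsmult_smult)
      qed
    qed
    then show False using mx[of "insert v E"] vE by blast
  qed
  then have "span V E = carrier V" using submoduleD(1)[OF S V] by blast
  then show thesis using that E by blast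
qed

text \<open>Independence is expressed by dual functionals. This is the form in which bases are used,
  and it passes directly to tensor products.\<close>

definition basis :: "'u vec \<Rightarrow> 'u set \<Rightarrow> bool" where
  "basis V E \<longleftrightarrow> V \<in> Vob \<and> E \<subseteq> carrier V \<and> span V E = carrier V \<and>
     (\<forall>e\<in>E. \<exists>\<phi>\<in>lin V kk. \<forall>e'\<in>E. \<phi> e' = (if e' = e then \<one>\<^bsub>fld B\<^esub> else \<zero>\<^bsub>fld B\<^esub>))"

lemma ground_minus_eq_zero:
  "x \<in> carrier (fld B) \<Longrightarrow> y \<in> carrier (fld B) \<Longrightarrow> x \<ominus>\<^bsub>fld B\<^esub> y = \<zero>\<^bsub>fld B\<^esub> \<longleftrightarrow> x = y"
  by (metis a_minus_def K.add.inv_closed K.minus_equality K.minus_minus K.r_neg)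

text \<open>The coordinate of x at e is the scalar c for which x - c e lies in the span of the other
  basis vectors; its uniqueness makes it linear in x.\<close>

lemma ex_basis:
  assumes V: "V \<in> Vob" obtains E where "basis V E"
proof -
  obtain E where E: "indep V E" and sp: "span V E = carrier V" using ex_maximal_indep[OF V] .
  have Ec: "E \<subseteq> carrier V" using E by (simp add: indep_def)
  have "\<exists>\<phi>\<in>lin V kk. \<forall>e'\<in>E. \<phi> e' = (if e' = e then \<one>\<^bsub>fld B\<^esub> else \<zero>\<^bsub>fld B\<^esub>)" if e: "e \<in> E" for e
  proof -
    have ec: "e \<in> carrier V" using e Ec by blast
    have Ec': "E - {e} \<subseteq> carrier V" using Ec by blast
    note S = span_submodule[OF V Ec']
    define \<phi> where "\<phi> x = (SOME c. c \<in> carrier (fld B) \<and> x \<ominus>\<^bsub>V\<^esub> c \<odot>\<^bsub>V\<^esub> e \<in> span V (E - {e}))" for x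
    have \<phi>: "\<phi> x \<in> carrier (fld B)" "x \<ominus>\<^bsub>V\<^esub> \<phi> x \<odot>\<^bsub>V\<^esub> e \<in> span V (E - {e})" if "x \<in> carrier V" for x
    proof -
      have "x \<in> span V (insert e (E - {e}))" using that sp e by (simp add: insert_absorb)
      then obtain c where "c \<in> carrier (fld B)" "x \<ominus>\<^bsub>V\<^esub> c \<odot>\<^bsub>V\<^esub> e \<in> span V (E - {e})"
        using span_insert[OF V Ec' ec, of x] by blast
      then have "\<phi> x \<in> carrier (fld B) \<and> x \<ominus>\<^bsub>V\<^esub> \<phi> x \<odot>\<^bsub>V\<^esub> e \<in> span V (E - {e})"
        unfolding \<phi>_def by (intro someI[of "\<lambda>c. c \<in> carrier (fld B) \<and> x \<ominus>\<^bsub>V\<^esub> c \<odot>\<^bsub>V\<^esub> e \<in> span V (E - {e})"]) simp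
      then show "\<phi> x \<in> carrier (fld B)" "x \<ominus>\<^bsub>V\<^esub> \<phi> x \<odot>\<^bsub>V\<^esub> e \<in> span V (E - {e})" by auto
    qed
    \<comment> \<open>Two different scalars would put a nonzero multiple of e, hence e itself, into
      the span of the other basis vectors.\<close>
    have uniq: "\<phi> x = c" if x: "x \<in> carrier V" and c: "c \<in> carrier (fld B)" "x \<ominus>\<^bsub>V\<^esub> c \<odot>\<^bsub>V\<^esub> e \<in> span V (E - {e})" for x c
    proof (rule ccontr)
      let ?d = "\<phi> x \<ominus>\<^bsub>fld B\<^esub> c"
      assume "\<phi> x \<noteq> c"
      then have d: "?d \<in> carrier (fld B)" "?d \<noteq> \<zero>\<^bsub>fld B\<^esub>" using \<phi> x c by (simp_all add: ground_minus_eq_zero)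
      then have u: "?d \<in> Units (fld B)" by (simp add: K.field_Units)
      have "?d \<odot>\<^bsub>V\<^esub> e = (x \<ominus>\<^bsub>V\<^esub> c \<odot>\<^bsub>V\<^esub> e) \<ominus>\<^bsub>V\<^esub> (x \<ominus>\<^bsub>V\<^esub> \<phi> x \<odot>\<^bsub>V\<^esub> e)"
        by (rule vminus_smult_diff[OF V x ec c(1) \<phi>(1)[OF x]])
      also have "\<dots> \<in> span V (E - {e})" by (rule submodule_minus[OF V S c(2) \<phi>(2)[OF x]])
      finally have "inv\<^bsub>fld B\<^esub> ?d \<odot>\<^bsub>V\<^esub> (?d \<odot>\<^bsub>V\<^esub> e) \<in> span V (E - {e})"
        using u submoduleD(4)[OF S V] by blast
      then have "e \<in> span V (E - {e})" using V ec d u by (simp add: vsmult_smult K.Units_l_inv)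
      then show False using E e unfolding indep_def by blast
    qed
    have "restrict \<phi> (carrier V) \<in> lin V kk"
    proof (rule lin_restrictI[OF V])
      fix x y assume xy: "x \<in> carrier V" "y \<in> carrier V"
      have "\<phi> (x \<oplus>\<^bsub>V\<^esub> y) = \<phi> x \<oplus>\<^bsub>fld B\<^esub> \<phi> y"
        using xy \<phi> V ec submoduleD(3)[OF S V] by (intro uniq) (simp_all add: vminus_smult_add)
      then show "\<phi> (x \<oplus>\<^bsub>V\<^esub> y) = \<phi> x \<oplus>\<^bsub>kk\<^esub> \<phi> y" by simp
    next
      fix c x assume xc: "c \<in> carrier (fld B)" "x \<in> carrier V"
      have "\<phi> (c \<odot>\<^bsub>V\<^esub> x) = c \<otimes>\<^bsub>fld B\<^esub> \<phi> x"
        using xc \<phi> V ec submoduleD(4)[OF S V] by (intro uniq) (simp_all add: vminus_smult_smult)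
      then show "\<phi> (c \<odot>\<^bsub>V\<^esub> x) = c \<odot>\<^bsub>kk\<^esub> \<phi> x" by simp
    qed (simp add: \<phi>)
    moreover have "\<phi> e' = (if e' = e then \<one>\<^bsub>fld B\<^esub> else \<zero>\<^bsub>fld B\<^esub>)" if e': "e' \<in> E" for e'
    proof (cases "e' = e")
      case True
      then show ?thesis using V ec submoduleD(2)[OF S V] by (simp add: uniq)
    next
      case False
      then have "e' \<in> span V (E - {e})" using e' span_superset[of "E - {e}" V] by blast
      then show ?thesis using False V ec e' Ec by (simp add: uniq subset_iff)
    qed
    ultimately show ?thesis using Ec by (intro bexI[of _ "restrict \<phi> (carrier V)"]) (auto simp: subset_iff)
  qed
  then have "basis V E" using V Ec sp by (simp add: basis_def)
  then show thesis by (rule that)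
qed

lemma lin_eq_on_span:
  assumes V: "V \<in> Vob" and W: "W \<in> Vob" and f: "f \<in> lin V W" and g: "g \<in> lin V W" and sp: "span V A = carrier V"
    and A: "A \<subseteq> carrier V" and eq: "\<And>a. a \<in> A \<Longrightarrow> f a = g a"
  shows "f = g"
proof (rule lin_eqI[OF f g])
  fix x assume x: "x \<in> carrier V"
  have "span V A \<subseteq> {x \<in> carrier V. f x = g x}"
    by (rule span_minimal[OF kernel_submodule[OF V W f g]]) (use A eq in blast)
  then show "f x = g x" using x sp by blast
qed

subsection \<open>Sums with finite support\<close>

text \<open>\<open>finsum\<close> over an infinite set is only a default value. Hence the
  restriction to the support, which is finite wherever the sum is used as an actual sum.\<close>

definition fsum :: "'u vec \<Rightarrow> 'u set \<Rightarrow> ('u \<Rightarrow> 'u) \<Rightarrow> 'u" where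
  "fsum W J a = finsum W a {j \<in> J. a j \<noteq> \<zero>\<^bsub>W\<^esub>}"

lemma fsum_eq:
  assumes W: "W \<in> Vob" and a: "\<And>j. j \<in> J \<Longrightarrow> a j \<in> carrier W" and F: "finite F" "F \<subseteq> J"
    and 0: "\<And>j. j \<in> J - F \<Longrightarrow> a j = \<zero>\<^bsub>W\<^esub>"
  shows "fsum W J a = finsum W a F"
proof -
  interpret abelian_monoid W using W by (rule Vob_monoid)
  show ?thesis unfolding fsum_def
    by (rule add.finprod_mono_neutral_cong_left) (use F a 0 in auto)
qed

lemma fsum_closed [simp]: "W \<in> Vob \<Longrightarrow> (\<And>j. j \<in> J \<Longrightarrow> a j \<in> carrier W) \<Longrightarrow> fsum W J a \<in> carrier W"
  unfolding fsum_def by (rule abelian_monoid.finsum_closed[OF Vob_monoid]) auto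

lemma fsum_add:
  assumes W: "W \<in> Vob" and a: "\<And>j. j \<in> J \<Longrightarrow> a j \<in> carrier W" and b: "\<And>j. j \<in> J \<Longrightarrow> b j \<in> carrier W"
    and fa: "finite {j \<in> J. a j \<noteq> \<zero>\<^bsub>W\<^esub>}" and fb: "finite {j \<in> J. b j \<noteq> \<zero>\<^bsub>W\<^esub>}"
  shows "fsum W J (\<lambda>j. a j \<oplus>\<^bsub>W\<^esub> b j) = fsum W J a \<oplus>\<^bsub>W\<^esub> fsum W J b"
proof -
  interpret abelian_monoid W using W by (rule Vob_monoid)
  let ?F = "{j \<in> J. a j \<noteq> \<zero>\<^bsub>W\<^esub>} \<union> {j \<in> J. b j \<noteq> \<zero>\<^bsub>W\<^esub>}"
  have F: "finite ?F" "?F \<subseteq> J" using fa fb by auto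
  have "fsum W J (\<lambda>j. a j \<oplus>\<^bsub>W\<^esub> b j) = finsum W (\<lambda>j. a j \<oplus>\<^bsub>W\<^esub> b j) ?F"
    by (rule fsum_eq[OF W _ F]) (use a b W in auto)
  also have "\<dots> = finsum W a ?F \<oplus>\<^bsub>W\<^esub> finsum W b ?F"
    by (rule finsum_addf) (use a b in auto)
  also have "finsum W a ?F = fsum W J a" by (rule fsum_eq[OF W a F, symmetric]) auto
  also have "finsum W b ?F = fsum W J b" by (rule fsum_eq[OF W b F, symmetric]) auto
  finally show ?thesis .
qed

lemma fsum_lin:
  assumes W: "W \<in> Vob" and W': "W' \<in> Vob" and f: "f \<in> lin W W'" and a: "\<And>j. j \<in> J \<Longrightarrow> a j \<in> carrier W"
    and fa: "finite {j \<in> J. a j \<noteq> \<zero>\<^bsub>W\<^esub>}"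
  shows "f (fsum W J a) = fsum W' J (\<lambda>j. f (a j))"
proof -
  have "f (fsum W J a) = finsum W' (\<lambda>j. f (a j)) {j \<in> J. a j \<noteq> \<zero>\<^bsub>W\<^esub>}"
    unfolding fsum_def using a by (intro lin_finsum[OF f W W' fa]) auto
  also have "\<dots> = fsum W' J (\<lambda>j. f (a j))"
    by (rule fsum_eq[OF W' _ fa, symmetric]) (use lin_closed[OF f a] lin_zero[OF f W W'] in auto)
  finally show ?thesis .
qed

lemma fsum_single:
  assumes W: "W \<in> Vob" and a: "\<And>j. j \<in> J \<Longrightarrow> a j \<in> carrier W" and i: "i \<in> J" and 0: "\<And>j. j \<in> J \<Longrightarrow> j \<noteq> i \<Longrightarrow> a j = \<zero>\<^bsub>W\<^esub>"
  shows "fsum W J a = a i"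
proof -
  interpret abelian_monoid W using W by (rule Vob_monoid)
  have "fsum W J a = finsum W a {i}" by (rule fsum_eq[OF W a]) (use i 0 in auto)
  then show ?thesis using a[OF i] by (simp add: finsum_insert)
qed

lemma smult_lin: "W \<in> Vob \<Longrightarrow> c \<in> carrier (fld B) \<Longrightarrow> (\<lambda>w\<in>carrier W. c \<odot>\<^bsub>W\<^esub> w) \<in> lin W W"
  by (rule lin_restrictI) (simp_all add: vsmult_add vsmult_comm[of W c])

lemma fsum_cong:
  assumes W: "W \<in> Vob" and b: "\<And>j. j \<in> J \<Longrightarrow> b j = b' j" and b': "\<And>j. j \<in> J \<Longrightarrow> b' j \<in> carrier W"
  shows "fsum W J b = fsum W J b'"
proof -
  have "{j \<in> J. b j \<noteq> \<zero>\<^bsub>W\<^esub>} = {j \<in> J. b' j \<noteq> \<zero>\<^bsub>W\<^esub>}" using b by auto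
  then show ?thesis unfolding fsum_def
    using abelian_monoid.finsum_cong'[OF Vob_monoid[OF W], of "{j \<in> J. b' j \<noteq> \<zero>\<^bsub>W\<^esub>}" _ b' b] b b' by simp
qed

context
  fixes V E assumes bas: "basis V E"
begin

lemma basis_Vob: "V \<in> Vob" and basis_subset: "E \<subseteq> carrier V" and basis_span: "span V E = carrier V"
  using bas by (simp_all add: basis_def)

lemma basis_mem: "e \<in> E \<Longrightarrow> e \<in> carrier V"
  using basis_subset by blast

definition coord where
  "coord e = (SOME \<phi>. \<phi> \<in> lin V kk \<and> (\<forall>e'\<in>E. \<phi> e' = (if e' = e then \<one>\<^bsub>fld B\<^esub> else \<zero>\<^bsub>fld B\<^esub>)))"

lemma coord: "e \<in> E \<Longrightarrow> coord e \<in> lin V kk \<and> (\<forall>e'\<in>E. coord e e' = (if e' = e then \<one>\<^bsub>fld B\<^esub> else \<zero>\<^bsub>fld B\<^esub>))"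
proof -
  assume "e \<in> E"
  then have "\<exists>\<phi>. \<phi> \<in> lin V kk \<and> (\<forall>e'\<in>E. \<phi> e' = (if e' = e then \<one>\<^bsub>fld B\<^esub> else \<zero>\<^bsub>fld B\<^esub>))"
    using bas unfolding basis_def by blast
  then show ?thesis unfolding coord_def by (rule someI_ex)
qed

lemma coord_lin: "e \<in> E \<Longrightarrow> coord e \<in> lin V kk"
  and coord_basis: "e \<in> E \<Longrightarrow> e' \<in> E \<Longrightarrow> coord e e' = (if e' = e then \<one>\<^bsub>fld B\<^esub> else \<zero>\<^bsub>fld B\<^esub>)"
  using coord by auto

lemma coord_closed: "e \<in> E \<Longrightarrow> x \<in> carrier V \<Longrightarrow> coord e x \<in> carrier (fld B)"
  using lin_closed[OF coord_lin] by simp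

definition supp where "supp x = {e \<in> E. coord e x \<noteq> \<zero>\<^bsub>fld B\<^esub>}"

text \<open>The vectors with finite support form a subspace, and it contains the basis.\<close>

lemma finite_supp:
  assumes x: "x \<in> carrier V" shows "finite (supp x)"
proof -
  note V = basis_Vob
  have "submodule {x \<in> carrier V. finite (supp x)} (fld B) V"
    unfolding submodule_iff[OF V]
  proof (intro conjI ballI)
    have "supp \<zero>\<^bsub>V\<^esub> = {}" using lin_zero[OF coord_lin V ground_Vob] by (auto simp: supp_def)
    then show "\<zero>\<^bsub>V\<^esub> \<in> {x \<in> carrier V. finite (supp x)}" using V by simp
  next
    fix x y assume *: "x \<in> {x \<in> carrier V. finite (supp x)}" "y \<in> {x \<in> carrier V. finite (supp x)}"
    have "supp (x \<oplus>\<^bsub>V\<^esub> y) \<subseteq> supp x \<union> supp y" using * lin_add[OF coord_lin] by (auto simp: supp_def)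
    then show "x \<oplus>\<^bsub>V\<^esub> y \<in> {x \<in> carrier V. finite (supp x)}" using * V by (auto intro: finite_subset)
  next
    fix c x assume *: "c \<in> carrier (fld B)" "x \<in> {x \<in> carrier V. finite (supp x)}"
    have "supp (c \<odot>\<^bsub>V\<^esub> x) \<subseteq> supp x" using * lin_smult[OF coord_lin] by (auto simp: supp_def)
    then show "c \<odot>\<^bsub>V\<^esub> x \<in> {x \<in> carrier V. finite (supp x)}" using * V by (auto intro: finite_subset)
  qed auto
  moreover have "E \<subseteq> {x \<in> carrier V. finite (supp x)}"
  proof
    fix e assume e: "e \<in> E"
    have "supp e \<subseteq> {e}" using e coord_basis by (auto simp: supp_def split: if_splits)
    then show "e \<in> {x \<in> carrier V. finite (supp x)}" using e basis_mem by (auto intro: finite_subset)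
  qed
  ultimately show ?thesis using span_minimal[of "{x \<in> carrier V. finite (supp x)}" V E] x basis_span by blast
qed

lemma basis_sum:
  assumes W: "W \<in> Vob" and f: "\<And>e. e \<in> E \<Longrightarrow> f e \<in> carrier W"
  defines "h \<equiv> \<lambda>x. fsum W E (\<lambda>e. coord e x \<odot>\<^bsub>W\<^esub> f e)"
  shows "restrict h (carrier V) \<in> lin V W" and "\<And>e. e \<in> E \<Longrightarrow> h e = f e"
proof -
  note V = basis_Vob
  have cl [simp]: "coord e x \<odot>\<^bsub>W\<^esub> f e \<in> carrier W" if "e \<in> E" "x \<in> carrier V" for e x
    using that W f coord_closed by simp
  have fin: "finite {e \<in> E. coord e x \<odot>\<^bsub>W\<^esub> f e \<noteq> \<zero>\<^bsub>W\<^esub>}" if "x \<in> carrier V" for x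
  proof (rule finite_subset[OF _ finite_supp[OF that]])
    show "{e \<in> E. coord e x \<odot>\<^bsub>W\<^esub> f e \<noteq> \<zero>\<^bsub>W\<^esub>} \<subseteq> supp x" using W f by (auto simp: supp_def)
  qed
  show "restrict h (carrier V) \<in> lin V W"
  proof (rule lin_restrictI[OF V])
    fix x assume "x \<in> carrier V"
    then show "h x \<in> carrier W" using W unfolding h_def by simp
  next
    fix x y assume xy: "x \<in> carrier V" "y \<in> carrier V"
    have "h (x \<oplus>\<^bsub>V\<^esub> y) = fsum W E (\<lambda>e. coord e x \<odot>\<^bsub>W\<^esub> f e \<oplus>\<^bsub>W\<^esub> coord e y \<odot>\<^bsub>W\<^esub> f e)"
      unfolding h_def using xy W f
      by (intro fsum_cong) (simp_all add: lin_add[OF coord_lin] vadd_smult coord_closed)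
    also have "\<dots> = h x \<oplus>\<^bsub>W\<^esub> h y"
      unfolding h_def using xy by (intro fsum_add W fin) simp_all
    finally show "h (x \<oplus>\<^bsub>V\<^esub> y) = h x \<oplus>\<^bsub>W\<^esub> h y" .
  next
    fix c x assume cx: "c \<in> carrier (fld B)" "x \<in> carrier V"
    \<comment> \<open>Scaling by c is itself a linear map, so it commutes with the sum by
      \<open>fsum_lin\<close>.\<close>
    have "c \<odot>\<^bsub>W\<^esub> h x = (\<lambda>w\<in>carrier W. c \<odot>\<^bsub>W\<^esub> w) (h x)" using cx W unfolding h_def by simp
    also have "\<dots> = fsum W E (\<lambda>e. (\<lambda>w\<in>carrier W. c \<odot>\<^bsub>W\<^esub> w) (coord e x \<odot>\<^bsub>W\<^esub> f e))"
      unfolding h_def by (rule fsum_lin[OF W W smult_lin[OF W cx(1)] _ fin]) (use cx in simp_all)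
    also have "\<dots> = h (c \<odot>\<^bsub>V\<^esub> x)"
      unfolding h_def using cx W V f
      by (intro fsum_cong) (simp_all add: lin_smult[OF coord_lin] vsmult_smult coord_closed)
    finally show "h (c \<odot>\<^bsub>V\<^esub> x) = c \<odot>\<^bsub>W\<^esub> h x" ..
  qed
  show "h e = f e" if e: "e \<in> E" for e
  proof -
    have "h e = coord e e \<odot>\<^bsub>W\<^esub> f e"
      unfolding h_def
    proof (rule fsum_single[OF W _ e])
      fix j assume "j \<in> E" "j \<noteq> e"
      then show "coord j e \<odot>\<^bsub>W\<^esub> f j = \<zero>\<^bsub>W\<^esub>" using e W f coord_basis[of j e] by simp
    qed (use e basis_mem in simp_all)
    then show ?thesis using e W f coord_basis[of e e] by simp
  qed
qed

lemma basis_lift: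
  assumes W: "W \<in> Vob" and f: "\<And>e. e \<in> E \<Longrightarrow> f e \<in> carrier W"
  shows "\<exists>h. h \<in> lin V W \<and> (\<forall>e\<in>E. h e = f e)"
proof (intro exI conjI ballI)
  show "restrict (\<lambda>x. fsum W E (\<lambda>e. coord e x \<odot>\<^bsub>W\<^esub> f e)) (carrier V) \<in> lin V W" by (rule basis_sum(1)[OF W f])
  fix e assume e: "e \<in> E"
  then show "restrict (\<lambda>x. fsum W E (\<lambda>e. coord e x \<odot>\<^bsub>W\<^esub> f e)) (carrier V) e = f e"
    unfolding restrict_apply'[OF basis_mem[OF e]] by (intro basis_sum(2)[OF W f])
qed

lemma basis_ext:
  assumes "W \<in> Vob" "f \<in> lin V W" "g \<in> lin V W" "\<And>e. e \<in> E \<Longrightarrow> f e = g e" shows "f = g"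
  by (rule lin_eq_on_span[OF basis_Vob assms(1-3) basis_span basis_subset assms(4)])

text \<open>The linear extension of the inclusion of the basis is the identity, which expands x in
  terms of its coordinates.\<close>

lemma basis_coord_zero:
  assumes x: "x \<in> carrier V" and 0: "\<And>e. e \<in> E \<Longrightarrow> coord e x = \<zero>\<^bsub>fld B\<^esub>" shows "x = \<zero>\<^bsub>V\<^esub>"
proof -
  note S = basis_sum[OF basis_Vob basis_mem]
  have e: "restrict (\<lambda>x. fsum V E (\<lambda>e. coord e x \<odot>\<^bsub>V\<^esub> e)) (carrier V) = idm V"
    by (rule basis_ext[OF basis_Vob S(1) idm_lin[OF basis_Vob]]) (simp_all add: basis_mem, rule S(2))
  have "x = fsum V E (\<lambda>e. coord e x \<odot>\<^bsub>V\<^esub> e)" using fun_cong[OF e, of x] x by simp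
  also have "{e \<in> E. coord e x \<odot>\<^bsub>V\<^esub> e \<noteq> \<zero>\<^bsub>V\<^esub>} = {}" using 0 basis_Vob basis_mem by auto
  then have "fsum V E (\<lambda>e. coord e x \<odot>\<^bsub>V\<^esub> e) = \<zero>\<^bsub>V\<^esub>"
    unfolding fsum_def by (simp only: abelian_monoid.finsum_empty[OF Vob_monoid[OF basis_Vob]])
  finally show ?thesis .
qed

end

text \<open>The quotient map modulo the span kills all pure tensors, so it is zero by uniqueness in
  the universal property.\<close>

lemma span_pure_tensors:
  assumes V [simp]: "V \<in> Vob" and W [simp]: "W \<in> Vob"
  shows "span (V \<star> W) {vb V W x y | x y. x \<in> carrier V \<and> y \<in> carrier W} = carrier (V \<star> W)" (is "span _ ?A = _")
proof -
  have A: "?A \<subseteq> carrier (V \<star> W)" by auto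
  note S = span_submodule[OF vt_Vob[OF V W] A]
  let ?H = "span (V \<star> W) ?A"
  let ?q = "restrict (quot_rep (V \<star> W) ?H) (carrier (V \<star> W))"
  have "?q = (\<lambda>t\<in>carrier (V \<star> W). \<zero>\<^bsub>quot (V \<star> W) ?H\<^esub>)"
  proof (rule vt_ext[OF V W quot_Vob[OF _ S] quot_map_lin[OF _ S]])
    fix x y assume xy: "x \<in> carrier V" "y \<in> carrier W"
    then have "vb V W x y \<in> ?H" using span_superset[of ?A "V \<star> W"] by blast
    then show "?q (vb V W x y) = (\<lambda>t\<in>carrier (V \<star> W). \<zero>\<^bsub>quot (V \<star> W) ?H\<^esub>) (vb V W x y)"
      using xy quot_map_zero[OF vt_Vob[OF V W] S] by simp
  qed (simp_all add: quot_Vob[OF _ S])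
  note qz = fun_cong[OF this]
  have "quot_rep (V \<star> W) ?H t = \<zero>\<^bsub>quot (V \<star> W) ?H\<^esub>" if "t \<in> carrier (V \<star> W)" for t
    using qz[of t] that by simp
  then show ?thesis using quot_map_zero[OF vt_Vob[OF V W] S] span_carrier[OF vt_Vob[OF V W] A] by blast
qed

lemma span_closed_lin:
  assumes V: "V \<in> Vob" and W: "W \<in> Vob" and f: "f \<in> lin V W" and H: "submodule H (fld B) W"
    and sp: "span V A = carrier V" and A: "\<And>a. a \<in> A \<Longrightarrow> a \<in> carrier V \<and> f a \<in> H" and x: "x \<in> carrier V"
  shows "f x \<in> H"
proof -
  have "submodule {x \<in> carrier V. f x \<in> H} (fld B) V"
    using V W lin_zero[OF f V W] by (auto simp: submodule_iff[OF V] submoduleD[OF H W] lin_add[OF f] lin_smult[OF f])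
  from span_minimal[OF this, of A] show ?thesis using A sp x by blast
qed

text \<open>Products of coordinate functionals are bilinear and induce the dual functionals.
  Spanning is obtained in one variable at a time.\<close>

lemma basis_tensor:
  assumes E: "basis V E" and F: "basis W F"
  shows "basis (V \<star> W) {vb V W x y | x y. x \<in> E \<and> y \<in> F}" (is "basis _ ?J")
proof -
  note [simp] = basis_Vob[OF E] basis_Vob[OF F] basis_mem[OF E] basis_mem[OF F]
  have J: "?J \<subseteq> carrier (V \<star> W)" by auto
  note S = span_submodule[OF vt_Vob[OF basis_Vob[OF E] basis_Vob[OF F]] J]
  have 1: "vb V W x y \<in> span (V \<star> W) ?J" if x: "x \<in> E" and y: "y \<in> carrier W" for x y
  proof -
    have l: "restrict (vb V W x) (carrier W) \<in> lin W (V \<star> W)" using x by (intro vb_left_lin) simp_all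
    have "restrict (vb V W x) (carrier W) y \<in> span (V \<star> W) ?J"
    proof (rule span_closed_lin[OF _ _ l S basis_span[OF F] _ y])
      fix a assume "a \<in> F"
      then show "a \<in> carrier W \<and> restrict (vb V W x) (carrier W) a \<in> span (V \<star> W) ?J"
        using x span_superset[of ?J "V \<star> W"] by auto
    qed simp_all
    then show ?thesis using y by simp
  qed
  have 2: "vb V W x y \<in> span (V \<star> W) ?J" if x: "x \<in> carrier V" and y: "y \<in> carrier W" for x y
  proof -
    have l: "(\<lambda>x\<in>carrier V. vb V W x y) \<in> lin V (V \<star> W)" using y by (intro vb_right_lin) simp_all
    have "(\<lambda>x\<in>carrier V. vb V W x y) x \<in> span (V \<star> W) ?J"
      by (rule span_closed_lin[OF _ _ l S basis_span[OF E] _ x]) (use 1 y in simp_all)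
    then show ?thesis using x by simp
  qed
  have "carrier (V \<star> W) \<subseteq> span (V \<star> W) ?J"
    unfolding span_pure_tensors[OF basis_Vob[OF E] basis_Vob[OF F], symmetric]
    by (rule span_minimal[OF S]) (use 2 in blast)
  moreover have "\<exists>\<phi>\<in>lin (V \<star> W) kk. \<forall>j'\<in>?J. \<phi> j' = (if j' = j then \<one>\<^bsub>fld B\<^esub> else \<zero>\<^bsub>fld B\<^esub>)" if j: "j \<in> ?J" for j
  proof -
    obtain x y where xy: "x \<in> E" "y \<in> F" "j = vb V W x y" using j by blast
    note [simp] = coord_closed[OF E xy(1)] coord_closed[OF F xy(2)]
    have "bilinear_on B V W kk (\<lambda>v w. coord V E x v \<otimes>\<^bsub>fld B\<^esub> coord W F y w)"
      by (rule bilinear_onI)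
        (simp_all add: lin_add[OF coord_lin[OF E xy(1)]] lin_add[OF coord_lin[OF F xy(2)]]
         lin_smult[OF coord_lin[OF E xy(1)]] lin_smult[OF coord_lin[OF F xy(2)]] K.l_distr K.r_distr K.m_ac)
    from vt_lift[OF _ _ _ this] obtain \<phi> where \<phi>: "\<phi> \<in> lin (V \<star> W) kk"
      and \<phi>v: "\<And>v w. v \<in> carrier V \<Longrightarrow> w \<in> carrier W \<Longrightarrow> \<phi> (vb V W v w) = coord V E x v \<otimes>\<^bsub>fld B\<^esub> coord W F y w" by auto
    have *: "\<phi> (vb V W v w) = (if v = x \<and> w = y then \<one>\<^bsub>fld B\<^esub> else \<zero>\<^bsub>fld B\<^esub>)" if "v \<in> E" "w \<in> F" for v w
      using that xy by (simp add: \<phi>v coord_basis[OF E] coord_basis[OF F])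
    \<comment> \<open>Different pairs might yield equal tensors; if \<open>j' = j\<close>, the value
      at the pair (x, y) decides.\<close>
    have "\<phi> j' = (if j' = j then \<one>\<^bsub>fld B\<^esub> else \<zero>\<^bsub>fld B\<^esub>)" if j': "j' \<in> ?J" for j'
    proof -
      obtain v w where vw: "v \<in> E" "w \<in> F" "j' = vb V W v w" using j' by blast
      show ?thesis using *[OF vw(1,2)] *[OF xy(1,2)] vw xy by auto
    qed
    then show ?thesis using \<phi> by blast
  qed
  ultimately show ?thesis using J span_carrier[OF _ J] by (auto simp: basis_def)
qed

subsection \<open>Subfunctors and quotients\<close>

definition subfun :: "'u vfun \<Rightarrow> ('u vec \<Rightarrow> 'u set) \<Rightarrow> bool" where
  "subfun X N \<longleftrightarrow> (\<forall>W\<in>Vob. submodule (N W) (fld B) (on_ob X W)) \<and>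
     (\<forall>W\<in>Vob. \<forall>W'\<in>Vob. \<forall>f\<in>lin W W'. \<forall>x\<in>N W. on_mor X W W' f x \<in> N W')"

definition subF :: "'u vfun \<Rightarrow> ('u vec \<Rightarrow> 'u set) \<Rightarrow> 'u vfun" where
  "subF X N = \<lparr> on_ob = (\<lambda>W. (on_ob X W)\<lparr>carrier := N W\<rparr>), on_mor = (\<lambda>W W' f. restrict (on_mor X W W' f) (N W))\<rparr>"

definition quoF :: "'u vfun \<Rightarrow> ('u vec \<Rightarrow> 'u set) \<Rightarrow> 'u vfun" where
  "quoF X N = \<lparr> on_ob = (\<lambda>W. quot (on_ob X W) (N W)),
     on_mor = (\<lambda>W W' f. \<lambda>z\<in>carrier (quot (on_ob X W) (N W)). quot_rep (on_ob X W') (N W') (on_mor X W W' f z))\<rparr>"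

definition qpr :: "'u vfun \<Rightarrow> ('u vec \<Rightarrow> 'u set) \<Rightarrow> 'u vnat" where
  "qpr X N = mknt X (\<lambda>W x. quot_rep (on_ob X W) (N W) x)"

context
  fixes X N assumes X [simp]: "X \<in> LF" and N: "subfun X N"
begin

lemma subfun_submodule: "W \<in> Vob \<Longrightarrow> submodule (N W) (fld B) (on_ob X W)"
  using N by (simp add: subfun_def)

lemma subfun_mor [simp]: "W \<in> Vob \<Longrightarrow> W' \<in> Vob \<Longrightarrow> f \<in> lin W W' \<Longrightarrow> x \<in> N W \<Longrightarrow> on_mor X W W' f x \<in> N W'"
  using N by (simp add: subfun_def)

lemma subfun_el [simp]: "W \<in> Vob \<Longrightarrow> x \<in> N W \<Longrightarrow> x \<in> el X W"
  using submoduleD(1)[OF subfun_submodule] by simp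

lemma subfun_closed [simp]: "W \<in> Vob \<Longrightarrow> x \<in> N W \<Longrightarrow> y \<in> N W \<Longrightarrow> x \<oplus>\<^bsub>on_ob X W\<^esub> y \<in> N W"
  "W \<in> Vob \<Longrightarrow> c \<in> carrier (fld B) \<Longrightarrow> x \<in> N W \<Longrightarrow> c \<odot>\<^bsub>on_ob X W\<^esub> x \<in> N W"
  using submoduleD(3,4)[OF subfun_submodule] by simp_all

lemma subF_simps [simp]: "el (subF X N) W = N W"
  "x \<oplus>\<^bsub>on_ob (subF X N) W\<^esub> y = x \<oplus>\<^bsub>on_ob X W\<^esub> y"
  "c \<odot>\<^bsub>on_ob (subF X N) W\<^esub> x = c \<odot>\<^bsub>on_ob X W\<^esub> x"
  "\<zero>\<^bsub>on_ob (subF X N) W\<^esub> = \<zero>\<^bsub>on_ob X W\<^esub>"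
  "x \<in> N W \<Longrightarrow> on_mor (subF X N) W W' f x = on_mor X W W' f x"
  by (simp_all add: subF_def)

lemma subF_LF [simp]: "subF X N \<in> LF"
proof (rule LF_I)
  show "on_ob (subF X N) W \<in> Vob" if "W \<in> Vob" for W
    using that subspace_Vob[OF LF_ob[OF X that] subfun_submodule[OF that]] by (simp add: subF_def)
  fix W W' f assume *: "W \<in> Vob" "W' \<in> Vob" "f \<in> lin W W'"
  show "on_mor (subF X N) W W' f \<in> lin (on_ob (subF X N) W) (on_ob (subF X N) W')"
    by (rule linI) (use * in \<open>simp_all add: lin_add[OF LF_mor] lin_smult[OF LF_mor], simp add: subF_def\<close>)
next
  fix U V W f g x assume *: "U \<in> Vob" "V \<in> Vob" "W \<in> Vob" "f \<in> lin U V" "g \<in> lin V W" "x \<in> el (subF X N) U"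
  then show "on_mor (subF X N) U W (cmp U g f) x = on_mor (subF X N) V W g (on_mor (subF X N) U V f x)"
    by (simp add: LF_cmp)
qed (simp_all add: LF_map_add LF_map_smult)

lemma nt_subF:
  assumes \<sigma>: "\<sigma> \<in> nt Y X" and Y: "Y \<in> LF" and im: "\<And>W y. W \<in> Vob \<Longrightarrow> y \<in> el Y W \<Longrightarrow> \<sigma> W y \<in> N W"
  shows "mknt Y \<sigma> \<in> nt Y (subF X N)"
  by (rule mknt_nt[OF Y]) (simp_all add: im nt_add[OF \<sigma>] nt_smult[OF \<sigma>] nt_natural[OF \<sigma>])

lemma incl_nt: "mknt (subF X N) (\<lambda>W x. x) \<in> nt (subF X N) X"
  by (rule mknt_nt) simp_all

lemma quoF_ob: "on_ob (quoF X N) W = quot (on_ob X W) (N W)"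
  by (simp add: quoF_def)

text \<open>The projection after X(f) kills N(W) because N is stable under X(f), so it descends to
  the quotient by \<open>quot_lift\<close>.\<close>

lemma quoF_mor:
  assumes [simp]: "W \<in> Vob" "W' \<in> Vob" and f [simp]: "f \<in> lin W W'"
  shows "on_mor (quoF X N) W W' f \<in> lin (on_ob (quoF X N) W) (on_ob (quoF X N) W')"
    and "x \<in> el X W \<Longrightarrow> on_mor (quoF X N) W W' f (quot_rep (on_ob X W) (N W) x) = quot_rep (on_ob X W') (N W') (on_mor X W W' f x)"
proof -
  let ?g = "cmp (on_ob X W) (restrict (quot_rep (on_ob X W') (N W')) (el X W')) (on_mor X W W' f)"
  note S = subfun_submodule[OF \<open>W \<in> Vob\<close>] and S' = subfun_submodule[OF \<open>W' \<in> Vob\<close>]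
  have g: "?g \<in> lin (on_ob X W) (quot (on_ob X W') (N W'))"
    by (rule cmp_lin[OF _ LF_mor quot_map_lin[OF _ S']]) simp_all
  have 0: "?g x = \<zero>\<^bsub>quot (on_ob X W') (N W')\<^esub>" if "x \<in> N W" for x
    using that by (simp add: quot_map_zero[OF _ S'])
  note L = quot_lift[OF _ S quot_Vob[OF _ S'] g 0]
  have e: "on_mor (quoF X N) W W' f = restrict ?g (carrier (quot (on_ob X W) (N W)))"
    using quot_carrier[OF _ S] by (auto simp: quoF_def fun_eq_iff)
  show "on_mor (quoF X N) W W' f \<in> lin (on_ob (quoF X N) W) (on_ob (quoF X N) W')"
    unfolding e quoF_ob using L(1) by simp
  show "on_mor (quoF X N) W W' f (quot_rep (on_ob X W) (N W) x) = quot_rep (on_ob X W') (N W') (on_mor X W W' f x)"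
    if x: "x \<in> el X W"
  proof -
    have "quot_rep (on_ob X W) (N W) x \<in> carrier (quot (on_ob X W) (N W))"
      using quot_map_surj[OF _ S] x by (metis LF_ob X \<open>W \<in> Vob\<close> imageI)
    then show ?thesis unfolding e using L(2)[of x] x quot_rep(1)[OF _ S x] by simp
  qed
qed

lemma quoF_surj: "W \<in> Vob \<Longrightarrow> z \<in> el (quoF X N) W \<Longrightarrow> \<exists>x\<in>el X W. z = quot_rep (on_ob X W) (N W) x"
  using quot_map_surj[OF _ subfun_submodule, of W] by (auto simp: quoF_ob)

lemma qpr_add: "W \<in> Vob \<Longrightarrow> x \<in> el X W \<Longrightarrow> y \<in> el X W \<Longrightarrow>
    quot_rep (on_ob X W) (N W) (x \<oplus>\<^bsub>on_ob X W\<^esub> y) =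
    quot_rep (on_ob X W) (N W) x \<oplus>\<^bsub>on_ob (quoF X N) W\<^esub> quot_rep (on_ob X W) (N W) y"
  using lin_add[OF quot_map_lin[OF _ subfun_submodule]] by (simp add: quoF_ob)

lemma qpr_smult: "W \<in> Vob \<Longrightarrow> c \<in> carrier (fld B) \<Longrightarrow> x \<in> el X W \<Longrightarrow>
    quot_rep (on_ob X W) (N W) (c \<odot>\<^bsub>on_ob X W\<^esub> x) = c \<odot>\<^bsub>on_ob (quoF X N) W\<^esub> quot_rep (on_ob X W) (N W) x"
  using lin_smult[OF quot_map_lin[OF _ subfun_submodule]] by (simp add: quoF_ob)

lemma quoF_LF [simp]: "quoF X N \<in> LF"
proof (rule LF_I)
  show "on_ob (quoF X N) W \<in> Vob" if "W \<in> Vob" for W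
    using that quot_Vob[OF _ subfun_submodule] by (simp add: quoF_ob)
  show "on_mor (quoF X N) W W' f \<in> lin (on_ob (quoF X N) W) (on_ob (quoF X N) W')"
    if "W \<in> Vob" "W' \<in> Vob" "f \<in> lin W W'" for W W' f using quoF_mor(1)[OF that] .
  fix U V W f g z assume [simp]: "U \<in> Vob" "V \<in> Vob" "W \<in> Vob" "f \<in> lin U V" "g \<in> lin V W" and "z \<in> el (quoF X N) U"
  then obtain x where [simp]: "x \<in> el X U" "z = quot_rep (on_ob X U) (N U) x" using quoF_surj by blast
  have c: "cmp U g f \<in> lin U W" by (rule cmp_lin[of _ _ V]) simp_all
  show "on_mor (quoF X N) U W (cmp U g f) z = on_mor (quoF X N) V W g (on_mor (quoF X N) U V f z)"
    by (simp add: quoF_mor(2) quoF_mor(2)[OF _ _ c] LF_cmp)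
next
  fix V z assume "V \<in> Vob" "z \<in> el (quoF X N) V"
  then show "on_mor (quoF X N) V V (idm V) z = z" using quoF_surj[of V z] by (auto simp: quoF_mor(2))
next
  fix V W f g z assume [simp]: "V \<in> Vob" "W \<in> Vob" "f \<in> lin V W" "g \<in> lin V W" and "z \<in> el (quoF X N) V"
  then obtain x where [simp]: "x \<in> el X V" "z = quot_rep (on_ob X V) (N V) x" using quoF_surj by blast
  show "on_mor (quoF X N) V W (map_add V W f g) z =
    on_mor (quoF X N) V W f z \<oplus>\<^bsub>on_ob (quoF X N) W\<^esub> on_mor (quoF X N) V W g z"
    by (simp add: quoF_mor(2) map_add_lin LF_map_add qpr_add)
next
  fix V W c f z assume [simp]: "V \<in> Vob" "W \<in> Vob" "c \<in> carrier (fld B)" "f \<in> lin V W" and "z \<in> el (quoF X N) V"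
  then obtain x where [simp]: "x \<in> el X V" "z = quot_rep (on_ob X V) (N V) x" using quoF_surj by blast
  show "on_mor (quoF X N) V W (map_smult V W c f) z = c \<odot>\<^bsub>on_ob (quoF X N) W\<^esub> on_mor (quoF X N) V W f z"
    by (simp add: quoF_mor(2) map_smult_lin LF_map_smult qpr_smult)
qed

lemma qpr_apply: "W \<in> Vob \<Longrightarrow> x \<in> el X W \<Longrightarrow> qpr X N W x = quot_rep (on_ob X W) (N W) x"
  by (simp add: qpr_def)

lemma qpr_nt: "qpr X N \<in> nt X (quoF X N)"
  unfolding qpr_def
  by (rule mknt_nt) (use quot_map_surj[OF _ subfun_submodule] in \<open>auto simp: qpr_add qpr_smult quoF_mor(2) quoF_ob\<close>)

lemma qpr_surj: "W \<in> Vob \<Longrightarrow> qpr X N W ` el X W = el (quoF X N) W"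
  using quoF_surj[of W] nt_closed[OF qpr_nt, of W] by (fastforce simp: qpr_apply)

lemma qpr_zero_iff: "W \<in> Vob \<Longrightarrow> x \<in> el X W \<Longrightarrow> qpr X N W x = \<zero>\<^bsub>on_ob (quoF X N) W\<^esub> \<longleftrightarrow> x \<in> N W"
  using quot_map_zero[OF _ subfun_submodule] by (simp add: qpr_apply quoF_ob)

text \<open>As for single spaces, the induced transformation is f restricted to representatives, and
  it is unique because every element of the quotient is represented.\<close>

lemma quoF_lift:
  assumes Z [simp]: "Z \<in> LF" and f: "f \<in> nt X Z" and f0: "\<And>W x. W \<in> Vob \<Longrightarrow> x \<in> N W \<Longrightarrow> f W x = \<zero>\<^bsub>on_ob Z W\<^esub>"
  shows "\<exists>!h. h \<in> nt (quoF X N) Z \<and> Comp (LinFun B) X h (qpr X N) = f"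
proof -
  note L = quot_lift[OF _ subfun_submodule LF_ob[OF Z] nt_lin[OF f] f0]
  have hq: "f W (quot_rep (on_ob X W) (N W) x) = f W x" if "W \<in> Vob" "x \<in> el X W" for W x
    using L(2)[of W] that by simp
  have l: "restrict (f W) (el (quoF X N) W) \<in> lin (on_ob (quoF X N) W) (on_ob Z W)" if "W \<in> Vob" for W
    using L(1)[of W] that by (simp add: quoF_ob)
  have qc: "quot_rep (on_ob X W) (N W) x \<in> el (quoF X N) W" if "W \<in> Vob" "x \<in> el X W" for W x
    using nt_closed[OF qpr_nt that] that by (simp add: qpr_apply)
  have h: "mknt (quoF X N) f \<in> nt (quoF X N) Z"
  proof (rule mknt_nt)
    fix W W' g z assume [simp]: "W \<in> Vob" "W' \<in> Vob" "g \<in> lin W W'" and "z \<in> el (quoF X N) W"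
    then obtain x where [simp]: "x \<in> el X W" "z = quot_rep (on_ob X W) (N W) x" using quoF_surj by blast
    show "f W' (on_mor (quoF X N) W W' g z) = on_mor Z W W' g (f W z)"
      by (simp add: quoF_mor(2) hq nt_natural[OF f])
  next
    fix W z z' assume *: "W \<in> Vob" "z \<in> el (quoF X N) W" "z' \<in> el (quoF X N) W"
    then show "f W (z \<oplus>\<^bsub>on_ob (quoF X N) W\<^esub> z') = f W z \<oplus>\<^bsub>on_ob Z W\<^esub> f W z'"
      using lin_add[OF l[of W], of z z'] by simp
  next
    fix W c z assume *: "W \<in> Vob" "c \<in> carrier (fld B)" "z \<in> el (quoF X N) W"
    then show "f W (c \<odot>\<^bsub>on_ob (quoF X N) W\<^esub> z) = c \<odot>\<^bsub>on_ob Z W\<^esub> f W z"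
      using lin_smult[OF l[of W], of c z] by simp
  next
    fix W z assume *: "W \<in> Vob" "z \<in> el (quoF X N) W"
    then show "f W z \<in> el Z W" using lin_closed[OF l[of W], of z] by simp
  qed simp
  show ?thesis
  proof (rule ex1I[of _ "mknt (quoF X N) f"], intro conjI h)
    show "Comp (LinFun B) X (mknt (quoF X N) f) (qpr X N) = f"
      by (rule nt_eqI[OF Comp_nt[OF X qpr_nt h] f]) (simp add: qpr_apply qc hq)
  next
    fix h' assume h': "h' \<in> nt (quoF X N) Z \<and> Comp (LinFun B) X h' (qpr X N) = f"
    show "h' = mknt (quoF X N) f"
    proof (rule nt_eqI[OF conjunct1[OF h'] h])
      fix W z assume [simp]: "W \<in> Vob" and z: "z \<in> el (quoF X N) W"
      then obtain x where [simp]: "x \<in> el X W" "z = quot_rep (on_ob X W) (N W) x" using quoF_surj by blast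
      have "Comp (LinFun B) X h' (qpr X N) W x = f W x" using h' by simp
      then show "h' W z = mknt (quoF X N) f W z" by (simp add: qpr_apply qc hq)
    qed
  qed
qed

end

subsection \<open>The unit as the identity functor\<close>

text \<open>Evaluation at 1 identifies \<Y>k with the identity functor: \<open>pt\<close> is this
  evaluation on codes, and \<open>kmap\<close>, followed by coding, is its inverse.\<close>

definition kmap :: "'u vec \<Rightarrow> 'u \<Rightarrow> 'u vmap" where
  "kmap W w = (\<lambda>c\<in>carrier kk. c \<odot>\<^bsub>W\<^esub> w)"

definition pt :: "'u \<Rightarrow> 'u" where
  "pt z = ug kk z \<one>\<^bsub>fld B\<^esub>"

lemma kmap_lin [simp]: "W \<in> Vob \<Longrightarrow> w \<in> carrier W \<Longrightarrow> kmap W w \<in> lin kk W"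
  unfolding kmap_def by (rule lin_restrictI) (simp_all add: vadd_smult vsmult_smult)

lemma kmap_apply [simp]: "c \<in> carrier (fld B) \<Longrightarrow> kmap W w c = c \<odot>\<^bsub>W\<^esub> w"
  by (simp add: kmap_def)

lemma kmap_one:
  assumes W: "W \<in> Vob" and g: "g \<in> lin kk W" shows "kmap W (g \<one>\<^bsub>fld B\<^esub>) = g"
proof (rule lin_eqI[OF kmap_lin g])
  fix c assume "c \<in> carrier kk"
  then have "g (c \<odot>\<^bsub>kk\<^esub> \<one>\<^bsub>fld B\<^esub>) = c \<odot>\<^bsub>W\<^esub> g \<one>\<^bsub>fld B\<^esub>" by (intro lin_smult[OF g]) simp_all
  then show "kmap W (g \<one>\<^bsub>fld B\<^esub>) c = g c" using \<open>c \<in> carrier kk\<close> by simp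
qed (simp_all add: W lin_closed[OF g])

lemma cmp_kmap: "V \<in> Vob \<Longrightarrow> f \<in> lin V W \<Longrightarrow> v \<in> carrier V \<Longrightarrow> cmp kk f (kmap V v) = kmap W (f v)"
  by (auto simp: compose_def kmap_def fun_eq_iff lin_smult)

lemma pt_gr [simp]: "g \<in> lin kk W \<Longrightarrow> pt (gr kk g) = g \<one>\<^bsub>fld B\<^esub>"
  by (simp add: pt_def ug_gr[of kk _ W])

lemma pt_kmap [simp]: "W \<in> Vob \<Longrightarrow> w \<in> carrier W \<Longrightarrow> pt (gr kk (kmap W w)) = w"
  using pt_gr[of "kmap W w" W] by simp

lemma Yo_kk_cases:
  assumes "W \<in> Vob" "z \<in> el (Yo B kk) W"
  obtains w where "w \<in> carrier W" "z = gr kk (kmap W w)"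
proof -
  obtain g where g: "g \<in> lin kk W" "z = gr kk g" using assms by (auto simp: el_Yo)
  then have "g \<one>\<^bsub>fld B\<^esub> \<in> carrier W" "z = gr kk (kmap W (g \<one>\<^bsub>fld B\<^esub>))"
    using lin_closed[of g kk W "\<one>\<^bsub>fld B\<^esub>"] kmap_one assms by simp_all
  then show thesis by (rule that)
qed

lemma gr_kmap_add:
  assumes [simp]: "W \<in> Vob" "w \<in> carrier W" "w' \<in> carrier W"
  shows "gr kk (kmap W (w \<oplus>\<^bsub>W\<^esub> w')) = gr kk (kmap W w) \<oplus>\<^bsub>on_ob (Yo B kk) W\<^esub> gr kk (kmap W w')"
proof -
  have "kmap W (w \<oplus>\<^bsub>W\<^esub> w') = map_add kk W (kmap W w) (kmap W w')"
    by (rule lin_eqI[OF kmap_lin map_add_lin]) (simp_all add: map_add_apply vsmult_add)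
  then show ?thesis by (simp add: Yo_ob hom_space_add)
qed

lemma gr_kmap_smult:
  assumes [simp]: "W \<in> Vob" "c \<in> carrier (fld B)" "w \<in> carrier W"
  shows "gr kk (kmap W (c \<odot>\<^bsub>W\<^esub> w)) = c \<odot>\<^bsub>on_ob (Yo B kk) W\<^esub> gr kk (kmap W w)"
proof -
  have "kmap W (c \<odot>\<^bsub>W\<^esub> w) = map_smult kk W c (kmap W w)"
    by (rule lin_eqI[OF kmap_lin map_smult_lin]) (simp_all add: map_smult_apply vsmult_comm[of W c])
  then show ?thesis by (simp add: Yo_ob hom_space_smult[of kk _ W])
qed

lemma gr_kmap_zero: "W \<in> Vob \<Longrightarrow> gr kk (kmap W \<zero>\<^bsub>W\<^esub>) = \<zero>\<^bsub>on_ob (Yo B kk) W\<^esub>"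
  by (auto simp: Yo_ob hom_space_zero kmap_def intro!: arg_cong[of _ _ "gr kk"])

lemma gr_kmap_mor: "W \<in> Vob \<Longrightarrow> f \<in> lin W W' \<Longrightarrow> w \<in> carrier W \<Longrightarrow>
    on_mor (Yo B kk) W W' f (gr kk (kmap W w)) = gr kk (kmap W' (f w))"
  by (simp add: cmp_kmap)

subsection \<open>Objects of Q3 built from a basis\<close>

context
  fixes T J assumes bas: "basis T J"
begin

interpretation T: abelian_monoid T by (rule Vob_monoid[OF basis_Vob[OF bas]])

lemma T_Vob [simp]: "T \<in> Vob" by (rule basis_Vob[OF bas])
lemma J_mem [simp]: "j \<in> J \<Longrightarrow> j \<in> carrier T" by (rule basis_mem[OF bas])
lemma co_lin [simp]: "j \<in> J \<Longrightarrow> coord T J j \<in> lin T kk" by (rule coord_lin[OF bas])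
lemma co_basis [simp]: "j \<in> J \<Longrightarrow> j' \<in> J \<Longrightarrow> coord T J j j' = (if j' = j then \<one>\<^bsub>fld B\<^esub> else \<zero>\<^bsub>fld B\<^esub>)"
  by (rule coord_basis[OF bas])

text \<open>The j-th coprojection into the copower, seen on vectors: w is placed at the basis vector
  j and 0 at all others. For W = T and w = j this is the projection onto the line through j.\<close>

definition unitmap :: "'u vec \<Rightarrow> 'u \<Rightarrow> 'u \<Rightarrow> 'u vmap" where
  "unitmap W w j = cmp T (kmap W w) (coord T J j)"

lemma unitmap_lin [simp]: "W \<in> Vob \<Longrightarrow> w \<in> carrier W \<Longrightarrow> j \<in> J \<Longrightarrow> unitmap W w j \<in> lin T W"
  unfolding unitmap_def by (rule cmp_lin[of _ _ kk]) simp_all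

lemma unitmap_basis: "W \<in> Vob \<Longrightarrow> w \<in> carrier W \<Longrightarrow> j \<in> J \<Longrightarrow> j' \<in> J \<Longrightarrow>
    unitmap W w j j' = (if j' = j then w else \<zero>\<^bsub>W\<^esub>)"
  by (simp add: unitmap_def)

text \<open>The copower inside the power: such a map is a family of vectors of W, indexed by the
  basis, with finitely many nonzero members.\<close>

definition finsup :: "'u vec \<Rightarrow> 'u vmap set" where
  "finsup W = {g \<in> lin T W. finite {j \<in> J. g j \<noteq> \<zero>\<^bsub>W\<^esub>}}"

lemma finsupI: "g \<in> lin T W \<Longrightarrow> finite {j \<in> J. g j \<noteq> \<zero>\<^bsub>W\<^esub>} \<Longrightarrow> g \<in> finsup W"
  by (simp add: finsup_def)

lemma finsup_finite: "g \<in> finsup W \<Longrightarrow> finite {j \<in> J. g j \<noteq> \<zero>\<^bsub>W\<^esub>}"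
  by (simp add: finsup_def)

lemma finsup_lin [simp]: "g \<in> finsup W \<Longrightarrow> g \<in> lin T W"
  by (simp add: finsup_def)

lemma unitmap_finsup [simp]:
  assumes "W \<in> Vob" "w \<in> carrier W" "j \<in> J" shows "unitmap W w j \<in> finsup W"
proof -
  have "{j' \<in> J. unitmap W w j j' \<noteq> \<zero>\<^bsub>W\<^esub>} \<subseteq> {j}"
  proof
    fix j' assume "j' \<in> {j' \<in> J. unitmap W w j j' \<noteq> \<zero>\<^bsub>W\<^esub>}"
    then have "j' \<in> J" "unitmap W w j j' \<noteq> \<zero>\<^bsub>W\<^esub>" by blast+
    then show "j' \<in> {j}" using unitmap_basis[OF assms(1,2,3), of j'] by (cases "j' = j") simp_all
  qed
  from finite_subset[OF this] show ?thesis using assms by (intro finsupI) simp_all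
qed

lemma finsup_add [simp]:
  assumes "W \<in> Vob" "f \<in> finsup W" "g \<in> finsup W" shows "map_add T W f g \<in> finsup W"
proof -
  have "{j \<in> J. map_add T W f g j \<noteq> \<zero>\<^bsub>W\<^esub>} \<subseteq> {j \<in> J. f j \<noteq> \<zero>\<^bsub>W\<^esub>} \<union> {j \<in> J. g j \<noteq> \<zero>\<^bsub>W\<^esub>}"
    using assms by (auto simp: map_add_apply)
  from finite_subset[OF this] show ?thesis using assms by (intro finsupI) (simp_all add: map_add_lin finsup_finite)
qed

lemma finsup_smult [simp]:
  assumes "W \<in> Vob" "c \<in> carrier (fld B)" "g \<in> finsup W" shows "map_smult T W c g \<in> finsup W"
proof -
  have "{j \<in> J. map_smult T W c g j \<noteq> \<zero>\<^bsub>W\<^esub>} \<subseteq> {j \<in> J. g j \<noteq> \<zero>\<^bsub>W\<^esub>}"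
    using assms by (auto simp: map_smult_apply)
  from finite_subset[OF this] show ?thesis using assms by (intro finsupI) (simp_all add: map_smult_lin finsup_finite)
qed

lemma finsup_zero [simp]:
  assumes "W \<in> Vob" shows "(\<lambda>t\<in>carrier T. \<zero>\<^bsub>W\<^esub>) \<in> finsup W"
proof (rule finsupI)
  have "{j \<in> J. (\<lambda>t\<in>carrier T. \<zero>\<^bsub>W\<^esub>) j \<noteq> \<zero>\<^bsub>W\<^esub>} \<subseteq> {}" by auto
  from finite_subset[OF this] show "finite {j \<in> J. (\<lambda>t\<in>carrier T. \<zero>\<^bsub>W\<^esub>) j \<noteq> \<zero>\<^bsub>W\<^esub>}" by blast
qed (simp add: assms)

lemma finsup_cmp [simp]:
  assumes "W \<in> Vob" "W' \<in> Vob" "f \<in> lin W W'" "g \<in> finsup W" shows "cmp T f g \<in> finsup W'"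
proof -
  have "{j \<in> J. cmp T f g j \<noteq> \<zero>\<^bsub>W'\<^esub>} \<subseteq> {j \<in> J. g j \<noteq> \<zero>\<^bsub>W\<^esub>}"
    using assms lin_zero[of f W W'] by auto
  from finite_subset[OF this] show ?thesis using assms cmp_lin[of T g W f W'] by (intro finsupI) (simp_all add: finsup_finite)
qed

text \<open>Induction on a finite set that carries the support: finitely supported maps are finite
  sums of unit maps.\<close>

lemma finsup_induct [consumes 2, case_names zero add unit]:
  assumes W: "W \<in> Vob" and g: "g \<in> finsup W"
    and z: "P (\<lambda>t\<in>carrier T. \<zero>\<^bsub>W\<^esub>)"
    and add: "\<And>f g. f \<in> finsup W \<Longrightarrow> g \<in> finsup W \<Longrightarrow> P f \<Longrightarrow> P g \<Longrightarrow> P (map_add T W f g)"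
    and u: "\<And>w j. w \<in> carrier W \<Longrightarrow> j \<in> J \<Longrightarrow> P (unitmap W w j)"
  shows "P g"
proof -
  have "\<forall>g\<in>finsup W. (\<forall>j\<in>J - F. g j = \<zero>\<^bsub>W\<^esub>) \<longrightarrow> P g" if "finite F" "F \<subseteq> J" for F
    using that
  proof (induction F)
    case empty
    show ?case
    proof (intro ballI impI)
      fix g assume "g \<in> finsup W" "\<forall>j\<in>J - {}. g j = \<zero>\<^bsub>W\<^esub>"
      then have "g = (\<lambda>t\<in>carrier T. \<zero>\<^bsub>W\<^esub>)" by (intro basis_ext[OF bas W]) (simp_all add: W)
      then show "P g" using z by simp
    qed
  next
    case (insert i F)
    show ?case
    proof (intro ballI impI)
      fix g assume g: "g \<in> finsup W" and g0: "\<forall>j\<in>J - insert i F. g j = \<zero>\<^bsub>W\<^esub>"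
      have i: "i \<in> J" using insert by simp
      have gi: "g i \<in> carrier W" using lin_closed[OF finsup_lin[OF g]] i by simp
      let ?m = "\<ominus>\<^bsub>fld B\<^esub> \<one>\<^bsub>fld B\<^esub>"
      \<comment> \<open>Subtracting the unit map at i clears the value there and leaves all other
        basis values unchanged.\<close>
      define g' where "g' = map_add T W g (map_smult T W ?m (unitmap W (g i) i))"
      have g': "g' \<in> finsup W" unfolding g'_def using W g gi i by simp
      have g'v: "g' j = (if j = i then \<zero>\<^bsub>W\<^esub> else g j)" if "j \<in> J" for j
        using that W gi i lin_closed[OF finsup_lin[OF g], of j] vminus_self[OF W gi]
        by (auto simp: g'_def map_add_apply map_smult_apply unitmap_basis a_minus_def vneg_eq_smult)
      have "P g'" using insert g' g0 g'v by auto
      then have "P (map_add T W g' (unitmap W (g i) i))" using W gi i g' by (intro add u) simp_all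
      moreover have "map_add T W g' (unitmap W (g i) i) = g"
      proof (rule basis_ext[OF bas W])
        show "map_add T W g' (unitmap W (g i) i) \<in> lin T W" using W g' gi i by (intro map_add_lin) simp_all
        show "g \<in> lin T W" using g by simp
        fix j assume j: "j \<in> J"
        then show "map_add T W g' (unitmap W (g i) i) j = g j"
          using W gi i lin_closed[OF finsup_lin[OF g], of j] by (simp add: map_add_apply g'v unitmap_basis)
      qed
      ultimately show "P g" by simp
    qed
  qed
  from this[of "{j \<in> J. g j \<noteq> \<zero>\<^bsub>W\<^esub>}"] show ?thesis using g finsup_finite[OF g] by auto
qed

abbreviation NN where "NN W \<equiv> gr T ` finsup W"

lemma subfun_NN: "subfun (Yo B T) NN"
  unfolding subfun_def
proof (intro conjI ballI)
  fix W assume [simp]: "W \<in> Vob"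
  have "gr T ` finsup W \<subseteq> el (Yo B T) W" by auto
  moreover have "\<zero>\<^bsub>on_ob (Yo B T) W\<^esub> \<in> gr T ` finsup W" by (simp add: Yo_ob hom_space_zero)
  ultimately show "submodule (gr T ` finsup W) (fld B) (on_ob (Yo B T) W)"
    by (auto simp: submodule_iff Yo_ob hom_space_Vob hom_space_add[of T _ W] hom_space_smult[of T _ W])
qed auto

abbreviation SS where "SS \<equiv> subF (Yo B T) NN"
abbreviation PP where "PP \<equiv> Yo B T"
abbreviation QQ where "QQ \<equiv> quoF (Yo B T) NN"

definition prj where "prj j = yon (Yo B kk) T (gr kk (kmap T j))"
text \<open>The coordinate functional at j is an element of \<Y>T over k, and its Yoneda map is the
  coprojection. Its values are finitely supported, so \<open>coprj\<close> can be given the smaller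
  target \<open>SS\<close>.\<close>

definition coprj0 where "coprj0 j = yon PP kk (gr T (coord T J j))"
definition coprj where "coprj j = mknt (Yo B kk) (coprj0 j)"
definition cc where "cc = mknt SS (\<lambda>W x. x)"

lemma prj_nt: "j \<in> J \<Longrightarrow> prj j \<in> nt PP (Yo B kk)"
  unfolding prj_def by (rule yon_nt) simp_all

lemma prj_apply: "j \<in> J \<Longrightarrow> W \<in> Vob \<Longrightarrow> g \<in> lin T W \<Longrightarrow> prj j W (gr T g) = gr kk (kmap W (g j))"
  by (simp add: prj_def yon_apply cmp_kmap)

lemma coprj0_apply: "j \<in> J \<Longrightarrow> W \<in> Vob \<Longrightarrow> w \<in> carrier W \<Longrightarrow> coprj0 j W (gr kk (kmap W w)) = gr T (unitmap W w j)"
  by (simp add: coprj0_def yon_apply unitmap_def)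

lemma coprj_apply: "j \<in> J \<Longrightarrow> W \<in> Vob \<Longrightarrow> w \<in> carrier W \<Longrightarrow> coprj j W (gr kk (kmap W w)) = gr T (unitmap W w j)"
  by (simp add: coprj_def coprj0_apply)

lemma coprj_nt: "j \<in> J \<Longrightarrow> coprj j \<in> nt (Yo B kk) SS"
  unfolding coprj_def
proof (rule nt_subF[OF _ subfun_NN])
  assume j: "j \<in> J"
  then show "coprj0 j \<in> nt (Yo B kk) PP" unfolding coprj0_def by (intro yon_nt) simp_all
  fix W z assume W: "W \<in> Vob" "z \<in> el (Yo B kk) W"
  obtain w where w: "w \<in> carrier W" "z = gr kk (kmap W w)" using Yo_kk_cases[OF W] .
  then show "coprj0 j W z \<in> NN W" using j W(1) by (simp add: coprj0_apply)
qed simp_all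

lemma SS_simps [simp]: "el SS W = NN W" "x \<oplus>\<^bsub>on_ob SS W\<^esub> y = x \<oplus>\<^bsub>on_ob PP W\<^esub> y"
  "c \<odot>\<^bsub>on_ob SS W\<^esub> x = c \<odot>\<^bsub>on_ob PP W\<^esub> x" "\<zero>\<^bsub>on_ob SS W\<^esub> = \<zero>\<^bsub>on_ob PP W\<^esub>"
  "x \<in> NN W \<Longrightarrow> on_mor SS W W' f x = on_mor PP W W' f x" "SS \<in> LF"
  by (simp_all add: subF_simps[OF _ subfun_NN] subF_LF[OF _ subfun_NN])

lemma cc_nt: "cc \<in> nt SS PP"
  unfolding cc_def by (rule incl_nt[OF _ subfun_NN]) simp

text \<open>A family of maps from Z to \<Y>k assigns to z one vector of W for each j, and these are
  the basis values of exactly one linear map from T to W.\<close>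

lemma product_PP: "is_product (LinFun B) J (\<lambda>_. Yo B kk) PP prj"
  unfolding is_product_def
proof (intro conjI ballI allI impI)
  fix Z f assume Z [simp]: "Z \<in> LF" and f: "\<forall>j\<in>J. f j \<in> nt Z (Yo B kk)"
  have fc: "pt (f j W z) \<in> carrier W" "gr kk (kmap W (pt (f j W z))) = f j W z"
    if jWz: "j \<in> J" "W \<in> Vob" "z \<in> el Z W" for j W z
  proof -
    have fe: "f j W z \<in> el (Yo B kk) W" by (rule nt_closed[OF bspec[OF f jWz(1)] jWz(2,3)])
    obtain w where w: "w \<in> carrier W" "f j W z = gr kk (kmap W w)" using Yo_kk_cases[OF jWz(2) fe] .
    then have "pt (f j W z) = w" using jWz pt_gr[of "kmap W w" W] by simp
    then show "pt (f j W z) \<in> carrier W" "gr kk (kmap W (pt (f j W z))) = f j W z" using w by simp_all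
  qed
  define L where "L W z = (SOME h. h \<in> lin T W \<and> (\<forall>j\<in>J. h j = pt (f j W z)))" for W z
  have L: "L W z \<in> lin T W \<and> (\<forall>j\<in>J. L W z j = pt (f j W z))" if Wz: "W \<in> Vob" "z \<in> el Z W" for W z
  proof -
    have "\<exists>h. h \<in> lin T W \<and> (\<forall>j\<in>J. h j = pt (f j W z))"
      by (rule basis_lift[OF bas Wz(1)]) (rule fc(1)[OF _ Wz])
    then show ?thesis unfolding L_def by (rule someI_ex)
  qed
  then have Ll [simp]: "L W z \<in> lin T W" and Lj: "\<And>j. j \<in> J \<Longrightarrow> L W z j = pt (f j W z)" if "W \<in> Vob" "z \<in> el Z W" for W z
    using that by auto
  have pt_eq: "pt (f j W z) = w" if "f j W z = gr kk (kmap W w)" "W \<in> Vob" "w \<in> carrier W" for j W z w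
    using that pt_gr[of "kmap W w" W] by simp
  let ?h = "mknt Z (\<lambda>W z. gr T (L W z))"
  have h: "?h \<in> nt Z PP"
  proof (rule mknt_nt)
    fix W z z' assume [simp]: "W \<in> Vob" "z \<in> el Z W" "z' \<in> el Z W"
    have "L W (z \<oplus>\<^bsub>on_ob Z W\<^esub> z') = map_add T W (L W z) (L W z')"
    proof (rule basis_ext[OF bas, of W])
      fix j assume j: "j \<in> J"
      have "f j W (z \<oplus>\<^bsub>on_ob Z W\<^esub> z') = gr kk (kmap W (pt (f j W z) \<oplus>\<^bsub>W\<^esub> pt (f j W z')))"
        using nt_add[of "f j" Z "Yo B kk" W z z'] f j fc by (simp add: gr_kmap_add)
      then show "L W (z \<oplus>\<^bsub>on_ob Z W\<^esub> z') j = map_add T W (L W z) (L W z') j"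
        using j fc by (simp add: Lj map_add_apply pt_eq)
    qed (simp_all add: map_add_lin)
    then show "gr T (L W (z \<oplus>\<^bsub>on_ob Z W\<^esub> z')) = gr T (L W z) \<oplus>\<^bsub>on_ob PP W\<^esub> gr T (L W z')"
      by (simp add: Yo_ob hom_space_add)
  next
    fix W c z assume [simp]: "W \<in> Vob" "z \<in> el Z W" "c \<in> carrier (fld B)"
    have "L W (c \<odot>\<^bsub>on_ob Z W\<^esub> z) = map_smult T W c (L W z)"
    proof (rule basis_ext[OF bas, of W])
      fix j assume j: "j \<in> J"
      have "f j W (c \<odot>\<^bsub>on_ob Z W\<^esub> z) = gr kk (kmap W (c \<odot>\<^bsub>W\<^esub> pt (f j W z)))"
        using nt_smult[of "f j" Z "Yo B kk" W c z] f j fc by (simp add: gr_kmap_smult)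
      then show "L W (c \<odot>\<^bsub>on_ob Z W\<^esub> z) j = map_smult T W c (L W z) j"
        using j fc by (simp add: Lj map_smult_apply pt_eq)
    qed (simp_all add: map_smult_lin)
    then show "gr T (L W (c \<odot>\<^bsub>on_ob Z W\<^esub> z)) = c \<odot>\<^bsub>on_ob PP W\<^esub> gr T (L W z)"
      by (simp add: Yo_ob hom_space_smult[of T _ W])
  next
    fix W W' g z assume [simp]: "W \<in> Vob" "W' \<in> Vob" "g \<in> lin W W'" "z \<in> el Z W"
    have "L W' (on_mor Z W W' g z) = cmp T g (L W z)"
    proof (rule basis_ext[OF bas, of W'])
      fix j assume j: "j \<in> J"
      have "f j W' (on_mor Z W W' g z) = on_mor (Yo B kk) W W' g (gr kk (kmap W (pt (f j W z))))"
        using nt_natural[of "f j" Z "Yo B kk" W W' g z] f j fc by simp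
      also have "\<dots> = gr kk (kmap W' (g (pt (f j W z))))" using j fc by (intro gr_kmap_mor) simp_all
      finally show "L W' (on_mor Z W W' g z) j = cmp T g (L W z) j"
        using j fc(1)[of j W z] lin_closed[of g W W'] by (simp add: Lj pt_eq)
    qed (simp_all add: cmp_lin[of _ _ W])
    then show "gr T (L W' (on_mor Z W W' g z)) = on_mor PP W W' g (gr T (L W z))" by simp
  qed simp_all
  show "\<exists>!h. h \<in> nt Z PP \<and> (\<forall>j\<in>J. Comp (LinFun B) Z (prj j) h = f j)"
  proof (rule ex1I[of _ ?h], intro conjI ballI h)
    fix j assume j: "j \<in> J"
    show "Comp (LinFun B) Z (prj j) ?h = f j"
      by (rule nt_eqI[OF Comp_nt[OF Z h prj_nt[OF j]]]) (use f j fc in \<open>simp_all add: prj_apply Lj\<close>)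
  next
    fix h' assume h': "h' \<in> nt Z PP \<and> (\<forall>j\<in>J. Comp (LinFun B) Z (prj j) h' = f j)"
    show "h' = ?h"
    proof (rule nt_eqI[OF conjunct1[OF h'] h])
      fix W z assume Wz [simp]: "W \<in> Vob" "z \<in> el Z W"
      have "h' W z \<in> el PP W" by (rule nt_closed[OF conjunct1[OF h'] Wz])
      then obtain g where g: "g \<in> lin T W" "h' W z = gr T g" by (auto simp: el_Yo)
      have "g = L W z"
      proof (rule basis_ext[OF bas, of W])
        fix j assume j: "j \<in> J"
        have "Comp (LinFun B) Z (prj j) h' W z = f j W z" using h' j by simp
        then have "f j W z = gr kk (kmap W (g j))" using g j by (simp add: prj_apply)
        then show "g j = L W z j" using j lin_closed[OF g(1), of j] by (simp add: Lj pt_eq)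
      qed (simp_all add: g)
      then show "h' W z = ?h W z" using g by simp
    qed
  qed
qed (simp_all add: prj_nt)

text \<open>A finitely supported g goes to the sum over j of the values of f j at g(j), almost all
  of which vanish. Uniqueness follows by \<open>finsup_induct\<close>, since unit maps are the
  values of the coprojections.\<close>

lemma coproduct_SS: "is_coproduct (LinFun B) J (\<lambda>_. Yo B kk) SS coprj"
  unfolding is_coproduct_def
proof (intro conjI ballI allI impI)
  fix Z f assume Z [simp]: "Z \<in> LF" and f: "\<forall>j\<in>J. f j \<in> nt (Yo B kk) Z"
  \<comment> \<open>The contribution of the basis vector j to the image of g.\<close>
  define a where "a W g j = f j W (gr kk (kmap W (g j)))" for W g j
  have gj [simp]: "g j \<in> carrier W" if "g \<in> finsup W" "j \<in> J" for g j W
    using lin_closed[OF finsup_lin[OF that(1)]] that by simp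
  have ac [simp]: "a W g j \<in> el Z W" if "W \<in> Vob" "g \<in> finsup W" "j \<in> J" for W g j
    unfolding a_def by (rule nt_closed[OF bspec[OF f that(3)] that(1) gr_Yo[OF kmap_lin]]) (use that in simp_all)
  have f0: "f j W (gr kk (kmap W \<zero>\<^bsub>W\<^esub>)) = \<zero>\<^bsub>on_ob Z W\<^esub>" if "j \<in> J" "W \<in> Vob" for j W
    using f that lin_zero[OF nt_lin[of "f j" "Yo B kk" Z W]] by (simp add: gr_kmap_zero)
  have af: "finite {j \<in> J. a W g j \<noteq> \<zero>\<^bsub>on_ob Z W\<^esub>}" if "W \<in> Vob" "g \<in> finsup W" for W g
  proof (rule finite_subset)
    show "{j \<in> J. a W g j \<noteq> \<zero>\<^bsub>on_ob Z W\<^esub>} \<subseteq> {j \<in> J. g j \<noteq> \<zero>\<^bsub>W\<^esub>}"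
      using f0 that by (auto simp: a_def)
    show "finite {j \<in> J. g j \<noteq> \<zero>\<^bsub>W\<^esub>}" using that by (simp add: finsup_finite)
  qed
  let ?h = "mknt SS (\<lambda>W x. fsum (on_ob Z W) J (a W (ug T x)))"
  have ug_fs [simp]: "ug T (gr T g) = g" if "g \<in> finsup W" for g W
    using ug_gr[OF T_Vob finsup_lin[OF that]] .
  have h: "?h \<in> nt SS Z"
  proof (rule mknt_nt)
    fix W x assume [simp]: "W \<in> Vob" and "x \<in> el SS W"
    then obtain g where g: "g \<in> finsup W" "x = gr T g" by auto
    then show "fsum (on_ob Z W) J (a W (ug T x)) \<in> el Z W" by (simp add: ug_fs[OF g(1)])
  next
    fix W x y assume [simp]: "W \<in> Vob" and "x \<in> el SS W" "y \<in> el SS W"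
    then obtain g g' where g: "g \<in> finsup W" "x = gr T g" "g' \<in> finsup W" "y = gr T g'" by auto
    have "fsum (on_ob Z W) J (a W (map_add T W g g')) = fsum (on_ob Z W) J (\<lambda>j. a W g j \<oplus>\<^bsub>on_ob Z W\<^esub> a W g' j)"
      by (rule fsum_cong)
        (use g f in \<open>simp_all add: a_def map_add_apply gr_kmap_add nt_add[of _ "Yo B kk" Z]\<close>, use g ac in \<open>auto simp: a_def\<close>)
    also have "\<dots> = fsum (on_ob Z W) J (a W g) \<oplus>\<^bsub>on_ob Z W\<^esub> fsum (on_ob Z W) J (a W g')"
      using g by (intro fsum_add af) simp_all
    finally show "fsum (on_ob Z W) J (a W (ug T (x \<oplus>\<^bsub>on_ob SS W\<^esub> y))) =
      fsum (on_ob Z W) J (a W (ug T x)) \<oplus>\<^bsub>on_ob Z W\<^esub> fsum (on_ob Z W) J (a W (ug T y))"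
      using g ug_fs[OF g(1)] ug_fs[OF g(3)] ug_fs[OF finsup_add[OF _ g(1) g(3)]] by (simp add: Yo_ob hom_space_add)
  next
    fix W c x assume [simp]: "W \<in> Vob" and c [simp]: "c \<in> carrier (fld B)" and "x \<in> el SS W"
    then obtain g where g: "g \<in> finsup W" "x = gr T g" by auto
    have "c \<odot>\<^bsub>on_ob Z W\<^esub> fsum (on_ob Z W) J (a W g) = (\<lambda>z\<in>el Z W. c \<odot>\<^bsub>on_ob Z W\<^esub> z) (fsum (on_ob Z W) J (a W g))"
      using g by simp
    also have "\<dots> = fsum (on_ob Z W) J (\<lambda>j. (\<lambda>z\<in>el Z W. c \<odot>\<^bsub>on_ob Z W\<^esub> z) (a W g j))"
      using g by (intro fsum_lin[OF _ _ smult_lin] af) simp_all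
    also have "\<dots> = fsum (on_ob Z W) J (a W (map_smult T W c g))"
    proof (rule fsum_cong)
      fix j assume "j \<in> J"
      then show "(\<lambda>z\<in>el Z W. c \<odot>\<^bsub>on_ob Z W\<^esub> z) (a W g j) = a W (map_smult T W c g) j"
        using g f ac[of W g j] nt_smult[of "f j" "Yo B kk" Z W c "gr kk (kmap W (g j))"]
        by (simp add: a_def map_smult_apply gr_kmap_smult)
    qed (use g in simp_all)
    finally show "fsum (on_ob Z W) J (a W (ug T (c \<odot>\<^bsub>on_ob SS W\<^esub> x))) = c \<odot>\<^bsub>on_ob Z W\<^esub> fsum (on_ob Z W) J (a W (ug T x))"
      using g ug_fs[OF g(1)] ug_fs[OF finsup_smult[OF _ c g(1)]] by (simp add: Yo_ob hom_space_smult[of T _ W])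
  next
    fix W W' k x assume [simp]: "W \<in> Vob" "W' \<in> Vob" and k [simp]: "k \<in> lin W W'" and "x \<in> el SS W"
    then obtain g where g: "g \<in> finsup W" "x = gr T g" by auto
    have "on_mor Z W W' k (fsum (on_ob Z W) J (a W g)) = fsum (on_ob Z W') J (\<lambda>j. on_mor Z W W' k (a W g j))"
      using g by (intro fsum_lin[OF _ _ LF_mor] af) simp_all
    also have "\<dots> = fsum (on_ob Z W') J (a W' (cmp T k g))"
    proof (rule fsum_cong)
      fix j assume "j \<in> J"
      then show "on_mor Z W W' k (a W g j) = a W' (cmp T k g) j"
        using g f nt_natural[of "f j" "Yo B kk" Z W W' k "gr kk (kmap W (g j))"] by (simp add: a_def cmp_kmap[of W k W'])
    qed (use g finsup_cmp[OF _ _ k g(1)] in simp_all)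
    finally show "fsum (on_ob Z W') J (a W' (ug T (on_mor SS W W' k x))) = on_mor Z W W' k (fsum (on_ob Z W) J (a W (ug T x)))"
      using g ug_fs[OF g(1)] ug_fs[OF finsup_cmp[OF _ _ k g(1)]] by simp
  qed simp
  have hgr: "?h W (gr T g) = fsum (on_ob Z W) J (a W g)" if "W \<in> Vob" "g \<in> finsup W" for W g
    using that ug_fs[OF that(2)] by simp
  have hinj: "?h W (gr T (unitmap W w i)) = f i W (gr kk (kmap W w))" if i: "i \<in> J" and [simp]: "W \<in> Vob" "w \<in> carrier W" for i W w
  proof -
    have "fsum (on_ob Z W) J (a W (unitmap W w i)) = a W (unitmap W w i) i"
      using i f0 by (intro fsum_single) (simp_all add: a_def[of W "unitmap W w i"] unitmap_basis, use f i in auto)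
    then show ?thesis using i by (simp add: hgr a_def unitmap_basis del: mknt_apply)
  qed
  show "\<exists>!h. h \<in> nt SS Z \<and> (\<forall>i\<in>J. Comp (LinFun B) (Yo B kk) h (coprj i) = f i)"
  proof (rule ex1I[of _ ?h], intro conjI ballI h)
    fix i assume i: "i \<in> J"
    show "Comp (LinFun B) (Yo B kk) ?h (coprj i) = f i"
    proof (rule nt_eqI[OF Comp_nt[OF _ coprj_nt[OF i] h]])
      show "f i \<in> nt (Yo B kk) Z" using f i by blast
      fix W z assume W: "W \<in> Vob" "z \<in> el (Yo B kk) W"
      then obtain w where "w \<in> carrier W" "z = gr kk (kmap W w)" by (rule Yo_kk_cases)
      then show "Comp (LinFun B) (Yo B kk) ?h (coprj i) W z = f i W z"
        using W i hinj[OF i W(1), of w] by (simp add: coprj_apply del: mknt_apply)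
    qed simp
  next
    fix h' assume h': "h' \<in> nt SS Z \<and> (\<forall>i\<in>J. Comp (LinFun B) (Yo B kk) h' (coprj i) = f i)"
    then have hn: "h' \<in> nt SS Z" by blast
    show "h' = ?h"
    proof (rule nt_eqI[OF hn h])
      fix W x assume W [simp]: "W \<in> Vob" and "x \<in> el SS W"
      then obtain g where g: "g \<in> finsup W" "x = gr T g" by auto
      have "h' W (gr T g) = ?h W (gr T g)"
        using W g(1)
      proof (induction rule: finsup_induct)
        case zero
        have eq: "gr T (\<lambda>t\<in>carrier T. \<zero>\<^bsub>W\<^esub>) = \<zero>\<^bsub>on_ob SS W\<^esub>" by (simp add: Yo_ob hom_space_zero)
        show ?case
          unfolding eq lin_zero[OF nt_lin[OF hn W] LF_ob[OF SS_simps(6) W] LF_ob[OF Z W]]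
            lin_zero[OF nt_lin[OF h W] LF_ob[OF SS_simps(6) W] LF_ob[OF Z W]] ..
      next
        case (add g1 g2)
        have "gr T (map_add T W g1 g2) = gr T g1 \<oplus>\<^bsub>on_ob SS W\<^esub> gr T g2" using add by (simp add: Yo_ob hom_space_add)
        then show ?case using add nt_add[OF hn, of W "gr T g1" "gr T g2"] nt_add[OF h, of W "gr T g1" "gr T g2"] by (simp del: mknt_apply SS_simps(2))
      next
        case (unit w j)
        have "Comp (LinFun B) (Yo B kk) h' (coprj j) W (gr kk (kmap W w)) = f j W (gr kk (kmap W w))" using h' unit by simp
        then show ?case using unit hinj[OF unit(2) W unit(1)] by (simp add: coprj_apply del: mknt_apply)
      qed
      then show "h' W x = ?h W x" using g by simp
    qed
  qed
qed (simp_all add: coprj_nt)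

lemma QQ_Q3: "QQ \<in> Q3 B"
proof -
  have s: "small B J" unfolding small_eq by (rule U.small_subset[OF Vob_small[OF T_Vob] basis_subset[OF bas]])
  have q: "qpr PP NN \<in> nt PP QQ" by (rule qpr_nt[OF _ subfun_NN]) simp
  have cc_apply: "cc W x = x" if "W \<in> Vob" "x \<in> NN W" for W x using that by (simp add: cc_def)
  have pci: "Comp (LinFun B) (Yo B kk) (prj j) (Comp (LinFun B) (Yo B kk) cc (coprj i)) =
     (if i = j then Idn (LinFun B) (Yo B kk) else zero_nat B (Yo B kk) (Yo B kk))" if ij: "i \<in> J" "j \<in> J" for i j
  proof (rule nt_eqI)
    show "Comp (LinFun B) (Yo B kk) (prj j) (Comp (LinFun B) (Yo B kk) cc (coprj i)) \<in> nt (Yo B kk) (Yo B kk)"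
      using ij by (intro Comp_nt[of _ _ PP, OF _ Comp_nt[OF _ coprj_nt cc_nt] prj_nt]) simp_all
    fix W z assume W: "W \<in> Vob" "z \<in> el (Yo B kk) W"
    then obtain w where "w \<in> carrier W" "z = gr kk (kmap W w)" by (rule Yo_kk_cases)
    then show "Comp (LinFun B) (Yo B kk) (prj j) (Comp (LinFun B) (Yo B kk) cc (coprj i)) W z =
      (if i = j then Idn (LinFun B) (Yo B kk) else zero_nat B (Yo B kk) (Yo B kk)) W z"
      using ij W by (simp add: coprj_apply prj_apply cc_apply unitmap_basis gr_kmap_zero)
  qed simp
  have "is_cokernel B SS PP cc QQ (qpr PP NN)"
    unfolding is_cokernel_def
  proof (intro conjI ballI impI)
    show "QQ \<in> LF" by (rule quoF_LF[OF _ subfun_NN]) simp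
    show "Comp (LinFun B) SS (qpr PP NN) cc = zero_nat B SS QQ"
    proof (rule nt_eqI[OF Comp_nt[OF _ cc_nt q]])
      fix W x assume [simp]: "W \<in> Vob" and x: "x \<in> el SS W"
      then have "x \<in> NN W" "x \<in> el PP W" by auto
      then show "Comp (LinFun B) SS (qpr PP NN) cc W x = zero_nat B SS QQ W x"
        using x by (simp add: cc_apply qpr_zero_iff[OF _ subfun_NN])
    qed (simp_all add: quoF_LF[OF _ subfun_NN])
    fix Z f assume Z: "Z \<in> LF" and f: "f \<in> nt PP Z" and f0: "Comp (LinFun B) SS f cc = zero_nat B SS Z"
    show "\<exists>!h. h \<in> nt QQ Z \<and> Comp (LinFun B) PP h (qpr PP NN) = f"
    proof (rule quoF_lift[OF _ subfun_NN Z f])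
      fix W x assume W: "W \<in> Vob" "x \<in> NN W"
      have "Comp (LinFun B) SS f cc W x = zero_nat B SS Z W x" using f0 by simp
      then show "f W x = \<zero>\<^bsub>on_ob Z W\<^esub>" using W by (simp add: cc_apply)
    qed simp
  qed (rule q)
  then show ?thesis
    unfolding Q3_def using s coproduct_SS product_PP cc_nt pci by blast
qed

text \<open>As a map from \<Y>T to Y, y kills every unit map at j, because that map factors through
  the projection onto j. So it kills the copower and factors through a member of
  \<open>Q3\<close>.\<close>

lemma Q3_vanish:
  assumes Y: "Y \<in> LF" and free: "Y \<in> Qfree B (Q3 B)" and y: "y \<in> el Y T"
    and kill: "\<And>j. j \<in> J \<Longrightarrow> on_mor Y T T (unitmap T j j) y = \<zero>\<^bsub>on_ob Y T\<^esub>"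
  shows "y = \<zero>\<^bsub>on_ob Y T\<^esub>"
proof -
  have f: "yon Y T y \<in> nt PP Y" by (rule yon_nt[OF Y T_Vob y])
  have "\<exists>!h. h \<in> nt QQ Y \<and> Comp (LinFun B) PP h (qpr PP NN) = yon Y T y"
  proof (rule quoF_lift[OF _ subfun_NN Y f])
    fix W x assume W [simp]: "W \<in> Vob" and "x \<in> NN W"
    then obtain g where g: "g \<in> finsup W" "x = gr T g" by auto
    have "on_mor Y T W g y = \<zero>\<^bsub>on_ob Y W\<^esub>" using W g(1)
    proof (induction rule: finsup_induct)
      case zero show ?case by (rule LF_zero_map[OF Y T_Vob W y])
    next
      case (add g1 g2) then show ?case using Y y by (simp add: LF_map_add)
    next
      case (unit w j)
      have "unitmap W w j = cmp T (unitmap W w j) (unitmap T j j)"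
        by (rule basis_ext[OF bas W]) (use unit in \<open>simp_all add: cmp_lin[of _ _ T] unitmap_basis lin_zero[OF unitmap_lin]\<close>)
      then have "on_mor Y T W (unitmap W w j) y = on_mor Y T W (unitmap W w j) (on_mor Y T T (unitmap T j j) y)"
        using unit Y y by (simp add: LF_cmp)
      also have "\<dots> = \<zero>\<^bsub>on_ob Y W\<^esub>" using unit Y by (simp add: kill lin_zero[OF LF_mor])
      finally show ?case .
    qed
    then show "yon Y T y W x = \<zero>\<^bsub>on_ob Y W\<^esub>" using g by (simp add: yon_apply)
  qed simp
  then obtain h where h: "h \<in> nt QQ Y" "Comp (LinFun B) PP h (qpr PP NN) = yon Y T y" by blast
  have "h = zero_nat B QQ Y" using free QQ_Q3 h(1) unfolding Qfree_def by blast
  moreover have "qpr PP NN T (gr T (idm T)) \<in> el QQ T"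
    by (rule nt_closed[OF qpr_nt[OF _ subfun_NN]]) simp_all
  moreover have "Comp (LinFun B) PP h (qpr PP NN) T (gr T (idm T)) = y"
    unfolding h(2) using Y y by (simp add: yon_apply)
  ultimately show ?thesis by simp
qed

end

subsection \<open>Shifts of Q3-free functors\<close>

lemma pt_lin: "W \<in> Vob \<Longrightarrow> restrict pt (el (Yo B kk) W) \<in> lin (on_ob (Yo B kk) W) W"
proof (rule lin_restrictI)
  assume W [simp]: "W \<in> Vob"
  show "on_ob (Yo B kk) W \<in> Vob" by simp
  fix z assume z: "z \<in> el (Yo B kk) W"
  obtain w where w: "w \<in> carrier W" "z = gr kk (kmap W w)" using Yo_kk_cases[OF W z] .
  then show "pt z \<in> carrier W" by simp
  show "pt (c \<odot>\<^bsub>on_ob (Yo B kk) W\<^esub> z) = c \<odot>\<^bsub>W\<^esub> pt z" if "c \<in> carrier (fld B)" for c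
    using that w by (simp flip: gr_kmap_smult)
  fix z' assume z': "z' \<in> el (Yo B kk) W"
  obtain w' where "w' \<in> carrier W" "z' = gr kk (kmap W w')" using Yo_kk_cases[OF W z'] .
  then show "pt (z \<oplus>\<^bsub>on_ob (Yo B kk) W\<^esub> z') = pt z \<oplus>\<^bsub>W\<^esub> pt z'"
    using w by (simp flip: gr_kmap_add)
qed

lemma pt_zero [simp]: "W \<in> Vob \<Longrightarrow> pt \<zero>\<^bsub>on_ob (Yo B kk) W\<^esub> = \<zero>\<^bsub>W\<^esub>"
  using lin_zero[OF pt_lin, of W] by simp

lemma gr_pt: "W \<in> Vob \<Longrightarrow> z \<in> el (Yo B kk) W \<Longrightarrow> gr kk (kmap W (pt z)) = z"
  using Yo_kk_cases[of W z] pt_kmap by metis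

lemma vb_zero_right: "V \<in> Vob \<Longrightarrow> W \<in> Vob \<Longrightarrow> x \<in> carrier V \<Longrightarrow> vb V W x \<zero>\<^bsub>W\<^esub> = \<zero>\<^bsub>V \<star> W\<^esub>"
  using lin_zero[OF vb_left_lin, of V W x] by simp

text \<open>A subspace of a subspace is a subspace of V, so forming the span inside the smaller
  space gives nothing smaller.\<close>

lemma basis_subspace_span:
  assumes V [simp]: "V \<in> Vob" and A: "A \<subseteq> carrier V"
  shows "span (V\<lparr>carrier := span V A\<rparr>) A = span V A"
proof -
  note S = span_submodule[OF V A]
  let ?T = "V\<lparr>carrier := span V A\<rparr>"
  have T: "?T \<in> Vob" by (rule subspace_Vob[OF V S])
  have AT: "A \<subseteq> carrier ?T" using span_superset[of A V] by simp
  note S' = span_submodule[OF T AT]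
  have "span ?T A \<subseteq> span V A" using submoduleD(1)[OF S' T] by auto
  moreover have "submodule (span ?T A) (fld B) V"
    unfolding submodule_iff[OF V]
    using submoduleD[OF S' T] submoduleD(1)[OF S V] by auto
  ultimately show ?thesis using span_minimal[OF _ span_superset, of ?T A V] by blast
qed

section \<open>Arbitrary presentations of members of Q3\<close>

context
  fixes I S s P p c
  assumes cop: "is_coproduct (LinFun B) I (\<lambda>_. Yo B kk) S s"
    and prd: "is_product (LinFun B) I (\<lambda>_. Yo B kk) P p"
    and cnt: "c \<in> nt S P"
    and can: "\<And>i j. i \<in> I \<Longrightarrow> j \<in> I \<Longrightarrow>
        Comp (LinFun B) (Yo B kk) (p j) (Comp (LinFun B) (Yo B kk) c (s i)) =
        (if i = j then Idn (LinFun B) (Yo B kk) else zero_nat B (Yo B kk) (Yo B kk))"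
begin

lemma S_LF: "S \<in> LF" and s_nt: "i \<in> I \<Longrightarrow> s i \<in> nt (Yo B kk) S"
  using cop by (simp_all add: is_coproduct_def)

lemma P_LF [simp]: "P \<in> LF" and p_nt: "i \<in> I \<Longrightarrow> p i \<in> nt P (Yo B kk)"
  using prd by (simp_all add: is_product_def)

lemma P_lift: "Z \<in> LF \<Longrightarrow> (\<And>i. i \<in> I \<Longrightarrow> f i \<in> nt Z (Yo B kk)) \<Longrightarrow>
    \<exists>!h. h \<in> nt Z P \<and> (\<forall>i\<in>I. Comp (LinFun B) Z (p i) h = f i)"
  using prd by (simp add: is_product_def)

text \<open>By Yoneda, elements of P(W) are maps from \<Y>W to P, so uniqueness in the product
  property separates them.\<close>

lemma P_ext:
  assumes W: "W \<in> Vob" and x: "x \<in> el P W" and y: "y \<in> el P W" and eq: "\<And>i. i \<in> I \<Longrightarrow> p i W x = p i W y"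
  shows "x = y"
proof -
  note nx = yon_nt[OF P_LF W x] and ny = yon_nt[OF P_LF W y]
  have "\<exists>!h. h \<in> nt (Yo B W) P \<and> (\<forall>i\<in>I. Comp (LinFun B) (Yo B W) (p i) h = Comp (LinFun B) (Yo B W) (p i) (yon P W x))"
    by (rule P_lift) (use W Comp_nt[OF _ nx p_nt] in simp_all)
  moreover have "Comp (LinFun B) (Yo B W) (p i) (yon P W y) = Comp (LinFun B) (Yo B W) (p i) (yon P W x)" if i: "i \<in> I" for i
    by (rule nt_Yo_eqI[OF Comp_nt[OF _ ny p_nt[OF i]] Comp_nt[OF _ nx p_nt[OF i]] W])
      (use W x y eq[OF i] in \<open>simp_all add: yon_apply\<close>)
  ultimately have "yon P W x = yon P W y" using nx ny by blast
  from fun_cong[OF fun_cong[OF this, of W], of "gr W (idm W)"] show ?thesis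
    using W x y by (simp add: yon_apply)
qed

lemma p_c_s:
  assumes i: "i \<in> I" and j: "j \<in> I" and W: "W \<in> Vob" and z: "z \<in> el (Yo B kk) W"
  shows "p j W (c W (s i W z)) = (if i = j then z else \<zero>\<^bsub>on_ob (Yo B kk) W\<^esub>)"
proof -
  have "p j W (c W (s i W z)) = Comp (LinFun B) (Yo B kk) (p j) (Comp (LinFun B) (Yo B kk) c (s i)) W z"
    using W z by simp
  then show ?thesis unfolding can[OF i j] using W z by simp
qed

lemma c_s_closed: "i \<in> I \<Longrightarrow> W \<in> Vob \<Longrightarrow> z \<in> el (Yo B kk) W \<Longrightarrow> c W (s i W z) \<in> el P W"
  by (rule nt_closed[OF cnt _ nt_closed[OF s_nt]])

text \<open>The i-th unit vector of the power of k that P(k) represents.\<close>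

definition del where "del i = c kk (s i kk (gr kk (idm kk)))"
text \<open>A space with basis indexed by I is found inside P(k) as the span of the unit vectors, so
  no free vector space has to be constructed and smallness is inherited.\<close>

definition TT where "TT = (on_ob P kk)\<lparr>carrier := span (on_ob P kk) (del ` I)\<rparr>"

lemma del_P: "i \<in> I \<Longrightarrow> del i \<in> el P kk"
  unfolding del_def by (rule c_s_closed) simp_all

lemma TT_Vob [simp]: "TT \<in> Vob"
  unfolding TT_def by (intro subspace_Vob span_submodule) (use del_P in auto)

lemma pt_p_del: "i \<in> I \<Longrightarrow> j \<in> I \<Longrightarrow> pt (p j kk (del i)) = (if i = j then \<one>\<^bsub>fld B\<^esub> else \<zero>\<^bsub>fld B\<^esub>)"
  using pt_gr[of "idm kk" kk] by (simp add: del_def p_c_s)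

lemma del_inj: "i \<in> I \<Longrightarrow> j \<in> I \<Longrightarrow> del i = del j \<Longrightarrow> i = j"
  using pt_p_del[of i j] pt_p_del[of j j] K.zero_not_one by (auto split: if_splits)

text \<open>The projections of the product, evaluated at k, are the dual functionals of the unit
  vectors.\<close>

lemma basis_TT: "basis TT (del ` I)"
proof -
  have d: "del ` I \<subseteq> el P kk" using del_P by blast
  have sub: "del ` I \<subseteq> span (on_ob P kk) (del ` I)" by (rule span_superset)
  have "\<exists>\<phi>\<in>lin TT kk. \<forall>e'\<in>del ` I. \<phi> e' = (if e' = del i then \<one>\<^bsub>fld B\<^esub> else \<zero>\<^bsub>fld B\<^esub>)" if i: "i \<in> I" for i
  proof -
    have el: "t \<in> el P kk" if "t \<in> carrier TT" for t
      using that span_carrier[OF _ d] by (simp add: TT_def)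
    note pl = p_nt[OF i]
    have "(\<lambda>t\<in>carrier TT. pt (p i kk t)) \<in> lin TT kk"
    proof (rule lin_restrictI[OF TT_Vob])
      fix t t' assume t: "t \<in> carrier TT" "t' \<in> carrier TT"
      show "pt (p i kk t) \<in> carrier kk" using lin_closed[OF pt_lin nt_closed[OF pl _ el]] t nt_closed[OF pl _ el] by simp
      have "p i kk (t \<oplus>\<^bsub>TT\<^esub> t') = p i kk t \<oplus>\<^bsub>on_ob (Yo B kk) kk\<^esub> p i kk t'"
        using nt_add[OF pl _ el el] t by (simp add: TT_def)
      then show "pt (p i kk (t \<oplus>\<^bsub>TT\<^esub> t')) = pt (p i kk t) \<oplus>\<^bsub>kk\<^esub> pt (p i kk t')"
        using lin_add[OF pt_lin nt_closed[OF pl _ el] nt_closed[OF pl _ el]] t nt_closed[OF pl _ el] by simp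
    next
      fix c t assume c: "c \<in> carrier (fld B)" and t: "t \<in> carrier TT"
      have "p i kk (c \<odot>\<^bsub>TT\<^esub> t) = c \<odot>\<^bsub>on_ob (Yo B kk) kk\<^esub> p i kk t"
        using nt_smult[OF pl _ c el] t by (simp add: TT_def)
      then show "pt (p i kk (c \<odot>\<^bsub>TT\<^esub> t)) = c \<odot>\<^bsub>kk\<^esub> pt (p i kk t)"
        using lin_smult[OF pt_lin c nt_closed[OF pl _ el]] t c nt_closed[OF pl _ el] by simp
    qed
    moreover have "(\<lambda>t\<in>carrier TT. pt (p i kk t)) e' = (if e' = del i then \<one>\<^bsub>fld B\<^esub> else \<zero>\<^bsub>fld B\<^esub>)" if e': "e' \<in> del ` I" for e'
    proof -
      obtain j where j: "j \<in> I" "e' = del j" using e' by blast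
      have "e' \<in> carrier TT" using e' sub by (auto simp: TT_def)
      then show ?thesis using j i pt_p_del[OF j(1) i] del_inj[OF j(1) i] by auto
    qed
    ultimately show ?thesis by blast
  qed
  moreover have "span TT (del ` I) = carrier TT"
    unfolding TT_def using basis_subspace_span[OF _ d] by simp
  moreover have "del ` I \<subseteq> carrier TT" using sub by (simp add: TT_def)
  ultimately show ?thesis by (simp add: basis_def)
qed

text \<open>P and \<open>Yo B TT\<close> are products of the same family of copies of the unit; m is
  the comparison map.\<close>

lemma ex_param:
  "\<exists>m\<in>nt (Yo B TT) P. \<forall>i\<in>I. \<forall>W\<in>Vob. \<forall>g\<in>lin TT W. p i W (m W (gr TT g)) = gr kk (kmap W (g (del i)))"
proof -
  have dT: "del i \<in> del ` I" if "i \<in> I" for i using that by blast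
  have "\<exists>!h. h \<in> nt (Yo B TT) P \<and> (\<forall>i\<in>I. Comp (LinFun B) (Yo B TT) (p i) h = prj TT (del i))"
    by (rule P_lift) (simp_all add: prj_nt[OF basis_TT])
  then obtain m where m: "m \<in> nt (Yo B TT) P" "\<And>i. i \<in> I \<Longrightarrow> Comp (LinFun B) (Yo B TT) (p i) m = prj TT (del i)" by blast
  have "p i W (m W (gr TT g)) = gr kk (kmap W (g (del i)))" if i: "i \<in> I" and W: "W \<in> Vob" and g: "g \<in> lin TT W" for i W g
  proof -
    have "p i W (m W (gr TT g)) = Comp (LinFun B) (Yo B TT) (p i) m W (gr TT g)" using W g by simp
    also have "\<dots> = gr kk (kmap W (g (del i)))" unfolding m(2)[OF i] using i by (intro prj_apply[OF basis_TT _ W g]) simp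
    finally show ?thesis .
  qed
  then show ?thesis using m(1) by blast
qed

text \<open>Along the comparison map m, \<zeta> becomes an element y of Y(V \<otimes> TT). Vanishing
  of \<zeta> on the image of c says that id \<otimes> (projection onto a unit vector) kills y. Every
  projection onto a basis vector b \<otimes> \<open>del i\<close> factors through such a map, so
  \<open>Q3_vanish\<close> gives y = 0.\<close>

lemma Q3_map_vanishes:
  assumes Y [simp]: "Y \<in> LF" and free: "Y \<in> Qfree B (Q3 B)" and V [simp]: "V \<in> Vob"
    and \<zeta>: "\<zeta> \<in> nt P (shl Y V)" and \<zeta>c: "\<And>W x. W \<in> Vob \<Longrightarrow> x \<in> el S W \<Longrightarrow> \<zeta> W (c W x) = \<zero>\<^bsub>on_ob Y (V \<star> W)\<^esub>"
  shows "\<zeta> = zero_nat B P (shl Y V)"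
proof -
  obtain m where m: "m \<in> nt (Yo B TT) P" and
    pm: "\<And>i W g. i \<in> I \<Longrightarrow> W \<in> Vob \<Longrightarrow> g \<in> lin TT W \<Longrightarrow> p i W (m W (gr TT g)) = gr kk (kmap W (g (del i)))"
    using ex_param by auto
  have dT: "del i \<in> carrier TT" if "i \<in> I" for i using basis_mem[OF basis_TT] that by blast
  define y where "y = \<zeta> TT (m TT (gr TT (idm TT)))"
  have sh: "shl Y V \<in> LF" by (rule shl_LF[OF Y V])
  have mc: "m W (gr TT g) \<in> el P W" if "W \<in> Vob" "g \<in> lin TT W" for W g
    using that by (intro nt_closed[OF m]) simp_all
  have yT: "y \<in> el Y (V \<star> TT)" unfolding y_def using nt_closed[OF \<zeta> TT_Vob mc[OF TT_Vob idm_lin[OF TT_Vob]]] by simp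
  have \<zeta>m: "\<zeta> W (m W (gr TT g)) = on_mor Y (V \<star> TT) (V \<star> W) (tm V V TT W (idm V) g) y" if W: "W \<in> Vob" and g: "g \<in> lin TT W" for W g
    using nt_Yo_apply[OF Comp_nt[OF _ m \<zeta>] _ W g] W g by (simp add: y_def)
  \<comment> \<open>A preimage is the linear map whose value at the i-th unit vector is the i-th
    component of x; injectivity of \<open>del\<close> makes this a definition.\<close>
  have surj: "\<exists>g\<in>lin TT W. x = m W (gr TT g)" if W: "W \<in> Vob" and x: "x \<in> el P W" for W x
  proof -
    have pc: "p i W x \<in> el (Yo B kk) W" if "i \<in> I" for i by (rule nt_closed[OF p_nt[OF that] W x])
    have ptc: "pt (p i W x) \<in> carrier W" if "i \<in> I" for i
      using lin_closed[OF pt_lin[OF W] pc[OF that]] pc[OF that] by simp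
    have ti: "the_inv_into I del (del i) = i" if "i \<in> I" for i
      by (rule the_inv_into_f_f[OF inj_onI that]) (rule del_inj)
    have fc: "pt (p (the_inv_into I del d) W x) \<in> carrier W" if "d \<in> del ` I" for d
      using that ptc ti by auto
    obtain g where g: "g \<in> lin TT W" "\<And>d. d \<in> del ` I \<Longrightarrow> g d = pt (p (the_inv_into I del d) W x)"
      using basis_lift[OF basis_TT W, where f = "\<lambda>d. pt (p (the_inv_into I del d) W x)", OF fc] by auto
    have "x = m W (gr TT g)"
    proof (rule P_ext[OF W x mc[OF W g(1)]])
      fix i assume i: "i \<in> I"
      then show "p i W x = p i W (m W (gr TT g))"
        using g(2)[of "del i"] pm[OF i W g(1)] ti[OF i] gr_pt[OF W pc[OF i]] by simp
    qed
    then show ?thesis using g(1) by blast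
  qed
  have kill: "on_mor Y (V \<star> TT) (V \<star> TT) (tm V V TT TT (idm V) (unitmap TT (del ` I) TT (del i) (del i))) y = \<zero>\<^bsub>on_ob Y (V \<star> TT)\<^esub>"
    if i: "i \<in> I" for i
  proof -
    let ?u = "unitmap TT (del ` I) TT (del i) (del i)"
    have u: "?u \<in> lin TT TT" using i dT by (intro unitmap_lin[OF basis_TT]) simp_all
    have k: "gr kk (kmap TT (del i)) \<in> el (Yo B kk) TT" using dT[OF i] by simp
    \<comment> \<open>The projection onto the i-th unit vector comes from the copower: its
      components are those of the i-th coprojection followed by c.\<close>
    have "m TT (gr TT ?u) = c TT (s i TT (gr kk (kmap TT (del i))))"
    proof (rule P_ext[OF TT_Vob mc[OF TT_Vob u] c_s_closed[OF i TT_Vob k]])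
      fix j assume j: "j \<in> I"
      have "?u (del j) = (if del j = del i then del i else \<zero>\<^bsub>TT\<^esub>)"
        using i j dT by (intro unitmap_basis[OF basis_TT]) simp_all
      then show "p j TT (m TT (gr TT ?u)) = p j TT (c TT (s i TT (gr kk (kmap TT (del i)))))"
        using pm[OF j TT_Vob u] p_c_s[OF i j TT_Vob k] del_inj[OF j i] gr_kmap_zero[OF TT_Vob] by auto
    qed
    then have "\<zeta> TT (m TT (gr TT ?u)) = \<zero>\<^bsub>on_ob Y (V \<star> TT)\<^esub>"
      using \<zeta>c[OF TT_Vob nt_closed[OF s_nt[OF i] TT_Vob k]] by simp
    then show ?thesis using \<zeta>m[OF TT_Vob u] by simp
  qed
  obtain E where E: "basis V E" using ex_basis[OF V] .
  let ?J = "{vb V TT b d | b d. b \<in> E \<and> d \<in> del ` I}"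
  have J: "basis (V \<star> TT) ?J" by (rule basis_tensor[OF E basis_TT])
  have "y = \<zero>\<^bsub>on_ob Y (V \<star> TT)\<^esub>"
  proof (rule Q3_vanish[OF J Y free yT])
    fix j assume j: "j \<in> ?J"
    then obtain b i where bi: "b \<in> E" "i \<in> I" "j = vb V TT b (del i)" by blast
    let ?U = "unitmap (V \<star> TT) ?J (V \<star> TT) j j"
    let ?u = "unitmap TT (del ` I) TT (del i) (del i)"
    let ?t = "tm V V TT TT (idm V) ?u"
    have u: "?u \<in> lin TT TT" using bi dT by (intro unitmap_lin[OF basis_TT]) simp_all
    have t: "?t \<in> lin (V \<star> TT) (V \<star> TT)" using u by simp
    have jc: "j \<in> carrier (V \<star> TT)" by (rule basis_mem[OF J j])
    have U: "?U \<in> lin (V \<star> TT) (V \<star> TT)" using jc j by (intro unitmap_lin[OF J]) simp_all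
    have ud: "?u (del i') = (if i' = i then del i else \<zero>\<^bsub>TT\<^esub>)" if i': "i' \<in> I" for i'
      using unitmap_basis[OF basis_TT, of TT "del i" "del i" "del i'"] bi i' dT del_inj[OF i' bi(2)] by auto
    have tv: "?t (vb V TT b' (del i')) = (if i' = i then vb V TT b' (del i) else \<zero>\<^bsub>V \<star> TT\<^esub>)" if "b' \<in> E" "i' \<in> I" for b' i'
      using that u basis_mem[OF E] dT by (simp add: tm_vb ud vb_zero_right)
    \<comment> \<open>This factorisation is why the basis of the tensor product is built from the
      unit vectors of \<open>TT\<close>: \<open>?t\<close> is already known to kill y.\<close>
    have "?U = cmp (V \<star> TT) ?U ?t"
    proof (rule basis_ext[OF J _ U cmp_lin[OF _ t U]])
      fix j' assume j': "j' \<in> ?J"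
      then obtain b' i' where bi': "b' \<in> E" "i' \<in> I" "j' = vb V TT b' (del i')" by blast
      have Uj: "?U j' = (if j' = j then j else \<zero>\<^bsub>V \<star> TT\<^esub>)" using j j' jc by (intro unitmap_basis[OF J]) simp_all
      have jc': "j' \<in> carrier (V \<star> TT)" by (rule basis_mem[OF J j'])
      show "?U j' = cmp (V \<star> TT) ?U ?t j'"
      proof (cases "i' = i")
        case True
        then show ?thesis using tv[OF bi'(1,2)] bi' jc' by simp
      next
        case False
        then have t0: "?t j' = \<zero>\<^bsub>V \<star> TT\<^esub>" using tv[OF bi'(1,2)] bi'(3) by simp
        \<comment> \<open>If \<open>j' = j\<close> although i' differs from i, then
          \<open>?t\<close> both fixes and kills j, so j is zero and so is the value of
          \<open>?U\<close>.\<close>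
        have "?U j' = \<zero>\<^bsub>V \<star> TT\<^esub>"
        proof (cases "j' = j")
          case True
          have "?t j = j" using tv[OF bi(1,2)] bi(3) by simp
          then show ?thesis using t0 True Uj by simp
        qed (simp add: Uj)
        then show ?thesis using t0 jc' lin_zero[OF U] by simp
      qed
    qed simp_all
    then have "on_mor Y (V \<star> TT) (V \<star> TT) ?U y = on_mor Y (V \<star> TT) (V \<star> TT) ?U (on_mor Y (V \<star> TT) (V \<star> TT) ?t y)"
      using LF_cmp[OF Y _ _ _ t U yT] by simp
    also have "\<dots> = \<zero>\<^bsub>on_ob Y (V \<star> TT)\<^esub>"
      unfolding kill[OF bi(2)] by (rule lin_zero[OF LF_mor[OF Y _ _ U]]) simp_all
    finally show "on_mor Y (V \<star> TT) (V \<star> TT) ?U y = \<zero>\<^bsub>on_ob Y (V \<star> TT)\<^esub>" .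
  qed
  then have y0: "\<zeta> W (m W (gr TT g)) = \<zero>\<^bsub>on_ob Y (V \<star> W)\<^esub>" if "W \<in> Vob" "g \<in> lin TT W" for W g
    using \<zeta>m[OF that] that lin_zero[OF LF_mor[OF Y, of "V \<star> TT" "V \<star> W"]] by simp
  show ?thesis
  proof (rule nt_eqI[OF \<zeta> zero_nat_nt[OF P_LF sh]])
    fix W x assume W: "W \<in> Vob" and x: "x \<in> el P W"
    obtain g where "g \<in> lin TT W" "x = m W (gr TT g)" using surj[OF W x] by blast
    then show "\<zeta> W x = zero_nat B P (shl Y V) W x" using y0[OF W] W x by simp
  qed
qed

end

lemma Q3_LF: "Q \<in> Q3 B \<Longrightarrow> Q \<in> LF"
  unfolding Q3_def is_cokernel_def by blast

text \<open>The composite of \<tau> with the cokernel map q vanishes, and uniqueness in the cokernel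
  property cancels q.\<close>

lemma Q3_no_map:
  assumes Y: "Y \<in> LF" and free: "Y \<in> Qfree B (Q3 B)" and V: "V \<in> Vob"
    and Q: "Q \<in> Q3 B" and \<tau>: "\<tau> \<in> nt Q (shl Y V)"
  shows "\<tau> = zero_nat B Q (shl Y V)"
proof -
  obtain I S s P p c q where Q3: "small B I \<and> is_coproduct (LinFun B) I (\<lambda>i. Yo B kk) S s \<and>
     is_product (LinFun B) I (\<lambda>i. Yo B kk) P p \<and> c \<in> nt S P \<and>
     (\<forall>i\<in>I. \<forall>j\<in>I. Comp (LinFun B) (Yo B kk) (p j) (Comp (LinFun B) (Yo B kk) c (s i)) =
        (if i = j then Idn (LinFun B) (Yo B kk) else zero_nat B (Yo B kk) (Yo B kk))) \<and>
     is_cokernel B S P c Q q"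
    using Q[unfolded Q3_def mem_Collect_eq] by (elim exE) (rule that)
  have cop: "is_coproduct (LinFun B) I (\<lambda>_. Yo B kk) S s" using Q3 by (elim conjE)
  have prd: "is_product (LinFun B) I (\<lambda>_. Yo B kk) P p" using Q3 by (elim conjE)
  have cnt: "c \<in> nt S P" using Q3 by (elim conjE)
  have ck: "is_cokernel B S P c Q q" using Q3 by (elim conjE)
  have can: "\<forall>i\<in>I. \<forall>j\<in>I. Comp (LinFun B) (Yo B kk) (p j) (Comp (LinFun B) (Yo B kk) c (s i)) =
        (if i = j then Idn (LinFun B) (Yo B kk) else zero_nat B (Yo B kk) (Yo B kk))" using Q3 by (elim conjE)
  have sh: "shl Y V \<in> LF" by (rule shl_LF[OF Y V])
  note ck' = ck[unfolded is_cokernel_def]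
  have QLF: "Q \<in> LF" by (rule ck'[THEN conjunct1])
  have q: "q \<in> nt P Q" by (rule ck'[THEN conjunct2, THEN conjunct1])
  have qc: "Comp (LinFun B) S q c = zero_nat B S Q" by (rule ck'[THEN conjunct2, THEN conjunct2, THEN conjunct1])
  have P: "P \<in> LF" by (rule prd[unfolded is_product_def, THEN conjunct1])
  have S: "S \<in> LF" by (rule cop[unfolded is_coproduct_def, THEN conjunct1])
  have \<zeta>: "Comp (LinFun B) P \<tau> q \<in> nt P (shl Y V)" by (rule Comp_nt[OF P q \<tau>])
  have e: "Comp (LinFun B) P \<tau> q = zero_nat B P (shl Y V)"
  proof (rule Q3_map_vanishes[OF cop prd cnt _ Y free V \<zeta>])
    fix W x assume W: "W \<in> Vob" and x: "x \<in> el S W"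
    have "q W (c W x) = Comp (LinFun B) S q c W x" using W x by simp
    then have "q W (c W x) = \<zero>\<^bsub>on_ob Q W\<^esub>" using qc W x by simp
    then show "Comp (LinFun B) P \<tau> q W (c W x) = \<zero>\<^bsub>on_ob Y (V \<star> W)\<^esub>"
      using nt_closed[OF cnt W x] W lin_zero[OF nt_lin[OF \<tau> W] LF_ob[OF QLF W] LF_ob[OF sh W]] by simp
  qed (rule can[THEN bspec, THEN bspec])
  have z0: "Comp (LinFun B) S (zero_nat B P (shl Y V)) c = zero_nat B S (shl Y V)"
    by (rule nt_eqI[OF Comp_nt[OF S cnt zero_nat_nt[OF P sh]] zero_nat_nt[OF S sh]]) (simp add: nt_closed[OF cnt])
  have "\<exists>!h. h \<in> nt Q (shl Y V) \<and> Comp (LinFun B) P h q = zero_nat B P (shl Y V)"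
    by (rule ck'[THEN conjunct2, THEN conjunct2, THEN conjunct2, THEN bspec, OF sh, THEN bspec,
        OF zero_nat_nt[OF P sh], THEN mp, OF z0])
  moreover have "Comp (LinFun B) P (zero_nat B Q (shl Y V)) q = zero_nat B P (shl Y V)"
    by (rule nt_eqI[OF Comp_nt[OF P q zero_nat_nt[OF QLF sh]] zero_nat_nt[OF P sh]]) (simp add: nt_closed[OF q])
  ultimately show ?thesis using \<tau> e zero_nat_nt[OF QLF sh] by blast
qed

subsection \<open>Shifts of Q4-free functors\<close>

context
  fixes V V' F assumes V [simp]: "V \<in> Vob" and V' [simp]: "V' \<in> Vob"
    and F: "subspace_filter B V' F" and F0: "\<Inter>F = {\<zero>\<^bsub>V'\<^esub>}"
begin

text \<open>The filter generated by the subspaces \<open>V \<otimes> H\<close>, \<open>H \<in> F\<close>.\<close>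

definition tfil :: "'u set set" where
  "tfil = {K. submodule K (fld B) (V \<star> V') \<and> (\<exists>H\<in>F. \<forall>v\<in>carrier V. \<forall>x\<in>H. vb V V' v x \<in> K)}"

lemmas F_props = F[unfolded subspace_filter_def]
lemmas F_ne = F_props[THEN conjunct1]
  and F_sub = F_props[THEN conjunct2, THEN conjunct1, rule_format]
  and F_int = F_props[THEN conjunct2, THEN conjunct2, THEN conjunct1, rule_format]

lemma F_el: "H \<in> F \<Longrightarrow> x \<in> H \<Longrightarrow> x \<in> carrier V'"
  by (rule submoduleD(1)[OF F_sub V'])

lemma tfil_int:
  assumes "K \<in> tfil" "K' \<in> tfil" shows "K \<inter> K' \<in> tfil"
proof -
  obtain H H' where H: "H \<in> F" "\<forall>v\<in>carrier V. \<forall>x\<in>H. vb V V' v x \<in> K" "H' \<in> F" "\<forall>v\<in>carrier V. \<forall>x\<in>H'. vb V V' v x \<in> K'"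
    using assms unfolding tfil_def by blast
  have S: "submodule K (fld B) (V \<star> V')" "submodule K' (fld B) (V \<star> V')" using assms by (simp_all add: tfil_def)
  have "submodule (K \<inter> K') (fld B) (V \<star> V')"
    unfolding submodule_iff[OF vt_Vob[OF V V']]
    using submoduleD[OF S(1) vt_Vob[OF V V']] submoduleD[OF S(2) vt_Vob[OF V V']] by auto
  moreover have "\<forall>v\<in>carrier V. \<forall>x\<in>H \<inter> H'. vb V V' v x \<in> K \<inter> K'" using H by simp
  ultimately show ?thesis using F_int[OF H(1) H(3)] unfolding tfil_def by blast
qed

lemma tfil_filter: "subspace_filter B (V \<star> V') tfil"
  unfolding subspace_filter_def
proof (intro conjI ballI allI impI)
  obtain H where H: "H \<in> F" using F_ne by blast
  have "carrier (V \<star> V') \<in> tfil"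
    unfolding tfil_def mem_Collect_eq
    by (intro conjI bexI[OF _ H] ballI carrier_submodule) (use F_el[OF H] in simp_all)
  then show "tfil \<noteq> {}" by blast
  show "submodule K (fld B) (V \<star> V')" if "K \<in> tfil" for K using that by (simp add: tfil_def)
  show "K \<inter> K' \<in> tfil" if "K \<in> tfil" "K' \<in> tfil" for K K' using tfil_int[OF that] .
  show "K' \<in> tfil" if "K \<in> tfil" "submodule K' (fld B) (V \<star> V')" "K \<subseteq> K'" for K K'
    using that unfolding tfil_def by blast
qed

text \<open>Slicing a tensor along the coordinates of \<open>V\<close> detects which subspaces of \<open>V'\<close> it involves.\<close>

lemma tfil_Inter: "\<Inter>tfil = {\<zero>\<^bsub>V \<star> V'\<^esub>}"
proof -
  obtain E where E: "basis V E" using ex_basis[OF V] .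
  obtain G where G: "basis V' G" using ex_basis[OF V'] .
  let ?J = "{vb V V' b d | b d. b \<in> E \<and> d \<in> G}"
  have J: "basis (V \<star> V') ?J" by (rule basis_tensor[OF E G])
  note cE = coord_closed[OF E]
  have ex: "\<exists>h. h \<in> lin (V \<star> V') V' \<and> (\<forall>v\<in>carrier V. \<forall>x\<in>carrier V'. h (vb V V' v x) = coord V E b v \<odot>\<^bsub>V'\<^esub> x)" if b: "b \<in> E" for b
  proof (rule vt_lift[OF V V' V'])
    show "bilinear_on B V V' V' (\<lambda>v x. coord V E b v \<odot>\<^bsub>V'\<^esub> x)"
      by (rule bilinear_onI) (simp_all add: cE[OF b] vadd_smult vsmult_add vsmult_smult
        lin_add[OF coord_lin[OF E b]] lin_smult[OF coord_lin[OF E b]] K.m_comm)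
  qed
  define L where "L b = (SOME h. h \<in> lin (V \<star> V') V' \<and> (\<forall>v\<in>carrier V. \<forall>x\<in>carrier V'. h (vb V V' v x) = coord V E b v \<odot>\<^bsub>V'\<^esub> x))" for b
  have Lp: "L b \<in> lin (V \<star> V') V' \<and> (\<forall>v\<in>carrier V. \<forall>x\<in>carrier V'. L b (vb V V' v x) = coord V E b v \<odot>\<^bsub>V'\<^esub> x)" if "b \<in> E" for b
    unfolding L_def by (rule someI_ex[OF ex[OF that]])
  have L: "L b \<in> lin (V \<star> V') V'" if "b \<in> E" for b using Lp[OF that] by simp
  have Lv: "L b (vb V V' v x) = coord V E b v \<odot>\<^bsub>V'\<^esub> x" if "b \<in> E" "v \<in> carrier V" "x \<in> carrier V'" for b v x
    using Lp[OF that(1)] that by simp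
  have "t = \<zero>\<^bsub>V \<star> V'\<^esub>" if t: "t \<in> \<Inter>tfil" for t
  proof -
    obtain K where K: "K \<in> tfil" using tfil_filter unfolding subspace_filter_def by blast
    have tc: "t \<in> carrier (V \<star> V')"
      using t K submoduleD(1)[of K "V \<star> V'" t] by (simp add: tfil_def)
    have LH: "L b t \<in> H" if H: "H \<in> F" and b: "b \<in> E" for H b
    proof -
      \<comment> \<open>The preimage of H under the slice belongs to the filter, because the slice
        sends v \<otimes> x to a multiple of x.\<close>
      let ?K = "{s \<in> carrier (V \<star> V'). L b s \<in> H}"
      have "submodule ?K (fld B) (V \<star> V')"
        unfolding submodule_iff[OF vt_Vob[OF V V']]
        using submoduleD[OF F_sub[OF H] V'] lin_zero[OF L[OF b]] by (auto simp: lin_add[OF L[OF b]] lin_smult[OF L[OF b]])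
      moreover have "\<forall>v\<in>carrier V. \<forall>x\<in>H. vb V V' v x \<in> ?K"
        using F_el[OF H] submoduleD(4)[OF F_sub[OF H] V'] cE[OF b] by (simp add: Lv[OF b])
      ultimately have "?K \<in> tfil" unfolding tfil_def using H by blast
      then show ?thesis using t by blast
    qed
    have L0: "L b t = \<zero>\<^bsub>V'\<^esub>" if "b \<in> E" for b
      using LH[OF _ that] F0 by blast
    show ?thesis
    proof (rule basis_coord_zero[OF J tc])
      fix j assume j: "j \<in> ?J"
      then obtain b d where bd: "b \<in> E" "d \<in> G" "j = vb V V' b d" by blast
      have "coord (V \<star> V') ?J j = cmp (V \<star> V') (coord V' G d) (L b)"
      proof (rule basis_ext[OF J ground_Vob coord_lin[OF J j] cmp_lin[OF _ L[OF bd(1)] coord_lin[OF G bd(2)]]])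
        fix j' assume j': "j' \<in> ?J"
        then obtain b' d' where bd': "b' \<in> E" "d' \<in> G" "j' = vb V V' b' d'" by blast
        have val: "coord V' G d (L b (vb V V' b1 d1)) = (if b1 = b \<and> d1 = d then \<one>\<^bsub>fld B\<^esub> else \<zero>\<^bsub>fld B\<^esub>)"
          if "b1 \<in> E" "d1 \<in> G" for b1 d1
          using that bd basis_mem[OF E] basis_mem[OF G] coord_basis[OF E, of b b1] coord_basis[OF G, of d d1] coord_basis[OF G bd(2) bd(2)]
            lin_smult[OF coord_lin[OF G bd(2)], of "\<one>\<^bsub>fld B\<^esub>" d1] lin_zero[OF coord_lin[OF G bd(2)]]
          by (simp add: Lv[OF bd(1)])
        have "coord (V \<star> V') ?J j j' = (if j' = j then \<one>\<^bsub>fld B\<^esub> else \<zero>\<^bsub>fld B\<^esub>)"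
          by (rule coord_basis[OF J j j'])
        \<comment> \<open>The composite functional is 1 at the pair (b, d) and 0 at all others, so
          this pair is recovered from its tensor.\<close>
        moreover have "j' = j \<longleftrightarrow> b' = b \<and> d' = d"
          using val[OF bd(1,2)] val[OF bd'(1,2)] bd(3) bd'(3) K.one_not_zero by (auto split: if_splits)
        ultimately show "coord (V \<star> V') ?J j j' = cmp (V \<star> V') (coord V' G d) (L b) j'"
          using val[OF bd'(1,2)] bd'(3) basis_mem[OF J j'] by simp
      qed simp
      then show "coord (V \<star> V') ?J j t = \<zero>\<^bsub>fld B\<^esub>"
        using tc L0[OF bd(1)] lin_zero[OF coord_lin[OF G bd(2)]] by simp
    qed
  qed
  moreover have "\<zero>\<^bsub>V \<star> V'\<^esub> \<in> \<Inter>tfil"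
    using submoduleD(2) vt_Vob[OF V V'] by (auto simp: tfil_def)
  ultimately show ?thesis by blast
qed

text \<open>The subfunctor that the definition of \<open>Q4\<close> attaches to the filter
  \<open>tfil\<close>.\<close>

definition N4 where "N4 W = gr (V \<star> V') ` {f \<in> lin (V \<star> V') W. \<exists>K\<in>tfil. \<forall>t\<in>K. f t = \<zero>\<^bsub>W\<^esub>}"

lemma tfil_el: "K \<in> tfil \<Longrightarrow> t \<in> K \<Longrightarrow> t \<in> carrier (V \<star> V')"
  using submoduleD(1)[of K "V \<star> V'" t] by (simp add: tfil_def)

lemma N4I: "f \<in> lin (V \<star> V') W \<Longrightarrow> K \<in> tfil \<Longrightarrow> (\<And>t. t \<in> K \<Longrightarrow> f t = \<zero>\<^bsub>W\<^esub>) \<Longrightarrow> gr (V \<star> V') f \<in> N4 W"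
  unfolding N4_def by blast

lemma N4E:
  assumes "x \<in> N4 W"
  shows "\<exists>f K. f \<in> lin (V \<star> V') W \<and> K \<in> tfil \<and> (\<forall>t\<in>K. f t = \<zero>\<^bsub>W\<^esub>) \<and> x = gr (V \<star> V') f"
  using assms unfolding N4_def by blast

lemma subfun_N4: "subfun (Yo B (V \<star> V')) N4"
  unfolding subfun_def
proof (intro conjI ballI)
  let ?T = "V \<star> V'"
  fix W assume W [simp]: "W \<in> Vob"
  obtain K where K: "K \<in> tfil" using tfil_filter unfolding subspace_filter_def by blast
  show "submodule (N4 W) (fld B) (on_ob (Yo B ?T) W)"
    unfolding submodule_iff[OF LF_ob[OF Yo_LF[OF vt_Vob[OF V V']] W]]
  proof (intro conjI ballI)
    show "N4 W \<subseteq> el (Yo B ?T) W" by (auto simp: N4_def)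
    have "gr ?T (\<lambda>t\<in>carrier ?T. \<zero>\<^bsub>W\<^esub>) \<in> N4 W"
      by (rule N4I[OF _ K]) (use tfil_el[OF K] in simp_all)
    then show "\<zero>\<^bsub>on_ob (Yo B ?T) W\<^esub> \<in> N4 W" by (simp add: Yo_ob hom_space_zero)
  next
    fix x y assume "x \<in> N4 W" "y \<in> N4 W"
    obtain f K where f: "f \<in> lin ?T W" "K \<in> tfil" "\<forall>t\<in>K. f t = \<zero>\<^bsub>W\<^esub>" "x = gr ?T f" using N4E[OF \<open>x \<in> N4 W\<close>] by blast
    obtain g K' where g: "g \<in> lin ?T W" "K' \<in> tfil" "\<forall>t\<in>K'. g t = \<zero>\<^bsub>W\<^esub>" "y = gr ?T g" using N4E[OF \<open>y \<in> N4 W\<close>] by blast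
    have "gr ?T (map_add ?T W f g) \<in> N4 W"
      by (rule N4I[OF _ tfil_int[OF f(2) g(2)]])
        (use f g tfil_el[OF f(2)] in \<open>simp_all add: map_add_lin map_add_apply\<close>)
    then show "x \<oplus>\<^bsub>on_ob (Yo B ?T) W\<^esub> y \<in> N4 W" using f g by (simp add: Yo_ob hom_space_add[of _ _ W])
  next
    fix c x assume c: "c \<in> carrier (fld B)" and "x \<in> N4 W"
    obtain f K where f: "f \<in> lin ?T W" "K \<in> tfil" "\<forall>t\<in>K. f t = \<zero>\<^bsub>W\<^esub>" "x = gr ?T f" using N4E[OF \<open>x \<in> N4 W\<close>] by blast
    have "gr ?T (map_smult ?T W c f) \<in> N4 W"
      by (rule N4I[OF _ f(2)]) (use f c tfil_el[OF f(2)] in \<open>simp_all add: map_smult_lin map_smult_apply\<close>)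
    then show "c \<odot>\<^bsub>on_ob (Yo B ?T) W\<^esub> x \<in> N4 W" using f by (simp add: Yo_ob hom_space_smult[of _ _ W])
  qed
  fix W' g x assume W' [simp]: "W' \<in> Vob" and g: "g \<in> lin W W'" and "x \<in> N4 W"
  obtain f K where f: "f \<in> lin ?T W" "K \<in> tfil" "\<forall>t\<in>K. f t = \<zero>\<^bsub>W\<^esub>" "x = gr ?T f" using N4E[OF \<open>x \<in> N4 W\<close>] by blast
  have "gr ?T (cmp ?T g f) \<in> N4 W'"
    by (rule N4I[OF cmp_lin[OF _ f(1) g] f(2)]) (use f lin_zero[OF g W W'] tfil_el[OF f(2)] in simp_all)
  then show "on_mor (Yo B ?T) W W' g x \<in> N4 W'" using f by simp
qed

lemma Q4_mem: "quoF (Yo B (V \<star> V')) N4 \<in> Q4 B"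
proof -
  let ?T = "V \<star> V'"
  let ?Y = "Yo B ?T"
  have Y: "?Y \<in> LF" by simp
  note sf = subfun_N4
  have "qpr ?Y N4 W ` el ?Y W = el (quoF ?Y N4) W \<and>
    {g \<in> el ?Y W. qpr ?Y N4 W g = \<zero>\<^bsub>on_ob (quoF ?Y N4) W\<^esub>} = gr ?T ` {f \<in> lin ?T W. \<exists>K\<in>tfil. \<forall>t\<in>K. f t = \<zero>\<^bsub>W\<^esub>}"
    if W: "W \<in> Vob" for W
  proof
    show "qpr ?Y N4 W ` el ?Y W = el (quoF ?Y N4) W" by (rule qpr_surj[OF Y sf W])
    have "{g \<in> el ?Y W. qpr ?Y N4 W g = \<zero>\<^bsub>on_ob (quoF ?Y N4) W\<^esub>} = {g \<in> el ?Y W. g \<in> N4 W}"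
      by (rule Collect_cong) (use qpr_zero_iff[OF Y sf W] in blast)
    also have "\<dots> = N4 W" using subfun_el[OF Y sf W] by blast
    finally show "{g \<in> el ?Y W. qpr ?Y N4 W g = \<zero>\<^bsub>on_ob (quoF ?Y N4) W\<^esub>} = gr ?T ` {f \<in> lin ?T W. \<exists>K\<in>tfil. \<forall>t\<in>K. f t = \<zero>\<^bsub>W\<^esub>}"
      unfolding N4_def .
  qed
  then show ?thesis
    unfolding Q4_def mem_Collect_eq
    by (intro conjI exI[of _ ?T] exI[of _ tfil] exI[of _ "qpr ?Y N4"] quoF_LF[OF Y sf] tfil_filter tfil_Inter qpr_nt[OF Y sf] ballI) simp_all
qed

text \<open>Since f kills V \<otimes> H, the value f(v \<otimes> z) depends only on the class of z
  and is bilinear on V and V'/H. The kernel of V \<otimes> V' \<rightarrow> V \<otimes> V'/H need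
  not be identified.\<close>

lemma factor_tensor_quotient:
  assumes H: "H \<in> F" and W: "W \<in> Vob" and f: "f \<in> lin (V \<star> V') W"
    and f0: "\<And>v x. v \<in> carrier V \<Longrightarrow> x \<in> H \<Longrightarrow> f (vb V V' v x) = \<zero>\<^bsub>W\<^esub>"
  shows "\<exists>f'\<in>lin (V \<star> quot V' H) W. f = cmp (V \<star> V') f' (tm V V V' (quot V' H) (idm V) (restrict (quot_rep V' H) (carrier V')))"
proof -
  note S = F_sub[OF H]
  let ?Q = "quot V' H" and ?q = "restrict (quot_rep V' H) (carrier V')"
  have Q [simp]: "?Q \<in> Vob" by (rule quot_Vob[OF V' S])
  have q [simp]: "?q \<in> lin V' ?Q" by (rule quot_map_lin[OF V' S])
  have l: "cmp V' f (restrict (vb V V' v) (carrier V')) \<in> lin V' W" if "v \<in> carrier V" for v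
    by (rule cmp_lin[OF V' vb_left_lin[OF V V' that] f])
  have l0: "cmp V' f (restrict (vb V V' v) (carrier V')) x = \<zero>\<^bsub>W\<^esub>" if "v \<in> carrier V" "x \<in> H" for v x
    using that F_el[OF H] f0 by simp
  have qc: "z \<in> carrier V'" if "z \<in> carrier ?Q" for z using quot_carrier[OF V' S that] by simp
  have rep: "f (vb V V' v (quot_rep V' H x)) = f (vb V V' v x)" if v: "v \<in> carrier V" and x: "x \<in> carrier V'" for v x
    using quot_lift(2)[OF V' S W l[OF v] l0[OF v] x] x quot_rep(1)[OF V' S x] by simp
  have "bilinear_on B V ?Q W (\<lambda>v z. f (vb V V' v z))"
  proof (rule bilinear_onI[OF V Q])
    fix v z assume "v \<in> carrier V" "z \<in> carrier ?Q"
    then show "f (vb V V' v z) \<in> carrier W" using qc by (intro lin_closed[OF f]) simp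
  next
    fix v v' z assume "v \<in> carrier V" "v' \<in> carrier V" "z \<in> carrier ?Q"
    then show "f (vb V V' (v \<oplus>\<^bsub>V\<^esub> v') z) = f (vb V V' v z) \<oplus>\<^bsub>W\<^esub> f (vb V V' v' z)"
      using qc by (simp add: vb_add_left lin_add[OF f])
  next
    fix c v z assume "c \<in> carrier (fld B)" "v \<in> carrier V" "z \<in> carrier ?Q"
    then show "f (vb V V' (c \<odot>\<^bsub>V\<^esub> v) z) = c \<odot>\<^bsub>W\<^esub> f (vb V V' v z)"
      using qc by (simp add: vb_smult_left lin_smult[OF f])
  next
    fix v z z' assume *: "v \<in> carrier V" "z \<in> carrier ?Q" "z' \<in> carrier ?Q"
    have "z \<oplus>\<^bsub>?Q\<^esub> z' = quot_rep V' H (z \<oplus>\<^bsub>V'\<^esub> z')" by (simp add: quot_def)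
    then show "f (vb V V' v (z \<oplus>\<^bsub>?Q\<^esub> z')) = f (vb V V' v z) \<oplus>\<^bsub>W\<^esub> f (vb V V' v z')"
      using * qc by (simp add: rep vb_add_right lin_add[OF f])
  next
    fix c v z assume *: "c \<in> carrier (fld B)" "v \<in> carrier V" "z \<in> carrier ?Q"
    have "c \<odot>\<^bsub>?Q\<^esub> z = quot_rep V' H (c \<odot>\<^bsub>V'\<^esub> z)" by (simp add: quot_def)
    then show "f (vb V V' v (c \<odot>\<^bsub>?Q\<^esub> z)) = c \<odot>\<^bsub>W\<^esub> f (vb V V' v z)"
      using * qc by (simp add: rep vb_smult_right lin_smult[OF f])
  qed
  from vt_lift[OF V Q W this] obtain f' where f': "f' \<in> lin (V \<star> ?Q) W"
    and f'v: "\<forall>v\<in>carrier V. \<forall>z\<in>carrier ?Q. f' (vb V ?Q v z) = f (vb V V' v z)" by blast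
  have qe: "quot_rep V' H x \<in> carrier ?Q" if "x \<in> carrier V'" for x using lin_closed[OF q that] that by simp
  have t: "tm V V V' ?Q (idm V) ?q \<in> lin (V \<star> V') (V \<star> ?Q)" by simp
  have "f = cmp (V \<star> V') f' (tm V V V' ?Q (idm V) ?q)"
  proof (rule vt_ext[OF V V' W f cmp_lin[OF _ t f']])
    fix v x assume "v \<in> carrier V" "x \<in> carrier V'"
    then show "f (vb V V' v x) = cmp (V \<star> V') f' (tm V V V' ?Q (idm V) ?q) (vb V V' v x)"
      using f'v qe by (simp add: tm_vb rep)
  qed simp
  then show ?thesis using f' by blast
qed

text \<open>A map f that vanishes on a member of \<open>tfil\<close> kills V \<otimes> H for some H
  in F and hence factors through V \<otimes> V'/H. The hypothesis \<open>kill\<close>, taken at the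
  quotient map of V', then shows that f kills y, so the Yoneda map of y factors through a member of
  \<open>Q4\<close>.\<close>

lemma Q4_vanish:
  assumes Y [simp]: "Y \<in> LF" and free: "Y \<in> Qfree B (Q4 B)" and y: "y \<in> el Y (V \<star> V')"
    and kill: "\<And>H W g. H \<in> F \<Longrightarrow> W \<in> Vob \<Longrightarrow> g \<in> lin V' W \<Longrightarrow> (\<And>x. x \<in> H \<Longrightarrow> g x = \<zero>\<^bsub>W\<^esub>) \<Longrightarrow>
      on_mor Y (V \<star> V') (V \<star> W) (tm V V V' W (idm V) g) y = \<zero>\<^bsub>on_ob Y (V \<star> W)\<^esub>"
  shows "y = \<zero>\<^bsub>on_ob Y (V \<star> V')\<^esub>"
proof -
  let ?T = "V \<star> V'"
  let ?Y = "Yo B ?T"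
  have T [simp]: "?T \<in> Vob" by simp
  have P: "?Y \<in> LF" by simp
  note sf = subfun_N4
  have f: "yon Y ?T y \<in> nt ?Y Y" by (rule yon_nt[OF Y T y])
  have "\<exists>!h. h \<in> nt (quoF ?Y N4) Y \<and> Comp (LinFun B) ?Y h (qpr ?Y N4) = yon Y ?T y"
  proof (rule quoF_lift[OF P sf Y f])
    fix W x assume W [simp]: "W \<in> Vob" and x: "x \<in> N4 W"
    obtain f K where f: "f \<in> lin ?T W" "K \<in> tfil" "\<forall>t\<in>K. f t = \<zero>\<^bsub>W\<^esub>" "x = gr ?T f" using N4E[OF x] by blast
    then obtain H where H: "H \<in> F" "\<forall>v\<in>carrier V. \<forall>x\<in>H. vb V V' v x \<in> K" unfolding tfil_def by blast
    note S = F_sub[OF H(1)]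
    let ?Q = "quot V' H" and ?q = "restrict (quot_rep V' H) (carrier V')"
    have Q [simp]: "?Q \<in> Vob" by (rule quot_Vob[OF V' S])
    have q [simp]: "?q \<in> lin V' ?Q" by (rule quot_map_lin[OF V' S])
    have t: "tm V V V' ?Q (idm V) ?q \<in> lin ?T (V \<star> ?Q)" by simp
    obtain f' where f': "f' \<in> lin (V \<star> ?Q) W" "f = cmp ?T f' (tm V V V' ?Q (idm V) ?q)"
      using factor_tensor_quotient[OF H(1) W f(1)] H(2) f(3) by blast
    have "on_mor Y ?T W f y = on_mor Y (V \<star> ?Q) W f' (on_mor Y ?T (V \<star> ?Q) (tm V V V' ?Q (idm V) ?q) y)"
      unfolding f'(2) by (rule LF_cmp[OF Y T _ W t f'(1) y, symmetric]) simp
    also have "on_mor Y ?T (V \<star> ?Q) (tm V V V' ?Q (idm V) ?q) y = \<zero>\<^bsub>on_ob Y (V \<star> ?Q)\<^esub>"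
      by (rule kill[OF H(1) Q q]) (use F_el[OF H(1)] quot_map_zero[OF V' S] in simp)
    also have "on_mor Y (V \<star> ?Q) W f' \<zero>\<^bsub>on_ob Y (V \<star> ?Q)\<^esub> = \<zero>\<^bsub>on_ob Y W\<^esub>"
      by (rule lin_zero[OF LF_mor[OF Y _ W f'(1)]]) simp_all
    finally show "yon Y ?T y W x = \<zero>\<^bsub>on_ob Y W\<^esub>" unfolding f(4) using yon_apply[OF T W f(1)] by simp
  qed
  then obtain h where h: "h \<in> nt (quoF ?Y N4) Y" "Comp (LinFun B) ?Y h (qpr ?Y N4) = yon Y ?T y" by blast
  have h0: "h = zero_nat B (quoF ?Y N4) Y" using free Q4_mem h(1) unfolding Qfree_def by blast
  have i: "gr ?T (idm ?T) \<in> el ?Y ?T" by simp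
  have "y = yon Y ?T y ?T (gr ?T (idm ?T))" using y by (simp add: yon_apply)
  also have "\<dots> = h ?T (qpr ?Y N4 ?T (gr ?T (idm ?T)))" unfolding h(2)[symmetric] using i by simp
  also have "\<dots> = \<zero>\<^bsub>on_ob Y ?T\<^esub>"
    unfolding h0 using nt_closed[OF qpr_nt[OF P sf] T i] by simp
  finally show ?thesis .
qed

end

text \<open>Composed with q, \<tau> becomes an element y of Y(V \<otimes> V'). Maps g vanishing on
  some H are killed by q, which is the hypothesis \<open>kill\<close> of \<open>Q4_vanish\<close>;
  surjectivity of q turns y = 0 into \<tau> = 0.\<close>

lemma Q4_no_map:
  assumes Y [simp]: "Y \<in> LF" and free: "Y \<in> Qfree B (Q4 B)" and V [simp]: "V \<in> Vob"
    and Q: "Q \<in> Q4 B" and \<tau>: "\<tau> \<in> nt Q (shl Y V)"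
  shows "\<tau> = zero_nat B Q (shl Y V)"
proof -
  obtain V' F q where Q4: "V' \<in> Vob \<and> subspace_filter B V' F \<and> \<Inter>F = {\<zero>\<^bsub>V'\<^esub>} \<and> q \<in> nt (Yo B V') Q \<and>
     (\<forall>W\<in>Vob. q W ` el (Yo B V') W = el Q W \<and>
      {g \<in> el (Yo B V') W. q W g = \<zero>\<^bsub>on_ob Q W\<^esub>} = gr V' ` {f \<in> lin V' W. \<exists>H\<in>F. \<forall>x\<in>H. f x = \<zero>\<^bsub>W\<^esub>})"
    using Q[unfolded Q4_def mem_Collect_eq, THEN conjunct2] by (elim exE) (rule that)
  have QLF: "Q \<in> LF" using Q by (simp add: Q4_def)
  have V' [simp]: "V' \<in> Vob" using Q4 by (elim conjE)
  have F: "subspace_filter B V' F" using Q4 by (elim conjE)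
  have F0: "\<Inter>F = {\<zero>\<^bsub>V'\<^esub>}" using Q4 by (elim conjE)
  have q: "q \<in> nt (Yo B V') Q" using Q4 by (elim conjE)
  have qW: "\<forall>W\<in>Vob. q W ` el (Yo B V') W = el Q W \<and>
      {g \<in> el (Yo B V') W. q W g = \<zero>\<^bsub>on_ob Q W\<^esub>} = gr V' ` {f \<in> lin V' W. \<exists>H\<in>F. \<forall>x\<in>H. f x = \<zero>\<^bsub>W\<^esub>}"
    using Q4 by (elim conjE)
  have sh: "shl Y V \<in> LF" by (rule shl_LF[OF Y V])
  have \<zeta>: "Comp (LinFun B) (Yo B V') \<tau> q \<in> nt (Yo B V') (shl Y V)" by (rule Comp_nt[OF Yo_LF[OF V'] q \<tau>])
  define y where "y = Comp (LinFun B) (Yo B V') \<tau> q V' (gr V' (idm V'))"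
  have i: "gr V' (idm V') \<in> el (Yo B V') V'" by simp
  have y: "y \<in> el Y (V \<star> V')" unfolding y_def using nt_closed[OF \<zeta> V' i] by simp
  have val: "\<tau> W (q W (gr V' g)) = on_mor Y (V \<star> V') (V \<star> W) (tm V V V' W (idm V) g) y" if W: "W \<in> Vob" and g: "g \<in> lin V' W" for W g
    using nt_Yo_apply[OF \<zeta> V' W g] W g by (simp add: y_def)
  have y0: "y = \<zero>\<^bsub>on_ob Y (V \<star> V')\<^esub>"
  proof (rule Q4_vanish[OF V V' F F0 Y free y])
    fix H W g assume H: "H \<in> F" and W: "W \<in> Vob" and g: "g \<in> lin V' W" and g0: "\<And>x. x \<in> H \<Longrightarrow> g x = \<zero>\<^bsub>W\<^esub>"
    have "gr V' g \<in> {g \<in> el (Yo B V') W. q W g = \<zero>\<^bsub>on_ob Q W\<^esub>}"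
      using qW W g g0 H by blast
    then have "\<tau> W (q W (gr V' g)) = \<zero>\<^bsub>on_ob (shl Y V) W\<^esub>"
      using lin_zero[OF nt_lin[OF \<tau> W] LF_ob[OF QLF W] LF_ob[OF sh W]] by simp
    then show "on_mor Y (V \<star> V') (V \<star> W) (tm V V V' W (idm V) g) y = \<zero>\<^bsub>on_ob Y (V \<star> W)\<^esub>"
      using val[OF W g] by simp
  qed
  show ?thesis
  proof (rule nt_eqI[OF \<tau> zero_nat_nt[OF QLF sh]])
    fix W x assume W [simp]: "W \<in> Vob" and x: "x \<in> el Q W"
    then have "x \<in> q W ` el (Yo B V') W" using qW by blast
    then obtain g where g: "g \<in> lin V' W" "x = q W (gr V' g)" by (auto simp: el_Yo)
    have "\<tau> W x = \<zero>\<^bsub>on_ob Y (V \<star> W)\<^esub>"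
      unfolding g(2) val[OF W g(1)] y0 using g(1) by (intro lin_zero[OF LF_mor[OF Y]]) simp_all
    then show "\<tau> W x = zero_nat B Q (shl Y V) W x" using x by simp
  qed
qed

lemma Q4_LF: "Q \<in> Q4 B \<Longrightarrow> Q \<in> LF"
  by (simp add: Q4_def)

lemma no_map_shl:
  assumes "\<Q> = Q3 B \<or> \<Q> = Q4 B" "Y \<in> LF" "Y \<in> Qfree B \<Q>" "V \<in> Vob" "Q \<in> \<Q>" "\<tau> \<in> nt Q (shl Y V)"
  shows "\<tau> = zero_nat B Q (shl Y V)"
  using assms(1)
proof
  assume "\<Q> = Q3 B"
  then show ?thesis using Q3_no_map[OF assms(2) _ assms(4) _ assms(6)] assms(3,5) by simp
next
  assume "\<Q> = Q4 B"
  then show ?thesis using Q4_no_map[OF assms(2) _ assms(4) _ assms(6)] assms(3,5) by simp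
qed

section \<open>The symmetry of the tensor product of vector spaces\<close>

lemma ex_swap:
  assumes V [simp]: "V \<in> Vob" and W [simp]: "W \<in> Vob"
  shows "\<exists>h. h \<in> lin (V \<star> W) (W \<star> V) \<and> (\<forall>v\<in>carrier V. \<forall>w\<in>carrier W. h (vb V W v w) = vb W V w v)"
proof (rule vt_lift[OF V W])
  show "bilinear_on B V W (W \<star> V) (\<lambda>v w. vb W V w v)"
    by (rule bilinear_onI) (simp_all add: vb_add_left vb_add_right vb_smult_left vb_smult_right)
qed simp

definition swp where
  "swp V W = (SOME h. h \<in> lin (V \<star> W) (W \<star> V) \<and> (\<forall>v\<in>carrier V. \<forall>w\<in>carrier W. h (vb V W v w) = vb W V w v))"

lemma swp_lin [simp]: "V \<in> Vob \<Longrightarrow> W \<in> Vob \<Longrightarrow> swp V W \<in> lin (V \<star> W) (W \<star> V)"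
  and swp_vb: "V \<in> Vob \<Longrightarrow> W \<in> Vob \<Longrightarrow> v \<in> carrier V \<Longrightarrow> w \<in> carrier W \<Longrightarrow> swp V W (vb V W v w) = vb W V w v"
  using someI_ex[OF ex_swap, of V W] unfolding swp_def by auto

lemma swp_swp: "V \<in> Vob \<Longrightarrow> W \<in> Vob \<Longrightarrow> cmp (V \<star> W) (swp W V) (swp V W) = idm (V \<star> W)"
  by (rule vt_ext[OF _ _ _ cmp_lin[OF _ swp_lin swp_lin]]) (simp_all add: swp_vb)

lemma swp_natural: "V \<in> Vob \<Longrightarrow> W \<in> Vob \<Longrightarrow> W' \<in> Vob \<Longrightarrow> g \<in> lin W W' \<Longrightarrow>
    cmp (V \<star> W) (swp V W') (tm V V W W' (idm V) g) = cmp (V \<star> W) (tm W W' V V g (idm V)) (swp V W)"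
  by (rule vt_ext[OF _ _ _ cmp_lin[OF _ tm_lin swp_lin] cmp_lin[OF _ swp_lin tm_lin]])
    (simp_all add: swp_vb tm_vb lin_closed[of g W W'])

end

subsection \<open>The monoidal closed structure on the Q-free objects\<close>

locale qfree_setting = ind_setting B D N for B :: "'u vdata" and D N +
  fixes \<Q> :: "'u vfun set" and R :: "'u vfun \<Rightarrow> 'u vfun" and \<eta> :: "'u vfun \<Rightarrow> 'u vnat"
  assumes \<Q>: "\<Q> = Q3 B \<or> \<Q> = Q4 B"
    and reflection: "is_reflection (Ind B) (Qfree B \<Q>) R \<eta>"
begin

lemma \<Q>_LF: "Q \<in> \<Q> \<Longrightarrow> Q \<in> LF"
  using \<Q> Q3_LF Q4_LF by blast

text \<open>Evaluation at a fixed x in X(H) turns a map from Q to Hom(X, Y) into a map from Q to Y(H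
  \<otimes> -), which is zero; elements of Hom(X, Y) are determined by these evaluations.\<close>

lemma hob_Qfree:
  assumes X [simp]: "X \<in> IO" and Y [simp]: "Y \<in> IO" and free: "Y \<in> Qfree B \<Q>"
  shows "hob N X Y \<in> Qfree B \<Q>"
  unfolding Qfree_def mem_Collect_eq
proof (intro ballI)
  fix Q \<tau> assume Q: "Q \<in> \<Q>" and \<tau>: "\<tau> \<in> nt Q (hob N X Y)"
  note QLF [simp] = \<Q>_LF[OF Q]
  have hLF [simp]: "hob N X Y \<in> LF" by simp
  show "\<tau> = zero_nat B Q (hob N X Y)"
  proof (rule nt_eqI[OF \<tau> zero_nat_nt[OF QLF hLF]])
    fix W a assume W [simp]: "W \<in> Vob" and a [simp]: "a \<in> el Q W"
    note \<tau>c [simp] = nt_closed[OF \<tau>]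
    have "\<tau> W a = \<zero>\<^bsub>on_ob (hob N X Y) W\<^esub>"
    proof (rule I.hnt_eqI[OF X Y W])
      fix H x assume H [simp]: "H \<in> Vob" and x [simp]: "x \<in> el X H"
      let ?\<sigma> = "mknt Q (\<lambda>W a. hnt N X Y W (\<tau> W a) H x)"
      have "?\<sigma> \<in> nt Q (shl Y H)"
        by (rule mknt_nt) (simp_all add: nt_add[OF \<tau>] nt_smult[OF \<tau>] nt_natural[OF \<tau>] I.hnt_add I.hnt_smult I.hnt_natural)
      then have "?\<sigma> = zero_nat B Q (shl Y H)"
        by (rule no_map_shl[OF \<Q> IO_LF[OF Y] free H Q])
      then have "?\<sigma> W a = zero_nat B Q (shl Y H) W a" by (rule arg_cong)
      then have "hnt N X Y W (\<tau> W a) H x = \<zero>\<^bsub>on_ob Y (H \<star> W)\<^esub>" by simp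
      moreover have "hnt N X Y W \<zero>\<^bsub>on_ob (hob N X Y) W\<^esub> H x = \<zero>\<^bsub>on_ob Y (H \<star> W)\<^esub>"
        using I.hnt_smult[of X Y W H x "\<zero>\<^bsub>on_ob (hob N X Y) W\<^esub>" "\<zero>\<^bsub>fld B\<^esub>"] by simp
      ultimately show "hnt N X Y W (\<tau> W a) H x = hnt N X Y W \<zero>\<^bsub>on_ob (hob N X Y) W\<^esub> H x" by simp
    qed simp_all
    then show "\<tau> W a = zero_nat B Q (hob N X Y) W a" by simp
  qed
qed

abbreviation FO where "FO \<equiv> IO \<inter> Qfree B \<Q>"

text \<open>The functors isomorphic to a \<open>\<Q>\<close>-free Ind-object.  They are closed under shifts because
  \<open>Z(V \<otimes> -) \<cong> Hom(\<Y>V, Z)\<close>.\<close>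

definition FT where "FT = {Z \<in> LF. \<exists>Z'\<in>FO. \<exists>a\<in>nt Z' Z. \<forall>V\<in>Vob. bij_betw (a V) (el Z' V) (el Z V)}"

lemma FO_FT: "Z \<in> FO \<Longrightarrow> Z \<in> FT"
  unfolding FT_def mem_Collect_eq
proof
  assume Z: "Z \<in> FO"
  then have [simp]: "Z \<in> LF" by simp
  have "bij_betw (Idn (LinFun B) Z V) (el Z V) (el Z V)" if "V \<in> Vob" for V
    using that by (simp add: bij_betw_def inj_on_def image_def)
  then show "\<exists>Z'\<in>FO. \<exists>a\<in>nt Z' Z. \<forall>V\<in>Vob. bij_betw (a V) (el Z' V) (el Z V)"
    using Z by (intro bexI[of _ Z] bexI[of _ "Idn (LinFun B) Z"]) simp_all
qed simp

lemma FT_LF [simp]: "Z \<in> FT \<Longrightarrow> Z \<in> LF"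
  by (simp add: FT_def)

lemma FT_bij:
  assumes Z: "Z \<in> FT" and Z1: "Z1 \<in> LF" and b: "b \<in> nt Z Z1" and bb: "\<And>V. V \<in> Vob \<Longrightarrow> bij_betw (b V) (el Z V) (el Z1 V)"
  shows "Z1 \<in> FT"
proof -
  obtain Z' a where a: "Z' \<in> FO" "a \<in> nt Z' Z" "\<forall>V\<in>Vob. bij_betw (a V) (el Z' V) (el Z V)"
    using Z unfolding FT_def by blast
  have [simp]: "Z' \<in> LF" using a(1) by simp
  have "bij_betw (Comp (LinFun B) Z' b a V) (el Z' V) (el Z1 V)" if V: "V \<in> Vob" for V
    using bij_betw_trans[OF a(3)[rule_format, OF V] bb[OF V]] V by (simp cong: bij_betw_cong)
  then show ?thesis using a(1) Z1 Comp_nt[OF _ a(2) b] unfolding FT_def by auto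
qed

text \<open>Elements of Hom(\<Y>V, Z')(W) are maps from \<Y>V to Z'(- \<otimes> W), which Yoneda
  identifies with elements of Z'(V \<otimes> W). The Ind-object Hom(\<Y>V, Z') is Q-free by
  \<open>hob_Qfree\<close>.\<close>

lemma shl_FT:
  assumes Z: "Z \<in> FT" and V [simp]: "V \<in> Vob" shows "shl Z V \<in> FT"
proof -
  have ZL [simp]: "Z \<in> LF" using Z by simp
  obtain Z' a where Z': "Z' \<in> FO" and a: "a \<in> nt Z' Z" and ab: "\<forall>V\<in>Vob. bij_betw (a V) (el Z' V) (el Z V)"
    using Z unfolding FT_def by blast
  have Z'I [simp]: "Z' \<in> IO" using Z' by simp
  let ?h = "hob N (Yo B V) Z'" and ?i = "gr V (idm V)"
  have h: "?h \<in> FO" using hob_Qfree[of "Yo B V" Z'] Z' by simp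
  have hL: "?h \<in> LF" by simp
  have bij: "bij_betw (\<lambda>s. hnt N (Yo B V) Z' W s V ?i) (el ?h W) (el Z' (V \<star> W))" if W [simp]: "W \<in> Vob" for W
  proof -
    note hb = I.hnt_bij[OF Yo_IO[OF V] Z'I W]
    have "bij_betw (\<lambda>\<theta>. \<theta> V ?i) (nt (Yo B V) (shr Z' W)) (el Z' (V \<star> W))"
    proof (rule bij_betw_imageI)
      show "inj_on (\<lambda>\<theta>. \<theta> V ?i) (nt (Yo B V) (shr Z' W))"
        by (rule inj_onI) (erule (1) nt_Yo_eqI[OF _ _ V])
      have "t \<in> (\<lambda>\<theta>. \<theta> V ?i) ` nt (Yo B V) (shr Z' W)" if t: "t \<in> el Z' (V \<star> W)" for t
      proof (rule image_eqI)
        show "yon (shr Z' W) V t \<in> nt (Yo B V) (shr Z' W)" by (rule yon_nt) (use t in \<open>simp_all add: shr_LF\<close>)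
        show "t = yon (shr Z' W) V t V ?i"
          using t yon_apply[of V V "idm V" "shr Z' W" t] LF_id[OF shr_LF, of Z' W V t] by simp
      qed
      moreover have "\<theta> V ?i \<in> el Z' (V \<star> W)" if "\<theta> \<in> nt (Yo B V) (shr Z' W)" for \<theta>
        using nt_closed[OF that V, of ?i] by simp
      ultimately show "(\<lambda>\<theta>. \<theta> V ?i) ` nt (Yo B V) (shr Z' W) = el Z' (V \<star> W)" by blast
    qed
    from bij_betw_trans[OF hb this] show ?thesis by (simp add: comp_def)
  qed
  let ?\<theta> = "mknt ?h (\<lambda>W s. a (V \<star> W) (hnt N (Yo B V) Z' W s V ?i))"
  show ?thesis
  proof (rule FT_bij[OF FO_FT[OF h]])
    show "?\<theta> \<in> nt ?h (shl Z V)"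
      by (rule mknt_nt) (simp_all add: nt_closed[OF a] nt_add[OF a] nt_smult[OF a] nt_natural[OF a] I.hnt_add I.hnt_smult I.hnt_natural)
    show "bij_betw (?\<theta> W) (el ?h W) (el (shl Z V) W)" if W [simp]: "W \<in> Vob" for W
    proof -
      have "bij_betw (a (V \<star> W)) (el Z' (V \<star> W)) (el Z (V \<star> W))" using ab by simp
      from bij_betw_trans[OF bij[OF W] this] show ?thesis
        unfolding shl_simps by (simp add: comp_def cong: bij_betw_cong)
    qed
  qed (simp add: shl_LF)
qed

text \<open>The symmetry of the tensor product of vector spaces makes the two shifts
  isomorphic.\<close>

lemma shr_FT:
  assumes Z: "Z \<in> FT" and V [simp]: "V \<in> Vob" shows "shr Z V \<in> FT"
proof -
  have ZL [simp]: "Z \<in> LF" using Z by simp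
  let ?\<theta> = "mknt (shl Z V) (\<lambda>W. on_mor Z (V \<star> W) (W \<star> V) (swp V W))"
  show ?thesis
  proof (rule FT_bij[OF shl_FT[OF Z V]])
    show "?\<theta> \<in> nt (shl Z V) (shr Z V)"
      by (rule mknt_nt) (simp_all add: shl_LF lin_add[OF LF_mor] lin_smult[OF LF_mor] LF_cmp swp_natural)
    show "bij_betw (?\<theta> W) (el (shl Z V) W) (el (shr Z V) W)" if W [simp]: "W \<in> Vob" for W
      by (rule bij_betw_byWitness[where f' = "on_mor Z (W \<star> V) (V \<star> W) (swp W V)"])
        (auto simp: LF_cmp swp_swp)
  qed (simp add: shr_LF)
qed

section \<open>The reflection and its universal property for targets in FT\<close>

lemma R_FO: "A \<in> IO \<Longrightarrow> R A \<in> FO"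
  and \<eta>_nt: "A \<in> IO \<Longrightarrow> \<eta> A \<in> nt A (R A)"
  and R_ex1: "A \<in> IO \<Longrightarrow> Z \<in> FO \<Longrightarrow> f \<in> nt A Z \<Longrightarrow> \<exists>!g. g \<in> nt (R A) Z \<and> Comp (LinFun B) A g (\<eta> A) = f"
  using reflection unfolding is_reflection_def by simp_all

lemma R_IO [simp]: "A \<in> IO \<Longrightarrow> R A \<in> IO"
  using R_FO by blast

lemma \<eta>_closed [simp]: "A \<in> IO \<Longrightarrow> V \<in> Vob \<Longrightarrow> x \<in> el A V \<Longrightarrow> \<eta> A V x \<in> el (R A) V"
  by (rule nt_closed[OF \<eta>_nt])

text \<open>A pointwise bijective transformation has a natural inverse b. Only the identity a b = id
  is recorded: it carries lifts back from Z' to Z and shows that b can be cancelled.\<close>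

lemma FT_inverse:
  assumes "Z \<in> FT"
  shows "\<exists>Z'\<in>FO. \<exists>a\<in>nt Z' Z. \<exists>b\<in>nt Z Z'. \<forall>V\<in>Vob. \<forall>x\<in>el Z V. a V (b V x) = x"
proof -
  have [simp]: "Z \<in> LF" using assms by simp
  obtain Z' a where Z': "Z' \<in> FO" and a: "a \<in> nt Z' Z" and ab: "\<forall>V\<in>Vob. bij_betw (a V) (el Z' V) (el Z V)"
    using assms unfolding FT_def by blast
  have [simp]: "Z' \<in> LF" using Z' by simp
  let ?b = "\<lambda>V. inv_into (el Z' V) (a V)"
  have bc [simp]: "?b V x \<in> el Z' V" and aba [simp]: "a V (?b V x) = x" if "V \<in> Vob" "x \<in> el Z V" for V x
    using ab that inv_into_into[of x "a V" "el Z' V"] f_inv_into_f[of x "a V" "el Z' V"] by (auto simp: bij_betw_def)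
  have inj: "y = z" if "V \<in> Vob" "y \<in> el Z' V" "z \<in> el Z' V" "a V y = a V z" for V y z
    using ab that by (auto simp: bij_betw_def dest: inj_onD)
  have "mknt Z ?b \<in> nt Z Z'"
  proof (rule mknt_nt)
    fix V x y assume [simp]: "V \<in> Vob" "x \<in> el Z V" "y \<in> el Z V"
    show "?b V (x \<oplus>\<^bsub>on_ob Z V\<^esub> y) = ?b V x \<oplus>\<^bsub>on_ob Z' V\<^esub> ?b V y"
      by (rule inj[of V]) (simp_all add: nt_add[OF a])
  next
    fix V c x assume [simp]: "V \<in> Vob" "c \<in> carrier (fld B)" "x \<in> el Z V"
    show "?b V (c \<odot>\<^bsub>on_ob Z V\<^esub> x) = c \<odot>\<^bsub>on_ob Z' V\<^esub> ?b V x"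
      by (rule inj[of V]) (simp_all add: nt_smult[OF a])
  next
    fix V W f x assume [simp]: "V \<in> Vob" "W \<in> Vob" "f \<in> lin V W" "x \<in> el Z V"
    show "?b W (on_mor Z V W f x) = on_mor Z' V W f (?b V x)"
      by (rule inj[of W]) (simp_all add: nt_natural[OF a])
  qed simp_all
  moreover have "\<forall>V\<in>Vob. \<forall>x\<in>el Z V. a V (mknt Z ?b V x) = x" by simp
  ultimately show ?thesis using Z' a by blast
qed

text \<open>The extension along the unit is built in the Q-free Ind-object Z' and carried back to Z
  along a.\<close>

lemma R_lift:
  assumes A [simp]: "A \<in> IO" and Z: "Z \<in> FT" and f: "f \<in> nt A Z"
  shows "\<exists>g\<in>nt (R A) Z. \<forall>V\<in>Vob. \<forall>x\<in>el A V. g V (\<eta> A V x) = f V x"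
proof -
  obtain Z' a b where *: "Z' \<in> FO" "a \<in> nt Z' Z" "b \<in> nt Z Z'" "\<forall>V\<in>Vob. \<forall>x\<in>el Z V. a V (b V x) = x"
    using FT_inverse[OF Z] by blast
  have bf: "Comp (LinFun B) A b f \<in> nt A Z'" by (rule Comp_nt[OF _ f *(3)]) simp
  from R_ex1[OF A *(1) bf]
  obtain g where g: "g \<in> nt (R A) Z'" "Comp (LinFun B) A g (\<eta> A) = Comp (LinFun B) A b f" by blast
  have "g V (\<eta> A V x) = b V (f V x)" if "V \<in> Vob" "x \<in> el A V" for V x
    using arg_cong[OF g(2), of "\<lambda>k. k V x"] that by simp
  then have "\<forall>V\<in>Vob. \<forall>x\<in>el A V. Comp (LinFun B) (R A) a g V (\<eta> A V x) = f V x"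
    using *(4) by (simp add: nt_closed[OF f])
  moreover have "Comp (LinFun B) (R A) a g \<in> nt (R A) Z" by (rule Comp_nt[OF _ g(1) *(2)]) simp
  ultimately show ?thesis by blast
qed

lemma R_ext:
  assumes A [simp]: "A \<in> IO" and Z: "Z \<in> FT" and g: "g \<in> nt (R A) Z" and g': "g' \<in> nt (R A) Z"
    and eq: "\<And>V x. V \<in> Vob \<Longrightarrow> x \<in> el A V \<Longrightarrow> g V (\<eta> A V x) = g' V (\<eta> A V x)"
  shows "g = g'"
proof -
  obtain Z' a b where *: "Z' \<in> FO" "a \<in> nt Z' Z" "b \<in> nt Z Z'" "\<forall>V\<in>Vob. \<forall>x\<in>el Z V. a V (b V x) = x"
    using FT_inverse[OF Z] by blast
  have RA [simp]: "R A \<in> LF" by simp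
  note bg = Comp_nt[OF RA g *(3)] and bg' = Comp_nt[OF RA g' *(3)]
  note \<eta> = \<eta>_nt[OF A]
  have AL: "A \<in> LF" by simp
  \<comment> \<open>Uniqueness for the reflection is available only with target Z', so both maps are
    composed with b first.\<close>
  have "Comp (LinFun B) A (Comp (LinFun B) (R A) b g) (\<eta> A) = Comp (LinFun B) A (Comp (LinFun B) (R A) b g') (\<eta> A)"
    by (rule nt_eqI[OF Comp_nt[OF AL \<eta> bg] Comp_nt[OF AL \<eta> bg']]) (simp add: eq)
  then have b: "Comp (LinFun B) (R A) b g = Comp (LinFun B) (R A) b g'"
    using R_ex1[OF A *(1) Comp_nt[OF AL \<eta> bg]] bg bg' by (elim ex1E) metis
  show ?thesis
  proof (rule nt_eqI[OF g g'])
    fix V x assume V: "V \<in> Vob" and x: "x \<in> el (R A) V"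
    have "b V (g V x) = b V (g' V x)" using arg_cong[OF b, of "\<lambda>k. k V x"] V x by simp
    then have "a V (b V (g V x)) = a V (b V (g' V x))" by simp
    then show "g V x = g' V x" using *(4) V nt_closed[OF g V x] nt_closed[OF g' V x] by simp
  qed
qed

abbreviation rt where "rt X Y \<equiv> R (dt X Y)"
definition ru where "ru X Y H L x y = \<eta> (dt X Y) (H \<star> L) (uu X Y H L x y)"

text \<open>Two universal properties in succession: the coend lifts \<beta> to the tensor product of
  Ind-objects, and the reflection extends this lift to targets in \<open>FT\<close>.\<close>

lemma ru_lift:
  assumes X: "X \<in> FO" and Y: "Y \<in> FO" and Z: "Z \<in> FT" and \<beta>: "bifam X Y Z \<beta>"
  shows "\<exists>\<theta>\<in>nt (rt X Y) Z. \<forall>H\<in>Vob. \<forall>L\<in>Vob. \<forall>x\<in>el X H. \<forall>y\<in>el Y L. \<theta> (H \<star> L) (ru X Y H L x y) = \<beta> H L x y"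
proof -
  have XY [simp]: "X \<in> IO" "Y \<in> IO" using X Y by simp_all
  obtain f where f: "f \<in> nt (dt X Y) Z" "\<forall>H\<in>Vob. \<forall>L\<in>Vob. \<forall>x\<in>el X H. \<forall>y\<in>el Y L. f (H \<star> L) (uu X Y H L x y) = \<beta> H L x y"
    using uu_lift[OF XY FT_LF[OF Z] \<beta>] by blast
  obtain g where g: "g \<in> nt (rt X Y) Z" "\<forall>V\<in>Vob. \<forall>x\<in>el (dt X Y) V. g V (\<eta> (dt X Y) V x) = f V x"
    using R_lift[OF dt_IO[OF XY] Z f(1)] by blast
  have "g (H \<star> L) (ru X Y H L x y) = \<beta> H L x y" if "H \<in> Vob" "L \<in> Vob" "x \<in> el X H" "y \<in> el Y L" for H L x y
    using that f(2) g(2) by (simp add: ru_def)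
  then show ?thesis using g(1) by blast
qed

lemma ru_ext:
  assumes X: "X \<in> FO" and Y: "Y \<in> FO" and Z: "Z \<in> FT" and \<theta>: "\<theta> \<in> nt (rt X Y) Z" and \<theta>': "\<theta>' \<in> nt (rt X Y) Z"
    and eq: "\<And>H L x y. H \<in> Vob \<Longrightarrow> L \<in> Vob \<Longrightarrow> x \<in> el X H \<Longrightarrow> y \<in> el Y L \<Longrightarrow>
        \<theta> (H \<star> L) (ru X Y H L x y) = \<theta>' (H \<star> L) (ru X Y H L x y)"
  shows "\<theta> = \<theta>'"
proof -
  have XY [simp]: "X \<in> IO" "Y \<in> IO" using X Y by simp_all
  have dL: "dt X Y \<in> LF" by simp
  note \<eta> = \<eta>_nt[OF dt_IO[OF XY]]
  have "Comp (LinFun B) (dt X Y) \<theta> (\<eta> (dt X Y)) = Comp (LinFun B) (dt X Y) \<theta>' (\<eta> (dt X Y))"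
    by (rule uu_ext[OF XY FT_LF[OF Z] Comp_nt[OF dL \<eta> \<theta>] Comp_nt[OF dL \<eta> \<theta>']])
      (use eq in \<open>simp add: ru_def\<close>)
  then have "\<theta> V (\<eta> (dt X Y) V x) = \<theta>' V (\<eta> (dt X Y) V x)" if "V \<in> Vob" "x \<in> el (dt X Y) V" for V x
    using that arg_cong[of _ _ "\<lambda>k. k V x"] by (metis LF_Comp_apply)
  then show ?thesis by (rule R_ext[OF dt_IO[OF XY] Z \<theta> \<theta>'])
qed

lemma ru_bifam:
  assumes X: "X \<in> FO" and Y: "Y \<in> FO" shows "bifam X Y (rt X Y) (ru X Y)"
proof -
  have XY [simp]: "X \<in> IO" "Y \<in> IO" using X Y by simp_all
  note \<eta> = \<eta>_nt[OF dt_IO[OF XY]]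
  show ?thesis
    by (rule bifamI) (simp_all add: ru_def I.u_add_left I.u_add_right I.u_smult_left I.u_smult_right I.u_natural
        nt_add[OF \<eta>] nt_smult[OF \<eta>] nt_natural[OF \<eta>])
qed

abbreviation J where "J \<equiv> R Y\<^sub>0"
abbreviation e\<^sub>F where "e\<^sub>F \<equiv> \<eta> Y\<^sub>0 kk e\<^sub>0"

text \<open>The unit object is the reflection of \<Y>k, and its universal element is the image of
  the code of the identity under the reflection unit.\<close>

sublocale F: day B FO FT rt ru J e\<^sub>F "hob N" "hnt N"
proof
  show "FO \<subseteq> FT" using FO_FT by blast
  show "FT \<subseteq> LF" by auto
  show "J \<in> FO" by (rule R_FO) simp
  show "\<exists>\<theta>\<in>nt J Z. \<theta> kk e\<^sub>F = z" if Z: "Z \<in> FT" and z: "z \<in> el Z kk" for Z z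
  proof -
    have "yon Z kk z \<in> nt Y\<^sub>0 Z" by (rule yon_nt) (use Z z in simp_all)
    from R_lift[OF _ Z this] obtain g where "g \<in> nt J Z" "g kk e\<^sub>F = yon Z kk z kk e\<^sub>0" by auto
    then show ?thesis using Z z yon_apply[of kk kk "idm kk" Z z] by auto
  qed
  show "\<theta> = \<theta>'" if Z: "Z \<in> FT" and \<theta>: "\<theta> \<in> nt J Z" and \<theta>': "\<theta>' \<in> nt J Z" and eq: "\<theta> kk e\<^sub>F = \<theta>' kk e\<^sub>F" for Z \<theta> \<theta>'
  proof (rule R_ext[OF _ Z \<theta> \<theta>'])
    have [simp]: "Y\<^sub>0 \<in> LF" by simp
    note \<eta> = \<eta>_nt[OF Yo_IO[OF ground_Vob]]
    have "Comp (LinFun B) Y\<^sub>0 \<theta> (\<eta> Y\<^sub>0) = Comp (LinFun B) Y\<^sub>0 \<theta>' (\<eta> Y\<^sub>0)"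
      by (rule nt_Yo_eqI[OF Comp_nt[OF _ \<eta> \<theta>] Comp_nt[OF _ \<eta> \<theta>'] ground_Vob]) (simp_all add: eq)
    then show "\<theta> V (\<eta> Y\<^sub>0 V x) = \<theta>' V (\<eta> Y\<^sub>0 V x)" if "V \<in> Vob" "x \<in> el Y\<^sub>0 V" for V x
      using that by (metis LF_Comp_apply)
  qed simp
  fix X Y assume X: "X \<in> FO" and Y: "Y \<in> FO"
  have XY [simp]: "X \<in> IO" "Y \<in> IO" using X Y by simp_all
  show "rt X Y \<in> FO" by (rule R_FO) simp
  show "bifam X Y (rt X Y) (ru X Y)" by (rule ru_bifam[OF X Y])
  show "\<exists>\<theta>\<in>nt (rt X Y) Z. \<forall>H\<in>Vob. \<forall>L\<in>Vob. \<forall>x\<in>el X H. \<forall>y\<in>el Y L. \<theta> (H \<star> L) (ru X Y H L x y) = \<beta> H L x y"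
    if "Z \<in> FT" "bifam X Y Z \<beta>" for Z \<beta> by (rule ru_lift[OF X Y that])
  show "hob N X Y \<in> FO" using hob_Qfree Y by simp
  fix V assume V [simp]: "V \<in> Vob"
  show "bij_betw (hnt N X Y V) (el (hob N X Y) V) (nt X (shr Y V))" by (rule I.hnt_bij) simp_all
qed (auto simp: shr_FT shl_FT R_FO I.hnt_add I.hnt_smult I.hnt_natural intro: ru_ext)

lemma full_subcat_Ind: "full_subcat (Ind B) S = subLF (IO \<inter> S)"
  unfolding full_subcat_def by (subst Ind_eq) simp

section \<open>Compatibility of the two structures along the reflection unit\<close>

context
  fixes M assumes dm: "day_mon B FO FT rt ru J e\<^sub>F (hob N) (hnt N) M"
begin

interpretation F: day_mon B FO FT rt ru J e\<^sub>F "hob N" "hnt N" M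
  by (rule dm)

text \<open>\<open>refl_mor\<close> denotes the unique map compatible with the reflection units; on
  universal elements both composites give the reflected tensor of \<sigma>(x) and \<tau>(y).\<close>

lemma tmor_refl_mor:
  assumes X: "X \<in> FO" "X' \<in> FO" and Y: "Y \<in> FO" "Y' \<in> FO" and \<sigma>: "\<sigma> \<in> nt X X'" and \<tau>: "\<tau> \<in> nt Y Y'"
  shows "tmor M X X' Y Y' \<sigma> \<tau> = refl_mor (Ind B) R \<eta> (dt X Y) (dt X' Y') (tmor MI X X' Y Y' \<sigma> \<tau>)"
proof -
  have I [simp]: "X \<in> IO" "X' \<in> IO" "Y \<in> IO" "Y' \<in> IO" using X Y by simp_all
  note [simp] = nt_closed[OF \<sigma>] nt_closed[OF \<tau>]
  have dL: "dt X Y \<in> LF" by simp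
  note \<eta> = \<eta>_nt[OF dt_IO[OF I(1,3)]] and \<eta>' = \<eta>_nt[OF dt_IO[OF I(2,4)]]
  note t = F.tmor_nt[OF X Y \<sigma> \<tau>] and t' = I.tmor_nt[OF I \<sigma> \<tau>]
  have T: "rt X' Y' \<in> FT" by (rule FO_FT[OF R_FO]) simp
  have eq: "Comp (LinFun B) (dt X Y) (tmor M X X' Y Y' \<sigma> \<tau>) (\<eta> (dt X Y)) =
    Comp (LinFun B) (dt X Y) (\<eta> (dt X' Y')) (tmor MI X X' Y Y' \<sigma> \<tau>)" (is "?l = ?r")
  proof (rule uu_ext[OF I(1,3) FT_LF[OF T] Comp_nt[OF dL \<eta> t] Comp_nt[OF dL t' \<eta>']])
    fix H L x y assume *: "H \<in> Vob" "L \<in> Vob" "x \<in> el X H" "y \<in> el Y L"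
    show "?l (H \<star> L) (uu X Y H L x y) = ?r (H \<star> L) (uu X Y H L x y)"
      using F.tmor_u[OF X Y \<sigma> \<tau> *] I.tmor_u[OF I \<sigma> \<tau> *] * by (simp add: ru_def)
  qed
  have "refl_mor (Ind B) R \<eta> (dt X Y) (dt X' Y') (tmor MI X X' Y Y' \<sigma> \<tau>) = tmor M X X' Y Y' \<sigma> \<tau>"
    unfolding refl_mor_def Hom_Ind
  proof (rule the_equality)
    show "tmor M X X' Y Y' \<sigma> \<tau> \<in> nt (rt X Y) (rt X' Y') \<and>
      Comp (LinFun B) (dt X Y) (tmor M X X' Y Y' \<sigma> \<tau>) (\<eta> (dt X Y)) = ?r" using t eq by blast
    fix g assume g: "g \<in> nt (rt X Y) (rt X' Y') \<and> Comp (LinFun B) (dt X Y) g (\<eta> (dt X Y)) = ?r"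
    then have "Comp (LinFun B) (dt X Y) g (\<eta> (dt X Y)) = ?l" using eq by simp
    then have "g V (\<eta> (dt X Y) V x) = tmor M X X' Y Y' \<sigma> \<tau> V (\<eta> (dt X Y) V x)" if "V \<in> Vob" "x \<in> el (dt X Y) V" for V x
      using that by (metis LF_Comp_apply)
    then show "g = tmor M X X' Y Y' \<sigma> \<tau>" by (rule R_ext[OF dt_IO[OF I(1,3)] T g[THEN conjunct1] t])
  qed
  then show ?thesis by (rule sym)
qed

text \<open>Both sides are maps out of (X \<otimes> Y) \<otimes> Z and are compared on its
  generators. There the inner tensors are first replaced by reflected ones, and the descriptions of
  the two associators then give the same element, transported along the same
  \<open>vai\<close>.\<close>

lemma asc_eta:
  assumes X: "X \<in> FO" and Y: "Y \<in> FO" and Z: "Z \<in> FO"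
  shows "Comp (LinFun B) (dt (dt X Y) Z) (asc M X Y Z)
      (Comp (LinFun B) (dt (dt X Y) Z) (\<eta> (dt (rt X Y) Z))
        (tmor MI (dt X Y) (rt X Y) Z Z (\<eta> (dt X Y)) (Idn (LinFun B) Z))) =
    Comp (LinFun B) (dt (dt X Y) Z) (\<eta> (dt X (rt Y Z)))
      (Comp (LinFun B) (dt (dt X Y) Z)
        (tmor MI X X (dt Y Z) (rt Y Z) (Idn (LinFun B) X) (\<eta> (dt Y Z))) (asc MI X Y Z))" (is "?l = ?r")
proof -
  have I [simp]: "X \<in> IO" "Y \<in> IO" "Z \<in> IO" using X Y Z by simp_all
  have [simp]: "rt X Y \<in> IO" "rt Y Z \<in> IO" by simp_all
  have dL: "dt (dt X Y) Z \<in> LF" by simp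
  note \<eta> = \<eta>_nt[of "dt X Y"] \<eta>_nt[of "dt Y Z"] \<eta>_nt[of "dt (rt X Y) Z"] \<eta>_nt[of "dt X (rt Y Z)"]
  have t1: "tmor MI (dt X Y) (rt X Y) Z Z (\<eta> (dt X Y)) (Idn (LinFun B) Z) \<in> nt (dt (dt X Y) Z) (dt (rt X Y) Z)"
    by (rule I.tmor_nt) (use \<eta> in simp_all)
  have t2: "tmor MI X X (dt Y Z) (rt Y Z) (Idn (LinFun B) X) (\<eta> (dt Y Z)) \<in> nt (dt X (dt Y Z)) (dt X (rt Y Z))"
    by (rule I.tmor_nt) (use \<eta> in simp_all)
  note a = F.asc_nt[OF X Y Z] and a' = I.asc_nt[OF I]
  have l: "?l \<in> nt (dt (dt X Y) Z) (rt X (rt Y Z))"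
    by (rule Comp_nt[OF dL Comp_nt[OF dL t1] a]) (simp add: \<eta>)
  have r: "?r \<in> nt (dt (dt X Y) Z) (rt X (rt Y Z))"
    by (rule Comp_nt[OF dL Comp_nt[OF dL a' t2]]) (simp add: \<eta>)
  show ?thesis
  proof (rule I.ext_ll[OF I _ l r])
    fix H0 H1 L x y z assume *: "H0 \<in> Vob" "H1 \<in> Vob" "L \<in> Vob" "x \<in> el X H0" "y \<in> el Y H1" "z \<in> el Z L"
    note e1 = \<eta>_nt[of "dt X Y"] and e2 = \<eta>_nt[of "dt Y Z"] and e4 = \<eta>_nt[of "dt X (rt Y Z)"]
    have u1: "tmor MI (dt X Y) (rt X Y) Z Z (\<eta> (dt X Y)) (Idn (LinFun B) Z) ((H0 \<star> H1) \<star> L)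
        (uu (dt X Y) Z (H0 \<star> H1) L (uu X Y H0 H1 x y) z) = uu (rt X Y) Z (H0 \<star> H1) L (ru X Y H0 H1 x y) z"
      by (subst I.tmor_u) (use * e1 in \<open>simp_all add: ru_def\<close>)
    have u2: "tmor MI X X (dt Y Z) (rt Y Z) (Idn (LinFun B) X) (\<eta> (dt Y Z)) (H0 \<star> H1 \<star> L)
        (uu X (dt Y Z) H0 (H1 \<star> L) x (uu Y Z H1 L y z)) = uu X (rt Y Z) H0 (H1 \<star> L) x (ru Y Z H1 L y z)"
      by (subst I.tmor_u) (use * e2 in \<open>simp_all add: ru_def\<close>)
    show "?l ((H0 \<star> H1) \<star> L) (uu (dt X Y) Z (H0 \<star> H1) L (uu X Y H0 H1 x y) z) =
      ?r ((H0 \<star> H1) \<star> L) (uu (dt X Y) Z (H0 \<star> H1) L (uu X Y H0 H1 x y) z)"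
      using F.asc_u[OF X Y Z *] I.asc_u[OF I *] *
      by (simp add: u1 u2 nt_natural[OF t2] ru_def[of "rt X Y" Z] ru_def[of X "rt Y Z"]) (simp add: ru_def nt_natural[OF e4])
  qed simp
qed

text \<open>The reflection unit sends \<open>e\<^sub>0\<close> to \<open>e\<^sub>F\<close>, and on
  these elements both unitors transport x along \<open>vlu\<close>.\<close>

lemma lun_eta:
  assumes X: "X \<in> FO"
  shows "Comp (LinFun B) (dt Y\<^sub>0 X) (lun M X) (Comp (LinFun B) (dt Y\<^sub>0 X) (\<eta> (dt J X))
      (tmor MI Y\<^sub>0 J X X (\<eta> Y\<^sub>0) (Idn (LinFun B) X))) = lun MI X" (is "?l = ?r")
proof -
  have I [simp]: "X \<in> IO" using X by simp
  have [simp]: "J \<in> IO" "Y\<^sub>0 \<in> IO" by simp_all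
  have dL: "dt Y\<^sub>0 X \<in> LF" by simp
  have e1: "\<eta> Y\<^sub>0 \<in> nt Y\<^sub>0 J" and e2: "\<eta> (dt J X) \<in> nt (dt J X) (rt J X)" by (simp_all add: \<eta>_nt)
  have t: "tmor MI Y\<^sub>0 J X X (\<eta> Y\<^sub>0) (Idn (LinFun B) X) \<in> nt (dt Y\<^sub>0 X) (dt J X)"
    by (rule I.tmor_nt) (use e1 in simp_all)
  show ?thesis
  proof (rule I.ext_J_left[OF I _ Comp_nt[OF dL Comp_nt[OF dL t e2] F.lun_nt[OF X]] I.lun_nt[OF I]])
    fix L x assume *: "L \<in> Vob" "x \<in> el X L"
    have "tmor MI Y\<^sub>0 J X X (\<eta> Y\<^sub>0) (Idn (LinFun B) X) (kk \<star> L) (uu Y\<^sub>0 X kk L e\<^sub>0 x) = uu J X kk L e\<^sub>F x"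
      by (subst I.tmor_u) (use * e1 in simp_all)
    then show "?l (kk \<star> L) (uu Y\<^sub>0 X kk L e\<^sub>0 x) = lun MI X (kk \<star> L) (uu Y\<^sub>0 X kk L e\<^sub>0 x)"
      using F.lun_u[OF X *] I.lun_u[OF I *] * by (simp add: ru_def)
  qed simp
qed

lemma run_eta:
  assumes X: "X \<in> FO"
  shows "Comp (LinFun B) (dt X Y\<^sub>0) (run M X) (Comp (LinFun B) (dt X Y\<^sub>0) (\<eta> (dt X J))
      (tmor MI X X Y\<^sub>0 J (Idn (LinFun B) X) (\<eta> Y\<^sub>0))) = run MI X" (is "?l = ?r")
proof -
  have I [simp]: "X \<in> IO" using X by simp
  have [simp]: "J \<in> IO" "Y\<^sub>0 \<in> IO" by simp_all
  have dL: "dt X Y\<^sub>0 \<in> LF" by simp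
  have e1: "\<eta> Y\<^sub>0 \<in> nt Y\<^sub>0 J" and e2: "\<eta> (dt X J) \<in> nt (dt X J) (rt X J)" by (simp_all add: \<eta>_nt)
  have t: "tmor MI X X Y\<^sub>0 J (Idn (LinFun B) X) (\<eta> Y\<^sub>0) \<in> nt (dt X Y\<^sub>0) (dt X J)"
    by (rule I.tmor_nt) (use e1 in simp_all)
  show ?thesis
  proof (rule I.ext_J_right[OF I _ Comp_nt[OF dL Comp_nt[OF dL t e2] F.run_nt[OF X]] I.run_nt[OF I]])
    fix L x assume *: "L \<in> Vob" "x \<in> el X L"
    have "tmor MI X X Y\<^sub>0 J (Idn (LinFun B) X) (\<eta> Y\<^sub>0) (L \<star> kk) (uu X Y\<^sub>0 L kk x e\<^sub>0) = uu X J L kk x e\<^sub>F"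
      by (subst I.tmor_u) (use * e1 in simp_all)
    then show "?l (L \<star> kk) (uu X Y\<^sub>0 L kk x e\<^sub>0) = run MI X (L \<star> kk) (uu X Y\<^sub>0 L kk x e\<^sub>0)"
      using F.run_u[OF X *] I.run_u[OF I *] * by (simp add: ru_def)
  qed simp
qed

text \<open>The internal hom is shared, so on generators both evaluations are given by the same
  \<open>hnt\<close>.\<close>

lemma evl_eta:
  assumes X: "X \<in> FO" and Z: "Z \<in> FO"
  shows "Comp (LinFun B) (dt X (hob N X Z)) (evl M X Z) (\<eta> (dt X (hob N X Z))) = evl MI X Z"
proof -
  have I [simp]: "X \<in> IO" "Z \<in> IO" using X Z by simp_all
  have h: "hob N X Z \<in> IO" by simp
  have dL: "dt X (hob N X Z) \<in> LF" by simp
  show ?thesis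
  proof (rule uu_ext[OF I(1) h _ Comp_nt[OF dL \<eta>_nt[OF dt_IO[OF I(1) h]] F.evl_nt[OF X Z]] I.evl_nt[OF I]])
    fix H L x s assume *: "H \<in> Vob" "L \<in> Vob" "x \<in> el X H" "s \<in> el (hob N X Z) L"
    show "Comp (LinFun B) (dt X (hob N X Z)) (evl M X Z) (\<eta> (dt X (hob N X Z))) (H \<star> L) (uu X (hob N X Z) H L x s) =
        evl MI X Z (H \<star> L) (uu X (hob N X Z) H L x s)"
      using F.evl_u[OF X Z *] I.evl_u[OF I *] * by (simp add: ru_def)
  qed simp
qed

lemma induced: "induced_structure (Ind B) MI (Qfree B \<Q>) R \<eta> M"
  unfolding induced_structure_def Hom_Ind F.M_simps I.M_simps
  using tmor_refl_mor asc_eta lun_eta run_eta evl_eta by blast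

lemma closed_monoidal_Qfree: "closed_monoidal_category (full_subcat (Ind B) (Qfree B \<Q>)) M"
  unfolding full_subcat_Ind by (rule F.closed_monoidal_category_CC)

end

end

theorem corollary6p14:
  fixes B :: "'u vdata" and D :: "'u ddata" and N :: "'u hdata"
    and \<Q> :: "'u vfun set" and R :: "'u vfun \<Rightarrow> 'u vfun" and \<eta> :: "'u vfun \<Rightarrow> 'u vnat"
  assumes "vect_setting B"
    and "is_ind_tensor B D"
    and "is_ind_hom B N"
    and "\<Q> = Q3 B \<or> \<Q> = Q4 B"
    and "is_reflection (Ind B) (Qfree B \<Q>) R \<eta>"
  shows "closed_monoidal_category (Ind B) (ind_clmon B D N) \<and>
    (\<exists>M. closed_monoidal_category (full_subcat (Ind B) (Qfree B \<Q>)) M \<and>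
         induced_structure (Ind B) (ind_clmon B D N) (Qfree B \<Q>) R \<eta> M)"
proof -
  interpret qfree_setting B D N \<Q> R \<eta>
    using assms by (intro qfree_setting.intro ind_setting.intro ind_setting_axioms.intro qfree_setting_axioms.intro)
  obtain M where M: "day_mon B FO FT rt ru J e\<^sub>F (hob N) (hnt N) M"
    using F.ex_day_mon by blast
  show ?thesis
    using closed_monoidal_Ind closed_monoidal_Qfree[OF M] induced[OF M] by blast
qed

end
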